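(* A pentagonal tiling of a compact connected surface without boundary is the simple pentagonal subdivision of some quadrilateral tiling if and only if it is possible to label some of its vertices by $\bullet$ such that every unlabelled vertex has degree $3$ and every tile is of one of the types $P_1$, $P_2$, $P_3$.
   Context: A tiling of a compact connected surface without boundary is a graph embedded in the surface such that the complementary regions (tiles) are open disks; tilings are edge-to-edge, every vertex has degree at least $3$, every tile has at least $3$ edges, and tiles may be degenerate (boundary not a simple closed curve). A pentagonal (resp. quadrilateral) tiling has $5$ (resp. $4$) edges along each tile boundary. A simple pentagonal subdivision of a quadrilateral tiling is the pentagonal tiling obtained by placing a new vertex at the middle point of every edge and, inside each quadrilateral tile, joining by an arc the middle points of one of the two pairs of opposite edges of the tile, such that the middle point of each edge is used exactly once. Given a labelling of some vertices by $\bullet$, the tile types are as follows, where the corners of the pentagon are $v_1,\dots,v_5$ in cyclic order, $v_1,v_3$ carry the label $\bullet$ and $v_2,v_4,v_5$ are unlabelled. $P_1$: the pentagon is non-degenerate. $P_2$: the corners $v_1$ and $v_3$ are the same ($\bullet$-)vertex, with no other identification, and the union of the tile with a small disk neighborhood of this vertex is a Möbius band. $P_3$: the edge $v_2v_3$ is identified with the edge $v_5v_1$ so that $v_2$ is glued to $v_5$ and $v_3$ to $v_1$ (a twisted identification, so the tile is a Möbius band); the tile has the single $\bullet$-vertex $v_1=v_3$ and two unlabelled vertices $v_2=v_5$ and $v_4$. *)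

theory Defs
  imports "HOL-Analysis.Analysis"
begin

section \<open>Closed surfaces and embedded graphs\<close>

definition closed_surface :: "'a::t2_space set \<Rightarrow> bool" where
  "closed_surface S \<longleftrightarrow>
     S \<noteq> {} \<and> compact S \<and> connected S \<and>
     (\<forall>x\<in>S. \<exists>U. openin (top_of_set S) U \<and> x \<in> U \<and> U homeomorphic ball (0::complex) 1)"

text \<open>
  A graph in a surface is a pair \<open>V\<close>, \<open>E\<close> of a set of points and a set of edges; an edge is the point
  set of an arc (or, for a loop, of a simple closed curve), its end points included, and it meets
  \<open>V\<close> in its end points only. Loops and multiple edges are allowed.
\<close>

definition edge_path :: "'a::t2_space set \<Rightarrow> 'a set \<Rightarrow> (real \<Rightarrow> 'a) \<Rightarrow> bool" where
  "edge_path V e g \<longleftrightarrow>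
     simple_path g \<and> path_image g = e \<and> e \<inter> V = {pathstart g, pathfinish g}"

definition embedded_graph :: "'a::t2_space set \<Rightarrow> 'a set \<Rightarrow> 'a set set \<Rightarrow> bool" where
  "embedded_graph S V E \<longleftrightarrow>
     finite V \<and> finite E \<and> V \<subseteq> S \<and>
     (\<forall>e\<in>E. e \<subseteq> S \<and> (\<exists>g. edge_path V e g)) \<and>
     (\<forall>e\<in>E. \<forall>e'\<in>E. e \<noteq> e' \<longrightarrow> e \<inter> e' \<subseteq> V)"

text \<open>A loop contributes 2 to the degree of its vertex.\<close>

definition vertex_degree :: "'a set \<Rightarrow> 'a set set \<Rightarrow> 'a \<Rightarrow> nat" where
  "vertex_degree V E v = (\<Sum>e\<in>{e\<in>E. v \<in> e}. if e \<inter> V = {v} then 2 else 1)"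

definition tiles :: "'a::t2_space set \<Rightarrow> 'a set \<Rightarrow> 'a set set \<Rightarrow> 'a set set" where
  "tiles S V E = components (S - (V \<union> \<Union>E))"

section \<open>Tilings\<close>

text \<open>
  The unit disk serves as the model \<open>k\<close>-gon: its corners are the \<open>k\<close>-th roots of unity, and side \<open>j\<close>
  is the circular arc from corner \<open>j\<close> to corner \<open>j + 1\<close>. Corners and sides are numbered from 1 to \<open>k\<close>,
  and corner \<open>k + 1\<close> is corner 1.
\<close>

definition corner :: "nat \<Rightarrow> nat \<Rightarrow> complex" where
  "corner k j = cis (2 * pi * real j / real k)"

definition side :: "nat \<Rightarrow> nat \<Rightarrow> complex set" where
  "side k j = cis ` {2 * pi * real j / real k .. 2 * pi * real (j + 1) / real k}"

definition open_side :: "nat \<Rightarrow> nat \<Rightarrow> complex set" where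
  "open_side k j = cis ` {2 * pi * real j / real k <..< 2 * pi * real (j + 1) / real k}"

text \<open>
  \<open>polygon_map V E k t \<phi>\<close> says that \<open>\<phi>\<close> exhibits \<open>t\<close> as an open disk with exactly \<open>k\<close> edges along its
  boundary, counted as they are met in a walk along the boundary: an edge that has \<open>t\<close> on both sides
  counts twice. The map \<open>\<phi>\<close> may run along the boundary in either direction and may start at any corner.
\<close>

definition polygon_map ::
    "'a::t2_space set \<Rightarrow> 'a set set \<Rightarrow> nat \<Rightarrow> 'a set \<Rightarrow> (complex \<Rightarrow> 'a) \<Rightarrow> bool" where
  "polygon_map V E k t \<phi> \<longleftrightarrow>
     continuous_on (cball 0 1) \<phi> \<and>
     (\<exists>\<psi>. homeomorphism (ball 0 1) t \<phi> \<psi>) \<and>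
     (\<forall>j\<in>{1..k}.
        \<phi> (corner k j) \<in> V \<and>
        \<phi> ` side k j \<in> E \<and>
        inj_on \<phi> (open_side k j) \<and>
        \<phi> ` open_side k j \<inter> V = {})"

definition tiling :: "'a::t2_space set \<Rightarrow> 'a set \<Rightarrow> 'a set set \<Rightarrow> bool" where
  "tiling S V E \<longleftrightarrow>
     closed_surface S \<and> embedded_graph S V E \<and>
     (\<forall>v\<in>V. vertex_degree V E v \<ge> 3) \<and>
     (\<forall>t\<in>tiles S V E.
        t homeomorphic ball (0::complex) 1 \<and> (\<exists>k\<ge>3. \<exists>\<phi>. polygon_map V E k t \<phi>))"

definition polygonal_tiling :: "nat \<Rightarrow> 'a::t2_space set \<Rightarrow> 'a set \<Rightarrow> 'a set set \<Rightarrow> bool" where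
  "polygonal_tiling k S V E \<longleftrightarrow>
     tiling S V E \<and> (\<forall>t\<in>tiles S V E. \<exists>\<phi>. polygon_map V E k t \<phi>)"

abbreviation "quadrilateral_tiling \<equiv> polygonal_tiling 4"
abbreviation "pentagonal_tiling \<equiv> polygonal_tiling 5"

section \<open>Simple pentagonal subdivision\<close>

text \<open>
  \<open>(V', E')\<close> is a simple pentagonal subdivision of the quadrilateral tiling \<open>(V, E)\<close>.
  Since edges carry no metric, the middle point of an edge \<open>e\<close> is \<open>\<gamma> e (1/2)\<close> for a parametrisation
  \<open>\<gamma> e\<close> of \<open>e\<close>. In the tile \<open>t\<close>, the opposite sides \<open>s t\<close> and \<open>s t + 2\<close> of the model quadrilateral are
  joined by \<open>c t\<close>. This arc is taken in the model, not in \<open>t\<close>, because an edge that has \<open>t\<close> on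
  both sides has to be approached from the selected side.
  The unique existence requirement ranges over all pairs of a tile and one of its selected sides.
\<close>

definition simple_pentagonal_subdivision ::
    "'a::t2_space set \<Rightarrow> 'a set \<Rightarrow> 'a set set \<Rightarrow> 'a set \<Rightarrow> 'a set set \<Rightarrow> bool" where
  "simple_pentagonal_subdivision S V E V' E' \<longleftrightarrow>
     (\<exists>(\<gamma> :: 'a set \<Rightarrow> real \<Rightarrow> 'a) (\<phi> :: 'a set \<Rightarrow> complex \<Rightarrow> 'a)
        (s :: 'a set \<Rightarrow> nat) (c :: 'a set \<Rightarrow> real \<Rightarrow> complex).
        (\<forall>e\<in>E. edge_path V e (\<gamma> e)) \<and>
        (\<forall>t\<in>tiles S V E.
           polygon_map V E 4 t (\<phi> t) \<and>
           s t \<in> {1, 2} \<and>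
           arc (c t) \<and> c t ` {0<..<1} \<subseteq> ball 0 1 \<and>
           pathstart (c t) \<in> side 4 (s t) \<and>
           pathfinish (c t) \<in> side 4 (s t + 2) \<and>
           \<phi> t (pathstart (c t)) = \<gamma> (\<phi> t ` side 4 (s t)) (1/2) \<and>
           \<phi> t (pathfinish (c t)) = \<gamma> (\<phi> t ` side 4 (s t + 2)) (1/2)) \<and>
        (\<forall>e\<in>E. \<exists>!p. p \<in> (SIGMA t:tiles S V E. {s t, s t + 2}) \<and>
                     \<phi> (fst p) ` side 4 (snd p) = e) \<and>
        V' = V \<union> (\<lambda>e. \<gamma> e (1/2)) ` E \<and>
        E' = (\<lambda>e. \<gamma> e ` {0..1/2}) ` E \<union> (\<lambda>e. \<gamma> e ` {1/2..1}) ` E \<union>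
             (\<lambda>t. \<phi> t ` path_image (c t)) ` tiles S V E)"

section \<open>The tile types\<close>

text \<open>
  The open Moebius band in \<open>\<complex> \<times> \<complex>\<close>: over the point \<open>cis \<theta>\<close> of the circle lies the open segment spanned
  by \<open>cis (\<theta>/2)\<close>, which is turned over when \<open>\<theta>\<close> increases by \<open>2 * pi\<close>.
\<close>

definition moebius_band :: "(complex \<times> complex) set" where
  "moebius_band = {(cis \<theta>, r *\<^sub>R cis (\<theta> / 2)) | \<theta> r :: real. \<bar>r\<bar> < 1}"

text \<open>
  \<open>B\<close> is the set of vertices labelled by a bullet. The corner \<open>v\<^sub>j\<close> of a pentagon is \<open>\<phi> (corner 5 j)\<close>, so
  side \<open>j\<close> of the pentagon runs from \<open>v\<^sub>j\<close> to \<open>v\<^sub>j\<^sub>+\<^sub>1\<close> and side 5 from \<open>v\<^sub>5\<close> to \<open>v\<^sub>1\<close>.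
\<close>

definition labelled_pentagon ::
    "'a::t2_space set \<Rightarrow> 'a set set \<Rightarrow> 'a set \<Rightarrow> 'a set \<Rightarrow> (complex \<Rightarrow> 'a) \<Rightarrow> bool" where
  "labelled_pentagon V E B t \<phi> \<longleftrightarrow>
     polygon_map V E 5 t \<phi> \<and>
     \<phi> (corner 5 1) \<in> B \<and> \<phi> (corner 5 3) \<in> B \<and>
     \<phi> (corner 5 2) \<notin> B \<and> \<phi> (corner 5 4) \<notin> B \<and> \<phi> (corner 5 5) \<notin> B"

definition type_P1 :: "'a::t2_space set \<Rightarrow> 'a set set \<Rightarrow> 'a set \<Rightarrow> 'a set \<Rightarrow> bool" where
  "type_P1 V E B t \<longleftrightarrow> (\<exists>\<phi>. labelled_pentagon V E B t \<phi> \<and> inj_on \<phi> (sphere 0 1))"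

text \<open>
  A small disk neighbourhood is expressed by asking for suitable open disks inside every neighbourhood
  of the vertex. As tiles are open disks, the union is an open Moebius band.
\<close>

definition type_P2 :: "'a::t2_space set \<Rightarrow> 'a set \<Rightarrow> 'a set set \<Rightarrow> 'a set \<Rightarrow> 'a set \<Rightarrow> bool" where
  "type_P2 S V E B t \<longleftrightarrow>
     (\<exists>\<phi>. labelled_pentagon V E B t \<phi> \<and>
        \<phi> (corner 5 1) = \<phi> (corner 5 3) \<and>
        (\<forall>x\<in>sphere 0 1. \<forall>y\<in>sphere 0 1.
           \<phi> x = \<phi> y \<longrightarrow> x = y \<or> {x, y} = {corner 5 1, corner 5 3}) \<and>
        (\<forall>U. openin (top_of_set S) U \<and> \<phi> (corner 5 1) \<in> U \<longrightarrow>
           (\<exists>D\<subseteq>U. openin (top_of_set S) D \<and> \<phi> (corner 5 1) \<in> D \<and>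
                  D homeomorphic ball (0::complex) 1 \<and>
                  (t \<union> D) homeomorphic moebius_band)))"

definition type_P3 :: "'a::t2_space set \<Rightarrow> 'a set set \<Rightarrow> 'a set \<Rightarrow> 'a set \<Rightarrow> bool" where
  "type_P3 V E B t \<longleftrightarrow>
     (\<exists>\<phi>. labelled_pentagon V E B t \<phi> \<and>
        \<phi> ` side 5 2 = \<phi> ` side 5 5 \<and>
        \<phi> (corner 5 2) = \<phi> (corner 5 5) \<and>
        \<phi> (corner 5 3) = \<phi> (corner 5 1) \<and>
        (\<forall>x\<in>sphere 0 1. \<forall>y\<in>sphere 0 1. \<phi> x = \<phi> y \<longrightarrow>
           x = y \<or> (x \<in> side 5 2 \<and> y \<in> side 5 5) \<or> (x \<in> side 5 5 \<and> y \<in> side 5 2)))"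

end

theory Submission
  imports Defs
begin

text \<open>
  In a subdivision, label the vertices of the quadrilateral tiling. Every edge of the pentagonal tiling is
  then half of an old edge, with one labelled end, or one of the added arcs, with none. Counting shows that
  every pentagon has exactly one side of the second kind, which fixes the labels of its corners. As the
  unlabelled vertices have degree 3, few identifications are possible on the boundary of a pentagon, and
  crossing an edge with one labelled end always leads from a side 3 or 5 to a side 1 or 2. So the corners
  at a labelled vertex are passed through in a consistent direction, and this forces a Moebius band when
  \<open>v\<^sub>1 = v\<^sub>3\<close>.

  Conversely, every unlabelled vertex lies on exactly one edge without labelled ends and on two edges with
  one labelled end. Erasing the edges of the first kind glues the pentagons in pairs along their sides 4 to
  quadrilaterals, and the two other edges at each unlabelled vertex are joined to one edge with that
  vertex as its middle point.
\<close>

section \<open>Gluing compact pieces\<close>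

text \<open>The surface is just a topological space, with no combinatorial structure given in
  advance. Two facts have to be extracted from its charts: an edge borders exactly two sides of
  tiles, by invariance of domain, and the corners around a vertex form a single class, by
  connectedness of a punctured disk. Counting rests on the first, rotation about a vertex on both.
  Homeomorphisms between glued spaces are obtained from finite families of compact pieces mapped in
  two ways with the same identifications. That an unlabelled vertex has exactly one edge without
  labelled ends is not a local fact. Locally there is at most one, since two or more would need more
  sides of the remaining edges than exist; a global count then gives one on average. The Moebius
  band comes from the labels alone: rotation enters \<open>v_1\<close> through the side after it and
  \<open>v_3\<close> through the side before it, so the two corners are passed in opposite senses
  relative to the boundary walk.\<close>

lemma factor_through_compact_pieces:
  fixes p :: "'i => 'y::t2_space => 'x::t2_space" and q :: "'i => 'y => 'z::t2_space"
  assumes fin: "finite I"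
    and Y: "\<And>i. i \<in> I ==> compact (Y i)"
    and p: "\<And>i. i \<in> I ==> continuous_on (Y i) (p i)"
    and q: "\<And>i. i \<in> I ==> continuous_on (Y i) (q i)"
    and sub: "\<And>i. i \<in> I ==> N i \<subseteq> Y i"
    and eq: "\<And>i j y z. [|i \<in> I; j \<in> I; y \<in> N i; z \<in> Y j; p i y = p j z|] ==> q i y = q j z"
  shows "\<exists>f. continuous_on (\<Union>i\<in>I. p i ` N i) f \<and> (\<forall>i\<in>I. \<forall>y\<in>N i. f (p i y) = q i y)"
proof -
  define f where "f x = (SOME z. \<exists>i\<in>I. \<exists>y\<in>N i. x = p i y \<and> z = q i y)" for x
  have f: "f (p i y) = q i y" if iy: "i \<in> I" "y \<in> N i" for i y
  proof -
    have "\<exists>j\<in>I. \<exists>y'\<in>N j. p i y = p j y' \<and> f (p i y) = q j y'"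
      unfolding f_def by (rule someI_ex) (use iy in blast)
    then show ?thesis using eq iy sub by (metis subsetD)
  qed
  have "continuous_on (\<Union>i\<in>I. p i ` N i) f"
    unfolding continuous_on_closed_invariant
  proof (intro allI impI)
    fix B :: "'z set" assume "closed B"
    \<comment> \<open>The part of the preimage of \<open>B\<close> in a piece \<open>Y i\<close> is
      compact, so its image is closed. \<open>?A\<close> uses the whole pieces; intersected with the
      images of the \<open>N i\<close> it is the preimage under \<open>f\<close>, because
      \<open>eq\<close> compares \<open>N i\<close> with all of \<open>Y j\<close>.\<close>
    let ?A = "\<Union>i\<in>I. p i ` (q i -` B \<inter> Y i)"
    have "compact (p i ` (q i -` B \<inter> Y i))" if i: "i \<in> I" for i
    proof -
      have "closed (Y i)" using Y i compact_imp_closed by blast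
      then have "closed (q i -` B \<inter> Y i)"
        using q[OF i] \<open>closed B\<close> continuous_on_closed_vimage by blast
      then have "compact (q i -` B \<inter> Y i)"
        by (metis Y[OF i] compact_Int_closed Int_left_absorb Int_commute)
      then show ?thesis
        using p[OF i] by (meson compact_continuous_image continuous_on_subset inf_le2)
    qed
    then have "closed ?A"
      using fin by (intro compact_imp_closed compact_UN) auto
    moreover have "?A \<inter> (\<Union>i\<in>I. p i ` N i) = f -` B \<inter> (\<Union>i\<in>I. p i ` N i)" (is "?L = ?R")
    proof (intro equalityI subsetI)
      fix x assume "x \<in> ?L"
      then obtain i y j z where "i \<in> I" "y \<in> N i" "x = p i y" "j \<in> I" "z \<in> Y j" "q j z \<in> B" "x = p j z"
        by auto
      then show "x \<in> ?R" using eq[of i j y z] f[of i y] by auto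
    next
      fix x assume "x \<in> ?R"
      then obtain i y where "i \<in> I" "y \<in> N i" "x = p i y" "f x \<in> B" by auto
      then show "x \<in> ?L" using f[of i y] sub[of i] by auto
    qed
    ultimately show "\<exists>A. closed A \<and> A \<inter> (\<Union>i\<in>I. p i ` N i) = f -` B \<inter> (\<Union>i\<in>I. p i ` N i)"
      by blast
  qed
  then show ?thesis using f by blast
qed

text \<open>
  Two ways of gluing the same compact pieces, with the same identifications along the parts \<open>N i\<close>,
  yield homeomorphic spaces.
\<close>

lemma homeomorphism_from_compact_pieces:
  fixes p :: "'i => 'y::t2_space => 'x::t2_space" and q :: "'i => 'y => 'z::t2_space"
  assumes fin: "finite I"
    and Y: "\<And>i. i \<in> I ==> compact (Y i)"
    and p: "\<And>i. i \<in> I ==> continuous_on (Y i) (p i)"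
    and q: "\<And>i. i \<in> I ==> continuous_on (Y i) (q i)"
    and sub: "\<And>i. i \<in> I ==> N i \<subseteq> Y i"
    and eq: "\<And>i j y z. [|i \<in> I; j \<in> I; y \<in> N i; z \<in> Y j|] ==> p i y = p j z \<longleftrightarrow> q i y = q j z"
  obtains f g where "homeomorphism (\<Union>i\<in>I. p i ` N i) (\<Union>i\<in>I. q i ` N i) f g"
    and "\<And>i y. i \<in> I ==> y \<in> N i ==> f (p i y) = q i y"
proof -
  have "\<exists>f. continuous_on (\<Union>i\<in>I. p i ` N i) f \<and> (\<forall>i\<in>I. \<forall>y\<in>N i. f (p i y) = q i y)"
    by (rule factor_through_compact_pieces[OF fin Y p q sub]) (simp_all add: eq)
  then obtain f where f: "continuous_on (\<Union>i\<in>I. p i ` N i) f" "\<forall>i\<in>I. \<forall>y\<in>N i. f (p i y) = q i y"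
    by (elim exE conjE)
  have "\<exists>g. continuous_on (\<Union>i\<in>I. q i ` N i) g \<and> (\<forall>i\<in>I. \<forall>y\<in>N i. g (q i y) = p i y)"
    by (rule factor_through_compact_pieces[OF fin Y q p sub]) (simp_all add: eq)
  then obtain g where g: "continuous_on (\<Union>i\<in>I. q i ` N i) g" "\<forall>i\<in>I. \<forall>y\<in>N i. g (q i y) = p i y"
    by (elim exE conjE)
  have "homeomorphism (\<Union>i\<in>I. p i ` N i) (\<Union>i\<in>I. q i ` N i) f g"
    by (rule homeomorphismI) (use f g in auto)
  then show ?thesis by (rule that) (use f in blast)
qed

text \<open>One compact piece, glued by the identity and by \<open>f\<close>. Injectivity of
  \<open>A\<close> against all of the compact set \<open>X\<close> replaces compactness of
  \<open>A\<close>; this is how open disks and open intervals are treated below.\<close>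

lemma homeomorphism_saturated:
  fixes f :: "'x::t2_space => 'z::t2_space"
  assumes "compact X" "continuous_on X f" "A \<subseteq> X"
    and "\<And>a x. [|a \<in> A; x \<in> X; f a = f x|] ==> a = x"
  shows "\<exists>g. homeomorphism A (f ` A) f g"
proof -
  have eq: "a = x \<longleftrightarrow> f a = f x" if "a \<in> A" "x \<in> X" for a x
    using assms(4) that by blast
  obtain f' g where "homeomorphism (\<Union>i\<in>{()}. (\<lambda>x. x) ` A) (\<Union>i\<in>{()}. f ` A) f' g"
    "\<And>i a. i \<in> {()} ==> a \<in> A ==> f' a = f a"
    by (rule homeomorphism_from_compact_pieces[of "{()}" "\<lambda>_. X" "\<lambda>_ x. x" "\<lambda>_. f" "\<lambda>_. A"])
      (use assms(1-3) eq in auto)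
  then have "homeomorphism A (f ` A) f' g" "\<And>a. a \<in> A ==> f' a = f a" by auto
  then have "homeomorphism A (f ` A) f g"
    by (simp add: homeomorphism_def cong: continuous_on_cong)
  then show ?thesis by blast
qed

text \<open>Near each point a chart turns \<open>\<beta>\<close> into a continuous injection between
  subsets of the plane, where invariance of domain applies. It serves to show that certain sets are
  too thin to be open in the surface.\<close>

lemma surface_invariance_of_domain:
  assumes S: "closed_surface S" and "openin (top_of_set S) U" and "continuous_on U \<beta>" "inj_on \<beta> U"
  shows "open (\<beta> ` U :: complex set)"
proof (subst open_subopen, intro ballI)
  fix w assume "w \<in> \<beta> ` U"
  then obtain x where x: "x \<in> U" "w = \<beta> x" by blast
  have US: "U \<subseteq> S" using assms(2) openin_imp_subset by blast
  obtain C where C: "openin (top_of_set S) C" "x \<in> C" "C homeomorphic ball (0::complex) 1"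
    using S x US unfolding closed_surface_def by blast
  then obtain h k where hk: "homeomorphism (ball (0::complex) 1) C h k"
    using homeomorphic_def homeomorphic_sym by blast
  have "openin (top_of_set C) (U \<inter> C)"
    by (metis C(1) assms(2) inf_le2 openin_Int openin_subset_trans openin_imp_subset)
  then have "openin (top_of_set (ball (0::complex) 1)) (k ` (U \<inter> C))"
    using homeomorphism_imp_open_map[OF homeomorphism_symD[OF hk]] by blast
  then have o: "open (k ` (U \<inter> C))"
    using open_ball openin_open_eq by blast
  have kU: "h (k y) = y" if "y \<in> C" for y using hk that by (simp add: homeomorphism_def)
  have kB: "k ` C \<subseteq> ball 0 1" using hk by (auto simp: homeomorphism_def)
  have "continuous_on (k ` (U \<inter> C)) (\<beta> \<circ> h)"
  proof (rule continuous_on_compose)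
    show "continuous_on (k ` (U \<inter> C)) h"
      using hk kB by (meson continuous_on_subset homeomorphism_def image_mono inf_le2 order_trans)
    show "continuous_on (h ` k ` (U \<inter> C)) \<beta>"
      by (rule continuous_on_subset[OF assms(3)]) (use kU in auto)
  qed
  moreover have "inj_on (\<beta> \<circ> h) (k ` (U \<inter> C))"
    using assms(4) kU by (auto simp: inj_on_def)
  ultimately have "open ((\<beta> \<circ> h) ` (k ` (U \<inter> C)))"
    using o invariance_of_domain by blast
  moreover have "(\<beta> \<circ> h) ` (k ` (U \<inter> C)) = \<beta> ` (U \<inter> C)"
    using kU by (force simp: image_image)
  ultimately show "\<exists>T. open T \<and> w \<in> T \<and> T \<subseteq> \<beta> ` U"
    using x C(2) by (intro exI[of _ "\<beta> ` (U \<inter> C)"]) auto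
qed

text \<open>The counterpart with source in the plane: \<open>G\<close> followed by a chart around
  one of its values is a planar injection, open by invariance of domain, and the chart carries
  openness back to the surface.\<close>

lemma surface_open_map:
  fixes G :: "complex => 'a::t2_space"
  assumes S: "closed_surface S" and "open W" "continuous_on W G" "inj_on G W" "G ` W \<subseteq> S"
  shows "openin (top_of_set S) (G ` W)"
proof (subst openin_subopen, intro ballI)
  fix y assume "y \<in> G ` W"
  then obtain w where w: "w \<in> W" "y = G w" by blast
  obtain C where C: "openin (top_of_set S) C" "y \<in> C" "C homeomorphic ball (0::complex) 1"
    using S w assms(5) unfolding closed_surface_def by blast
  then obtain k h where kh: "homeomorphism C (ball (0::complex) 1) k h"
    using homeomorphic_def by blast
  have hk: "h (k z) = z" if "z \<in> C" for z using kh that by (simp add: homeomorphism_def)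
  define W' where "W' = W \<inter> G -` C"
  have "openin (top_of_set W) W'"
    using C(1) assms(3,5) continuous_on_open_gen unfolding W'_def
    by (metis image_subset_iff_funcset)
  then have W': "open W'" using assms(2) openin_open_eq by blast
  have GW': "G ` W' \<subseteq> C" by (auto simp: W'_def)
  have "continuous_on W' (k \<circ> G)"
    by (rule continuous_on_compose)
      (use assms(3) kh GW' in \<open>auto simp: W'_def homeomorphism_def intro: continuous_on_subset\<close>)
  moreover have "inj_on (k \<circ> G) W'"
  proof (rule inj_onI)
    fix a b assume ab: "a \<in> W'" "b \<in> W'" "(k \<circ> G) a = (k \<circ> G) b"
    then have "G a = G b" by (metis GW' hk comp_apply image_subset_iff)
    then show "a = b" using assms(4) ab by (auto simp: W'_def inj_on_def)
  qed
  ultimately have "open ((k \<circ> G) ` W')" using invariance_of_domain W' by blast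
  then have "openin (top_of_set (ball 0 1)) ((k \<circ> G) ` W')"
    using kh GW' by (intro open_subset) (auto simp: homeomorphism_def)
  then have "openin (top_of_set C) (h ` ((k \<circ> G) ` W'))"
    using homeomorphism_imp_open_map[OF homeomorphism_symD[OF kh]] by blast
  moreover have "h ` ((k \<circ> G) ` W') = G ` W'"
    using hk GW' by (force simp: image_image)
  ultimately have "openin (top_of_set S) (G ` W')"
    using C(1) openin_trans by metis
  moreover have "y \<in> G ` W'" using w C(2) by (auto simp: W'_def)
  ultimately show "\<exists>T. openin (top_of_set S) T \<and> y \<in> T \<and> T \<subseteq> G ` W"
    by (intro exI[of _ "G ` W'"]) (auto simp: W'_def)
qed

section \<open>Polygons on a surface\<close>

text \<open>The integer index of \<open>corner\<close> becomes a real parameter: integers are the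
  corners, and side \<open>j\<close> lies over the interval from \<open>j\<close> to
  \<open>j + 1\<close>. The period used below runs from 1 to \<open>k + 1\<close>, because corners
  are numbered from 1.\<close>

definition circle_point :: "nat => real => complex" where
  "circle_point k s = cis (2 * pi * s / real k)"

lemma corner_circle_point: "corner k j = circle_point k (real j)"
  by (simp add: corner_def circle_point_def)

lemma image_mult_greaterThanLessThan_real:
  assumes "(c::real) > 0" shows "(\<lambda>x. c * x) ` {a<..<b} = {c * a<..<c * b}"
proof (intro equalityI subsetI)
  fix y assume "y \<in> {c * a<..<c * b}"
  then have "a < y / c" "y / c < b" using assms by (simp_all add: field_simps)
  then show "y \<in> (\<lambda>x. c * x) ` {a<..<b}" using assms by (intro image_eqI[of _ _ "y / c"]) auto
qed (use assms in auto)

lemma image_shift_unit_Icc: "(\<lambda>x. c + x) ` {0..1} = {c..c + 1 :: real}"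
proof (intro equalityI subsetI)
  fix y assume "y \<in> {c..c + 1}"
  then show "y \<in> (\<lambda>x. c + x) ` {0..1}" by (intro image_eqI[of _ _ "y - c"]) auto
qed auto

lemma image_shift_unit_Ioo: "(\<lambda>x. c + x) ` {0<..<1} = {c<..<c + 1 :: real}"
proof (intro equalityI subsetI)
  fix y assume "y \<in> {c<..<c + 1}"
  then show "y \<in> (\<lambda>x. c + x) ` {0<..<1}" by (intro image_eqI[of _ _ "y - c"]) auto
qed auto

lemma side_circle_point:
  assumes "k > 0" shows "side k j = circle_point k ` {real j .. real j + 1}"
proof -
  have "(\<lambda>s. 2 * pi * s / real k) ` {real j .. real j + 1} =
        {2 * pi * real j / real k .. 2 * pi * real (j + 1) / real k}"
    using image_mult_atLeastAtMost[of "2 * pi / real k" "real j" "real j + 1"] assms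
    by (simp add: add.commute)
  then show ?thesis unfolding side_def circle_point_def by (metis image_image)
qed

lemma open_side_circle_point:
  assumes "k > 0" shows "open_side k j = circle_point k ` {real j <..< real j + 1}"
proof -
  have "(\<lambda>s. 2 * pi * s / real k) ` {real j <..< real j + 1} =
        {2 * pi * real j / real k <..< 2 * pi * real (j + 1) / real k}"
    using image_mult_greaterThanLessThan_real[of "2 * pi / real k" "real j" "real j + 1"] assms
    by (simp add: add.commute)
  then show ?thesis unfolding open_side_def circle_point_def by (metis image_image)
qed

lemma norm_circle_point [simp]: "norm (circle_point k s) = 1"
  by (simp add: circle_point_def)

lemma continuous_on_circle_point [continuous_intros]:
  "continuous_on A f ==> continuous_on A (\<lambda>x. circle_point k (f x))"
  unfolding circle_point_def by (cases "k = 0") (auto intro!: continuous_intros)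

lemma circle_point_add: "circle_point k (s + s') = circle_point k s * circle_point k s'"
  by (simp add: circle_point_def cis_mult add_divide_distrib ring_distribs)

lemma circle_point_period [simp]: "k > 0 ==> circle_point k (real k) = 1"
  by (simp add: circle_point_def)

section \<open>Coincidences of parameters on the unit circle\<close>

lemma cis_eq_iff_int: "cis a = cis b \<longleftrightarrow> (\<exists>n::int. a = b + 2 * pi * n)"
proof -
  have "cis a = cis b \<longleftrightarrow> exp (\<i> * of_real a) = exp (\<i> * of_real b)"
    by (simp add: cis_conv_exp)
  also have "\<dots> \<longleftrightarrow> (\<exists>n::int. \<i> * of_real a = \<i> * of_real b + (of_int (2 * n) * pi) * \<i>)"
    by (rule exp_eq)
  also have "\<dots> \<longleftrightarrow> (\<exists>n::int. a = b + 2 * pi * n)"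
  proof -
    have "(\<i> * of_real a = \<i> * of_real b + (of_int (2 * n) * pi) * \<i>) \<longleftrightarrow> a = b + 2 * pi * n" for n :: int
    proof -
      have "\<i> * of_real b + (of_int (2 * n) * pi) * \<i> = \<i> * of_real (b + 2 * pi * n)"
        by (simp add: algebra_simps)
      then show ?thesis
        by (simp only: mult_cancel_left of_real_eq_iff) simp
    qed
    then show ?thesis by simp
  qed
  finally show ?thesis .
qed

lemma cis_eq_iff_within_period:
  assumes "a \<in> {c..c + 2 * pi}" "b \<in> {c..c + 2 * pi}"
  shows "cis a = cis b \<longleftrightarrow> a = b \<or> {a, b} = {c, c + 2 * pi}"
proof
  assume "cis a = cis b"
  then obtain n :: int where n: "a = b + 2 * pi * n" using cis_eq_iff_int by blast
  have "\<bar>2 * pi * n\<bar> \<le> 2 * pi" using n assms by auto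
  then have "\<bar>real_of_int n\<bar> \<le> 1" by (simp add: abs_mult)
  then consider "n = 0" | "n = 1" | "n = -1" by linarith
  then show "a = b \<or> {a, b} = {c, c + 2 * pi}"
    by cases (use n assms in auto)
next
  assume "a = b \<or> {a, b} = {c, c + 2 * pi}"
  then show "cis a = cis b"
    by (auto simp: doubleton_eq_iff cis_eq_iff_int intro: exI[of _ "-1"] exI[of _ 1])
qed

lemma circle_point_eq_iff:
  assumes k: "k > 0" and "s \<in> {1..real k + 1}" "s' \<in> {1..real k + 1}"
  shows "circle_point k s = circle_point k s' \<longleftrightarrow> s = s' \<or> {s, s'} = {1, real k + 1}"
proof -
  let ?f = "\<lambda>s. 2 * pi * s / real k"
  have inj: "?f a = ?f b \<longleftrightarrow> a = b" for a b using k by simp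
  have 2: "?f (real k + 1) = ?f 1 + 2 * pi" using k by (simp add: field_simps)
  have mono: "?f a \<le> ?f b \<longleftrightarrow> a \<le> b" for a b using k by (simp add: divide_le_cancel)
  have "?f a \<in> {?f 1..?f 1 + 2 * pi}" if "a \<in> {1..real k + 1}" for a
    unfolding 2[symmetric] using that by (simp only: atLeastAtMost_iff mono)
  then have "cis (?f s) = cis (?f s') \<longleftrightarrow> ?f s = ?f s' \<or> {?f s, ?f s'} = {?f 1, ?f 1 + 2 * pi}"
    using assms by (intro cis_eq_iff_within_period)
  then show ?thesis
    unfolding circle_point_def 2[symmetric] doubleton_eq_iff inj .
qed

lemma sphere_circle_point:
  assumes "k > 0" shows "sphere 0 1 = circle_point k ` {1..<real k + 1}"
proof (intro equalityI subsetI)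
  fix z :: complex assume "z \<in> sphere 0 1"
  then have "norm z = 1" by simp
  then obtain a where a: "z = cis a" using rcis_cmod_Arg[of z] by (metis cis_rcis_eq)
  define s where "s = a * real k / (2 * pi)"
  \<comment> \<open>\<open>n\<close> counts the whole turns to remove, so that the parameter lands
    in the period starting at 1.\<close>
  define n where "n = \<lfloor>(s - 1) / real k\<rfloor>"
  have "s - 1 - n * real k \<ge> 0" "s - 1 - n * real k < real k"
  proof -
    have "n \<le> (s - 1) / real k" "(s - 1) / real k < n + 1"
      unfolding n_def using floor_correct[of "(s - 1) / real k"] by auto
    then have "n * real k \<le> s - 1" "s - 1 < (n + 1) * real k"
      using assms by (simp_all add: pos_le_divide_eq pos_divide_less_eq)
    then show "s - 1 - n * real k \<ge> 0" "s - 1 - n * real k < real k"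
      by (simp_all add: algebra_simps)
  qed
  moreover have "z = circle_point k (s - n * real k)"
    unfolding a circle_point_def cis_eq_iff_int s_def using assms
    by (intro exI[of _ n]) (simp add: field_simps)
  ultimately show "z \<in> circle_point k ` {1..<real k + 1}" by force
qed auto

lemma ex_side_index:
  assumes "s \<in> {1..<real k + 1}"
  obtains j where "j \<in> {1..k}" "s \<in> {real j..<real j + 1}"
proof
  have "1 \<le> \<lfloor>s\<rfloor>" "\<lfloor>s\<rfloor> \<le> int k" using assms by (auto simp: le_floor_iff floor_le_iff)
  then show "nat \<lfloor>s\<rfloor> \<in> {1..k}" by (simp only: atLeastAtMost_iff) linarith
  have "real (nat \<lfloor>s\<rfloor>) = of_int \<lfloor>s\<rfloor>" using \<open>1 \<le> \<lfloor>s\<rfloor>\<close> by simp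
  then show "s \<in> {real (nat \<lfloor>s\<rfloor>)..<real (nat \<lfloor>s\<rfloor>) + 1}"
    using floor_correct[of s] by (simp only: atLeastLessThan_iff) auto
qed

lemma sphere_cases:
  assumes "z \<in> sphere 0 1" "k > 0"
  obtains j where "j \<in> {1..k}" "z = corner k j" | j where "j \<in> {1..k}" "z \<in> open_side k j"
proof -
  obtain s where s: "s \<in> {1..<real k + 1}" "z = circle_point k s"
    using sphere_circle_point assms by blast
  obtain j where j: "j \<in> {1..k}" "s \<in> {real j..<real j + 1}" using ex_side_index s by blast
  show ?thesis
  proof (cases "s = real j")
    case True then show ?thesis using that(1) j s by (simp add: corner_circle_point)
  next
    case False then show ?thesis using that(2)[of j] j s assms by (auto simp: open_side_circle_point)
  qed
qed

lemma side_subset_sphere: "side k j \<subseteq> sphere 0 1"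
  by (auto simp: side_def)

lemma open_side_subset_side: "open_side k j \<subseteq> side k j"
  unfolding side_def open_side_def by (rule image_mono) auto

lemma open_side_disjoint:
  assumes "k > 0" "i \<in> {1..k}" "j \<in> {1..k}" "z \<in> open_side k i" "z \<in> open_side k j"
  shows "i = j"
proof -
  obtain s where si: "s \<in> {real i<..<real i + 1}" "z = circle_point k s"
    using assms(4) unfolding open_side_circle_point[OF assms(1)] by (rule imageE)
  obtain s' where sj: "s' \<in> {real j<..<real j + 1}" "z = circle_point k s'"
    using assms(5) unfolding open_side_circle_point[OF assms(1)] by (rule imageE)
  have s: "s \<in> {real i<..<real i + 1}" "s' \<in> {real j<..<real j + 1}"
    "circle_point k s = circle_point k s'" using si sj by auto
  have *: "real i \<le> real k" "real j \<le> real k" "real i \<ge> 1" "real j \<ge> 1" using assms by auto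
  have "s \<in> {1..real k + 1}" "s' \<in> {1..real k + 1}" using s * by auto
  then have "s = s'"
    using circle_point_eq_iff[of k s s'] s(3) assms(1) s(1,2) * by (auto simp: doubleton_eq_iff)
  then have "real i < real j + 1" "real j < real i + 1" using s by auto
  then show ?thesis by linarith
qed

text \<open>An interior parameter of a simple path shares its value with no other parameter, end
  points included. So the open interval is saturated, even for a loop, and
  \<open>homeomorphism_saturated\<close> applies.\<close>

lemma edge_path_interior:
  assumes "edge_path V e g"
  shows "g ` {0<..<1} = e - V" and "\<exists>h. homeomorphism {0<..<1} (e - V) g h"
proof -
  have g: "simple_path g" "path_image g = e" "e \<inter> V = {g 0, g 1}"
    using assms by (auto simp: edge_path_def pathstart_def pathfinish_def)
  have sat: "a = x" if "a \<in> {0<..<1}" "x \<in> {0..1}" "g a = g x" for a x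
    using g(1) that by (force simp: simple_path_def loop_free_def)
  have "g ` {0<..<1} = g ` {0..1} - {g 0, g 1}"
  proof (intro equalityI subsetI)
    fix y assume "y \<in> g ` {0<..<1}"
    then obtain a where a: "a \<in> {0<..<1}" "y = g a" by blast
    then have "g a ~= g 0" "g a ~= g 1" using sat[of a 0] sat[of a 1] by force+
    then show "y \<in> g ` {0..1} - {g 0, g 1}" using a by auto
  next
    fix y assume "y \<in> g ` {0..1} - {g 0, g 1}"
    then show "y \<in> g ` {0<..<1}" by (force simp: image_iff less_le)
  qed
  then show 1: "g ` {0<..<1} = e - V" using g by (auto simp: path_image_def)
  have "continuous_on {0..1} g" using g by (simp add: simple_path_def path_def)
  then have "\<exists>h. homeomorphism {0<..<1} (g ` {0<..<1}) g h"
    by (rule homeomorphism_saturated[OF compact_Icc _ _ sat]) auto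
  then show "\<exists>h. homeomorphism {0<..<1} (e - V) g h" using 1 by simp
qed

text \<open>One boundary chart is fixed for every tile. With \<open>k\<close> and
  \<open>\<phi>\<close> as parameters the same facts serve quadrilateral and pentagonal tilings, and
  also charts that have been rotated or reflected.\<close>

locale polygons =
  fixes S V :: "'a::t2_space set" and E :: "'a set set" and k :: nat
    and \<phi> :: "'a set => complex => 'a"
  assumes surface: "closed_surface S" and graph: "embedded_graph S V E" and k3: "k \<ge> 3"
    and polygon: "t \<in> tiles S V E ==> polygon_map V E k t (\<phi> t)"
begin

abbreviation "T \<equiv> tiles S V E"

definition rim :: "'a set => real => 'a" where "rim t s = \<phi> t (circle_point k s)"

definition edge :: "'a set => nat => 'a set" where "edge t j = \<phi> t ` side k j"

text \<open>Pairs of a tile and an index rather than tiles, so that an edge with the same tile on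
  both sides still has two elements here.\<close>

definition sides_of :: "'a set => ('a set \<times> nat) set" where
  "sides_of e = {(t, j). t \<in> T \<and> j \<in> {1..k} \<and> edge t j = e}"

lemma k_pos: "k > 0" using k3 by simp

lemma finite_V: "finite V" and finite_E: "finite E" and V_S: "V \<subseteq> S"
  using graph unfolding embedded_graph_def by blast+

lemma E_S: "e \<in> E ==> e \<subseteq> S" using graph unfolding embedded_graph_def by blast

lemma ex_edge_path: "e \<in> E ==> \<exists>g. edge_path V e g"
  using graph unfolding embedded_graph_def by blast

lemma edges_meet: "[|e \<in> E; e' \<in> E; x \<in> e; x \<in> e'; x \<notin> V|] ==> e = e'"
  using graph unfolding embedded_graph_def by blast

lemma compact_edge: "e \<in> E ==> compact e"
  using ex_edge_path[of e] compact_simple_path_image unfolding edge_path_def by blast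

lemma S_eq: "S = V \<union> \<Union>E \<union> \<Union>T"
proof -
  have "\<Union>T = S - (V \<union> \<Union>E)" unfolding tiles_def by (rule Union_components)
  moreover have "V \<union> \<Union>E \<subseteq> S" using V_S E_S by blast
  ultimately show ?thesis by blast
qed

lemma tile_disj_graph: "t \<in> T ==> t \<inter> (V \<union> \<Union>E) = {}"
  using in_components_subset[of t "S - (V \<union> \<Union>E)"] unfolding tiles_def by blast

lemma tiles_disjoint: "[|t \<in> T; t' \<in> T; x \<in> t; x \<in> t'|] ==> t = t'"
  using components_nonoverlap[of t "S - (V \<union> \<Union>E)" t'] unfolding tiles_def by blast

lemma cont: "t \<in> T ==> continuous_on (cball 0 1) (\<phi> t)"
  using polygon by (simp add: polygon_map_def)

lemma homeo: "t \<in> T ==> \<exists>\<psi>. homeomorphism (ball 0 1) t (\<phi> t) \<psi>"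
  using polygon by (simp add: polygon_map_def)

lemma image_ball: "t \<in> T ==> \<phi> t ` ball 0 1 = t"
  using homeo[of t] unfolding homeomorphism_def by blast

lemma inj_ball: "t \<in> T ==> inj_on (\<phi> t) (ball 0 1)"
  using homeo[of t] homeomorphism_apply1 inj_on_inverseI by metis

lemma edge_in_E: "[|t \<in> T; j \<in> {1..k}|] ==> edge t j \<in> E"
  using polygon[of t] unfolding polygon_map_def edge_def by blast

lemma rim_period: "rim t (s + real k) = rim t s"
  by (simp add: rim_def circle_point_add k_pos)

lemma rim_last: "rim t (real k + 1) = rim t 1"
  using rim_period[of t 1] by (simp add: add.commute)

lemma rim_vertex:
  assumes "t \<in> T" "j \<in> {1..k + 1}" shows "rim t (real j) \<in> V"
proof (cases "j = k + 1")
  case True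
  then have "rim t (real j) = rim t (real 1)" using rim_last[of t] by (simp add: add.commute)
  then show ?thesis
    using polygon[OF assms(1)] k3 unfolding polygon_map_def rim_def
    by (metis One_nat_def atLeastAtMost_iff corner_circle_point k_pos le_refl Suc_leI)
next
  case False
  then show ?thesis
    using polygon[OF assms(1)] assms unfolding polygon_map_def rim_def
    by (metis Suc_eq_plus1 atLeastAtMost_iff corner_circle_point le_SucE)
qed

lemma edge_rim: "edge t j = (\<lambda>x. rim t (real j + x)) ` {0..1}"
  unfolding edge_def rim_def side_circle_point[OF k_pos] image_shift_unit_Icc[symmetric] image_image ..

lemma rim_open_side: "(\<lambda>x. rim t (real j + x)) ` {0<..<1} = \<phi> t ` open_side k j"
  unfolding rim_def open_side_circle_point[OF k_pos] image_shift_unit_Ioo[symmetric] image_image ..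

lemma cont_rim: "t \<in> T ==> continuous_on A (rim t)"
  unfolding rim_def
  by (rule continuous_on_compose2[of "cball 0 1" "\<phi> t"]) (auto intro!: continuous_intros cont)

text \<open>\<open>polygon_map\<close> gives injectivity on the open side only. The ends are
  vertices and the interior avoids the vertices, so the only coincidence left is that of the two
  ends.\<close>

lemma edge_path_side:
  assumes "t \<in> T" "j \<in> {1..k}"
  shows "edge_path V (edge t j) (\<lambda>x. rim t (real j + x))"
proof -
  let ?g = "\<lambda>x. rim t (real j + x)"
  have pm: "inj_on (\<phi> t) (open_side k j)" "\<phi> t ` open_side k j \<inter> V = {}"
    using polygon[OF assms(1)] assms(2) by (auto simp: polygon_map_def)
  have V0: "?g 0 \<in> V" and V1: "?g 1 \<in> V"
    using rim_vertex[OF assms(1), of j] rim_vertex[OF assms(1), of "j + 1"] assms(2)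
    by (auto simp: add.commute)
  have nV: "?g x \<notin> V" if "0 < x" "x < 1" for x
  proof -
    have "?g x \<in> \<phi> t ` open_side k j" using rim_open_side[of t j] that by auto
    then show ?thesis using pm(2) by blast
  qed
  have inj: "x = y" if "0 < x" "x < 1" "0 < y" "y < 1" "?g x = ?g y" for x y
  proof -
    have o: "circle_point k (real j + a) \<in> open_side k j" if "0 < a" "a < 1" for a
      using that by (auto simp: open_side_circle_point k_pos)
    then have "circle_point k (real j + x) = circle_point k (real j + y)"
      using pm(1) that unfolding rim_def inj_on_def by blast
    moreover have "real j \<ge> 1" "real j \<le> real k" using assms(2) by auto
    ultimately show ?thesis
      using circle_point_eq_iff[OF k_pos, of "real j + x" "real j + y"] that
      by (auto simp: doubleton_eq_iff)
  qed
  have path: "path ?g" unfolding path_def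
    by (rule continuous_on_compose2[OF cont_rim[OF assms(1), of UNIV]]) (auto intro!: continuous_intros)
  have "simple_path ?g" unfolding simple_path_def loop_free_def
  proof (intro conjI path ballI impI)
    fix x y :: real assume xy: "x \<in> {0..1}" "y \<in> {0..1}" "?g x = ?g y"
    show "x = y \<or> x = 0 \<and> y = 1 \<or> x = 1 \<and> y = 0"
    proof (cases "?g x \<in> V")
      case True
      then have "x = 0 \<or> x = 1" "y = 0 \<or> y = 1"
        using nV[of x] nV[of y] xy by (auto simp: less_le)
      then show ?thesis by auto
    next
      case False
      then have "x ~= 0" "x ~= 1" "y ~= 0" "y ~= 1" using V0 V1 xy by auto
      then show ?thesis using inj[of x y] xy by (auto simp: less_le)
    qed
  qed
  moreover have "edge t j \<inter> V = {?g 0, ?g 1}"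
  proof
    show "edge t j \<inter> V \<subseteq> {?g 0, ?g 1}"
    proof
      fix v assume "v \<in> edge t j \<inter> V"
      then obtain x where "x \<in> {0..1}" "v = ?g x" "v \<in> V" by (auto simp: edge_rim)
      then show "v \<in> {?g 0, ?g 1}" using nV[of x] by (cases "x = 0"; cases "x = 1") auto
    qed
    have "?g 0 \<in> edge t j" "?g 1 \<in> edge t j" unfolding edge_rim
      by (rule image_eqI[OF refl], simp)+
    then show "{?g 0, ?g 1} \<subseteq> edge t j \<inter> V" using V0 V1 by blast
  qed
  ultimately show ?thesis
    by (auto simp: edge_path_def path_image_def edge_rim pathstart_def pathfinish_def)
qed

lemma edge_Int_V:
  assumes "t \<in> T" "j \<in> {1..k}" shows "edge t j \<inter> V = {rim t (real j), rim t (real j + 1)}"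
  using edge_path_side[OF assms] by (simp add: edge_path_def pathstart_def pathfinish_def)

lemma image_sphere: "t \<in> T ==> z \<in> sphere 0 1 ==> \<phi> t z \<in> \<Union>E"
proof -
  assume t: "t \<in> T" "z \<in> sphere 0 1"
  obtain s where s: "s \<in> {1..<real k + 1}" "z = circle_point k s"
    using sphere_circle_point[OF k_pos] t by blast
  obtain j where j: "j \<in> {1..k}" "s \<in> {real j..<real j + 1}" using ex_side_index s by blast
  then have "\<phi> t z \<in> edge t j" unfolding edge_def side_circle_point[OF k_pos] using s by auto
  then show ?thesis using edge_in_E t j by blast
qed

lemma image_cball: "t \<in> T ==> z \<in> cball 0 1 ==> \<phi> t z \<in> S"
proof -
  assume t: "t \<in> T" "z \<in> cball 0 1"
  then consider "z \<in> ball 0 1" | "z \<in> sphere 0 1" by fastforce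
  then show ?thesis
  proof cases
    case 1 then show ?thesis using image_ball t S_eq by blast
  next
    case 2 then show ?thesis using image_sphere t S_eq by blast
  qed
qed

lemma boundary_point:
  assumes "t \<in> T" "z \<in> cball 0 1" "e \<in> E" "\<phi> t z \<in> e" "\<phi> t z \<notin> V"
  obtains j where "j \<in> {1..k}" "z \<in> open_side k j" "edge t j = e"
proof -
  have "z \<notin> ball 0 1" using image_ball[OF assms(1)] tile_disj_graph[OF assms(1)] assms(3,4) by blast
  then have "z \<in> sphere 0 1" using assms(2) by auto
  then show ?thesis
  proof (rule sphere_cases[OF _ k_pos])
    fix j assume "j \<in> {1..k}" "z = corner k j"
    then have "\<phi> t z \<in> V" using polygon[OF assms(1)] by (auto simp: polygon_map_def)
    then show ?thesis using assms(5) by blast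
  next
    fix j assume j: "j \<in> {1..k}" "z \<in> open_side k j"
    then have "\<phi> t z \<in> edge t j" using open_side_subset_side by (auto simp: edge_def)
    then have "edge t j = e" using edges_meet edge_in_E assms j by metis
    then show ?thesis using that j by blast
  qed
qed

text \<open>A point of a tile lies on no edge, so its other preimage cannot be on the circle; it
  then belongs to the same tile, where the chart is injective. All identifications therefore happen
  over the circle.\<close>

lemma tile_points:
  assumes "t \<in> T" "t' \<in> T" "z \<in> ball 0 1" "z' \<in> cball 0 1" "\<phi> t z = \<phi> t' z'"
  shows "t = t'" "z = z'"
proof -
  have zt: "\<phi> t z \<in> t" using image_ball assms by blast
  have z': "z' \<in> ball 0 1"
  proof (rule ccontr)
    assume "z' \<notin> ball 0 1"
    then have "z' \<in> sphere 0 1" using assms(4) by auto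
    then have "\<phi> t' z' \<in> \<Union>E" using image_sphere assms by blast
    then show False using zt assms(5) tile_disj_graph[OF assms(1)] by auto
  qed
  then have "\<phi> t' z' \<in> t'" using image_ball assms(2) by blast
  then show t: "t = t'" using zt assms tiles_disjoint by metis
  then show "z = z'" using inj_ball z' assms unfolding inj_on_def by metis
qed

end

section \<open>The two sides of an edge\<close>

context polygons
begin

lemma sector_point_inj:
  assumes "i \<in> {1..k}" "j \<in> {1..k}" "x \<in> {0<..<1}" "y \<in> {0<..<1}" "a > 0" "b > 0"
    and "of_real a * circle_point k (real i + x) = of_real b * circle_point k (real j + y)"
  shows "i = j" "x = y" "a = b"
proof -
  have "norm (of_real a * circle_point k (real i + x)) = norm (of_real b * circle_point k (real j + y))"
    using assms(7) by simp
  then show ab: "a = b" using assms(5,6) by (simp add: norm_mult)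
  then have eq: "circle_point k (real i + x) = circle_point k (real j + y)"
    using assms(5,7) by simp
  have "circle_point k (real i + x) \<in> open_side k i" "circle_point k (real j + y) \<in> open_side k j"
    using assms(3,4) by (auto simp: open_side_circle_point k_pos)
  then show ij: "i = j" using open_side_disjoint[OF k_pos assms(1,2)] eq by metis
  have "real i \<ge> 1" "real i \<le> real k" using assms(1) by auto
  then show "x = y"
    using circle_point_eq_iff[OF k_pos, of "real i + x" "real j + y"] eq ij assms(3,4)
    by (auto simp: doubleton_eq_iff)
qed

text \<open>
  The sectors over two sides glued to the same edge form an open subset of the surface, by invariance of
  domain, so there is no room for a third one.
\<close>

lemma at_most_two_sides:
  assumes i1: "(t1, j1) \<in> sides_of e" and i2: "(t2, j2) \<in> sides_of e" and ne: "(t1, j1) ~= (t2, j2)"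
    and i3: "(t3, j3) \<in> sides_of e"
  shows "(t3, j3) = (t1, j1) \<or> (t3, j3) = (t2, j2)"
proof -
  note t = i1[unfolded sides_of_def, simplified] i2[unfolded sides_of_def, simplified]
    i3[unfolded sides_of_def, simplified]
  define \<sigma>1 where "\<sigma>1 = (\<lambda>x. rim t1 (real j1 + x))"
  define \<sigma>2 where "\<sigma>2 = (\<lambda>x. rim t2 (real j2 + x))"
  define \<sigma>3 where "\<sigma>3 = (\<lambda>x. rim t3 (real j3 + x))"
  have ep: "edge_path V e \<sigma>1" "edge_path V e \<sigma>2" "edge_path V e \<sigma>3"
    using edge_path_side[of t1 j1] edge_path_side[of t2 j2] edge_path_side[of t3 j3] t
    by (auto simp: \<sigma>1_def \<sigma>2_def \<sigma>3_def)
  have eE: "e \<in> E" using edge_in_E[of t1 j1] t by auto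
  obtain h1 where h1: "homeomorphism {0<..<1} (e - V) \<sigma>1 h1" using edge_path_interior(2)[OF ep(1)] by blast
  obtain h2 where h2: "homeomorphism {0<..<1} (e - V) \<sigma>2 h2" using edge_path_interior(2)[OF ep(2)] by blast
  \<comment> \<open>The two sides may run along \<open>e\<close> with different parameters, even in
    opposite directions; \<open>h\<close> converts the parameter of the first into that of the
    second.\<close>
  define h where "h = (\<lambda>x. h2 (\<sigma>1 x))"
  have s1: "\<sigma>1 x \<in> e - V" if "x \<in> {0<..<1}" for x using h1 that by (auto simp: homeomorphism_def)
  have h01: "h x \<in> {0<..<1}" if "x \<in> {0<..<1}" for x
    using s1[OF that] h2 unfolding homeomorphism_def h_def by blast
  have h_eq: "\<sigma>2 (h x) = \<sigma>1 x" if "x \<in> {0<..<1}" for x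
    using s1[OF that] h2 unfolding homeomorphism_def h_def by blast
  have h_cont: "continuous_on {0<..<1} h" unfolding h_def
    by (rule continuous_on_compose2[of "e - V" h2]) (use h1 h2 in \<open>auto simp: homeomorphism_def\<close>)
  have h_inj: "x = y" if "x \<in> {0<..<1}" "y \<in> {0<..<1}" "h x = h y" for x y
  proof -
    have "\<sigma>1 x = \<sigma>1 y" using h_eq that by metis
    then show ?thesis using h1 that unfolding homeomorphism_def by metis
  qed
  \<comment> \<open>In the rectangle \<open>W\<close> the real part is the position along
    \<open>e\<close> and the absolute value of the imaginary part the distance from the circle. The
    upper half covers a sector of \<open>t1\<close>, the lower half one of \<open>t2\<close>; on the
    real line both agree thanks to \<open>h\<close>.\<close>
  define W :: "complex set" where "W = {w. 0 < Re w \<and> Re w < 1 \<and> -1 < Im w \<and> Im w < 1}"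
  have W_open: "open W" unfolding W_def
    by (intro open_Collect_conj open_Collect_less continuous_intros)
  define P1 where "P1 w = of_real (1 - Im w) * circle_point k (real j1 + Re w)" for w
  define P2 where "P2 w = of_real (1 + Im w) * circle_point k (real j2 + h (Re w))" for w
  define G where "G w = (if Im w \<le> 0 then \<phi> t2 (P2 w) else \<phi> t1 (P1 w))" for w
  have n1: "norm (P1 w) = 1 - Im w" if "w \<in> W" for w
    using that by (simp add: P1_def norm_mult W_def del: of_real_diff)
  have n2: "norm (P2 w) = 1 + Im w" if "w \<in> W" for w
    using that by (simp add: P2_def norm_mult W_def del: of_real_add)
  have G0: "G w = \<sigma>1 (Re w)" "G w = \<phi> t2 (P2 w)" if "w \<in> W" "Im w = 0" for w
    using that h_eq[of "Re w"]
    by (auto simp: G_def P1_def P2_def \<sigma>1_def \<sigma>2_def rim_def W_def)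
  have b1: "P1 w \<in> ball 0 1" if "w \<in> W" "Im w > 0" for w using n1[OF that(1)] that by simp
  have b2: "P2 w \<in> ball 0 1" if "w \<in> W" "Im w < 0" for w using n2[OF that(1)] that by simp
  have Gt1: "G w \<in> t1" if "w \<in> W" "Im w > 0" for w
    using b1[OF that] that image_ball[of t1] t by (auto simp: G_def)
  have Gt2: "G w \<in> t2" if "w \<in> W" "Im w < 0" for w
    using b2[OF that] that image_ball[of t2] t by (auto simp: G_def)
  have Ge: "G w \<in> e" if "w \<in> W" "Im w = 0" for w
    using G0[OF that] s1[of "Re w"] that by (auto simp: W_def)
  have "continuous_on W (\<lambda>w. if Im w \<le> 0 then \<phi> t2 (P2 w) else \<phi> t1 (P1 w))"
  proof (rule continuous_on_cases_le)
    show "continuous_on {w \<in> W. Im w \<le> 0} (\<lambda>w. \<phi> t2 (P2 w))"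
    proof (rule continuous_on_compose2[OF cont])
      have "continuous_on {w \<in> W. Im w \<le> 0} (\<lambda>w. h (Re w))"
        by (rule continuous_on_compose2[OF h_cont]) (auto intro!: continuous_intros simp: W_def)
      then show "continuous_on {w \<in> W. Im w \<le> 0} P2" unfolding P2_def by (intro continuous_intros)
      show "P2 ` {w \<in> W. Im w \<le> 0} \<subseteq> cball 0 1" using n2 by auto
    qed (use t in auto)
    show "continuous_on {w \<in> W. 0 \<le> Im w} (\<lambda>w. \<phi> t1 (P1 w))"
    proof (rule continuous_on_compose2[OF cont])
      show "continuous_on {w \<in> W. 0 \<le> Im w} P1" unfolding P1_def by (intro continuous_intros)
      show "P1 ` {w \<in> W. 0 \<le> Im w} \<subseteq> cball 0 1" using n1 by auto
    qed (use t in auto)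
    show "continuous_on W Im" by (intro continuous_intros)
    show "\<phi> t2 (P2 w) = \<phi> t1 (P1 w)" if "w \<in> W" "Im w = 0" for w
      using G0[OF that] that(2) by (simp add: P1_def \<sigma>1_def rim_def)
  qed
  then have G_cont: "continuous_on W G" unfolding G_def .
  have J1: "j1 \<in> {1..k}" and J2: "j2 \<in> {1..k}" and J3: "j3 \<in> {1..k}" using t by simp_all
  have WRe: "Re w \<in> {0<..<1}" and Wm: "1 - Im w > 0" and Wp: "1 + Im w > 0" if "w \<in> W" for w
    using that by (simp_all add: W_def)
  have eq1: "w = w'" if "P1 w = P1 w'" "w \<in> W" "w' \<in> W" for w w'
    using sector_point_inj(2,3)[OF J1 J1 WRe[OF that(2)] WRe[OF that(3)] Wm[OF that(2)] Wm[OF that(3)]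
        that(1)[unfolded P1_def]]
    by (simp add: complex_eq_iff)
  have eq2: "w = w'" if "P2 w = P2 w'" "w \<in> W" "w' \<in> W" for w w'
    using sector_point_inj(2,3)[OF J2 J2 h01[OF WRe[OF that(2)]] h01[OF WRe[OF that(3)]] Wp[OF that(2)] Wp[OF that(3)]
        that(1)[unfolded P2_def]] h_inj[OF WRe[OF that(2)] WRe[OF that(3)]]
    by (simp add: complex_eq_iff)
  \<comment> \<open>Here \<open>ne\<close> enters. The tiles \<open>t1\<close> and \<open>t2\<close>
    may coincide; the two sectors are then told apart by their side indices.\<close>
  have eq12: False if "w \<in> W" "w' \<in> W" "Im w > 0" "Im w' < 0" "G w = G w'" for w w'
  proof -
    have "\<phi> t1 (P1 w) = \<phi> t2 (P2 w')" using that by (simp add: G_def)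
    then have "t1 = t2" "P1 w = P2 w'"
      using tile_points[of t1 t2 "P1 w" "P2 w'"] b1[of w] b2[of w'] that t by auto
    moreover have "j1 = j2"
      using sector_point_inj(1)[OF J1 J2 WRe[OF that(1)] h01[OF WRe[OF that(2)]] Wm[OF that(1)] Wp[OF that(2)]
          \<open>P1 w = P2 w'\<close>[unfolded P1_def P2_def]] .
    ultimately show False using ne by simp
  qed
  have not_e: "x \<notin> e" if "x \<in> t'" "t' \<in> T" for x t'
    using tile_disj_graph[OF that(2)] that(1) eE by blast
  have G_inj: "inj_on G W"
  proof (rule inj_onI)
    fix w w' assume w: "w \<in> W" "w' \<in> W" "G w = G w'"
    have T12: "t1 \<in> T" "t2 \<in> T" using t by auto
    consider "Im w > 0" "Im w' > 0" | "Im w < 0" "Im w' < 0" | "Im w = 0" "Im w' = 0"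
      | "Im w > 0" "Im w' < 0" | "Im w < 0" "Im w' > 0" | "Im w = 0" "Im w' ~= 0" | "Im w ~= 0" "Im w' = 0"
      by linarith
    then show "w = w'"
    proof cases
      case 1
      then have "P1 w = P1 w'"
        using tile_points(2)[of t1 t1 "P1 w" "P1 w'"] b1[of w] b1[of w'] w T12 by (auto simp: G_def)
      then show ?thesis using eq1 w by blast
    next
      case 2
      then have "P2 w = P2 w'"
        using tile_points(2)[of t2 t2 "P2 w" "P2 w'"] b2[of w] b2[of w'] w T12 by (auto simp: G_def)
      then show ?thesis using eq2 w by blast
    next
      case 3
      then have "\<sigma>1 (Re w) = \<sigma>1 (Re w')" using G0(1) w by metis
      then have "Re w = Re w'" using homeomorphism_apply1[OF h1] WRe[OF w(1)] WRe[OF w(2)] by metis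
      then show ?thesis using 3 by (simp add: complex_eq_iff)
    next
      case 4 then show ?thesis using eq12 w by blast
    next
      case 5 then show ?thesis using eq12[of w' w] w by simp
    next
      case 6
      then have "G w' \<in> t1 \<or> G w' \<in> t2" using Gt1[of w'] Gt2[of w'] w by linarith
      then show ?thesis using Ge[OF w(1)] 6(1) w(3) not_e[OF _ T12(1)] not_e[OF _ T12(2)] by auto
    next
      case 7
      then have "G w \<in> t1 \<or> G w \<in> t2" using Gt1[of w] Gt2[of w] w by linarith
      then show ?thesis using Ge[OF w(2)] 7(2) w(3) not_e[OF _ T12(1)] not_e[OF _ T12(2)] by auto
    qed
  qed
  have G_S: "G ` W \<subseteq> S"
  proof
    fix y assume "y \<in> G ` W"
    then obtain w where w: "w \<in> W" "y = G w" by blast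
    show "y \<in> S"
      using Gt1[of w] Gt2[of w] Ge[of w] w eE t S_eq by (cases "Im w" "0::real" rule: linorder_cases) auto
  qed
  have op: "openin (top_of_set S) (G ` W)"
    by (rule surface_open_map[OF surface W_open G_cont G_inj G_S])
  \<comment> \<open>A radial path from the middle of the third side into \<open>t3\<close>. The
    image of \<open>W\<close> under \<open>G\<close> is open and contains its start, hence also
    points of the path inside \<open>t3\<close>, and those determine the tile and the index.\<close>
  define \<rho> where "\<rho> r = \<phi> t3 (of_real (1 - r) * circle_point k (real j3 + 1 / 2))" for r
  have \<rho>_cont: "continuous_on {0..1} \<rho>" unfolding \<rho>_def
    by (rule continuous_on_compose2[OF cont]) (use t in \<open>auto intro!: continuous_intros simp: norm_mult simp del: of_real_diff\<close>)
  have \<rho>_S: "\<rho> ` {0..1} \<subseteq> S" unfolding \<rho>_def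
    using image_cball[of t3] t by (auto simp: norm_mult simp del: of_real_diff)
  have "openin (top_of_set {0..1}) ({0..1} \<inter> \<rho> -` (G ` W))"
    using continuous_openin_preimage[OF \<rho>_cont _ op] \<rho>_S by (auto simp: image_subset_iff_funcset)
  moreover have "0 \<in> {0..1} \<inter> \<rho> -` (G ` W)"
  proof -
    have "\<rho> 0 = \<sigma>3 (1/2)" by (simp add: \<rho>_def \<sigma>3_def rim_def)
    also have "\<dots> \<in> e - V" using edge_path_interior(1)[OF ep(3)] by auto
    finally obtain x where "x \<in> {0<..<1}" "\<rho> 0 = \<sigma>1 x"
      using edge_path_interior(1)[OF ep(1)] by blast
    then have "Complex x 0 \<in> W" "\<rho> 0 = G (Complex x 0)"
      using G0(1)[of "Complex x 0"] by (auto simp: W_def)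
    then show ?thesis by auto
  qed
  ultimately obtain d where d: "d > 0" "\<And>r. r \<in> {0..1} ==> dist r 0 < d ==> \<rho> r \<in> G ` W"
    unfolding openin_euclidean_subtopology_iff by blast
  define r where "r = min (d / 2) (1 / 2)"
  have r: "0 < r" "r < 1" "\<rho> r \<in> G ` W" using d by (auto simp: r_def)
  define z where "z = of_real (1 - r) * circle_point k (real j3 + 1 / 2)"
  have zb: "z \<in> ball 0 1" using r by (simp add: z_def norm_mult del: of_real_diff)
  obtain w where w: "w \<in> W" "\<phi> t3 z = G w" using r(3) by (auto simp: \<rho>_def z_def)
  have zt3: "\<phi> t3 z \<in> t3" using zb image_ball[of t3] t by blast
  have "Im w ~= 0" using Ge[of w] w zt3 not_e[of "\<phi> t3 z" t3] t by auto
  then consider "Im w > 0" | "Im w < 0" by linarith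
  then show ?thesis
  proof cases
    case 1
    then have "t3 = t1" "z = P1 w"
      using tile_points[of t3 t1 z "P1 w"] b1[of w] w zb t by (auto simp: G_def)
    moreover have "j3 = j1"
      using sector_point_inj(1)[OF J3 J1 _ WRe[OF w(1)] _ Wm[OF w(1)] \<open>z = P1 w\<close>[unfolded P1_def z_def]] r
      by simp
    ultimately show ?thesis by simp
  next
    case 2
    then have "t3 = t2" "z = P2 w"
      using tile_points[of t3 t2 z "P2 w"] b2[of w] w zb t by (auto simp: G_def)
    moreover have "j3 = j2"
      using sector_point_inj(1)[OF J3 J2 _ h01[OF WRe[OF w(1)]] _ Wp[OF w(1)] \<open>z = P2 w\<close>[unfolded P2_def z_def]] r
      by simp
    ultimately show ?thesis by simp
  qed
qed

lemma finite_sides_of: "finite (sides_of e)"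
proof (cases "\<exists>a\<in>sides_of e. \<exists>b\<in>sides_of e. a ~= b")
  case True
  then obtain a b where "a \<in> sides_of e" "b \<in> sides_of e" "a ~= b" by blast
  then have "sides_of e \<subseteq> {a, b}"
    using at_most_two_sides[of "fst a" "snd a" e "fst b" "snd b"] by auto
  then show ?thesis by (rule finite_subset) simp
next
  case False
  then have "\<exists>x. sides_of e \<subseteq> {x}" by blast
  then show ?thesis using finite_subset by blast
qed

lemma finite_tiles: "finite T"
proof -
  have "T \<subseteq> fst ` (\<Union>e\<in>E. sides_of e)"
  proof
    fix t assume "t \<in> T"
    then have "(t, 1) \<in> sides_of (edge t 1)" "edge t 1 \<in> E"
      using edge_in_E k_pos by (auto simp: sides_of_def)
    then show "t \<in> fst ` (\<Union>e\<in>E. sides_of e)" by force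
  qed
  then show ?thesis using finite_sides_of finite_E by (meson finite_UN finite_imageI finite_subset)
qed

lemma closed_image_tile:
  assumes "t \<in> T" "compact X" "X \<subseteq> cball 0 1" shows "compact (\<phi> t ` X)"
  using assms cont compact_continuous_image continuous_on_subset by metis

text \<open>
  If an edge met only one sector, the surface would look like a half plane there, and if it met none,
  like a line.
\<close>

lemma card_sides_of:
  assumes e: "e \<in> E" shows "card (sides_of e) = 2"
proof (rule ccontr)
  assume ne2: "card (sides_of e) ~= 2"
  have uniq: "a = b" if ab: "a \<in> sides_of e" "b \<in> sides_of e" for a b
  proof (rule ccontr)
    assume "a ~= b"
    then have "sides_of e = {a, b}"
      using at_most_two_sides[of "fst a" "snd a" e "fst b" "snd b"] ab by auto
    then show False using ne2 \<open>a ~= b\<close> by simp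
  qed
  obtain \<gamma> where \<gamma>: "edge_path V e \<gamma>" using ex_edge_path e by blast
  obtain \<eta> where \<eta>: "homeomorphism {0<..<1} (e - V) \<gamma> \<eta>" using edge_path_interior(2)[OF \<gamma>] by blast
  define p where "p = \<gamma> (1/2)"
  have p: "p \<in> e - V" using edge_path_interior(1)[OF \<gamma>] by (auto simp: p_def)
  \<comment> \<open>\<open>C j\<close> is the closed disk without the open sector over side
    \<open>j\<close>; that sector, outer arc included, is \<open>O' j\<close>. Being compact,
    \<open>C j\<close> can be removed together with the other edges and leaves an open neighbourhood
    of \<open>p\<close>.\<close>
  define C where "C j = (\<lambda>(a, s). of_real a * circle_point k s) ` ({0..1} \<times> ({1..real j} \<union> {real j + 1..real k + 1}))" for j
  have C_compact: "compact (C j)" for j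
    unfolding C_def case_prod_beta
    by (intro compact_continuous_image continuous_intros compact_Times compact_Un compact_Icc)
  have C_cball: "C j \<subseteq> cball 0 1" for j by (auto simp: C_def norm_mult)
  define O' where "O' j = {of_real a * circle_point k (real j + x) | a x. 0 < a \<and> a \<le> 1 \<and> x \<in> {0<..<1}}" for j
  have O_cball: "O' j \<subseteq> cball 0 1" for j by (auto simp: O'_def norm_mult)
  have cover: "z \<in> C j \<or> z \<in> O' j" if "z \<in> cball 0 1" for z j
  proof (cases "z = 0")
    case True
    have "z = (\<lambda>(a, s). of_real a * circle_point k s) (0, real k + 1)" using True by simp
    moreover have "(0, real k + 1) \<in> {0..1::real} \<times> ({1..real j} \<union> {real j + 1..real k + 1}) \<or> real j > real k" by auto
    moreover have "(0, 1) \<in> {0..1::real} \<times> ({1..real j} \<union> {real j + 1..real k + 1})" if "real j > real k"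
      using that k_pos by auto
    moreover have "z = (\<lambda>(a, s). of_real a * circle_point k s) (0, 1)" using True by simp
    ultimately show ?thesis unfolding C_def by blast
  next
    case False
    then have "z / of_real (norm z) \<in> sphere 0 1" by (simp add: norm_divide)
    then obtain s where s: "s \<in> {1..<real k + 1}" "z / of_real (norm z) = circle_point k s"
      using sphere_circle_point[OF k_pos] by blast
    then have z: "z = of_real (norm z) * circle_point k s" using False by (simp add: field_simps)
    show ?thesis
    proof (cases "s \<in> {real j<..<real j + 1}")
      case True
      have "z = of_real (norm z) * circle_point k (real j + (s - real j))" using z by simp
      then show ?thesis unfolding O'_def using True False that by (intro disjI2 CollectI exI[of _ "norm z"] exI[of _ "s - real j"]) auto
    next
      case ns: False
      have "z = (\<lambda>(a, s). of_real a * circle_point k s) (norm z, s)" using z by simp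
      moreover have "(norm z, s) \<in> {0..1} \<times> ({1..real j} \<union> {real j + 1..real k + 1})"
        using ns s(1) that by auto
      ultimately show ?thesis unfolding C_def by blast
    qed
  qed
  \<comment> \<open>The part of a tile to be removed: all of it, unless it has \<open>e\<close> as a
    side. By \<open>uniq\<close> there is at most one tile and one index of this kind.\<close>
  define X where "X t = (if \<exists>j. (t, j) \<in> sides_of e then C (SOME j. (t, j) \<in> sides_of e) else cball 0 1)" for t
  have X1: "X t = C j" if "(t, j) \<in> sides_of e" for t j
  proof -
    have "(t, SOME j. (t, j) \<in> sides_of e) \<in> sides_of e" using that by (rule someI)
    then have "(SOME j. (t, j) \<in> sides_of e) = j" using uniq that by blast
    then show ?thesis using that by (auto simp: X_def)
  qed
  have X_compact: "compact (X t)" and X_cball: "X t \<subseteq> cball 0 1" for t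
    using C_compact C_cball by (auto simp: X_def)
  define Z where "Z = V \<union> \<Union>(E - {e}) \<union> (\<Union>t\<in>T. \<phi> t ` X t)"
  have "compact Z" unfolding Z_def
    using finite_V finite_E finite_tiles compact_edge closed_image_tile X_compact X_cball
    by (intro compact_Un finite_imp_compact[OF finite_V] compact_Union compact_UN) auto
  then have U: "openin (top_of_set S) (S - Z)"
    using compact_imp_closed by (metis closedin_closed_Int openin_diff openin_subtopology_self Diff_Int2 Int_absorb Int_commute)
  have on_e: "\<exists>j. (t, j) \<in> sides_of e \<and> z \<in> open_side k j" if "t \<in> T" "z \<in> cball 0 1" "\<phi> t z \<in> e - V" for t z
    using boundary_point[of t z e] that e by (auto simp: sides_of_def)
  have notC: "z \<notin> C j" if zo: "z \<in> open_side k j" "j \<in> {1..k}" for z j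
  proof
    assume "z \<in> C j"
    then obtain q where q: "q \<in> {0..1} \<times> ({1..real j} \<union> {real j + 1..real k + 1})"
      "z = (\<lambda>(a, s). of_real a * circle_point k s) q" unfolding C_def by blast
    define a s where "a = fst q" and "s = snd q"
    have as: "a \<in> {0..1}" "s \<in> {1..real j} \<union> {real j + 1..real k + 1}" "z = of_real a * circle_point k s"
      using q by (simp_all only: a_def s_def mem_Times_iff case_prod_beta)
    have "norm z = 1" using that side_subset_sphere open_side_subset_side by fastforce
    then have "a = 1" using as by (simp add: norm_mult)
    obtain s' where s': "s' \<in> {real j<..<real j + 1}" "z = circle_point k s'"
      using zo(1) unfolding open_side_circle_point[OF k_pos] by blast
    have j: "real j \<ge> 1" "real j \<le> real k" using that(2) by auto
    have "s \<in> {1..real k + 1}" using as(2) j by auto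
    moreover have "s' \<in> {1..real k + 1}" using s'(1) j by auto
    moreover have "circle_point k s = circle_point k s'" using as(3) s'(2) \<open>a = 1\<close> by simp
    ultimately have "s = s' \<or> {s, s'} = {1, real k + 1}" using circle_point_eq_iff[OF k_pos] by blast
    then show False using as(2) s'(1) j unfolding doubleton_eq_iff by auto
  qed
  have pZ: "p \<notin> Z"
  proof
    assume "p \<in> Z"
    then consider "p \<in> V" | e' where "e' \<in> E" "e' ~= e" "p \<in> e'" | t z where "t \<in> T" "z \<in> X t" "p = \<phi> t z"
      unfolding Z_def by blast
    then show False
    proof cases
      case 1 then show ?thesis using p by blast
    next
      case 2 then show ?thesis using p edges_meet[of e e' p] e by blast
    next
      case 3
      then obtain j where j: "(t, j) \<in> sides_of e" "z \<in> open_side k j"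
        using on_e[of t z] X_cball p by blast
      then show False using X1 notC 3 by (auto simp: sides_of_def)
    qed
  qed
  have pU: "p \<in> S - Z" using pZ p E_S e by blast
  show False
  proof (cases "sides_of e = {}")
    case True
    \<comment> \<open>Without any side the neighbourhood of \<open>p\<close> lies in the edge itself
      and embeds in the real line, which contains no nonempty open subset of the plane.\<close>
    then have Xt: "X t = cball 0 1" for t by (simp add: X_def)
    have "S - Z \<subseteq> e - V"
    proof
      fix x assume x: "x \<in> S - Z"
      have xt: "x \<notin> t" if tT: "t \<in> T" for t
      proof
        assume "x \<in> t"
        then obtain z where z: "z \<in> ball 0 1" "x = \<phi> t z" using image_ball[OF tT] by blast
        then have "x \<in> \<phi> t ` X t" unfolding Xt by auto
        then show False using x tT unfolding Z_def by blast
      qed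
      have "x \<in> V \<union> \<Union>E \<union> \<Union>T" using x S_eq by blast
      moreover have "x \<notin> V" "x \<notin> \<Union>(E - {e})" using x unfolding Z_def by blast+
      ultimately show "x \<in> e - V" using xt by blast
    qed
    then have "continuous_on (S - Z) \<eta>" "inj_on \<eta> (S - Z)"
      using homeomorphism_cont2[OF \<eta>] continuous_on_subset inj_on_inverseI[of "e - V" \<gamma> \<eta>, OF homeomorphism_apply2[OF \<eta>]]
        inj_on_subset by blast+
    then have "continuous_on (S - Z) (\<lambda>x. complex_of_real (\<eta> x))" "inj_on (\<lambda>x. complex_of_real (\<eta> x)) (S - Z)"
      by (simp_all add: continuous_on_of_real inj_on_def)
    then have "open ((\<lambda>x. complex_of_real (\<eta> x)) ` (S - Z))"
      by (rule surface_invariance_of_domain[OF surface U])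
    then obtain d where d: "d > 0" "ball (complex_of_real (\<eta> p)) d \<subseteq> (\<lambda>x. complex_of_real (\<eta> x)) ` (S - Z)"
      using pU openE[of "(\<lambda>x. complex_of_real (\<eta> x)) ` (S - Z)" "complex_of_real (\<eta> p)"] by blast
    have "complex_of_real (\<eta> p) + \<i> * of_real (d / 2) \<in> ball (complex_of_real (\<eta> p)) d"
      using d(1) by (simp add: dist_norm norm_mult)
    then obtain x where "complex_of_real (\<eta> p) + \<i> * of_real (d / 2) = complex_of_real (\<eta> x)"
      using d(2) by blast
    then have "Im (complex_of_real (\<eta> p) + \<i> * of_real (d / 2)) = 0" by (metis Im_complex_of_real)
    then show False using d(1) by simp
  next
    case False
    then obtain t j where tj: "(t, j) \<in> sides_of e" by auto
    then have t: "t \<in> T" "j \<in> {1..k}" "edge t j = e" by (auto simp: sides_of_def)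
    \<comment> \<open>With one side only, the neighbourhood embeds in the sector with its outer arc.
      Its image would be open in the plane, hence contained in the open disk, although
      \<open>p\<close> comes from the arc.\<close>
    have sat: "a = x" if a: "a \<in> O' j" "x \<in> cball 0 1" "\<phi> t a = \<phi> t x" for a x
    proof (cases "a \<in> ball 0 1")
      case True then show ?thesis using tile_points(2)[OF t(1) t(1)] a by blast
    next
      case False
      obtain b y where b: "a = of_real b * circle_point k (real j + y)" "0 < b" "b \<le> 1" "y \<in> {0<..<1}"
        using a(1) by (auto simp: O'_def)
      have "b = 1" using False b by (simp add: norm_mult)
      then have ao: "a \<in> open_side k j" using b by (auto simp: open_side_circle_point k_pos)
      then have "\<phi> t a \<in> \<phi> t ` open_side k j" by blast
      then have ae: "\<phi> t a \<in> e - V"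
        using edge_path_interior(1)[OF edge_path_side[OF t(1,2)]] rim_open_side[of t j] t(3) by auto
      then obtain j' where "(t, j') \<in> sides_of e" "x \<in> open_side k j'" using on_e[OF t(1) a(2)] a(3) by auto
      then have "x \<in> open_side k j" using uniq tj by blast
      then show ?thesis using ao a(3) polygon[OF t(1)] t(2) by (auto simp: polygon_map_def inj_on_def)
    qed
    obtain g where g: "homeomorphism (O' j) (\<phi> t ` O' j) (\<phi> t) g"
      using homeomorphism_saturated[OF compact_cball cont[OF t(1)] O_cball sat] by blast
    have sub: "S - Z \<subseteq> \<phi> t ` O' j"
    proof
      fix x assume x: "x \<in> S - Z"
      then have "x \<notin> V" "\<And>e'. e' \<in> E ==> e' ~= e ==> x \<notin> e'" by (auto simp: Z_def)
      moreover have "x \<in> V \<union> \<Union>E \<union> \<Union>T" using x S_eq by blast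
      ultimately consider "x \<in> e - V" | t' where "t' \<in> T" "x \<in> t'" by blast
      then show "x \<in> \<phi> t ` O' j"
      proof cases
        case 1
        then have "x \<in> (\<lambda>x. rim t (real j + x)) ` {0<..<1}"
          using edge_path_interior(1)[OF edge_path_side[OF t(1,2)]] t(3) by auto
        then obtain y where y: "y \<in> {0<..<1}" "x = rim t (real j + y)" by blast
        have "circle_point k (real j + y) \<in> O' j"
          unfolding O'_def using y by (intro CollectI exI[of _ 1] exI[of _ y]) auto
        then show ?thesis using y by (auto simp: rim_def)
      next
        case 2
        then obtain z where z: "z \<in> ball 0 1" "x = \<phi> t' z" using image_ball by blast
        have zX: "z \<notin> X t'" using x z 2 unfolding Z_def by blast
        have "\<exists>j'. (t', j') \<in> sides_of e"
        proof (rule ccontr)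
          assume "\<nexists>j'. (t', j') \<in> sides_of e"
          then have "X t' = cball 0 1" unfolding X_def by (rule if_not_P)
          then show False using zX z(1) by auto
        qed
        then have "t' = t" using uniq tj by blast
        then have "z \<notin> C j" using zX X1[OF tj] by simp
        then have "z \<in> O' j" using cover[of z j] z by auto
        then show ?thesis using z \<open>t' = t\<close> by blast
      qed
    qed
    have "continuous_on (S - Z) g" "inj_on g (S - Z)"
      using homeomorphism_cont2[OF g] continuous_on_subset inj_on_inverseI[of "\<phi> t ` O' j" "\<phi> t" g, OF homeomorphism_apply2[OF g]]
        inj_on_subset sub by blast+
    then have "open (g ` (S - Z))" by (rule surface_invariance_of_domain[OF surface U])
    moreover have "g ` (S - Z) \<subseteq> cball 0 1"
      using homeomorphism_image2[OF g] sub O_cball[of j] by blast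
    ultimately have "g ` (S - Z) \<subseteq> ball 0 1"
      by (metis interior_cball interior_maximal)
    then have gb: "g p \<in> ball 0 1" using pU by blast
    have "\<phi> t (g p) = p" using homeomorphism_apply2[OF g] sub pU by blast
    then have "p \<in> t" using gb image_ball[OF t(1)] by (metis imageI)
    then show False using p tile_disj_graph[OF t(1)] e by blast
  qed
qed

end

section \<open>The corners at a vertex\<close>

lemma finite_uniform_positive:
  fixes P :: "'i => real => bool"
  assumes "finite J" "\<And>j. j \<in> J ==> \<exists>d>0. P j d" "\<And>j d d'. [|P j d; 0 < d'; d' \<le> d|] ==> P j d'"
  shows "\<exists>d>0. \<forall>j\<in>J. P j d"
  using assms(1,2)
proof (induction J rule: finite_induct)
  case empty
  then show ?case by (auto intro: exI[of _ 1])
next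
  case (insert i J)
  obtain d where d: "d > 0" "\<forall>j\<in>J. P j d" using insert by blast
  obtain d' where d': "d' > 0" "P i d'" using insert by blast
  have "\<forall>j\<in>insert i J. P j (min d d')" using assms(3) d d' by auto
  then show ?case using d d' by (intro exI[of _ "min d d'"]) auto
qed

locale polygonal_surface = polygons +
  assumes degree: "v \<in> V ==> vertex_degree V E v \<ge> 3"
begin

definition corners_at :: "'a => ('a set \<times> nat) set" where
  "corners_at v = {(t, j). t \<in> T \<and> j \<in> {1..k} \<and> rim t (real j) = v}"

definition pred_side :: "nat => nat" where "pred_side j = (if j = 1 then k else j - 1)"

definition succ_side :: "nat => nat" where "succ_side j = (if j = k then 1 else j + 1)"

definition corner_edges :: "'a set \<times> nat => 'a set set" where
  "corner_edges c = {edge (fst c) (snd c), edge (fst c) (pred_side (snd c))}"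

lemma pred_side: "j \<in> {1..k} ==> pred_side j \<in> {1..k}" "j \<in> {1..k} ==> pred_side j ~= j"
  using k3 by (auto simp: pred_side_def)

lemma succ_side: "j \<in> {1..k} ==> succ_side j \<in> {1..k}" "j \<in> {1..k} ==> pred_side (succ_side j) = j"
  using k3 by (auto simp: succ_side_def pred_side_def)

lemma rim_succ: "rim t (real j + 1) = rim t (real (succ_side j))"
  using rim_last[of t] by (auto simp: succ_side_def add.commute)

lemma rim_pred: "j \<in> {1..k} ==> rim t (real (pred_side j) + 1) = rim t (real j)"
  using rim_last[of t] by (auto simp: pred_side_def)

lemma finite_corners_at: "finite (corners_at v)"
proof (rule finite_subset)
  show "corners_at v \<subseteq> T \<times> {1..k}" by (auto simp: corners_at_def)
qed (use finite_tiles in auto)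

lemma edge_side: "e \<in> E ==> \<exists>t j. (t, j) \<in> sides_of e"
  using card_sides_of[of e] by (metis all_not_in_conv card.empty surj_pair zero_neq_numeral)

lemma vertex_on_edge: assumes "v \<in> V" shows "\<exists>e\<in>E. v \<in> e"
proof (rule ccontr)
  assume "\<not> (\<exists>e\<in>E. v \<in> e)"
  then have "vertex_degree V E v = 0" by (auto simp: vertex_degree_def intro: sum.neutral)
  then show False using degree[OF assms] by simp
qed

lemma S_covered: assumes "x \<in> S" shows "\<exists>t\<in>T. \<exists>z\<in>cball 0 1. x = \<phi> t z"
proof -
  have *: "\<exists>t\<in>T. \<exists>z\<in>cball 0 1. x = \<phi> t z" if xe: "e \<in> E" "x \<in> e" for e
  proof -
    obtain t j where "(t, j) \<in> sides_of e" using edge_side xe(1) by blast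
    then have "t \<in> T" "x \<in> \<phi> t ` side k j" using xe(2) by (auto simp: sides_of_def edge_def)
    then show ?thesis using side_subset_sphere[of k j] sphere_cball by blast
  qed
  have **: "\<exists>z\<in>cball 0 1. x = \<phi> t z" if "t \<in> T" "x \<in> t" for t
    using image_ball[OF that(1)] that(2) ball_subset_cball by blast
  have "x \<in> V \<union> \<Union>E \<union> \<Union>T" using S_eq assms by blast
  then show ?thesis
  proof (elim UnE)
    assume "x \<in> V"
    then obtain e where "e \<in> E" "x \<in> e" using vertex_on_edge by blast
    then show ?thesis using * by blast
  next
    assume "x \<in> \<Union>E"
    then show ?thesis using * by blast
  next
    assume "x \<in> \<Union>T"
    then obtain t where "t \<in> T" "x \<in> t" by blast
    then show ?thesis using ** by blast
  qed
qed

lemma edge_at_vertex: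
  assumes "e \<in> E" "v \<in> e" "v \<in> V" shows "\<exists>c\<in>corners_at v. e \<in> corner_edges c"
proof -
  obtain t j where tj: "(t, j) \<in> sides_of e" using edge_side assms(1) by blast
  then have t: "t \<in> T" "j \<in> {1..k}" "edge t j = e" by (auto simp: sides_of_def)
  then have "v = rim t (real j) \<or> v = rim t (real (succ_side j))"
    using edge_Int_V[OF t(1,2)] assms rim_succ[of t j] by auto
  then show ?thesis
  proof
    assume "v = rim t (real j)"
    then have "(t, j) \<in> corners_at v" using t by (auto simp: corners_at_def)
    moreover have "e \<in> corner_edges (t, j)" using t(3) by (simp add: corner_edges_def)
    ultimately show ?thesis by blast
  next
    assume "v = rim t (real (succ_side j))"
    then have "(t, succ_side j) \<in> corners_at v" 
      using t(1) succ_side(1)[OF t(2)] by (simp add: corners_at_def)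
    moreover have "e \<in> corner_edges (t, succ_side j)"
      using t(3) succ_side(2)[OF t(2)] by (simp add: corner_edges_def)
    ultimately show ?thesis by blast
  qed
qed

text \<open>
  The corners at a vertex cannot fall into two classes without common edges, since a small punctured
  disk about the vertex is connected.
\<close>

lemma corners_connected:
  assumes v: "v \<in> V" and X: "X \<subseteq> corners_at v" "X ~= {}"
    and cl: "\<And>c c'. [|c \<in> X; c' \<in> corners_at v - X|] ==> corner_edges c \<inter> corner_edges c' = {}"
  shows "X = corners_at v"
proof (rule ccontr)
  define Y where "Y = corners_at v - X"
  assume "X ~= corners_at v"
  then have Y: "Y ~= {}" "Y \<subseteq> corners_at v" using X by (auto simp: Y_def)
  \<comment> \<open>Everything corner \<open>j\<close> must keep away from: the sides that do not
    end there and the other corners. This set is closed and misses the corner, so it has positive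
    distance from it.\<close>
  define F where "F j = (\<Union>i\<in>{1..k} - {j, pred_side j}. side k i) \<union> corner k ` ({1..k} - {j})" for j
  have "\<exists>d>0. \<forall>j\<in>{1..k}. \<forall>x\<in>F j. d \<le> dist (corner k j) x"
  proof (rule finite_uniform_positive)
    fix j assume j: "j \<in> {1..k}"
    have "compact (side k i)" for i
      unfolding side_circle_point[OF k_pos]
      by (intro compact_continuous_image continuous_intros compact_Icc)
    then have "compact (\<Union>i\<in>{1..k} - {j, pred_side j}. side k i)" by (intro compact_UN) auto
    moreover have "compact (corner k ` ({1..k} - {j}))" by (intro finite_imp_compact) auto
    ultimately have "closed (F j)" unfolding F_def by (intro compact_imp_closed compact_Un)
    moreover have "corner k j \<notin> F j"
    proof
      assume a: "corner k j \<in> F j"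
      have *: "real j \<le> real k" "real j \<ge> 1" using j by auto
      have u: "s = real j \<or> (j = 1 \<and> s = real k + 1)"
        if s: "s \<in> {1..real k + 1}" "circle_point k (real j) = circle_point k s" for s
      proof -
        have "real j = s \<or> {real j, s} = {1, real k + 1}"
          using iffD1[OF circle_point_eq_iff[OF k_pos _ s(1)] s(2)] * by simp
        then show ?thesis using * unfolding doubleton_eq_iff by linarith
      qed
      consider i where "i \<in> {1..k}" "i ~= j" "i ~= pred_side j" "corner k j \<in> side k i"
        | i where "i \<in> {1..k}" "i ~= j" "corner k j = corner k i"
        using a unfolding F_def by (elim UnE UN_E imageE) auto
      then show False
      proof cases
        case 1
        then obtain s where s: "s \<in> {real i..real i + 1}" "circle_point k (real j) = circle_point k s"
          unfolding side_circle_point[OF k_pos] corner_circle_point by blast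
        have "real i \<le> real k" "real i \<ge> 1" using 1 by auto
        then have "s = real j \<or> (j = 1 \<and> s = real k + 1)" using u[of s] s by auto
        then have "i = j \<or> i + 1 = j \<or> (j = 1 \<and> i = k)"
          using s(1) 1(1) by (simp only: atLeastAtMost_iff) linarith
        then show ?thesis using 1(1-3) by (simp add: pred_side_def split: if_splits)
      next
        case 2
        then have "real i = real j \<or> j = 1 \<and> real i = real k + 1"
          by (intro u) (simp_all add: corner_circle_point)
        then show ?thesis using 2(1,2) by auto
      qed
    qed
    ultimately show "\<exists>d>0. \<forall>x\<in>F j. d \<le> dist (corner k j) x"
      by (rule separate_point_closed)
  qed force+
  then obtain d where d: "d > 0" "\<And>j x. [|j \<in> {1..k}; x \<in> F j|] ==> d \<le> dist (corner k j) x" by blast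
  \<comment> \<open>\<open>2 * \<delta> < d\<close> makes the neighbourhoods of two corners of one
    tile disjoint; in particular \<open>\<delta> < d\<close>, so a neighbourhood meets only the two
    sides at its corner.\<close>
  define \<delta> where "\<delta> = min (d / 3) (1 / 2)"
  have \<delta>: "\<delta> > 0" "2 * \<delta> < d" "\<delta> < 1" using d(1) by (auto simp: \<delta>_def)
  define N where "N j = cball (corner k j) \<delta> \<inter> cball 0 1" for j
  have N_side: "i = j \<or> i = pred_side j" if "i \<in> {1..k}" "j \<in> {1..k}" "z \<in> N j" "z \<in> side k i" for i j z
  proof (rule ccontr)
    assume "\<not> ?thesis"
    then have "z \<in> F j" using that by (auto simp: F_def)
    then show False using d(2)[of j z] that(2,3) \<delta> by (auto simp: N_def)
  qed
  have N_disj: "i = j" if "i \<in> {1..k}" "j \<in> {1..k}" "z \<in> N j" "z \<in> N i" for i j z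
  proof (rule ccontr)
    assume "i ~= j"
    then have "corner k i \<in> F j" using that by (auto simp: F_def)
    then have "d \<le> dist (corner k j) (corner k i)" using d(2) that by blast
    also have "\<dots> \<le> dist (corner k j) z + dist (corner k i) z" by (rule dist_triangle2)
    finally show False using that \<delta> by (auto simp: N_def)
  qed
  have N_corner: "corner k j \<in> N j" for j
    using \<delta> by (auto simp: N_def corner_circle_point)
  \<comment> \<open>\<open>K\<close> is what remains of all tiles after the open corner
    neighbourhoods at \<open>v\<close> are removed. It is compact and misses \<open>v\<close>, so a
    disk around \<open>v\<close> fits into its complement.\<close>
  define Q where "Q t = cball 0 1 - (\<Union>j\<in>{j. (t, j) \<in> corners_at v}. ball (corner k j) \<delta>)" for t
  define K where "K = (\<Union>t\<in>T. \<phi> t ` Q t)"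
  have Q_compact: "compact (Q t)" for t unfolding Q_def by (intro compact_diff compact_cball open_UN) auto
  have K_compact: "compact K" unfolding K_def
    using finite_tiles closed_image_tile Q_compact by (intro compact_UN) (auto simp: Q_def)
  have "v \<notin> K"
  proof
    assume "v \<in> K"
    then obtain t z where tz: "t \<in> T" "z \<in> Q t" "v = \<phi> t z" by (auto simp: K_def)
    have zc: "z \<in> cball 0 1" using tz(2) by (simp add: Q_def)
    have "z \<notin> ball 0 1" using tz tile_disj_graph[OF tz(1)] image_ball[OF tz(1)] v by blast
    then have "z \<in> sphere 0 1" using zc by auto
    then show False
    proof (rule sphere_cases[OF _ k_pos])
      fix j assume j: "j \<in> {1..k}" "z = corner k j"
      then have "(t, j) \<in> corners_at v" using tz by (auto simp: corners_at_def rim_def corner_circle_point)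
      then have "z \<notin> ball (corner k j) \<delta>" using tz(2) by (auto simp: Q_def)
      then show False using j \<delta> by simp
    next
      fix j assume j: "j \<in> {1..k}" "z \<in> open_side k j"
      then have "\<phi> t ` open_side k j \<inter> V = {}" using polygon[OF tz(1)] by (auto simp: polygon_map_def)
      then show False using j(2) tz(3) v by blast
    qed
  qed
  obtain C where C: "openin (top_of_set S) C" "v \<in> C" "C homeomorphic ball (0::complex) 1"
    using surface V_S v unfolding closed_surface_def by blast
  then obtain h h' where "homeomorphism C (ball (0::complex) 1) h' h"
    unfolding homeomorphic_def by blast
  then have h: "homeomorphism (ball (0::complex) 1) C h h'" by (rule homeomorphism_symD)
  have "closed K" using K_compact by (rule compact_imp_closed)
  then have "openin (top_of_set C) (C - K)" by (simp add: Diff_eq openin_open_Int open_Compl)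
  then have "openin (top_of_set (ball (0::complex) 1)) (h' ` (C - K))"
    using homeomorphism_imp_open_map[OF homeomorphism_symD[OF h]] by blast
  then have "open (h' ` (C - K))" using open_ball openin_open_eq by blast
  moreover have "h' v \<in> h' ` (C - K)" using C(2) \<open>v \<notin> K\<close> by blast
  ultimately obtain \<epsilon> where \<epsilon>: "\<epsilon> > 0" "ball (h' v) \<epsilon> \<subseteq> h' ` (C - K)" by (rule openE)
  define D where "D = ball (h' v) \<epsilon>"
  have hh': "h (h' x) = x" if "x \<in> C" for x using homeomorphism_apply2[OF h that] .
  have D_ball: "D \<subseteq> ball 0 1" using \<epsilon>(2) homeomorphism_image2[OF h] unfolding D_def by blast
  have hD: "h ` D \<subseteq> C - K"
  proof
    fix y assume "y \<in> h ` D"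
    then obtain x where "x \<in> C - K" "y = h (h' x)" using \<epsilon>(2) unfolding D_def by blast
    then show "y \<in> C - K" using hh' by simp
  qed
  have hDo: "openin (top_of_set S) (h ` D)"
  proof (rule openin_trans[OF _ C(1)])
    have "openin (top_of_set (ball 0 1)) D" using D_ball by (intro open_subset) (auto simp: D_def)
    then show "openin (top_of_set C) (h ` D)" using homeomorphism_imp_open_map[OF h] by blast
  qed
  have hD_S: "h ` D \<subseteq> S" using hDo openin_imp_subset by blast
  have vD: "h' v \<in> D" "h (h' v) = v" using \<epsilon>(1) hh'[OF C(2)] by (auto simp: D_def)
  define U where "U = h ` D - {v}"
  have U_eq: "U = h ` (D - {h' v})"
  proof -
    have "inj_on h (ball 0 1)"
      by (rule inj_on_inverseI[of _ h']) (use homeomorphism_apply1[OF h] in blast)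
    then have "inj_on h D" using D_ball inj_on_subset by blast
    then have "h ` (D - {h' v}) = h ` D - h ` {h' v}" using vD(1) by (intro inj_on_image_set_diff[of h D]) auto
    then show ?thesis using vD(2) by (simp add: U_def)
  qed
  have "connected (D - {h' v})"
    unfolding D_def by (rule connected_punctured_ball) simp
  moreover have "continuous_on (D - {h' v}) h"
    by (rule continuous_on_subset[OF homeomorphism_cont1[OF h]]) (use D_ball in blast)
  ultimately have U_conn: "connected U" unfolding U_eq by (rule connected_continuous_image[rotated])
  define R where "R A = (\<Union>(t, j)\<in>A. \<phi> t ` N j)" for A
  have R_closed: "closed (R A)" if "A \<subseteq> corners_at v" for A
  proof -
    have "compact (\<phi> (fst c) ` N (snd c))" if "c \<in> A" for c
      using \<open>A \<subseteq> corners_at v\<close> that by (intro closed_image_tile) (auto simp: N_def corners_at_def)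
    moreover have "finite A" using that finite_corners_at finite_subset by blast
    ultimately show ?thesis unfolding R_def case_prod_beta
      by (intro compact_imp_closed compact_UN) auto
  qed
  have U_cover: "U \<subseteq> R X \<union> R Y"
  proof
    fix x assume x: "x \<in> U"
    then have "x \<in> S" "x \<notin> K" using hD_S hD by (auto simp: U_def)
    then obtain t z where tz: "t \<in> T" "z \<in> cball 0 1" "x = \<phi> t z" using S_covered by blast
    then have "z \<notin> Q t" using \<open>x \<notin> K\<close> by (auto simp: K_def)
    then obtain j where "(t, j) \<in> corners_at v" "z \<in> ball (corner k j) \<delta>" using tz(2) by (auto simp: Q_def)
    then have "(t, j) \<in> X \<union> Y" "z \<in> N j" using tz(2) by (auto simp: Y_def N_def)
    then show "x \<in> R X \<union> R Y" using tz(3) by (auto simp: R_def)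
  qed
  \<comment> \<open>The radius of a tile towards the corner enters every neighbourhood of
    \<open>v\<close> and consists of tile points, so it reaches the punctured disk.\<close>
  have R_meets: "R A \<inter> U ~= {}" if A: "A \<subseteq> corners_at v" "A ~= {}" for A
  proof -
    obtain t j where tj: "(t, j) \<in> A" using A(2) by auto
    then have t: "t \<in> T" "j \<in> {1..k}" "rim t (real j) = v" using A(1) by (auto simp: corners_at_def)
    define \<rho> where "\<rho> r = \<phi> t (of_real (1 - r) * corner k j)" for r
    have nc: "norm (corner k j) = 1" by (simp add: corner_circle_point)
    have \<rho>_cont: "continuous_on {0..1} \<rho>" unfolding \<rho>_def
      by (rule continuous_on_compose2[OF cont[OF t(1)]])
        (use nc in \<open>auto intro!: continuous_intros simp: norm_mult simp del: of_real_diff\<close>)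
    have \<rho>_S: "\<rho> \<in> {0..1} \<rightarrow> S" unfolding \<rho>_def
      using image_cball[OF t(1)] nc by (auto simp: norm_mult simp del: of_real_diff)
    have "openin (top_of_set {0..1}) ({0..1} \<inter> \<rho> -` (h ` D))"
      by (rule continuous_openin_preimage[OF \<rho>_cont \<rho>_S hDo])
    moreover have "\<rho> 0 = v" using t(3) by (simp add: \<rho>_def rim_def corner_circle_point)
    then have "0 \<in> {0..1} \<inter> \<rho> -` (h ` D)" using vD by force
    ultimately obtain b where b: "b > 0" "\<And>r. r \<in> {0..1} ==> dist r 0 < b ==> \<rho> r \<in> h ` D"
      unfolding openin_euclidean_subtopology_iff by blast
    define r where "r = min (b / 2) \<delta>"
    have r: "0 < r" "r < 1" "r < b" "r \<le> \<delta>" using b(1) \<delta> by (auto simp: r_def)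
    define z where "z = of_real (1 - r) * corner k j"
    have zb: "z \<in> ball 0 1" using r nc by (simp add: z_def norm_mult del: of_real_diff)
    have "dist (corner k j) z = norm (of_real r * corner k j)"
      by (simp add: z_def dist_norm algebra_simps)
    then have "z \<in> N j" using r nc zb by (auto simp: N_def norm_mult)
    then have "\<phi> t z \<in> R A" using tj by (auto simp: R_def)
    moreover have "\<phi> t z \<in> h ` D" using b(2)[of r] r by (simp add: \<rho>_def z_def)
    moreover have "\<phi> t z ~= v" using zb image_ball[OF t(1)] tile_disj_graph[OF t(1)] v by blast
    ultimately show ?thesis by (auto simp: U_def)
  qed
  \<comment> \<open>A common point of two different corners cannot lie inside a tile; it lies on an
    edge that bounds both corners, which \<open>cl\<close> forbids. Two closed sets would then split
    the connected set \<open>U\<close>.\<close>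
  have "R X \<inter> R Y \<inter> U = {}"
  proof (rule ccontr)
    assume "R X \<inter> R Y \<inter> U ~= {}"
    then obtain x where xx: "x \<in> U" "x \<in> R X" "x \<in> R Y" by blast
    obtain t j z where xX: "(t, j) \<in> X" "z \<in> N j" "x = \<phi> t z" using xx(2) unfolding R_def by blast
    obtain t' j' z' where xY: "(t', j') \<in> Y" "z' \<in> N j'" "x = \<phi> t' z'" using xx(3) unfolding R_def by blast
    note x = xx(1) xX xY
    have t: "t \<in> T" "j \<in> {1..k}" "rim t (real j) = v" and t': "t' \<in> T" "j' \<in> {1..k}" "rim t' (real j') = v"
      using x X Y by (auto simp: corners_at_def)
    have zc: "z \<in> cball 0 1" "z' \<in> cball 0 1" using x by (auto simp: N_def)
    have ne: "(t, j) ~= (t', j')" using x(2,5) by (auto simp: Y_def)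
    have eq: "\<phi> t z = \<phi> t' z'" using x by simp
    have zn: "z \<notin> ball 0 1"
      using tile_points[OF t(1) t'(1) _ zc(2) eq] N_disj[OF t(2) t'(2)] x ne by auto
    have on_edge: "\<exists>e\<in>E. x \<in> e \<and> e \<in> corner_edges (s, i)" "x \<notin> V"
      if s: "s \<in> T" "i \<in> {1..k}" "rim s (real i) = v" "y \<in> N i" "x = \<phi> s y" "y \<in> sphere 0 1" for s i y
    proof -
      have "x \<notin> V \<and> (\<exists>e\<in>E. x \<in> e \<and> e \<in> corner_edges (s, i))"
        using s(6)
      proof (rule sphere_cases[OF _ k_pos])
        fix l assume l: "l \<in> {1..k}" "y = corner k l"
        then have "l = i" using N_disj[OF s(2) l(1) _ s(4)] N_corner[of l] by metis
        then have "x = v" using s l by (simp add: rim_def corner_circle_point)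
        then show ?thesis using x(1) by (simp add: U_def)
      next
        fix l assume l: "l \<in> {1..k}" "y \<in> open_side k l"
        then have yl: "y \<in> side k l" using open_side_subset_side by blast
        then have "l = i \<or> l = pred_side i" using N_side[OF l(1) s(2) s(4)] by blast
        then have "edge s l \<in> corner_edges (s, i)" by (auto simp: corner_edges_def)
        moreover have "x \<in> edge s l" using s(5) yl by (auto simp: edge_def)
        moreover have "\<phi> s ` open_side k l \<inter> V = {}" using polygon[OF s(1)] l(1) by (auto simp: polygon_map_def)
        then have "x \<notin> V" using l(2) s(5) by blast
        ultimately show ?thesis using edge_in_E[OF s(1) l(1)] by blast
      qed
      then show "\<exists>e\<in>E. x \<in> e \<and> e \<in> corner_edges (s, i)" "x \<notin> V" by blast+
    qed
    have "z \<in> sphere 0 1" using zn zc by auto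
    then obtain e where e: "e \<in> E" "x \<in> e" "e \<in> corner_edges (t, j)" "x \<notin> V"
      using on_edge[OF t x(3,4)] by blast
    have "z' \<notin> ball 0 1" using image_ball[OF t'(1)] tile_disj_graph[OF t'(1)] e x(7) by blast
    then have "z' \<in> sphere 0 1" using zc by auto
    then obtain e' where e': "e' \<in> E" "x \<in> e'" "e' \<in> corner_edges (t', j')"
      using on_edge[OF t' x(6,7)] by blast
    have "e = e'" using edges_meet e e' by blast
    then show False using cl[of "(t, j)" "(t', j')"] x(2,5) e(3) e'(3) by (auto simp: Y_def)
  qed
  then have "R X \<inter> U = {} \<or> R Y \<inter> U = {}"
    by (rule connected_closedD[OF U_conn _ U_cover R_closed[OF X(1)] R_closed[OF Y(2)]])
  then show False using R_meets[OF X] R_meets[OF Y(2,1)] by blast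
qed

lemma degree_no_loops:
  assumes nl: "\<And>t j. [|t \<in> T; j \<in> {1..k}|] ==> rim t (real j) ~= rim t (real j + 1)"
  shows "vertex_degree V E v = card {e \<in> E. v \<in> e}"
proof -
  have "e \<inter> V ~= {v}" if e: "e \<in> E" for e
  proof -
    obtain t j where "t \<in> T" "j \<in> {1..k}" "edge t j = e"
      using edge_side[OF e] by (auto simp: sides_of_def)
    then show ?thesis using edge_Int_V[of t j] nl[of t j] by auto
  qed
  then have "vertex_degree V E v = (\<Sum>e\<in>{e \<in> E. v \<in> e}. 1)"
    unfolding vertex_degree_def by (intro sum.cong) auto
  then show ?thesis by simp
qed

text \<open>If two consecutive sides were glued to one edge \<open>g\<close>, both sides of
  \<open>g\<close> would be used up at this corner, and no other corner at \<open>v\<close> could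
  touch \<open>g\<close>. By \<open>corners_connected\<close> it would be the only corner at
  \<open>v\<close>, and \<open>v\<close> would have degree 1.\<close>

lemma consecutive_sides_distinct:
  assumes nl: "\<And>t j. [|t \<in> T; j \<in> {1..k}|] ==> rim t (real j) ~= rim t (real j + 1)"
    and t: "t \<in> T" "j \<in> {1..k}"
  shows "edge t j ~= edge t (pred_side j)"
proof
  assume eq: "edge t j = edge t (pred_side j)"
  define g where "g = edge t j"
  define v where "v = rim t (real j)"
  have vV: "v \<in> V" unfolding v_def using rim_vertex[OF t(1), of j] t(2) by auto
  have gE: "g \<in> E" unfolding g_def using edge_in_E t by blast
  have two: "{(t, j), (t, pred_side j)} \<subseteq> sides_of g"
    using t eq pred_side[OF t(2)] by (auto simp: sides_of_def g_def)
  have "card {(t, j), (t, pred_side j)} = 2" using pred_side[OF t(2)] by simp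
  then have sg: "sides_of g = {(t, j), (t, pred_side j)}"
    using two card_sides_of[OF gE] finite_sides_of[of g] by (metis card_subset_eq)
  have X: "{(t, j)} = corners_at v"
  proof (rule corners_connected[OF vV])
    show "{(t, j)} \<subseteq> corners_at v" using t by (auto simp: corners_at_def v_def)
    fix c c' assume c: "c \<in> {(t, j)}" "c' \<in> corners_at v - {(t, j)}"
    obtain s i where si: "c' = (s, i)" by (cases c')
    have s: "s \<in> T" "i \<in> {1..k}" "rim s (real i) = v" "(s, i) ~= (t, j)"
      using c(2) si by (auto simp: corners_at_def)
    have "g ~= edge s i"
    proof
      assume "g = edge s i"
      then have "(s, i) \<in> sides_of g" using s by (auto simp: sides_of_def)
      then have "s = t" "i = pred_side j" using sg s(4) by auto
      \<comment> \<open>The far end of \<open>g\<close> could carry another corner with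
        \<open>g\<close>; it would be at \<open>v\<close> only if \<open>g\<close> were a
        loop.\<close>
      then have "rim t (real (pred_side j)) = rim t (real (pred_side j) + 1)"
        using s(3) rim_pred[OF t(2), of t] by (simp add: v_def)
      then show False using nl[OF t(1) pred_side(1)[OF t(2)]] by blast
    qed
    moreover have "g ~= edge s (pred_side i)"
    proof
      assume "g = edge s (pred_side i)"
      then have "(s, pred_side i) \<in> sides_of g" using s pred_side by (auto simp: sides_of_def)
      then consider "s = t" "pred_side i = j" | "s = t" "pred_side i = pred_side j" using sg by auto
      then show False
      proof cases
        case 1
        then have "rim t (real j) = rim t (real j + 1)" using rim_pred[OF s(2), of t] s(3) by (simp add: v_def)
        then show False using nl[OF t] by blast
      next
        case 2
        then have "i = j" using s(2) t(2) by (auto simp: pred_side_def split: if_splits)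
        then show False using 2 s(4) by simp
      qed
    qed
    ultimately show "corner_edges c \<inter> corner_edges c' = {}"
      using c(1) si eq by (auto simp: corner_edges_def g_def)
  qed simp
  have "{e \<in> E. v \<in> e} \<subseteq> {g}"
  proof
    fix e assume "e \<in> {e \<in> E. v \<in> e}"
    then have "\<exists>c\<in>{(t, j)}. e \<in> corner_edges c" using edge_at_vertex vV unfolding X by blast
    then show "e \<in> {g}" using eq by (simp add: corner_edges_def g_def)
  qed
  then have "card {e \<in> E. v \<in> e} \<le> 1" using card_mono[of "{g}"] by simp
  then show False using degree[OF vV] degree_no_loops[OF nl] by simp
qed

end

section \<open>Labelled pentagons\<close>

lemma sum_card_swap:
  assumes "finite A" "finite C"
  shows "(\<Sum>x\<in>A. card {y \<in> C. R x y}) = (\<Sum>y\<in>C. card {x \<in> A. R x y})"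
proof -
  have "(\<Sum>x\<in>A. card {y \<in> C. R x y}) = (\<Sum>x\<in>A. \<Sum>y\<in>C. if R x y then 1 else 0)"
    using assms by (intro sum.cong refl) (simp add: sum.If_cases Int_def)
  also have "\<dots> = (\<Sum>y\<in>C. \<Sum>x\<in>A. if R x y then 1 else 0)" by (rule sum.swap)
  also have "\<dots> = (\<Sum>y\<in>C. card {x \<in> A. R x y})"
    using assms by (intro sum.cong refl) (simp add: sum.If_cases Int_def)
  finally show ?thesis .
qed

text \<open>Each side belongs to one edge, so the sets are disjoint, with two elements each. The
  numerical identities below come from this.\<close>

lemma (in polygons) card_sides_of_Union:
  assumes "F \<subseteq> E" shows "card (\<Union>e\<in>F. sides_of e) = 2 * card F"
proof -
  have "card (\<Union>e\<in>F. sides_of e) = (\<Sum>e\<in>F. card (sides_of e))"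
    by (rule card_UN_disjoint)
      (use assms finite_E finite_subset finite_sides_of in \<open>auto simp: sides_of_def\<close>)
  also have "\<dots> = (\<Sum>e\<in>F. 2)" using assms card_sides_of by (intro sum.cong) auto
  finally show ?thesis by simp
qed

text \<open>
  The corners of every tile are labelled as in the types \<open>P\<^sub>1\<close>, \<open>P\<^sub>2\<close>, \<open>P\<^sub>3\<close>; of the identifications
  allowed there only \<open>v\<^sub>4 ~= v\<^sub>5\<close> matters.
\<close>

locale labelled_pentagons = polygonal_surface S V E 5 \<phi>
  for S V :: "'a::t2_space set" and E :: "'a set set" and \<phi> :: "'a set => complex => 'a" +
  fixes B :: "'a set"
  assumes B_V: "B \<subseteq> V"
    and degree3: "u \<in> V - B ==> vertex_degree V E u = 3"
    and bullets: "t \<in> T ==> rim t 1 \<in> B" "t \<in> T ==> rim t 3 \<in> B"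
    and blanks: "t \<in> T ==> rim t 2 \<notin> B" "t \<in> T ==> rim t 4 \<notin> B" "t \<in> T ==> rim t 5 \<notin> B"
    and rim45: "t \<in> T ==> rim t 4 ~= rim t 5"
begin

lemma side_index_cases:
  assumes "j \<in> {1..5::nat}"
  obtains "j = 1" | "j = 2" | "j = 3" | "j = 4" | "j = 5"
proof -
  have "j = 1 \<or> j = 2 \<or> j = 3 \<or> j = 4 \<or> j = 5" using assms by auto
  then show ?thesis using that by blast
qed

lemma rim6: "rim t 6 = rim t 1"
  using rim_last[of t] by simp

lemma rims_V:
  assumes "t \<in> T"
  shows "rim t 1 \<in> V" "rim t 2 \<in> V" "rim t 3 \<in> V" "rim t 4 \<in> V" "rim t 5 \<in> V"
  using rim_vertex[OF assms, of 1] rim_vertex[OF assms, of 2] rim_vertex[OF assms, of 3]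
    rim_vertex[OF assms, of 4] rim_vertex[OF assms, of 5] by simp_all

lemma edge_V:
  assumes "t \<in> T"
  shows "edge t 1 \<inter> V = {rim t 1, rim t 2}" "edge t 2 \<inter> V = {rim t 2, rim t 3}"
    "edge t 3 \<inter> V = {rim t 3, rim t 4}" "edge t 4 \<inter> V = {rim t 4, rim t 5}"
    "edge t 5 \<inter> V = {rim t 5, rim t 1}"
  using edge_Int_V[OF assms, of 1] edge_Int_V[OF assms, of 2] edge_Int_V[OF assms, of 3]
    edge_Int_V[OF assms, of 4] edge_Int_V[OF assms, of 5] rim6[of t] by simp_all

lemma rims_distinct:
  assumes "t \<in> T"
  shows "rim t 1 ~= rim t 2" "rim t 2 ~= rim t 3" "rim t 3 ~= rim t 4" "rim t 4 ~= rim t 5" "rim t 5 ~= rim t 1"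
    "rim t 1 ~= rim t 4" "rim t 3 ~= rim t 5"
  using bullets[OF assms] blanks[OF assms] rim45[OF assms] by metis+

lemma no_loops:
  assumes "t \<in> T" "j \<in> {1..5}" shows "rim t (real j) ~= rim t (real j + 1)"
  using assms(2) by (cases rule: side_index_cases) (use rims_distinct[OF assms(1)] rim6[of t] in simp_all)

lemma degree_card: "vertex_degree V E v = card {e \<in> E. v \<in> e}"
  by (rule degree_no_loops[OF no_loops])

lemma next_side_distinct:
  assumes "t \<in> T" shows "edge t 2 ~= edge t 1" "edge t 3 ~= edge t 2" "edge t 1 ~= edge t 5"
  using consecutive_sides_distinct[OF no_loops assms, of 2] consecutive_sides_distinct[OF no_loops assms, of 3]
    consecutive_sides_distinct[OF no_loops assms, of 1] by (simp_all add: pred_side_def)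

section \<open>Counting the edges without and with a labelled end\<close>

definition blank_edges :: "'a set set" where "blank_edges = {e \<in> E. e \<inter> B = {}}"

lemma blank_edges_E: "blank_edges \<subseteq> E" by (auto simp: blank_edges_def)

lemma edge_Int_B: "e \<inter> B = (e \<inter> V) \<inter> B" using B_V by blast

text \<open>Around a tile the labels read bullet, blank, bullet, blank, blank, so only the side from
  \<open>v_4\<close> to \<open>v_5\<close> has two blank ends.\<close>

lemma edge_blank_iff:
  assumes "t \<in> T" "j \<in> {1..5}" shows "edge t j \<in> blank_edges \<longleftrightarrow> j = 4"
proof -
  have "edge t j \<in> E" using edge_in_E assms by blast
  then have "edge t j \<in> blank_edges \<longleftrightarrow> (edge t j \<inter> V) \<inter> B = {}"
    by (simp add: blank_edges_def edge_Int_B[symmetric])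
  also have "\<dots> \<longleftrightarrow> j = 4"
    using assms(2) by (cases rule: side_index_cases)
      (use edge_V[OF assms(1)] bullets[OF assms(1)] blanks[OF assms(1)] in auto)
  finally show ?thesis .
qed

lemma blank_sides: "(\<Union>e\<in>blank_edges. sides_of e) = T \<times> {4}"
proof (intro equalityI subsetI)
  fix c assume "c \<in> (\<Union>e\<in>blank_edges. sides_of e)"
  then have "fst c \<in> T" "snd c \<in> {1..5}" "edge (fst c) (snd c) \<in> blank_edges"
    by (auto simp: sides_of_def)
  then show "c \<in> T \<times> {4}" using edge_blank_iff by (simp add: mem_Times_iff)
next
  fix c :: "'a set \<times> nat" assume "c \<in> T \<times> {4}"
  then have "fst c \<in> T" "snd c = 4" by auto
  then have "c \<in> sides_of (edge (fst c) 4)" "edge (fst c) 4 \<in> blank_edges"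
    using edge_blank_iff[of "fst c" 4] by (auto simp: sides_of_def)
  then show "c \<in> (\<Union>e\<in>blank_edges. sides_of e)" by blast
qed

lemma bullet_sides: "(\<Union>e\<in>E - blank_edges. sides_of e) = T \<times> {1, 2, 3, 5}"
proof (intro equalityI subsetI)
  fix c assume "c \<in> (\<Union>e\<in>E - blank_edges. sides_of e)"
  then have c: "fst c \<in> T" "snd c \<in> {1..5}" "edge (fst c) (snd c) \<notin> blank_edges"
    by (auto simp: sides_of_def)
  then have "snd c ~= 4" using edge_blank_iff by blast
  have "snd c \<in> {1, 2, 3, 5}" by (rule side_index_cases[OF c(2)]) (use \<open>snd c ~= 4\<close> in auto)
  then show "c \<in> T \<times> {1, 2, 3, 5}" using c(1) by (simp add: mem_Times_iff)
next
  fix c :: "'a set \<times> nat" assume "c \<in> T \<times> {1, 2, 3, 5}"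
  then have c: "fst c \<in> T" "snd c \<in> {1..5}" "snd c ~= 4" by auto
  then have "c \<in> sides_of (edge (fst c) (snd c))" "edge (fst c) (snd c) \<in> E - blank_edges"
    using edge_blank_iff[OF c(1,2)] edge_in_E[OF c(1,2)] by (auto simp: sides_of_def)
  then show "c \<in> (\<Union>e\<in>E - blank_edges. sides_of e)" by blast
qed

lemma card_blank_edges: "2 * card blank_edges = card T"
  using card_sides_of_Union[OF blank_edges_E] unfolding blank_sides by (simp add: card_cartesian_product)

lemma card_bullet_edges: "2 * card (E - blank_edges) = 4 * card T"
  using card_sides_of_Union[of "E - blank_edges"] unfolding bullet_sides
  by (simp add: card_cartesian_product)

text \<open>\<open>rim45\<close> excludes loops. The value 2 enters the double count of incidences
  in \<open>card_blank_edges_at\<close>.\<close>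

lemma blank_edge_ends:
  assumes "e \<in> blank_edges" shows "card {u \<in> V - B. u \<in> e} = 2"
proof -
  obtain t j where tj: "(t, j) \<in> sides_of e" using edge_side blank_edges_E assms by blast
  then have t: "t \<in> T" "j \<in> {1..5}" "edge t j = e" by (auto simp: sides_of_def)
  then have "j = 4" using edge_blank_iff assms by blast
  then have "{u \<in> V - B. u \<in> e} = {rim t 4, rim t 5}"
    using edge_V(4)[OF t(1)] t(3) blanks[OF t(1)] by blast
  then show ?thesis using rim45[OF t(1)] by simp
qed

lemma bullet_edge_ends:
  assumes "e \<in> E - blank_edges"
  obtains b u where "e \<inter> V = {b, u}" "b \<in> B" "u \<in> V - B"
proof -
  obtain t j where tj: "(t, j) \<in> sides_of e" using edge_side assms by blast
  then have t: "t \<in> T" "j \<in> {1..5}" "edge t j = e" by (auto simp: sides_of_def)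
  then have "j ~= 4" using edge_blank_iff assms by blast
  have r: "rim t 2 \<in> V - B" "rim t 4 \<in> V - B" "rim t 5 \<in> V - B"
    using rims_V[OF t(1)] blanks[OF t(1)] by blast+
  note E = edge_V[OF t(1)]
  show ?thesis using t(2)
  proof (cases rule: side_index_cases)
    case 1 then show ?thesis using that[of "rim t 1" "rim t 2"] E(1) t(3) bullets[OF t(1)] r by auto
  next
    case 2 then show ?thesis using that[of "rim t 3" "rim t 2"] E(2) t(3) bullets[OF t(1)] r by auto
  next
    case 3 then show ?thesis using that[of "rim t 3" "rim t 4"] E(3) t(3) bullets[OF t(1)] r by auto
  next
    case 4 then show ?thesis using \<open>j ~= 4\<close> by simp
  next
    case 5 then show ?thesis using that[of "rim t 1" "rim t 5"] E(5) t(3) bullets[OF t(1)] r by auto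
  qed
qed

lemma bullet_edge_blank_end:
  assumes "e \<in> E - blank_edges" "u \<in> e" "u \<in> V - B" "u' \<in> e" "u' \<in> V - B" shows "u = u'"
  using bullet_edge_ends[OF assms(1)] assms by (metis DiffD1 DiffD2 IntI insertE singletonD)

lemma card_blank_end:
  assumes "e \<in> E - blank_edges" shows "card {u \<in> V - B. u \<in> e} = 1"
proof -
  obtain b u where "e \<inter> V = {b, u}" "b \<in> B" "u \<in> V - B" using bullet_edge_ends[OF assms] .
  then have "{u \<in> V - B. u \<in> e} = {u}" by auto
  then show ?thesis by simp
qed

lemma card_edges_at_blank: "u \<in> V - B ==> card {e \<in> E. u \<in> e} = 3"
  using degree3 degree_card by metis

lemma card_edges_split:
  "card {e \<in> E. u \<in> e} = card {e \<in> blank_edges. u \<in> e} + card {e \<in> E - blank_edges. u \<in> e}"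
proof -
  have "{e \<in> E. u \<in> e} = {e \<in> blank_edges. u \<in> e} \<union> {e \<in> E - blank_edges. u \<in> e}"
    using blank_edges_E by auto
  moreover have "card ({e \<in> blank_edges. u \<in> e} \<union> {e \<in> E - blank_edges. u \<in> e}) =
      card {e \<in> blank_edges. u \<in> e} + card {e \<in> E - blank_edges. u \<in> e}"
    by (rule card_Un_disjoint) (use finite_E finite_subset[OF blank_edges_E] in auto)
  ultimately show ?thesis by simp
qed

text \<open>The side of \<open>t\<close> that meets side 4 at its end \<open>u\<close>: 3 if
  \<open>u\<close> is \<open>v_4\<close>, and 5 otherwise. The tile is returned as well, so that the
  result can be an element of \<open>sides_of\<close>.\<close>

definition out_side :: "'a => 'a set => 'a set \<times> nat" where
  "out_side u t = (t, if rim t 4 = u then 3 else 5)"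

lemma out_side:
  assumes "t \<in> T" "u \<in> edge t 4" "u \<in> V"
  shows "out_side u t \<in> T \<times> {3, 5}" "u \<in> edge t (snd (out_side u t))"
    "edge t (snd (out_side u t)) \<in> E - blank_edges"
proof -
  have "u = rim t 4 \<or> u = rim t 5" using edge_V(4)[OF assms(1)] assms by blast
  then show "u \<in> edge t (snd (out_side u t))"
    using edge_V(3,5)[OF assms(1)] by (auto simp: out_side_def)
  show "out_side u t \<in> T \<times> {3, 5}" using assms by (simp add: out_side_def)
  then show "edge t (snd (out_side u t)) \<in> E - blank_edges"
    using edge_blank_iff[OF assms(1)] edge_in_E[OF assms(1)] by (auto simp: out_side_def)
qed

lemma out_side_unique:
  assumes "t \<in> T" "j \<in> {3, 5}" "u \<in> edge t j" "u \<in> V - B"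
  shows "(t, j) = out_side u t" "u \<in> edge t 4"
proof -
  have "u \<in> edge t j \<inter> V" "u ~= rim t 1" "u ~= rim t 3"
    using assms(3,4) bullets[OF assms(1)] by auto
  then have "j = 3 \<and> u = rim t 4 \<or> j = 5 \<and> u = rim t 5"
    using assms(2) edge_V(3,5)[OF assms(1)] by auto
  then show "(t, j) = out_side u t" "u \<in> edge t 4"
    using rim45[OF assms(1)] edge_V(4)[OF assms(1)] by (auto simp: out_side_def)
qed

text \<open>Every side lying on a blank edge at \<open>u\<close> is the side 4 of a tile of its own,
  and each such tile contributes its \<open>out_side\<close> on a bullet edge at \<open>u\<close>.
  So twice the number of blank edges is at most twice the number of bullet edges, and the two
  numbers add up to 3.\<close>

lemma card_blank_edges_at_le:
  assumes u: "u \<in> V - B" shows "card {e \<in> blank_edges. u \<in> e} \<le> 1"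
proof (rule ccontr)
  define F where "F = {e \<in> blank_edges. u \<in> e}"
  define G where "G = {e \<in> E - blank_edges. u \<in> e}"
  assume "\<not> ?thesis"
  then have F2: "card F \<ge> 2" by (simp add: F_def)
  define T' where "T' = {t \<in> T. u \<in> edge t 4}"
  have fin: "finite T'" "finite G" using finite_tiles finite_E by (auto simp: T'_def G_def)
  have "(\<Union>e\<in>F. sides_of e) = T' \<times> {4}"
  proof (intro equalityI subsetI)
    fix c assume "c \<in> (\<Union>e\<in>F. sides_of e)"
    then obtain e where e: "e \<in> blank_edges" "u \<in> e" "c \<in> sides_of e" by (auto simp: F_def)
    then have "c \<in> T \<times> {4}" using blank_sides by blast
    then show "c \<in> T' \<times> {4}" using e by (auto simp: T'_def sides_of_def)
  next
    fix c assume "c \<in> T' \<times> {4::nat}"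
    then have c: "fst c \<in> T" "snd c = 4" "u \<in> edge (fst c) 4" by (auto simp: T'_def)
    then have "c \<in> sides_of (edge (fst c) 4)" "edge (fst c) 4 \<in> F"
      using edge_blank_iff[of "fst c" 4] by (auto simp: sides_of_def F_def)
    then show "c \<in> (\<Union>e\<in>F. sides_of e)" by blast
  qed
  moreover have "F \<subseteq> E" using blank_edges_E by (auto simp: F_def)
  ultimately have T': "card T' = 2 * card F"
    using card_sides_of_Union[of F] by (simp add: card_cartesian_product)
  have "out_side u ` T' \<subseteq> (\<Union>e\<in>G. sides_of e)"
  proof
    fix c assume "c \<in> out_side u ` T'"
    then obtain t where t: "t \<in> T" "u \<in> edge t 4" "c = out_side u t" by (auto simp: T'_def)
    note os = out_side[OF t(1,2)] u
    have "edge t (snd c) \<in> G" "c \<in> sides_of (edge t (snd c))"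
      using os t by (auto simp: G_def sides_of_def out_side_def)
    then show "c \<in> (\<Union>e\<in>G. sides_of e)" by blast
  qed
  moreover have "card (out_side u ` T') = card T'"
    by (rule card_image) (auto simp: inj_on_def out_side_def)
  moreover have "finite (\<Union>e\<in>G. sides_of e)" using fin finite_sides_of by blast
  ultimately have "card T' \<le> 2 * card G"
    using card_sides_of_Union[of G] card_mono by (metis (no_types, lifting) DiffD1 G_def mem_Collect_eq subsetI)
  moreover have "card F + card G = 3"
    using card_edges_at_blank[OF u] card_edges_split[of u] by (simp add: F_def G_def)
  ultimately show False using T' F2 by linarith
qed

text \<open>Summing degrees over the blank vertices gives three times their number. Summing over
  edges gives two ends for each blank edge and one for each bullet edge, in total
  \<open>3 * card T\<close>. Hence there are as many blank vertices as tiles, the blank edges at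
  them number one on average, and by the local bound exactly one each.\<close>

lemma card_blank_edges_at:
  assumes u: "u \<in> V - B"
  shows "card {e \<in> blank_edges. u \<in> e} = 1" "card {e \<in> E - blank_edges. u \<in> e} = 2"
proof -
  let ?a = "\<lambda>u. card {e \<in> blank_edges. u \<in> e}"
  have fin: "finite (V - B)" "finite E" "finite blank_edges"
    using finite_V finite_E finite_subset[OF blank_edges_E] by auto
  have A: "(\<Sum>u\<in>V - B. ?a u) = 2 * card blank_edges"
    using sum_card_swap[OF fin(1,3), of "\<lambda>u e. u \<in> e"] blank_edge_ends by simp
  have "(\<Sum>u\<in>V - B. card {e \<in> E - blank_edges. u \<in> e}) = card (E - blank_edges)"
    using sum_card_swap[OF fin(1), of "E - blank_edges" "\<lambda>u e. u \<in> e"] card_blank_end fin by simp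
  then have "(\<Sum>u\<in>V - B. card {e \<in> E. u \<in> e}) = 2 * card blank_edges + card (E - blank_edges)"
    unfolding card_edges_split sum.distrib using A by simp
  moreover have "(\<Sum>u\<in>V - B. card {e \<in> E. u \<in> e}) = 3 * card (V - B)"
    using card_edges_at_blank by simp
  ultimately have "card (V - B) = card T" using card_blank_edges card_bullet_edges by linarith
  then have "(\<Sum>u\<in>V - B. ?a u) = (\<Sum>u\<in>V - B. 1)" using A card_blank_edges by simp
  then show 1: "?a u = 1"
    using sum_mono_inv[of ?a "V - B" "\<lambda>_. 1"] card_blank_edges_at_le u fin by blast
  then show "card {e \<in> E - blank_edges. u \<in> e} = 2"
    using card_edges_at_blank[OF u] card_edges_split[of u] by simp
qed

text \<open>
  Of the three corners at an unlabelled vertex, two contain the unlabelled edge. Hence crossing an edge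
  with one labelled end always leads from a side 3 or 5 to a side 1 or 2.
\<close>

lemma blank_vertex_structure:
  assumes u: "u \<in> V - B"
  obtains e t t' where "e \<in> blank_edges" "sides_of e = {(t, 4), (t', 4)}" "t ~= t'" "u \<in> e" "t \<in> T" "t' \<in> T"
    "edge t (snd (out_side u t)) ~= edge t' (snd (out_side u t'))"
    "{e \<in> E - blank_edges. u \<in> e} = {edge t (snd (out_side u t)), edge t' (snd (out_side u t'))}"
proof -
  obtain e where e: "{f \<in> blank_edges. u \<in> f} = {e}"
    using card_blank_edges_at(1)[OF u] by (rule card_1_singletonE)
  have "e \<in> {f \<in> blank_edges. u \<in> f}" unfolding e by (rule singletonI)
  then have eb: "e \<in> blank_edges" "u \<in> e" by simp_all
  have "sides_of e \<subseteq> T \<times> {4}" using blank_sides eb by blast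
  moreover have "card (sides_of e) = 2" using card_sides_of blank_edges_E eb by blast
  then obtain c c' where cc: "sides_of e = {c, c'}" "c ~= c'" unfolding card_2_iff by blast
  ultimately have "c \<in> T \<times> {4}" "c' \<in> T \<times> {4}" by simp_all
  then obtain t t' where t: "c = (t, 4)" "c' = (t', 4)" "t \<in> T" "t' \<in> T" by (elim SigmaE) simp
  have ne: "t ~= t'" using cc t by simp
  have "(t, 4) \<in> sides_of e" "(t', 4) \<in> sides_of e" using cc t by simp_all
  then have et: "edge t 4 = e" "edge t' 4 = e" by (simp_all add: sides_of_def)
  have uV: "u \<in> V" using u by simp
  have u4: "u \<in> edge t 4" "u \<in> edge t' 4" using et eb by simp_all
  define g where "g = edge t (snd (out_side u t))"
  define g' where "g' = edge t' (snd (out_side u t'))"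
  have gG: "g \<in> E - blank_edges" "u \<in> g" "g' \<in> E - blank_edges" "u \<in> g'"
    using out_side(2,3)[OF t(3) u4(1) uV] out_side(2,3)[OF t(4) u4(2) uV] by (auto simp: g_def g'_def)
  have so: "out_side u t \<in> sides_of g" "out_side u t' \<in> sides_of g'"
    using t by (auto simp: sides_of_def g_def g'_def out_side_def)
  \<comment> \<open>A tile with a side 3 or 5 ending at \<open>u\<close> also has its side 4 ending
    there. Only one blank edge passes through \<open>u\<close>, so the tile is \<open>t\<close> or
    \<open>t'\<close>.\<close>
  have on: "(s, j) = out_side u t \<or> (s, j) = out_side u t'"
    if s: "s \<in> T" "j \<in> {3, 5}" "u \<in> edge s j" for s j
  proof -
    have "u \<in> edge s 4" "(s, j) = out_side u s" using out_side_unique[OF s u] by auto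
    moreover have "edge s 4 \<in> blank_edges" using edge_blank_iff[OF s(1), of 4] by simp
    ultimately have "edge s 4 = e" using e by blast
    then have "(s, 4) \<in> sides_of e" using s(1) by (simp add: sides_of_def)
    then show ?thesis using cc t \<open>(s, j) = out_side u s\<close> by auto
  qed
  \<comment> \<open>If both tiles left through the same edge, its two sides would be used up, and
    the other bullet edge \<open>f\<close> could carry only sides 1 and 2. A tile with such a side
    has \<open>v_2 = u\<close>, and its sides 1 and 2 would both be glued to \<open>f\<close>,
    against \<open>next_side_distinct\<close>.\<close>
  have gg: "g ~= g'"
  proof
    assume eq: "g = g'"
    have "card {out_side u t, out_side u t'} = 2" using ne by (simp add: out_side_def)
    moreover have "{out_side u t, out_side u t'} \<subseteq> sides_of g" using so eq by simp
    moreover have "card (sides_of g) = 2" using card_sides_of gG(1) by blast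
    ultimately have sg: "sides_of g = {out_side u t, out_side u t'}"
      using card_subset_eq[OF finite_sides_of, of "{out_side u t, out_side u t'}" g] by simp
    have fin2: "finite {e \<in> E - blank_edges. u \<in> e}" using finite_E by simp
    have "\<not> {e \<in> E - blank_edges. u \<in> e} \<subseteq> {g}"
      using card_blank_edges_at(2)[OF u] card_mono[of "{g}" "{e \<in> E - blank_edges. u \<in> e}"] by auto
    then obtain f where f: "f \<in> E - blank_edges" "u \<in> f" "f ~= g" by blast
    obtain s j where sj: "(s, j) \<in> sides_of f" using edge_side f by blast
    then have s: "s \<in> T" "edge s j = f" "j \<in> {1, 2, 3, 5}" using bullet_sides f(1) by (auto simp: sides_of_def)
    have "j \<notin> {3, 5}"
    proof
      assume "j \<in> {3, 5}"
      then have "(s, j) \<in> sides_of g" using on[of s j] s f sg by auto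
      then show False using s(2) f(3) by (simp add: sides_of_def)
    qed
    then have j12: "j = 1 \<or> j = 2" using s(3) by blast
    have "u \<in> edge s j \<inter> V" "u ~= rim s 1" "u ~= rim s 3" using bullets[OF s(1)] u f(2) s(2) by auto
    then have u2: "u = rim s 2" using j12 edge_V(1,2)[OF s(1)] by auto
    have "edge s 1 = f \<and> edge s 2 = f"
    proof -
      have "edge s i = f" if i: "i = 1 \<or> i = 2" for i
      proof -
        have i5: "i \<in> {1..5}" "i ~= 4" using i by auto
        have "rim s 2 \<in> edge s 1" "rim s 2 \<in> edge s 2" using edge_V(1,2)[OF s(1)] by blast+
        then have ue: "u \<in> edge s i" using i u2 by auto
        have iE: "edge s i \<in> E - blank_edges" using edge_blank_iff[OF s(1) i5(1)] edge_in_E[OF s(1) i5(1)] i5 by simp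
        have "edge s i ~= g"
        proof
          assume "edge s i = g"
          then have "(s, i) \<in> {out_side u t, out_side u t'}" using sg i5 s(1) by (auto simp: sides_of_def)
          then show False using i by (auto simp: out_side_def split: if_splits)
        qed
        moreover have "card {g, f} = 2" "{g, f} \<subseteq> {e \<in> E - blank_edges. u \<in> e}"
          using f gG by (auto simp del: insert_subset simp: subset_iff)
        then have "{e \<in> E - blank_edges. u \<in> e} = {g, f}"
          using card_blank_edges_at(2)[OF u] card_subset_eq[OF fin2, of "{g, f}"] by simp
        moreover have "edge s i \<in> {e \<in> E - blank_edges. u \<in> e}" using ue iE by simp
        ultimately show "edge s i = f" by simp
      qed
      then show ?thesis by blast
    qed
    then show False using next_side_distinct(1)[OF s(1)] by simp
  qed
  have "card {g, g'} = 2" "{g, g'} \<subseteq> {e \<in> E - blank_edges. u \<in> e}" using gg gG by simp_all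
  then have "{e \<in> E - blank_edges. u \<in> e} = {g, g'}"
    using card_blank_edges_at(2)[OF u] card_subset_eq[of "{e \<in> E - blank_edges. u \<in> e}" "{g, g'}"] finite_E by simp
  then show ?thesis using that[of e t t'] eb cc t ne gg by (simp add: g_def g'_def)
qed

text \<open>At its blank end \<open>u\<close> the edge is the outgoing edge of one of the two tiles
  at the blank edge of \<open>u\<close>, which gives the index 3 or 5. A second index of this kind
  would belong to the other of these two tiles, but its outgoing edge is different. This one-way
  rule orients the rotation about labelled vertices.\<close>

lemma bullet_edge_sides:
  assumes f: "f \<in> E - blank_edges"
  obtains s i s' j where "sides_of f = {(s, i), (s', j)}" "i \<in> {1, 2}" "j \<in> {3, 5}" "s \<in> T" "s' \<in> T"
proof -
  obtain b u where bu: "f \<inter> V = {b, u}" "b \<in> B" "u \<in> V - B" using bullet_edge_ends[OF f] .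
  then have uf: "u \<in> f" by blast
  obtain e t t' where e: "e \<in> blank_edges" "sides_of e = {(t, 4), (t', 4)}" "t ~= t'" "u \<in> e" "t \<in> T" "t' \<in> T"
    "edge t (snd (out_side u t)) ~= edge t' (snd (out_side u t'))"
    "{e \<in> E - blank_edges. u \<in> e} = {edge t (snd (out_side u t)), edge t' (snd (out_side u t'))}"
    using blank_vertex_structure[OF bu(3)] .
  have "f \<in> {edge t (snd (out_side u t)), edge t' (snd (out_side u t'))}" using e(8) f uf by blast
  then have "\<exists>s\<in>{t, t'}. edge s (snd (out_side u s)) = f" by auto
  then obtain s where s: "s \<in> {t, t'}" "edge s (snd (out_side u s)) = f" by blast
  have sT: "s \<in> T" using s(1) e(5,6) by auto
  have su: "out_side u s \<in> sides_of f" using sT s(2) by (auto simp: sides_of_def out_side_def)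
  have "card (sides_of f) = 2" using card_sides_of f by blast
  then obtain c c' where cc: "sides_of f = {c, c'}" "c ~= c'" unfolding card_2_iff by blast
  have "out_side u s = c \<or> out_side u s = c'" using su cc by simp
  then have "\<exists>d. sides_of f = {out_side u s, d} \<and> d ~= out_side u s"
  proof
    assume "out_side u s = c"
    then show ?thesis using cc by (intro exI[of _ c']) simp
  next
    assume "out_side u s = c'"
    then show ?thesis using cc by (intro exI[of _ c]) (simp add: insert_commute)
  qed
  then obtain d where d: "sides_of f = {out_side u s, d}" "d ~= out_side u s" by blast
  obtain r j where rj: "d = (r, j)" by (cases d)
  have rs: "(r, j) \<in> sides_of f" using d(1) rj by simp
  then have "(r, j) \<in> T \<times> {1, 2, 3, 5}" using bullet_sides f by blast
  then have dd: "r \<in> T" "edge r j = f" "j \<in> {1, 2, 3, 5}" using rs by (simp_all add: sides_of_def)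
  have "j \<notin> {3, 5}"
  proof
    assume "j \<in> {3, 5}"
    then have o: "(r, j) = out_side u r" "u \<in> edge r 4"
      using out_side_unique[OF dd(1) _ _ bu(3)] dd(2) uf by auto
    have r4: "edge r 4 \<in> blank_edges" using edge_blank_iff[OF dd(1), of 4] by simp
    obtain e' where e': "{e \<in> blank_edges. u \<in> e} = {e'}"
      using card_blank_edges_at(1)[OF bu(3)] by (rule card_1_singletonE)
    have "edge r 4 \<in> {e \<in> blank_edges. u \<in> e}" "e \<in> {e \<in> blank_edges. u \<in> e}"
      using o(2) e(1,4) r4 by simp_all
    then have "edge r 4 = e" unfolding e' by simp
    then have "(r, 4) \<in> sides_of e" using dd(1) by (simp add: sides_of_def)
    then have rt: "r \<in> {t, t'}" using e(2) by auto
    have "snd (out_side u r) = j" using o(1)[symmetric] by simp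
    then have "edge r (snd (out_side u r)) = f" using dd(2) by simp
    then have "r = s" using rt s e(7) by auto
    then show False using o(1) d(2) rj by simp
  qed
  then have "j \<in> {1, 2}" using dd(3) by blast
  moreover have "out_side u s = (s, snd (out_side u s))" "snd (out_side u s) \<in> {3, 5}" by (auto simp: out_side_def)
  ultimately show ?thesis using that[of r j s "snd (out_side u s)"] d(1) rj dd(1) sT by (simp add: insert_commute)
qed

end

section \<open>Changing the boundary parametrisation of a tile\<close>

lemma polar_eq_iff:
  fixes w w' :: complex
  assumes "norm w = 1" "norm w' = 1" "0 \<le> a" "0 \<le> b"
  shows "of_real a * w = of_real b * w' \<longleftrightarrow> a = b \<and> (a = 0 \<or> w = w')"
proof
  assume eq: "of_real a * w = of_real b * w'"
  then have "norm (of_real a * w) = norm (of_real b * w')" by simp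
  then have "a = b" using assms by (simp add: norm_mult)
  then show "a = b \<and> (a = 0 \<or> w = w')" using eq by auto
qed auto

lemma cis_surj_period:
  assumes "norm z = 1" obtains \<theta> where "\<theta> \<in> {c..<c + 2 * pi}" "z = cis \<theta>"
proof -
  have "z * cis (- c) \<in> sphere 0 1" using assms by (simp add: norm_mult)
  then obtain s where s: "s \<in> {1..<2}" "z * cis (- c) = circle_point 1 s"
    using sphere_circle_point[of 1] by auto
  have "z = z * cis (- c) * cis c" by (simp add: mult.assoc cis_mult)
  also have "\<dots> = cis (2 * pi * s + c)" unfolding s(2) by (simp add: circle_point_def cis_mult)
  also have "\<dots> = cis (c + 2 * pi * (s - 1))"
    unfolding cis_eq_iff_int by (intro exI[of _ 1]) (simp add: algebra_simps)
  finally show ?thesis using s(1) by (intro that[of "c + 2 * pi * (s - 1)"]) auto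
qed

text \<open>The pair of \<open>i\<close> and \<open>w\<close> is a coordinate for the interval from
  \<open>\<beta> 0\<close> to \<open>\<beta> n\<close>: a piece and a fraction of it. By
  monotonicity two coordinates agree only at a break point shared by neighbouring pieces.\<close>

lemma interpolation_eq_iff:
  fixes \<beta> :: "nat => real"
  assumes mono: "\<And>i j. i < j ==> j \<le> n ==> \<beta> i < \<beta> j"
    and ij: "i < n" "j < n" and w: "w \<in> {0..1}" "w' \<in> {0..1}"
  shows "\<beta> i + w * (\<beta> (i + 1) - \<beta> i) = \<beta> j + w' * (\<beta> (j + 1) - \<beta> j) \<longleftrightarrow>
    i = j \<and> w = w' \<or> j = i + 1 \<and> w = 1 \<and> w' = 0 \<or> i = j + 1 \<and> w = 0 \<and> w' = 1" (is "?l \<longleftrightarrow> ?r")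
    and "\<beta> i + w * (\<beta> (i + 1) - \<beta> i) \<in> {\<beta> 0..\<beta> n}"
    and "\<beta> i + w * (\<beta> (i + 1) - \<beta> i) = \<beta> 0 \<longleftrightarrow> i = 0 \<and> w = 0"
    and "\<beta> i + w * (\<beta> (i + 1) - \<beta> i) = \<beta> n \<longleftrightarrow> i + 1 = n \<and> w = 1"
proof -
  have mono': "\<beta> i \<le> \<beta> j" if "i \<le> j" "j \<le> n" for i j
    using mono[of i j] that by (cases "i = j") auto
  have lo: "\<beta> i \<le> \<beta> i + w * (\<beta> (i + 1) - \<beta> i)" and hi: "\<beta> i + w * (\<beta> (i + 1) - \<beta> i) \<le> \<beta> (i + 1)"
    and lo0: "\<beta> i + w * (\<beta> (i + 1) - \<beta> i) = \<beta> i \<longleftrightarrow> w = 0"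
    and hi1: "\<beta> i + w * (\<beta> (i + 1) - \<beta> i) = \<beta> (i + 1) \<longleftrightarrow> w = 1"
    if "i < n" "w \<in> {0..1}" for i w
  proof -
    have d: "\<beta> (i + 1) - \<beta> i > 0" using mono[of i "i + 1"] that(1) by simp
    show "\<beta> i \<le> \<beta> i + w * (\<beta> (i + 1) - \<beta> i)" using d that(2) by simp
    have "w * (\<beta> (i + 1) - \<beta> i) \<le> 1 * (\<beta> (i + 1) - \<beta> i)" using d that(2) by (intro mult_right_mono) auto
    then show "\<beta> i + w * (\<beta> (i + 1) - \<beta> i) \<le> \<beta> (i + 1)" by simp
    show "\<beta> i + w * (\<beta> (i + 1) - \<beta> i) = \<beta> i \<longleftrightarrow> w = 0" using d by simp
    have "\<beta> i + w * (\<beta> (i + 1) - \<beta> i) = \<beta> (i + 1) \<longleftrightarrow> (w - 1) * (\<beta> (i + 1) - \<beta> i) = 0"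
      by (simp add: algebra_simps)
    then show "\<beta> i + w * (\<beta> (i + 1) - \<beta> i) = \<beta> (i + 1) \<longleftrightarrow> w = 1" using d by simp
  qed
  have less: "i + 1 = j \<and> w = 1 \<and> w' = 0"
    if "i < j" "j < n" "w \<in> {0..1}" "w' \<in> {0..1}"
      and eq: "\<beta> i + w * (\<beta> (i + 1) - \<beta> i) = \<beta> j + w' * (\<beta> (j + 1) - \<beta> j)" for i j w w'
  proof -
    have i: "i < n" using that by simp
    have "\<beta> (i + 1) \<le> \<beta> j" using mono'[of "i + 1" j] that by simp
    then have e: "\<beta> (i + 1) = \<beta> j" "\<beta> i + w * (\<beta> (i + 1) - \<beta> i) = \<beta> (i + 1)" "\<beta> j + w' * (\<beta> (j + 1) - \<beta> j) = \<beta> j"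
      using hi[OF i that(3)] lo[OF that(2,4)] eq by linarith+
    have "i + 1 = j" using e(1) mono[of "i + 1" j] that by (cases "i + 1 = j") auto
    then show ?thesis using e(2,3) hi1[OF i that(3)] lo0[OF that(2,4)] by simp
  qed
  show "?l \<longleftrightarrow> ?r"
  proof
    assume eq: ?l
    consider "i = j" | "i < j" | "j < i" by linarith
    then show ?r
    proof cases
      case 1
      have "(w - w') * (\<beta> (i + 1) - \<beta> i) = 0" using eq 1 by (simp add: algebra_simps)
      moreover have "\<beta> (i + 1) - \<beta> i > 0" using mono[of i "i + 1"] ij by simp
      ultimately show ?thesis using 1 by simp
    next
      case 2 then show ?thesis using less[OF 2 ij(2) w eq] by auto
    next
      case 3 then show ?thesis using less[OF 3 ij(1) w(2,1) eq[symmetric]] by auto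
    qed
  next
    assume ?r
    then show ?l by (elim disjE conjE) auto
  qed
  show "\<beta> i + w * (\<beta> (i + 1) - \<beta> i) \<in> {\<beta> 0..\<beta> n}"
    using lo[OF ij(1) w(1)] hi[OF ij(1) w(1)] mono'[of 0 i] mono'[of "i + 1" n] ij by auto
  show "\<beta> i + w * (\<beta> (i + 1) - \<beta> i) = \<beta> 0 \<longleftrightarrow> i = 0 \<and> w = 0"
    using lo[OF ij(1) w(1)] lo0[OF ij(1) w(1)] mono[of 0 i] ij by (cases "i = 0") auto
  show "\<beta> i + w * (\<beta> (i + 1) - \<beta> i) = \<beta> n \<longleftrightarrow> i + 1 = n \<and> w = 1"
    using hi[OF ij(1) w(1)] hi1[OF ij(1) w(1)] mono[of "i + 1" n] ij by (cases "i + 1 = n") auto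
qed

text \<open>A homeomorphism of the circle extends to the disk along the radii. It is composed with
  \<open>\<phi> t\<close>, so both the position of the sides on the circle and the parametrisation
  of each side can be prescribed; charts of neighbouring tiles can then be made to agree along an
  edge.\<close>

lemma (in polygons) reparametrize:
  fixes \<Theta> :: "real => real" and \<delta> :: "nat => real => 'a"
  assumes t: "t \<in> T"
    and \<Theta>: "continuous_on {1..real k + 1} \<Theta>" "strict_mono_on {1..real k + 1} \<Theta>"
      "\<Theta> (real k + 1) = \<Theta> 1 + 2 * pi"
    and \<delta>: "\<And>j. j \<in> {1..k} ==> arc (\<delta> j)" "\<And>j. j \<in> {1..k} ==> path_image (\<delta> j) = edge t j"
      "\<And>j. j \<in> {1..k} ==> \<delta> j 0 = rim t (real j)" "\<And>j. j \<in> {1..k} ==> \<delta> j 1 = rim t (real j + 1)"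
  shows "\<exists>\<omega>. continuous_on (cball 0 1) \<omega> \<and> (\<exists>\<psi>. homeomorphism (ball 0 1) t \<omega> \<psi>) \<and>
    (\<forall>j\<in>{1..k}. \<forall>x\<in>{0..1}. \<omega> (cis (\<Theta> (real j + x))) = \<delta> j x)"
proof -
  define \<sigma> where "\<sigma> j = (\<lambda>x. rim t (real j + x))" for j
  have \<sigma>ep: "simple_path (\<sigma> j)" "path_image (\<sigma> j) = edge t j" if "j \<in> {1..k}" for j
    using edge_path_side[OF t that] by (auto simp: edge_path_def \<sigma>_def)
  have \<sigma>arc: "arc (\<sigma> j)" if j: "j \<in> {1..k}" for j
  proof -
    have "\<delta> j 0 ~= \<delta> j 1" using \<delta>(1)[OF j] inj_onD[of "\<delta> j" "{0..1}" 0 1] by (auto simp: arc_def)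
    then have "\<sigma> j 0 ~= \<sigma> j 1" using \<delta>(3,4)[OF j] by (simp add: \<sigma>_def)
    then show ?thesis using \<sigma>ep(1)[OF j] by (simp add: arc_simple_path pathstart_def pathfinish_def)
  qed
  have "\<forall>j\<in>{1..k}. \<exists>h. homeomorphism {0..1} (edge t j) (\<sigma> j) h"
    using homeomorphism_arc[OF \<sigma>arc] \<sigma>ep(2) by metis
  then obtain h where h: "\<And>j. j \<in> {1..k} ==> homeomorphism {0..1} (edge t j) (\<sigma> j) (h j)" by metis
  \<comment> \<open>\<open>A j\<close> converts the prescribed parameter of side \<open>j\<close>
    into that of \<open>rim\<close>. It is a bijection of the unit interval fixing both ends, so the
    pieces fit together at the corners.\<close>
  define A where "A j x = h j (\<delta> j x)" for j x
  have \<delta>img: "\<delta> j x \<in> edge t j" if "j \<in> {1..k}" "x \<in> {0..1}" for j x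
    using \<delta>(2)[OF that(1)] that(2) by (auto simp: path_image_def)
  have A01: "A j x \<in> {0..1}" if "j \<in> {1..k}" "x \<in> {0..1}" for j x
    using homeomorphism_image2[OF h[OF that(1)]] \<delta>img[OF that] unfolding A_def by blast
  have \<sigma>A: "\<sigma> j (A j x) = \<delta> j x" if "j \<in> {1..k}" "x \<in> {0..1}" for j x
    unfolding A_def by (rule homeomorphism_apply2[OF h[OF that(1)] \<delta>img[OF that]])
  have A_cont: "continuous_on {0..1} (A j)" if "j \<in> {1..k}" for j unfolding A_def
    by (rule continuous_on_compose2[OF homeomorphism_cont2[OF h[OF that]]])
      (use \<delta>(1)[OF that] \<delta>img[OF that] in \<open>auto simp: arc_def path_def\<close>)
  have h\<sigma>: "h j (\<sigma> j x) = x" if "j \<in> {1..k}" "x \<in> {0..1}" for j x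
    by (rule homeomorphism_apply1[OF h[OF that(1)] that(2)])
  have A0: "A j 0 = 0" and A1: "A j 1 = 1" if "j \<in> {1..k}" for j
    using h\<sigma>[OF that, of 0] h\<sigma>[OF that, of 1] \<delta>(3,4)[OF that] by (simp_all add: A_def \<sigma>_def)
  have A_inj: "A j x = A j y \<longleftrightarrow> x = y" if "j \<in> {1..k}" "x \<in> {0..1}" "y \<in> {0..1}" for j x y
  proof
    assume "A j x = A j y"
    then have "\<delta> j x = \<delta> j y" using \<sigma>A[OF that(1,2)] \<sigma>A[OF that(1,3)] by simp
    then show "x = y" using \<delta>(1)[OF that(1)] that(2,3) unfolding arc_def inj_on_def by blast
  qed simp
  have A_surj: "\<exists>x\<in>{0..1}. A j x = y" if jy: "j \<in> {1..k}" "y \<in> {0..1}" for j y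
  proof -
    have "\<sigma> j y \<in> \<sigma> j ` {0..1}" using jy(2) by blast
    also have "\<dots> = \<delta> j ` {0..1}" using \<sigma>ep(2)[OF jy(1)] \<delta>(2)[OF jy(1)] by (simp add: path_image_def)
    finally obtain x where x: "x \<in> {0..1}" "\<sigma> j y = \<delta> j x" by blast
    then have "A j x = y" using h\<sigma>[OF jy] by (simp add: A_def)
    then show ?thesis using x(1) by blast
  qed
  \<comment> \<open>Polar coordinates of a sector: the radius and the position along the side.
    \<open>p\<close> spaces the sectors by \<open>\<Theta>\<close>, \<open>q\<close> by the
    parameter of \<open>rim\<close>; in both, sectors are glued at the centre and along common
    radii.\<close>
  define Y where "Y = {0..1::real} \<times> {0..1::real}"
  define p where "p j y = of_real (fst y) * cis (\<Theta> (real j + snd y))" for j and y :: "real \<times> real"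
  define q where "q j y = of_real (fst y) * circle_point k (real j + A j (snd y))" for j and y :: "real \<times> real"
  have range: "real j + x \<in> {1..real k + 1}" if "j \<in> {1..k}" "x \<in> {0..1}" for j x using that by auto
  have sum_eq: "real i + A i x = real j + A j y \<longleftrightarrow> real i + x = real j + y"
    if ij: "i \<in> {1..k}" "j \<in> {1..k}" and xy: "x \<in> {0..1}" "y \<in> {0..1}" for i j x y
  proof -
    have "real i + u * (real (i + 1) - real i) = real j + v * (real (j + 1) - real j) \<longleftrightarrow>
      i = j \<and> u = v \<or> j = i + 1 \<and> u = 1 \<and> v = 0 \<or> i = j + 1 \<and> u = 0 \<and> v = 1"
      if "u \<in> {0..1}" "v \<in> {0..1}" for u v
      by (rule interpolation_eq_iff(1)[of "k + 1"]) (use ij that in auto)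
    then have *: "real i + u = real j + v \<longleftrightarrow>
      i = j \<and> u = v \<or> j = i + 1 \<and> u = 1 \<and> v = 0 \<or> i = j + 1 \<and> u = 0 \<and> v = 1"
      if "u \<in> {0..1}" "v \<in> {0..1}" for u v
      using that by simp
    have "A i x = 1 \<longleftrightarrow> x = 1" "A i x = 0 \<longleftrightarrow> x = 0" "A j y = 1 \<longleftrightarrow> y = 1" "A j y = 0 \<longleftrightarrow> y = 0"
      using A_inj[OF ij(1) xy(1), of 1] A_inj[OF ij(1) xy(1), of 0] A_inj[OF ij(2) xy(2), of 1]
        A_inj[OF ij(2) xy(2), of 0] A0 A1 ij by auto
    moreover have "i = j ==> A i x = A j y \<longleftrightarrow> x = y" using A_inj[OF ij(1) xy] by simp
    ultimately show ?thesis
      unfolding *[OF xy] *[OF A01[OF ij(1) xy(1)] A01[OF ij(2) xy(2)]] by blast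
  qed
  have end1: "real i + A i x = 1 \<longleftrightarrow> real i + x = 1" and end2: "real i + A i x = real k + 1 \<longleftrightarrow> real i + x = real k + 1"
    if "i \<in> {1..k}" "x \<in> {0..1}" for i x
    using sum_eq[of i 1 x 0] sum_eq[of i k x 1] that A0[of 1] A1[of k] k_pos by auto
  have \<Theta>inj: "\<Theta> s = \<Theta> s' \<longleftrightarrow> s = s'" if "s \<in> {1..real k + 1}" "s' \<in> {1..real k + 1}" for s s'
    using \<Theta>(2) that by (auto simp: strict_mono_on_eqD)
  have \<Theta>range: "\<Theta> s \<in> {\<Theta> 1..\<Theta> 1 + 2 * pi}" if "s \<in> {1..real k + 1}" for s
  proof -
    have "\<Theta> 1 \<le> \<Theta> s" "\<Theta> s \<le> \<Theta> (real k + 1)"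
      using strict_mono_on_leD[OF \<Theta>(2), of 1 s] strict_mono_on_leD[OF \<Theta>(2), of s "real k + 1"] that by auto
    then show ?thesis using \<Theta>(3) by simp
  qed
  have cis_eq: "cis (\<Theta> s) = cis (\<Theta> s') \<longleftrightarrow> s = s' \<or> {s, s'} = {1, real k + 1}"
    if s: "s \<in> {1..real k + 1}" "s' \<in> {1..real k + 1}" for s s'
  proof -
    have "1 \<in> {1..real k + 1}" "real k + 1 \<in> {1..real k + 1}" by auto
    then have "\<Theta> a = \<Theta> 1 \<longleftrightarrow> a = 1" "\<Theta> a = \<Theta> 1 + 2 * pi \<longleftrightarrow> a = real k + 1" if "a \<in> {1..real k + 1}" for a
      using \<Theta>inj[OF that] \<Theta>(3) by metis+
    then show ?thesis
      unfolding cis_eq_iff_within_period[OF \<Theta>range[OF s(1)] \<Theta>range[OF s(2)]] doubleton_eq_iff \<Theta>inj[OF s]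
      using s by blast
  qed
  have eq: "p i y = p j z \<longleftrightarrow> q i y = q j z" if "i \<in> {1..k}" "j \<in> {1..k}" "y \<in> Y" "z \<in> Y" for i j y z
  proof -
    have y: "fst y \<in> {0..1}" "snd y \<in> {0..1}" and z: "fst z \<in> {0..1}" "snd z \<in> {0..1}"
      using that by (auto simp: Y_def)
    let ?s = "real i + snd y" and ?s' = "real j + snd z"
    let ?r = "real i + A i (snd y)" and ?r' = "real j + A j (snd z)"
    have "p i y = p j z \<longleftrightarrow> fst y = fst z \<and> (fst y = 0 \<or> cis (\<Theta> ?s) = cis (\<Theta> ?s'))"
      unfolding p_def using y z by (intro polar_eq_iff) auto
    moreover have "q i y = q j z \<longleftrightarrow> fst y = fst z \<and> (fst y = 0 \<or> circle_point k ?r = circle_point k ?r')"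
      unfolding q_def using y z by (intro polar_eq_iff) auto
    moreover have "cis (\<Theta> ?s) = cis (\<Theta> ?s') \<longleftrightarrow> ?s = ?s' \<or> {?s, ?s'} = {1, real k + 1}"
      by (intro cis_eq range that y z)
    moreover have "circle_point k ?r = circle_point k ?r' \<longleftrightarrow> ?r = ?r' \<or> {?r, ?r'} = {1, real k + 1}"
      by (intro circle_point_eq_iff[OF k_pos] range that A01 y z)
    moreover have "{?r, ?r'} = {1, real k + 1} \<longleftrightarrow> {?s, ?s'} = {1, real k + 1}"
      unfolding doubleton_eq_iff using end1[OF that(1) y(2)] end2[OF that(1) y(2)] end1[OF that(2) z(2)] end2[OF that(2) z(2)]
      by simp
    ultimately show ?thesis using sum_eq[OF that(1,2) y(2) z(2)] by simp
  qed
  have p_cont: "continuous_on Y (p j)" if "j \<in> {1..k}" for j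
  proof -
    have "continuous_on Y (\<lambda>y. \<Theta> (real j + snd y))"
      by (rule continuous_on_compose2[OF \<Theta>(1)]) (use range[OF that] in \<open>auto intro!: continuous_intros simp: Y_def\<close>)
    then show ?thesis unfolding p_def by (intro continuous_intros)
  qed
  have q_cont: "continuous_on Y (q j)" if "j \<in> {1..k}" for j
  proof -
    have "continuous_on Y (\<lambda>y. A j (snd y))"
      by (rule continuous_on_compose2[OF A_cont[OF that]]) (auto intro!: continuous_intros simp: Y_def)
    then show ?thesis unfolding q_def by (intro continuous_intros)
  qed
  have Yc: "compact Y" unfolding Y_def by (intro compact_Times compact_Icc)
  obtain f g where fg: "homeomorphism (\<Union>j\<in>{1..k}. p j ` Y) (\<Union>j\<in>{1..k}. q j ` Y) f g"
    and f: "\<And>j y. j \<in> {1..k} ==> y \<in> Y ==> f (p j y) = q j y"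
    by (rule homeomorphism_from_compact_pieces[of "{1..k}" "\<lambda>_. Y" p q "\<lambda>_. Y"])
      (use p_cont q_cont Yc eq in auto)
  have p_norm: "norm (p j y) = fst y" "norm (q j y) = fst y" if "y \<in> Y" for j y
    using that by (auto simp: p_def q_def Y_def norm_mult)
  have p_ex: "\<exists>j\<in>{1..k}. \<exists>y\<in>Y. z = p j y" if z: "z \<in> cball 0 1" for z
  proof -
    obtain w where w: "norm w = 1" "z = of_real (norm z) * w"
    proof (cases "z = 0")
      case True then show ?thesis using that[of 1] by simp
    next
      case False then show ?thesis using that[of "z / of_real (norm z)"] by (simp add: norm_divide)
    qed
    obtain \<theta> where \<theta>: "\<theta> \<in> {\<Theta> 1..<\<Theta> 1 + 2 * pi}" "w = cis \<theta>" using cis_surj_period[OF w(1)] .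
    have "\<exists>s\<ge>1. s \<le> real k + 1 \<and> \<Theta> s = \<theta>"
      using \<theta>(1) \<Theta> by (intro IVT') auto
    then obtain s where s: "s \<in> {1..real k + 1}" "\<Theta> s = \<theta>" by auto
    then have "s ~= real k + 1" using \<theta>(1) \<Theta>(3) by auto
    then have "s \<in> {1..<real k + 1}" using s by auto
    then obtain j where j: "j \<in> {1..k}" "s \<in> {real j..<real j + 1}" using ex_side_index by blast
    have "z = p j (norm z, s - real j)" using w(2) \<theta>(2) s(2) by (simp add: p_def)
    moreover have "(norm z, s - real j) \<in> Y" using z j by (auto simp: Y_def)
    ultimately show ?thesis using j(1) by blast
  qed
  have q_ex: "\<exists>j\<in>{1..k}. \<exists>y\<in>Y. z = q j y" if z: "z \<in> cball 0 1" for z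
  proof -
    obtain w where w: "norm w = 1" "z = of_real (norm z) * w"
    proof (cases "z = 0")
      case True then show ?thesis using that[of 1] by simp
    next
      case False then show ?thesis using that[of "z / of_real (norm z)"] by (simp add: norm_divide)
    qed
    have "w \<in> sphere 0 1" using w(1) by simp
    then obtain s where s: "s \<in> {1..<real k + 1}" "w = circle_point k s"
      unfolding sphere_circle_point[OF k_pos] by blast
    obtain j where j: "j \<in> {1..k}" "s \<in> {real j..<real j + 1}" using ex_side_index[OF s(1)] .
    obtain x where x: "x \<in> {0..1}" "A j x = s - real j" using A_surj[OF j(1), of "s - real j"] j(2) by auto
    have "z = q j (norm z, x)" using w(2) s(2) x(2) by (simp add: q_def)
    moreover have "(norm z, x) \<in> Y" using z x by (auto simp: Y_def)
    ultimately show ?thesis using j(1) by blast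
  qed
  have "fst y \<le> 1" if "y \<in> Y" for y using that by (auto simp: Y_def)
  then have pq: "p j y \<in> cball 0 1" "q j y \<in> cball 0 1" if "y \<in> Y" for j y using p_norm that by auto
  have p_ball: "(\<Union>j\<in>{1..k}. p j ` Y) = cball 0 1"
    by (intro equalityI subsetI) (use pq(1) p_ex in blast)+
  have q_ball: "(\<Union>j\<in>{1..k}. q j ` Y) = cball 0 1"
    by (intro equalityI subsetI) (use pq(2) q_ex in blast)+
  \<comment> \<open>As \<open>f\<close> keeps the radius, the homeomorphism of closed disks
    restricts to the open disks.\<close>
  have f_norm: "norm (f z) = norm z" if "z \<in> cball 0 1" for z
    using p_ex[OF that] f p_norm by metis
  have fh: "homeomorphism (cball 0 1) (cball 0 1) f g" using fg unfolding p_ball q_ball .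
  have fball: "f ` ball 0 1 = ball 0 1"
  proof
    show "f ` ball 0 1 \<subseteq> ball 0 1" using f_norm by auto
    show "ball 0 1 \<subseteq> f ` ball 0 1"
    proof
      fix z :: complex assume z: "z \<in> ball 0 1"
      then have zc: "z \<in> cball 0 1" by simp
      have "z = f (g z)" using homeomorphism_apply2[OF fh zc] by simp
      moreover have "g z \<in> cball 0 1" using homeomorphism_image2[OF fh] zc by blast
      ultimately show "z \<in> f ` ball 0 1" using f_norm[of "g z"] z by (metis image_eqI mem_ball_0)
    qed
  qed
  have fb: "homeomorphism (ball 0 1) (ball 0 1) f g"
    by (rule homeomorphism_of_subsets[OF fh _ _ fball]) auto
  obtain \<psi> where \<psi>: "homeomorphism (ball 0 1) t (\<phi> t) \<psi>" using homeo[OF t] by blast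
  define \<omega> where "\<omega> = \<phi> t \<circ> f"
  have "continuous_on (cball 0 1) \<omega>" unfolding \<omega>_def
    using homeomorphism_cont1[OF fh] homeomorphism_image1[OF fh] cont[OF t] by (intro continuous_on_compose) auto
  moreover have "homeomorphism (ball 0 1) t \<omega> (g \<circ> \<psi>)" unfolding \<omega>_def
    by (rule homeomorphism_compose[OF fb \<psi>])
  moreover have "\<omega> (cis (\<Theta> (real j + x))) = \<delta> j x" if "j \<in> {1..k}" "x \<in> {0..1}" for j x
  proof -
    have "f (p j (1, x)) = q j (1, x)" using f that by (simp add: Y_def)
    then have "\<omega> (cis (\<Theta> (real j + x))) = rim t (real j + A j x)" by (simp add: p_def q_def \<omega>_def rim_def)
    then show ?thesis using \<sigma>A[OF that] by (simp add: \<sigma>_def)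
  qed
  ultimately show ?thesis by blast
qed

section \<open>Rotation about a labelled vertex\<close>

text \<open>
  Position of the sides on the unit circle: \<open>v\<^sub>1\<close> is placed at \<open>1\<close> and \<open>v\<^sub>3\<close> at \<open>-1\<close>, and near these two
  points the circle is traversed with the constant speed \<open>pi / 3\<close>.
\<close>

definition side_angle :: "real => real" where
  "side_angle s = pi / 3 * (s - 1) + pi / 3 * max 0 (min 1 (s - 3 / 2))"

lemma side_angle_cont: "continuous_on A side_angle"
  unfolding side_angle_def by (intro continuous_intros)

lemma side_angle_mono: "strict_mono_on A side_angle"
proof (rule strict_mono_onI)
  fix r s :: real assume "r < s"
  then have "max 0 (min 1 (r - 3 / 2)) \<le> max 0 (min 1 (s - 3 / 2))" by auto
  then have "pi / 3 * max 0 (min 1 (r - 3 / 2)) \<le> pi / 3 * max 0 (min 1 (s - 3 / 2))"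
    by (intro mult_left_mono) auto
  moreover have "pi / 3 * (r - 1) < pi / 3 * (s - 1)" using \<open>r < s\<close> by (intro mult_strict_left_mono) auto
  ultimately show "side_angle r < side_angle s" unfolding side_angle_def by linarith
qed

text \<open>Five sides at speed \<open>pi / 3\<close> fall short of a full turn by
  \<open>pi / 3\<close>. This surplus is spent between \<open>s = 3 / 2\<close> and
  \<open>s = 5 / 2\<close>, around \<open>v_2\<close>, so the half sides next to \<open>v_1\<close>
  and \<open>v_3\<close> keep the constant speed. Hence the bound 1/2 here and the bound
  \<open>pi / 6\<close> for angles below.\<close>

lemma side_angle_values:
  assumes "x \<in> {0..1/2}"
  shows "side_angle (1 + x) = pi * x / 3" "side_angle (2 + (1 - x)) = pi - pi * x / 3"
    "side_angle (3 + x) = pi + pi * x / 3" "side_angle (5 + (1 - x)) = 2 * pi - pi * x / 3"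
  using assms by (simp_all add: side_angle_def field_simps)

text \<open>The points \<open>cap 1 a y\<close> and \<open>cap 3 a y\<close> with \<open>\<bar>y\<bar> \<le> 1\<close> form the chord at angular distance \<open>a\<close> from \<open>v\<^sub>1\<close> and \<open>v\<^sub>3\<close>.\<close>

definition cap :: "nat => real => real => complex" where
  "cap j a y = Complex ((if j = 1 then 1 else -1) * cos a) (y * sin a)"

text \<open>Ends of chords: \<open>y = 1\<close> lies on side 1 near \<open>v_1\<close> and on side
  2 near \<open>v_3\<close>, while \<open>y = -1\<close> lies on side 5 and side 3.\<close>

lemma cap_circle:
  "cis a = cap 1 a 1" "cis (pi - a) = cap 3 a 1" "cis (pi + a) = cap 3 a (-1)" "cis (2 * pi - a) = cap 1 a (-1)"
  by (simp_all add: cap_def complex_eq_iff cos_diff sin_diff)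

lemma cap_cball: "\<bar>y\<bar> \<le> 1 ==> cap j a y \<in> cball 0 1"
proof -
  assume "\<bar>y\<bar> \<le> 1"
  then have "y\<^sup>2 * (sin a)\<^sup>2 \<le> 1 * (sin a)\<^sup>2" by (intro mult_right_mono) (auto simp: abs_square_le_1)
  moreover have "(norm (cap j a y))\<^sup>2 = (cos a)\<^sup>2 + y\<^sup>2 * (sin a)\<^sup>2"
    by (simp add: cap_def cmod_power2 power_mult_distrib)
  ultimately have "(norm (cap j a y))\<^sup>2 \<le> 1"
    using sin_cos_squared_add[of a] by linarith
  then have "norm (cap j a y) \<le> 1" using power2_le_imp_le[of "norm (cap j a y)" 1] by simp
  then show ?thesis by simp
qed

lemma cap_ball:
  assumes "\<bar>y\<bar> < 1" "sin a ~= 0" shows "cap j a y \<in> ball 0 1"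
proof -
  have "y\<^sup>2 * (sin a)\<^sup>2 < 1 * (sin a)\<^sup>2"
    using assms by (intro mult_strict_right_mono) (auto simp: abs_square_less_1)
  moreover have "(norm (cap j a y))\<^sup>2 = (cos a)\<^sup>2 + y\<^sup>2 * (sin a)\<^sup>2"
    by (simp add: cap_def cmod_power2 power_mult_distrib)
  ultimately have "(norm (cap j a y))\<^sup>2 < 1"
    using sin_cos_squared_add[of a] by linarith
  then have "norm (cap j a y) < 1" using power2_less_imp_less[of "norm (cap j a y)" 1] by simp
  then show ?thesis by simp
qed

text \<open>Up to \<open>pi / 6\<close> the cosine is positive, so the sign of the real part
  separates the two caps; since \<open>a\<close> is positive, \<open>sin a\<close> does not vanish
  and \<open>y\<close> can be recovered.\<close>

lemma cap_eq_iff: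
  assumes "j \<in> {1, 3}" "j' \<in> {1, 3}" "a \<in> {0<..pi / 6}" "a' \<in> {0<..pi / 6}"
  shows "cap j a y = cap j' a' y' \<longleftrightarrow> j = j' \<and> a = a' \<and> y = y'"
proof
  assume eq: "cap j a y = cap j' a' y'"
  have c: "cos a > 0" "cos a' > 0" using assms(3,4) by (auto intro!: cos_gt_zero)
  have "(if j = 1 then 1 else -1) * cos a = (if j' = 1 then 1 else -1) * cos a'"
    and y: "y * sin a = y' * sin a'" using eq by (simp_all add: cap_def)
  then have "j = j'" "cos a = cos a'" using c assms(1,2) by (auto split: if_splits)
  moreover have "a = a'" using cos_inj_pi[of a a'] \<open>cos a = cos a'\<close> assms(3,4) by auto
  moreover have "sin a > 0" using assms(3) by (auto intro!: sin_gt_zero)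
  ultimately show "j = j' \<and> a = a' \<and> y = y'" using y by auto
qed auto

lemma continuous_on_cap [continuous_intros]:
  fixes f :: "'b::t2_space => real"
  assumes "continuous_on A f" "continuous_on A g"
  shows "continuous_on A (\<lambda>x. cap j (f x) (g x))"
proof -
  have *: "cap j a y = of_real ((if j = 1 then 1 else -1) * cos a) + \<i> * of_real (y * sin a)" for a y
    by (simp add: cap_def complex_eq_iff)
  show ?thesis unfolding * by (intro continuous_on_add continuous_on_mult continuous_on_of_real
      continuous_on_const continuous_on_cos continuous_on_sin assms)
qed

text \<open>Every bullet edge gets one parametrisation \<open>\<gamma>\<close>, starting at its
  labelled end, and all charts follow it; sides 2 and 5 end at a bullet and are reversed. Points at
  equal angular distance from a labelled vertex then match across edges. Side 4 has no labelled end,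
  and only its location is recorded.\<close>

locale flow_charts = labelled_pentagons S V E \<phi> B
  for S V :: "'a::t2_space set" and E \<phi> B +
  fixes \<gamma> :: "'a set => real => 'a" and \<omega> :: "'a set => complex => 'a"
  assumes \<gamma>: "e \<in> E - blank_edges ==> arc (\<gamma> e)" "e \<in> E - blank_edges ==> path_image (\<gamma> e) = e"
      "e \<in> E - blank_edges ==> \<gamma> e 0 \<in> B" "e \<in> E - blank_edges ==> \<gamma> e 1 \<in> V - B"
    and \<omega>_cont: "t \<in> T ==> continuous_on (cball 0 1) (\<omega> t)"
    and \<omega>_homeo: "t \<in> T ==> \<exists>\<psi>. homeomorphism (ball 0 1) t (\<omega> t) \<psi>"
    and \<omega>_side: "[|t \<in> T; x \<in> {0..1}|] ==> \<omega> t (cis (side_angle (1 + x))) = \<gamma> (edge t 1) x"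
      "[|t \<in> T; x \<in> {0..1}|] ==> \<omega> t (cis (side_angle (2 + x))) = \<gamma> (edge t 2) (1 - x)"
      "[|t \<in> T; x \<in> {0..1}|] ==> \<omega> t (cis (side_angle (3 + x))) = \<gamma> (edge t 3) x"
      "[|t \<in> T; x \<in> {0..1}|] ==> \<omega> t (cis (side_angle (4 + x))) \<in> edge t 4"
      "[|t \<in> T; x \<in> {0..1}|] ==> \<omega> t (cis (side_angle (5 + x))) = \<gamma> (edge t 5) (1 - x)"
begin

text \<open>Corner 1 is entered through the side after it and corner 3 through the side before it,
  in accordance with \<open>bullet_edge_sides\<close>. Relative to the boundary walk these are
  opposite senses, the source of the Moebius band.\<close>

definition in_edge :: "'a set \<times> nat => 'a set" where
  "in_edge c = edge (fst c) (if snd c = 1 then 1 else 2)"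

definition out_edge :: "'a set \<times> nat => 'a set" where
  "out_edge c = edge (fst c) (if snd c = 1 then 5 else 3)"

lemma bullet_edge:
  assumes "t \<in> T" shows "edge t 1 \<in> E - blank_edges" "edge t 2 \<in> E - blank_edges"
    "edge t 3 \<in> E - blank_edges" "edge t 5 \<in> E - blank_edges" "edge t 4 \<in> blank_edges"
  using edge_blank_iff[OF assms] edge_in_E[OF assms] by auto

lemma in_out_edge_bullet:
  assumes "c \<in> T \<times> {1, 3}" shows "in_edge c \<in> E - blank_edges" "out_edge c \<in> E - blank_edges"
  using assms bullet_edge by (auto simp: in_edge_def out_edge_def)

lemma \<gamma>_in: "e \<in> E - blank_edges ==> x \<in> {0..1} ==> \<gamma> e x \<in> e"
  using \<gamma>(2)[of e] unfolding path_image_def by blast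

lemma \<gamma>_inj: "e \<in> E - blank_edges ==> x \<in> {0..1} ==> y \<in> {0..1} ==> \<gamma> e x = \<gamma> e y \<longleftrightarrow> x = y"
  using \<gamma>(1) unfolding arc_def inj_on_def by blast

lemma \<gamma>_V:
  assumes e: "e \<in> E - blank_edges" shows "e \<inter> V = {\<gamma> e 0, \<gamma> e 1}"
proof -
  obtain b u where bu: "e \<inter> V = {b, u}" "b \<in> B" "u \<in> V - B" using bullet_edge_ends[OF e] .
  have "\<gamma> e 0 \<in> e \<inter> V" "\<gamma> e 1 \<in> e \<inter> V" using \<gamma>_in[OF e] \<gamma>(3,4)[OF e] B_V by auto
  then have "\<gamma> e 0 = b" "\<gamma> e 1 = u" using bu \<gamma>(3,4)[OF e] by auto
  then show ?thesis using bu by simp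
qed

lemma \<gamma>_not_V:
  assumes e: "e \<in> E - blank_edges" and x: "x \<in> {0..1}"
  shows "\<gamma> e x \<in> V \<longleftrightarrow> x = 0 \<or> x = 1"
proof -
  have "\<gamma> e x \<in> V \<longleftrightarrow> \<gamma> e x \<in> e \<inter> V" using \<gamma>_in[OF e x] by blast
  also have "\<dots> \<longleftrightarrow> \<gamma> e x = \<gamma> e 0 \<or> \<gamma> e x = \<gamma> e 1" unfolding \<gamma>_V[OF e] by blast
  finally show ?thesis using \<gamma>_inj[OF e x, of 0] \<gamma>_inj[OF e x, of 1] by simp
qed

lemma \<gamma>_B:
  assumes e: "e \<in> E - blank_edges" and x: "x \<in> {0..1}"
  shows "\<gamma> e x \<in> B \<longleftrightarrow> x = 0"
  using \<gamma>_not_V[OF e x] \<gamma>(3,4)[OF e] B_V by auto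

lemma \<gamma>_eq_iff:
  assumes e: "e \<in> E - blank_edges" "e' \<in> E - blank_edges" and x: "x \<in> {0<..<1}" "x' \<in> {0<..<1}"
  shows "\<gamma> e x = \<gamma> e' x' \<longleftrightarrow> e = e' \<and> x = x'"
proof
  assume eq: "\<gamma> e x = \<gamma> e' x'"
  have "\<gamma> e x \<in> e" "\<gamma> e x \<in> e'" using \<gamma>_in[OF e(1), of x] \<gamma>_in[OF e(2), of x'] eq x by auto
  moreover have "\<gamma> e x \<notin> V" using \<gamma>_not_V[OF e(1), of x] x by auto
  ultimately have "e = e'" using edges_meet e by blast
  then show "e = e' \<and> x = x'" using \<gamma>_inj[OF e(1), of x x'] eq x by auto
qed simp

lemma \<gamma>_rim:
  assumes t: "t \<in> T"
  shows "\<gamma> (edge t 1) 0 = rim t 1" "\<gamma> (edge t 2) 0 = rim t 3" "\<gamma> (edge t 3) 0 = rim t 3" "\<gamma> (edge t 5) 0 = rim t 1"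
proof -
  note b = bullet_edge[OF t] and r = edge_V[OF t] and l = bullets[OF t] blanks[OF t]
  have "\<gamma> (edge t 1) 0 \<in> {rim t 1, rim t 2}" using \<gamma>_V[OF b(1)] r(1) by auto
  then show "\<gamma> (edge t 1) 0 = rim t 1" using \<gamma>(3)[OF b(1)] l by auto
  have "\<gamma> (edge t 2) 0 \<in> {rim t 2, rim t 3}" using \<gamma>_V[OF b(2)] r(2) by auto
  then show "\<gamma> (edge t 2) 0 = rim t 3" using \<gamma>(3)[OF b(2)] l by auto
  have "\<gamma> (edge t 3) 0 \<in> {rim t 3, rim t 4}" using \<gamma>_V[OF b(3)] r(3) by auto
  then show "\<gamma> (edge t 3) 0 = rim t 3" using \<gamma>(3)[OF b(3)] l by auto
  have "\<gamma> (edge t 5) 0 \<in> {rim t 5, rim t 1}" using \<gamma>_V[OF b(4)] r(5) by auto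
  then show "\<gamma> (edge t 5) 0 = rim t 1" using \<gamma>(3)[OF b(4)] l by auto
qed

lemma \<gamma>_corner:
  assumes "c \<in> T \<times> {1, 3}"
  shows "\<gamma> (in_edge c) 0 = rim (fst c) (real (snd c))" "\<gamma> (out_edge c) 0 = rim (fst c) (real (snd c))"
  using assms \<gamma>_rim by (auto simp: in_edge_def out_edge_def)

lemma \<omega>_image_ball: "t \<in> T ==> \<omega> t ` ball 0 1 = t"
  using \<omega>_homeo[of t] homeomorphism_image1 by blast

lemma sphere_side_angle:
  assumes "z \<in> sphere 0 1"
  obtains j x where "j \<in> {1..5}" "x \<in> {0..1}" "z = cis (side_angle (real j + x))"
proof -
  have "norm z = 1" using assms by simp
  then obtain \<theta> where \<theta>: "\<theta> \<in> {0..<0 + 2 * pi}" "z = cis \<theta>" by (rule cis_surj_period)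
  have "side_angle 1 = 0" "side_angle 6 = 2 * pi" by (simp_all add: side_angle_def)
  then have "\<exists>s\<ge>1. s \<le> 6 \<and> side_angle s = \<theta>" using \<theta>(1) by (intro IVT' side_angle_cont) auto
  then obtain s where s: "s \<in> {1..6}" "side_angle s = \<theta>" by auto
  have "\<exists>j\<in>{1..5::nat}. s - real j \<in> {0..1}"
  proof (cases "s = 6")
    case True then show ?thesis by (intro bexI[of _ 5]) auto
  next
    case False
    then have "s \<in> {1..<real 5 + 1}" using s by auto
    then obtain j where "j \<in> {1..5}" "s \<in> {real j..<real j + 1}" by (rule ex_side_index)
    then show ?thesis by (intro bexI[of _ j]) auto
  qed
  then obtain j where "j \<in> {1..5::nat}" "s - real j \<in> {0..1}" by blast
  then show ?thesis using that[of j "s - real j"] s \<theta> by simp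
qed

lemma \<omega>_sphere: "t \<in> T ==> z \<in> sphere 0 1 ==> \<omega> t z \<in> \<Union>E"
proof -
  assume t: "t \<in> T" and "z \<in> sphere 0 1"
  then obtain j x where j: "j \<in> {1..5}" "x \<in> {0..1}" "z = cis (side_angle (real j + x))"
    using sphere_side_angle by blast
  have x': "1 - x \<in> {0..1}" using j(2) by auto
  note b = bullet_edge[OF t]
  have "\<omega> t z \<in> edge t j"
    by (rule side_index_cases[OF j(1)])
      (use \<omega>_side[OF t j(2)] j(3) \<gamma>_in[OF b(1) j(2)] \<gamma>_in[OF b(2) x'] \<gamma>_in[OF b(3) j(2)] \<gamma>_in[OF b(4) x'] in simp_all)
  then show ?thesis using edge_in_E[OF t j(1)] by blast
qed

lemma \<omega>_not_ball:
  assumes "t \<in> T" "z \<in> cball 0 1" "\<omega> t z \<in> V \<union> \<Union>E" shows "z \<in> sphere 0 1"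
proof -
  have "z \<notin> ball 0 1" using \<omega>_image_ball[OF assms(1)] tile_disj_graph[OF assms(1)] assms(3) by blast
  then show ?thesis using assms(2) by auto
qed

lemma \<omega>_tile_points:
  assumes "t \<in> T" "t' \<in> T" "z \<in> ball 0 1" "z' \<in> cball 0 1" "\<omega> t z = \<omega> t' z'"
  shows "t = t'" "z = z'"
proof -
  have zt: "\<omega> t z \<in> t" using \<omega>_image_ball assms by blast
  have z': "z' \<in> ball 0 1"
  proof (rule ccontr)
    assume "z' \<notin> ball 0 1"
    then have "z' \<in> sphere 0 1" using assms(4) by auto
    then have "\<omega> t' z' \<in> \<Union>E" using \<omega>_sphere assms by blast
    then show False using zt assms(5) tile_disj_graph[OF assms(1)] by auto
  qed
  then have "\<omega> t' z' \<in> t'" using \<omega>_image_ball assms(2) by blast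
  then show t: "t = t'" using zt assms(1,2,5) tiles_disjoint[of t t' "\<omega> t z"] by simp
  obtain \<psi> where "homeomorphism (ball 0 1) t (\<omega> t) \<psi>" using \<omega>_homeo assms(1) by blast
  then show "z = z'" using homeomorphism_apply1[of "ball 0 1" t "\<omega> t" \<psi>] z' assms(3,5) t by metis
qed

text \<open>The speed of \<open>side_angle\<close> next to a labelled corner turns the edge
  parameter \<open>x\<close> into the angle \<open>pi * x / 3\<close>, the same for entrance and
  exit.\<close>

lemma \<omega>_cap:
  assumes c: "c \<in> T \<times> {1, 3}" and x: "x \<in> {0..1/2}"
  shows "\<omega> (fst c) (cap (snd c) (pi * x / 3) 1) = \<gamma> (in_edge c) x"
    "\<omega> (fst c) (cap (snd c) (pi * x / 3) (-1)) = \<gamma> (out_edge c) x"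
proof -
  obtain t j where tj: "c = (t, j)" "t \<in> T" "j = 1 \<or> j = 3" using c by auto
  have x1: "x \<in> {0..1}" "1 - x \<in> {0..1}" using x by auto
  have "\<omega> t (cap 1 (pi * x / 3) 1) = \<gamma> (edge t 1) x"
    unfolding cap_circle(1)[symmetric] side_angle_values(1)[OF x, symmetric] using \<omega>_side(1)[OF tj(2) x1(1)] .
  moreover have "\<omega> t (cap 3 (pi * x / 3) 1) = \<gamma> (edge t 2) x"
    unfolding cap_circle(2)[symmetric] side_angle_values(2)[OF x, symmetric] using \<omega>_side(2)[OF tj(2) x1(2)] by simp
  moreover have "\<omega> t (cap 3 (pi * x / 3) (-1)) = \<gamma> (edge t 3) x"
    unfolding cap_circle(3)[symmetric] side_angle_values(3)[OF x, symmetric] using \<omega>_side(3)[OF tj(2) x1(1)] .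
  moreover have "\<omega> t (cap 1 (pi * x / 3) (-1)) = \<gamma> (edge t 5) x"
    unfolding cap_circle(4)[symmetric] side_angle_values(4)[OF x, symmetric] using \<omega>_side(5)[OF tj(2) x1(2)] by simp
  ultimately show "\<omega> (fst c) (cap (snd c) (pi * x / 3) 1) = \<gamma> (in_edge c) x"
    "\<omega> (fst c) (cap (snd c) (pi * x / 3) (-1)) = \<gamma> (out_edge c) x"
    using tj(1,3) by (auto simp: in_edge_def out_edge_def)
qed

lemma cap_zero: "cap j 0 y = (if j = 1 then 1 else -1)"
  by (simp add: cap_def complex_eq_iff)

text \<open>Conversely to \<open>\<omega>_cap\<close>, every preimage of a point in the first half
  of a bullet edge is an end of a chord. With \<open>\<omega>_bullet\<close> this makes the union of
  caps at a vertex saturated, which is needed for openness of small disks.\<close>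

lemma \<omega>_eq_\<gamma>:
  assumes t: "t \<in> T" and z: "z \<in> cball 0 1" and e: "e \<in> E - blank_edges" and x: "x \<in> {0<..1/2}"
    and eq: "\<omega> t z = \<gamma> e x"
  shows "\<exists>j\<in>{1, 3}. in_edge (t, j) = e \<and> z = cap j (pi * x / 3) 1 \<or> out_edge (t, j) = e \<and> z = cap j (pi * x / 3) (-1)"
proof -
  have xx: "x \<in> {0..1}" "x \<in> {0..1/2}" using x by auto
  have nV: "\<gamma> e x \<notin> V" using \<gamma>_not_V[OF e xx(1)] x by auto
  have xe: "\<gamma> e x \<in> e" by (rule \<gamma>_in[OF e xx(1)])
  then have "\<omega> t z \<in> V \<union> \<Union>E" using eq e by auto
  then have "z \<in> sphere 0 1" using \<omega>_not_ball[OF t z] by blast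
  then obtain j y where j: "j \<in> {1..5}" "y \<in> {0..1}" "z = cis (side_angle (real j + y))"
    by (rule sphere_side_angle)
  have y': "1 - y \<in> {0..1}" using j(2) by auto
  note b = bullet_edge[OF t]
  have same: "edge t i = e" if "edge t i \<in> E" "\<omega> t z \<in> edge t i" for i
    using edges_meet[OF that(1) _ that(2), of e] xe nV eq e by simp
  show ?thesis using j(1)
  proof (cases rule: side_index_cases)
    case 1
    have w: "\<omega> t z = \<gamma> (edge t 1) y" using \<omega>_side(1)[OF t j(2)] j(3) 1 by simp
    then have "edge t 1 = e" using same[of 1] b(1) \<gamma>_in[OF b(1) j(2)] by simp
    then have "y = x" using w eq \<gamma>_inj[OF e j(2) xx(1)] by simp
    then have "z = cap 1 (pi * x / 3) 1"
      using j(3) 1 side_angle_values(1)[OF xx(2)] cap_circle(1) by simp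
    then show ?thesis using \<open>edge t 1 = e\<close> by (simp add: in_edge_def)
  next
    case 2
    have w: "\<omega> t z = \<gamma> (edge t 2) (1 - y)" using \<omega>_side(2)[OF t j(2)] j(3) 2 by simp
    then have "edge t 2 = e" using same[of 2] b(2) \<gamma>_in[OF b(2) y'] by simp
    then have "y = 1 - x" using w eq \<gamma>_inj[OF e y' xx(1)] by simp
    then have "z = cap 3 (pi * x / 3) 1"
      using j(3) 2 side_angle_values(2)[OF xx(2)] cap_circle(2) by simp
    then show ?thesis using \<open>edge t 2 = e\<close> by (simp add: in_edge_def)
  next
    case 3
    have w: "\<omega> t z = \<gamma> (edge t 3) y" using \<omega>_side(3)[OF t j(2)] j(3) 3 by simp
    then have "edge t 3 = e" using same[of 3] b(3) \<gamma>_in[OF b(3) j(2)] by simp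
    then have "y = x" using w eq \<gamma>_inj[OF e j(2) xx(1)] by simp
    then have "z = cap 3 (pi * x / 3) (-1)"
      using j(3) 3 side_angle_values(3)[OF xx(2)] cap_circle(3) by simp
    then show ?thesis using \<open>edge t 3 = e\<close> by (simp add: out_edge_def)
  next
    case 4
    have "\<omega> t z \<in> edge t 4" using \<omega>_side(4)[OF t j(2)] j(3) 4 by simp
    then have "edge t 4 = e" using same[of 4] b(5) blank_edges_E by auto
    then show ?thesis using b(5) e by simp
  next
    case 5
    have w: "\<omega> t z = \<gamma> (edge t 5) (1 - y)" using \<omega>_side(5)[OF t j(2)] j(3) 5 by simp
    then have "edge t 5 = e" using same[of 5] b(4) \<gamma>_in[OF b(4) y'] by simp
    then have "y = 1 - x" using w eq \<gamma>_inj[OF e y' xx(1)] by simp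
    then have "z = cap 1 (pi * x / 3) (-1)"
      using j(3) 5 side_angle_values(4)[OF xx(2)] cap_circle(4) by simp
    then show ?thesis using \<open>edge t 5 = e\<close> by (simp add: out_edge_def)
  qed
qed

lemma \<omega>_bullet:
  assumes t: "t \<in> T" and z: "z \<in> cball 0 1" and B: "\<omega> t z \<in> B"
  shows "\<exists>j\<in>{1, 3}. z = cap j 0 1 \<and> rim t (real j) = \<omega> t z"
proof -
  have "z \<in> sphere 0 1" using \<omega>_not_ball[OF t z] B B_V by blast
  then obtain j y where j: "j \<in> {1..5}" "y \<in> {0..1}" "z = cis (side_angle (real j + y))"
    by (rule sphere_side_angle)
  have y': "1 - y \<in> {0..1}" using j(2) by auto
  note b = bullet_edge[OF t]
  have v: "side_angle 1 = 0" "side_angle 3 = pi" "side_angle 6 = 2 * pi" by (simp_all add: side_angle_def field_simps)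
  show ?thesis using j(1)
  proof (cases rule: side_index_cases)
    case 1
    have w: "\<omega> t z = \<gamma> (edge t 1) y" using \<omega>_side(1)[OF t j(2)] j(3) 1 by simp
    then have "y = 0" using B \<gamma>_B[OF b(1) j(2)] by simp
    then show ?thesis using w j(3) 1 v \<gamma>_rim[OF t] by (simp add: cap_zero)
  next
    case 2
    have w: "\<omega> t z = \<gamma> (edge t 2) (1 - y)" using \<omega>_side(2)[OF t j(2)] j(3) 2 by simp
    then have "y = 1" using B \<gamma>_B[OF b(2) y'] by simp
    then show ?thesis using w j(3) 2 v \<gamma>_rim[OF t] by (simp add: cap_zero)
  next
    case 3
    have w: "\<omega> t z = \<gamma> (edge t 3) y" using \<omega>_side(3)[OF t j(2)] j(3) 3 by simp
    then have "y = 0" using B \<gamma>_B[OF b(3) j(2)] by simp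
    then show ?thesis using w j(3) 3 v \<gamma>_rim[OF t] by (simp add: cap_zero)
  next
    case 4
    have "\<omega> t z \<in> edge t 4" using \<omega>_side(4)[OF t j(2)] j(3) 4 by simp
    then show ?thesis using b(5) B by (auto simp: blank_edges_def)
  next
    case 5
    have w: "\<omega> t z = \<gamma> (edge t 5) (1 - y)" using \<omega>_side(5)[OF t j(2)] j(3) 5 by simp
    then have "y = 1" using B \<gamma>_B[OF b(4) y'] by simp
    then show ?thesis using w j(3) 5 v \<gamma>_rim[OF t] by (simp add: cap_zero)
  qed
qed

lemma bullet_corners:
  assumes "v \<in> B" shows "corners_at v = {c \<in> T \<times> {1, 3}. rim (fst c) (real (snd c)) = v}"
proof -
  have j13: "j \<in> {1, 3}" if tj: "t \<in> T" "j \<in> {1..5}" "rim t (real j) = v" for t j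
    by (rule side_index_cases[OF tj(2)]) (use tj(3) assms blanks[OF tj(1)] in auto)
  show ?thesis
  proof (intro equalityI subsetI)
    fix c assume "c \<in> corners_at v"
    then have "fst c \<in> T" "snd c \<in> {1..5}" "rim (fst c) (real (snd c)) = v"
      by (simp_all add: corners_at_def case_prod_beta)
    then show "c \<in> {c \<in> T \<times> {1, 3}. rim (fst c) (real (snd c)) = v}"
      using j13 by (simp add: mem_Times_iff)
  next
    fix c assume "c \<in> {c \<in> T \<times> {1, 3}. rim (fst c) (real (snd c)) = v}"
    then show "c \<in> corners_at v" by (auto simp: corners_at_def)
  qed
qed

text \<open>Of the two sides of a bullet edge exactly one has index 1 or 2. Only through that side
  can the edge be an entrance, so the tile and the corner are determined. The same holds for exits
  with the indices 3 and 5.\<close>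

lemma in_edge_inj:
  assumes "c \<in> T \<times> {1, 3}" "c' \<in> T \<times> {1, 3}" "in_edge c = in_edge c'" shows "c = c'"
proof -
  obtain s i s' j where st: "sides_of (in_edge c) = {(s, i), (s', j)}" "i \<in> {1, 2}" "j \<in> {3, 5}"
    using bullet_edge_sides[OF in_out_edge_bullet(1)[OF assms(1)]] .
  have "(fst d, if snd d = 1 then 1 else 2) \<in> sides_of (in_edge d)" if "d \<in> T \<times> {1, 3}" for d
    using that by (auto simp: sides_of_def in_edge_def)
  then have m: "(fst c, if snd c = 1 then 1 else 2) \<in> {(s, i), (s', j)}"
    "(fst c', if snd c' = 1 then 1 else 2) \<in> {(s, i), (s', j)}" using assms st(1) by metis+
  have key: "x = s \<and> b = i" if "(x, b) \<in> {(s, i), (s', j)}" "b = 1 \<or> b = 2" for x b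
    using that st(3) by auto
  have "fst c = fst c'" "(if snd c = 1 then 1 else 2) = (if snd c' = 1 then 1 else (2::nat))"
    using key[OF m(1)] key[OF m(2)] by simp_all
  moreover have "snd c = 1 \<or> snd c = 3" "snd c' = 1 \<or> snd c' = 3" using assms(1,2) by auto
  ultimately show ?thesis by (auto simp: prod_eq_iff)
qed

lemma out_edge_inj:
  assumes "c \<in> T \<times> {1, 3}" "c' \<in> T \<times> {1, 3}" "out_edge c = out_edge c'" shows "c = c'"
proof -
  obtain s i s' j where st: "sides_of (out_edge c) = {(s, i), (s', j)}" "i \<in> {1, 2}" "j \<in> {3, 5}"
    using bullet_edge_sides[OF in_out_edge_bullet(2)[OF assms(1)]] .
  have "(fst d, if snd d = 1 then 5 else 3) \<in> sides_of (out_edge d)" if "d \<in> T \<times> {1, 3}" for d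
    using that by (auto simp: sides_of_def out_edge_def)
  then have m: "(fst c, if snd c = 1 then 5 else 3) \<in> {(s, i), (s', j)}"
    "(fst c', if snd c' = 1 then 5 else 3) \<in> {(s, i), (s', j)}" using assms st(1) by metis+
  have key: "x = s' \<and> b = j" if "(x, b) \<in> {(s, i), (s', j)}" "b = 3 \<or> b = 5" for x b
    using that st(2) by auto
  have "fst c = fst c'" "(if snd c = 1 then 5 else 3) = (if snd c' = 1 then 5 else (3::nat))"
    using key[OF m(1)] key[OF m(2)] by simp_all
  moreover have "snd c = 1 \<or> snd c = 3" "snd c' = 1 \<or> snd c' = 3" using assms(1,2) by auto
  ultimately show ?thesis by (auto simp: prod_eq_iff)
qed

text \<open>The side of the exit edge with index 1 or 2 is the entrance of a corner. Both corners
  are at the start \<open>\<gamma> e 0\<close> of this edge, hence at the same vertex.\<close>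

lemma ex_next_corner:
  assumes v: "v \<in> B" and c: "c \<in> corners_at v"
  shows "\<exists>c'\<in>corners_at v. in_edge c' = out_edge c"
proof -
  have cT: "c \<in> T \<times> {1, 3}" and cv: "rim (fst c) (real (snd c)) = v"
    using c unfolding bullet_corners[OF v] by simp_all
  obtain s i s' j where st: "sides_of (out_edge c) = {(s, i), (s', j)}" "i \<in> {1, 2}" "s \<in> T"
    using bullet_edge_sides[OF in_out_edge_bullet(2)[OF cT]] .
  define c' where "c' = (s, if i = 1 then 1 else 3::nat)"
  have "(s, i) \<in> sides_of (out_edge c)" using st(1) by simp
  then have "edge s i = out_edge c" by (simp add: sides_of_def)
  moreover have "i = 1 \<or> i = 2" using st(2) by simp
  ultimately have ie: "in_edge c' = out_edge c" by (elim disjE) (simp_all add: c'_def in_edge_def)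
  have c'T: "c' \<in> T \<times> {1, 3}" using st(3) by (simp add: c'_def)
  have "rim (fst c') (real (snd c')) = v"
    using \<gamma>_corner(1)[OF c'T] \<gamma>_corner(2)[OF cT] ie cv by simp
  then have "c' \<in> corners_at v" using c'T unfolding bullet_corners[OF v] by simp
  then show ?thesis using ie by blast
qed

text \<open>
  Turning around a labelled vertex one always enters a corner through \<open>in_edge\<close> and leaves it through
  \<open>out_edge\<close>; this defines a rotation at the vertex, which meets all corners there.
\<close>

lemma corner_cycle:
  assumes v: "v \<in> B" and c0: "c0 \<in> corners_at v"
  obtains n and c :: "nat => 'a set \<times> nat" where "n > 0" "c 0 = c0" "c ` {..<n} = corners_at v" "inj_on c {..<n}"
    "\<And>i j. i < n ==> j < n ==> out_edge (c i) = in_edge (c j) \<longleftrightarrow> j = (if i + 1 = n then 0 else i + 1)"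
proof -
  define C where "C = corners_at v"
  have CT: "d \<in> T \<times> {1, 3}" if "d \<in> C" for d using that unfolding C_def bullet_corners[OF v] by simp
  have "\<forall>d\<in>C. \<exists>d'. d' \<in> C \<and> in_edge d' = out_edge d"
    using ex_next_corner[OF v] unfolding C_def by blast
  then obtain nx where nx': "\<forall>d\<in>C. nx d \<in> C \<and> in_edge (nx d) = out_edge d" by (rule bchoice[THEN exE])
  then have nx: "\<And>d. d \<in> C ==> nx d \<in> C" "\<And>d. d \<in> C ==> in_edge (nx d) = out_edge d" by auto
  have nx_inj: "d = d'" if "d \<in> C" "d' \<in> C" "nx d = nx d'" for d d'
    using out_edge_inj[OF CT[OF that(1)] CT[OF that(2)]] nx(2)[OF that(1)] nx(2)[OF that(2)] that(3) by simp
  define c where "c i = (nx ^^ i) c0" for i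
  have c_Suc: "c (Suc i) = nx (c i)" for i by (simp add: c_def)
  have cC: "c i \<in> C" for i by (induction i) (use c0 nx(1) in \<open>simp_all add: c_def C_def\<close>)
  \<comment> \<open>\<open>nx\<close> is injective, so a repetition can be moved back to the start:
    the orbit of \<open>c0\<close> returns to \<open>c0\<close> itself.\<close>
  have shift: "c (j - i) = c0" if "c i = c j" "i \<le> j" for i j
    using that
  proof (induction i arbitrary: j)
    case 0 then show ?case by (simp add: c_def)
  next
    case (Suc i)
    then obtain j' where j': "j = Suc j'" by (cases j) auto
    then have "nx (c i) = nx (c j')" using Suc.prems(1) c_Suc by simp
    then have "c i = c j'" using nx_inj cC by blast
    then show ?case using Suc.IH[of j'] Suc.prems(2) j' by simp
  qed
  have "finite C" unfolding C_def by (rule finite_corners_at)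
  moreover have "range c \<subseteq> C" using cC by blast
  ultimately have "\<not> inj c" using range_inj_infinite finite_subset by blast
  then have "\<exists>i j. c i = c j \<and> i < j" unfolding inj_def by (metis linorder_neqE_nat)
  then obtain i j where "c i = c j" "i < j" by blast
  then have ex: "\<exists>n>0. c n = c0" using shift[of i j] by (intro exI[of _ "j - i"]) simp
  define n where "n = (LEAST n. n > 0 \<and> c n = c0)"
  have n: "n > 0" "c n = c0" using LeastI_ex[OF ex] by (simp_all add: n_def)
  have n_min: "\<not> (k > 0 \<and> c k = c0)" if "k < n" for k using not_less_Least that unfolding n_def by blast
  have inj: "inj_on c {..<n}"
  proof (rule inj_onI)
    fix i j assume ij: "i \<in> {..<n}" "j \<in> {..<n}" "c i = c j"
    show "i = j"
    proof (rule ccontr)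
      assume "i ~= j"
      then consider "i < j" | "j < i" by linarith
      then show False
      proof cases
        case 1
        then have "c (j - i) = c0" "j - i < n" "j - i > 0" using shift[of i j] ij by auto
        then show False using n_min by blast
      next
        case 2
        then have "c (i - j) = c0" "i - j < n" "i - j > 0" using shift[of j i] ij by auto
        then show False using n_min by blast
      qed
    qed
  qed
  \<comment> \<open>The orbit is closed under forward steps and, being a cycle, under backward
    steps. A corner outside it thus shares no edge with it, and \<open>corners_connected\<close>
    applies.\<close>
  have X: "c ` {..<n} = corners_at v"
  proof (rule corners_connected)
    show "v \<in> V" using v B_V by blast
    show "c ` {..<n} \<subseteq> corners_at v" using cC by (auto simp: C_def)
    show "c ` {..<n} ~= {}" using n by auto
    fix d d' assume d: "d \<in> c ` {..<n}" "d' \<in> corners_at v - c ` {..<n}"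
    then obtain i where i: "i < n" "d = c i" by auto
    have dC: "d \<in> C" "d' \<in> C" "d' \<notin> c ` {..<n}" using d i cC by (auto simp: C_def)
    have ce: "corner_edges d = {in_edge d, out_edge d}" if "d \<in> C" for d
    proof -
      have "snd d = 1 \<or> snd d = 3" using CT[OF that] by auto
      then show ?thesis
        by (elim disjE) (simp_all add: corner_edges_def in_edge_def out_edge_def pred_side_def insert_commute)
    qed
    have 1: "in_edge d ~= in_edge d'" using in_edge_inj[OF CT CT] dC d(1) by blast
    have 2: "out_edge d ~= out_edge d'" using out_edge_inj[OF CT CT] dC d(1) by blast
    have 3: "out_edge d ~= in_edge d'"
    proof
      assume "out_edge d = in_edge d'"
      then have "nx d = d'" using in_edge_inj[OF CT[OF nx(1)[OF dC(1)]] CT[OF dC(2)]] nx(2)[OF dC(1)] by simp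
      then have "d' = c (Suc i)" using i c_Suc by simp
      moreover have "c (Suc i) \<in> c ` {..<n}"
      proof (cases "Suc i = n")
        case True then show ?thesis using n by (intro image_eqI[of _ _ 0]) (auto simp: c_def)
      next
        case False then show ?thesis using i by auto
      qed
      ultimately show False using dC by simp
    qed
    have 4: "in_edge d ~= out_edge d'"
    proof
      assume "in_edge d = out_edge d'"
      then have e: "nx d' = d" using in_edge_inj[OF CT[OF nx(1)[OF dC(2)]] CT[OF dC(1)]] nx(2)[OF dC(2)] by simp
      have "\<exists>k<n. d = nx (c k)"
      proof (cases i)
        case 0
        then have "d = c (Suc (n - 1))" using n i by (simp add: c_def)
        then show ?thesis using n(1) c_Suc[of "n - 1"] by (intro exI[of _ "n - 1"]) simp
      next
        case (Suc k) then show ?thesis using i c_Suc[of k] by (intro exI[of _ k]) simp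
      qed
      then obtain k where "k < n" "nx d' = nx (c k)" using e by auto
      then have "d' = c k" using nx_inj[OF dC(2) cC] by blast
      then show False using dC(3) \<open>k < n\<close> by auto
    qed
    show "corner_edges d \<inter> corner_edges d' = {}"
      unfolding ce[OF dC(1)] ce[OF dC(2)] using 1 2 3 4 by auto
  qed
  have next_iff: "out_edge (c i) = in_edge (c j) \<longleftrightarrow> j = (if i + 1 = n then 0 else i + 1)" if ij: "i < n" "j < n" for i j
  proof -
    define l where "l = (if i + 1 = n then 0 else i + 1)"
    have l: "l < n" using ij n(1) by (simp add: l_def)
    have cl: "c l = nx (c i)"
    proof (cases "i + 1 = n")
      case True
      have c0': "c 0 = c0" unfolding c_def by simp
      have "Suc i = n" using True by simp
      then have "c (Suc i) = c 0" unfolding c0' using n(2) by metis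
      moreover have "l = 0" unfolding l_def using True by (rule if_P)
      ultimately show ?thesis using c_Suc[of i] by metis
    next
      case False
      then have "l = Suc i" unfolding l_def by simp
      then show ?thesis using c_Suc[of i] by metis
    qed
    have "out_edge (c i) = in_edge (c j) \<longleftrightarrow> in_edge (c l) = in_edge (c j)" using nx(2)[OF cC] cl by simp
    also have "\<dots> \<longleftrightarrow> c l = c j" using in_edge_inj[OF CT[OF cC[of l]] CT[OF cC[of j]]] by metis
    also have "\<dots> \<longleftrightarrow> l = j" using inj_on_eq_iff[OF inj] l ij by simp
    also have "\<dots> \<longleftrightarrow> j = l" by (rule eq_commute)
    finally show ?thesis unfolding l_def .
  qed
  show ?thesis
    by (rule that[OF n(1) _ X inj next_iff]) (simp_all add: c_def)
qed

end

section \<open>Intervals glued in a cycle\<close>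

definition cyclic_succ :: "nat => nat => nat" where "cyclic_succ n i = (if i + 1 = n then 0 else i + 1)"

text \<open>The gluing of \<open>n\<close> unit intervals end to end in a cycle. For
  \<open>n = 1\<close> the single interval is closed up to a circle.\<close>

definition cyclic_adj :: "nat => nat => real => nat => real => bool" where
  "cyclic_adj n i w j w' \<longleftrightarrow> i = j \<and> w = w' \<or> w = 1 \<and> w' = 0 \<and> j = cyclic_succ n i \<or> w = 0 \<and> w' = 1 \<and> i = cyclic_succ n j"

text \<open>Identifying \<open>\<beta> 0\<close> with \<open>\<beta> n\<close> closes the interval
  to a circle, so the adjacency of pieces becomes cyclic. The left side has the form in which
  \<open>circle_point_eq_iff\<close> and \<open>square_rim_eq_iff\<close> describe
  coincidences.\<close>

lemma interpolation_cyclic: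
  fixes \<beta> :: "nat => real"
  assumes mono: "\<And>i j. i < j ==> j \<le> n ==> \<beta> i < \<beta> j"
    and ij: "i < n" "j < n" and w: "w \<in> {0..1}" "w' \<in> {0..1}"
  shows "\<beta> i + w * (\<beta> (i + 1) - \<beta> i) = \<beta> j + w' * (\<beta> (j + 1) - \<beta> j) \<or>
      {\<beta> i + w * (\<beta> (i + 1) - \<beta> i), \<beta> j + w' * (\<beta> (j + 1) - \<beta> j)} = {\<beta> 0, \<beta> n} \<longleftrightarrow> cyclic_adj n i w j w'"
proof -
  define b where "b = \<beta> i + w * (\<beta> (i + 1) - \<beta> i)"
  define b' where "b' = \<beta> j + w' * (\<beta> (j + 1) - \<beta> j)"
  have eq: "b = b' \<longleftrightarrow> i = j \<and> w = w' \<or> j = i + 1 \<and> w = 1 \<and> w' = 0 \<or> i = j + 1 \<and> w = 0 \<and> w' = 1"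
    unfolding b_def b'_def by (rule interpolation_eq_iff(1)[OF mono ij w])
  have b: "b = \<beta> 0 \<longleftrightarrow> i = 0 \<and> w = 0" "b = \<beta> n \<longleftrightarrow> i + 1 = n \<and> w = 1"
    unfolding b_def by (rule interpolation_eq_iff(3,4)[OF mono ij w], assumption+)+
  have b': "b' = \<beta> 0 \<longleftrightarrow> j = 0 \<and> w' = 0" "b' = \<beta> n \<longleftrightarrow> j + 1 = n \<and> w' = 1"
    unfolding b'_def by (rule interpolation_eq_iff(3,4)[OF mono ij(2,1) w(2,1)], assumption+)+
  have "b = b' \<or> {b, b'} = {\<beta> 0, \<beta> n} \<longleftrightarrow> cyclic_adj n i w j w'"
  proof -
    have cs: "j = cyclic_succ n i \<longleftrightarrow> j = i + 1 \<or> i + 1 = n \<and> j = 0"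
      "i = cyclic_succ n j \<longleftrightarrow> i = j + 1 \<or> j + 1 = n \<and> i = 0"
      using ij by (simp_all add: cyclic_succ_def)
    show ?thesis unfolding doubleton_eq_iff eq b b' cyclic_adj_def cs by argo
  qed
  then show ?thesis unfolding b_def b'_def .
qed

lemma interpolation_surj:
  fixes \<beta> :: "nat => real"
  assumes mono: "\<And>i j. i < j ==> j \<le> n ==> \<beta> i < \<beta> j" and s: "\<beta> 0 \<le> s" "s \<le> \<beta> n" and "n > 0"
  obtains i w where "i < n" "w \<in> {0..1}" "s = \<beta> i + w * (\<beta> (i + 1) - \<beta> i)"
proof -
  define i where "i = (GREATEST i. i < n \<and> \<beta> i \<le> s)"
  have b: "\<And>k. k < n \<and> \<beta> k \<le> s ==> k \<le> n" by simp
  have i: "i < n \<and> \<beta> i \<le> s" unfolding i_def using GreatestI_nat[of "\<lambda>i. i < n \<and> \<beta> i \<le> s" 0 n] s \<open>n > 0\<close> b by blast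
  have "s \<le> \<beta> (i + 1)"
  proof (rule ccontr)
    assume "\<not> s \<le> \<beta> (i + 1)"
    then have "i + 1 < n" using i s(2) by (cases "i + 1 = n") auto
    then have "i + 1 \<le> i"
      unfolding i_def using Greatest_le_nat[of "\<lambda>i. i < n \<and> \<beta> i \<le> s" "i + 1" n] b \<open>\<not> s \<le> \<beta> (i + 1)\<close>
      by (simp add: i_def)
    then show False by simp
  qed
  moreover have d: "\<beta> (i + 1) - \<beta> i > 0" using mono[of i "i + 1"] i by simp
  ultimately have "(s - \<beta> i) / (\<beta> (i + 1) - \<beta> i) \<in> {0..1}" using i by (simp add: field_simps)
  moreover have "s = \<beta> i + (s - \<beta> i) / (\<beta> (i + 1) - \<beta> i) * (\<beta> (i + 1) - \<beta> i)" using d by simp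
  ultimately show ?thesis using that i by blast
qed

section \<open>Caps as regions of the disk\<close>

lemma cap_Re: "Re (cap j a y) = (if j = 1 then 1 else -1) * cos a"
  and cap_Im: "Im (cap j a y) = y * sin a"
  by (simp_all add: cap_def)

text \<open>Since the cosine decreases, a half plane cuts off exactly the chords at angular distance
  less than \<open>\<epsilon>\<close>. Chord coordinates thus describe a relatively open part of the
  disk.\<close>

lemma cap_region:
  assumes z: "z \<in> cball 0 1" and j: "j \<in> {1, 3}" and \<epsilon>: "\<epsilon> \<in> {0<..pi / 6}"
  shows "(if j = 1 then 1 else -1) * Re z > cos \<epsilon> \<longleftrightarrow> (\<exists>a\<in>{0..<\<epsilon>}. \<exists>y\<in>{-1..1}. z = cap j a y)"
proof
  let ?r = "(if j = 1 then 1 else -1) * Re z"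
  assume r: "?r > cos \<epsilon>"
  have c0: "cos \<epsilon> > 0" using \<epsilon> by (intro cos_gt_zero) auto
  have nz: "norm z \<le> 1" using z by simp
  then have "\<bar>Re z\<bar> \<le> 1" using abs_Re_le_cmod[of z] by linarith
  then have r1: "?r \<le> 1" "-1 \<le> ?r" by auto
  define a where "a = arccos ?r"
  have ca: "cos a = ?r" unfolding a_def by (rule cos_arccos) (use r1 in auto)
  have a0: "0 \<le> a" "a \<le> pi" unfolding a_def using r1 arccos_lbound arccos_ubound by auto
  have a\<epsilon>: "a < \<epsilon>"
  proof (rule ccontr)
    assume "\<not> a < \<epsilon>"
    then have "cos a \<le> cos \<epsilon>" using \<epsilon> a0 by (intro cos_monotone_0_pi_le) auto
    then show False using ca r by simp
  qed
  have sq: "(Re z)\<^sup>2 + (Im z)\<^sup>2 \<le> 1" using nz by (simp add: cmod_power2[symmetric] power_le_one)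
  have "(Re z)\<^sup>2 = (cos a)\<^sup>2" unfolding ca by (simp add: power2_eq_square)
  then have Im: "(Im z)\<^sup>2 \<le> (sin a)\<^sup>2" using sq sin_cos_squared_add[of a] by linarith
  have sa: "sin a \<ge> 0" using a0 by (intro sin_ge_zero) auto
  have "\<bar>Im z\<bar> \<le> sin a" using Im sa abs_le_square_iff[of "Im z" "sin a"] by simp
  \<comment> \<open>For \<open>a = 0\<close> the chord shrinks to the corner and every
    \<open>y\<close> gives the same point; 1 is a default.\<close>
  define y where "y = (if sin a = 0 then 1 else Im z / sin a)"
  have "y \<in> {-1..1}" using \<open>\<bar>Im z\<bar> \<le> sin a\<close> sa by (auto simp: y_def field_simps)
  moreover have "z = cap j a y"
    using ca \<open>\<bar>Im z\<bar> \<le> sin a\<close> by (auto simp: complex_eq_iff cap_Re cap_Im y_def)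
  moreover have "a \<in> {0..<\<epsilon>}" using a0 a\<epsilon> by simp
  ultimately show "\<exists>a\<in>{0..<\<epsilon>}. \<exists>y\<in>{-1..1}. z = cap j a y" by blast
next
  assume "\<exists>a\<in>{0..<\<epsilon>}. \<exists>y\<in>{-1..1}. z = cap j a y"
  then obtain a y where a: "a \<in> {0..<\<epsilon>}" "z = cap j a y" by blast
  have "cos \<epsilon> < cos a" using a(1) \<epsilon> by (intro cos_monotone_0_pi) auto
  then show "(if j = 1 then 1 else -1) * Re z > cos \<epsilon>" unfolding a(2) cap_Re by auto
qed

text \<open>Real and imaginary part each change by at most \<open>a\<close>, hence the factor
  2.\<close>

lemma cap_near_vertex:
  assumes "a \<ge> 0" "\<bar>y\<bar> \<le> 1" shows "dist (cap j a y) (cap j 0 y') \<le> 2 * a"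
proof -
  have "\<bar>Re (cap j a y - cap j 0 y')\<bar> = 1 - cos a" by (auto simp: cap_Re)
  also have "\<dots> = 2 * (sin (a / 2))\<^sup>2" using cos_double_sin[of "a / 2"] by simp
  also have "\<dots> \<le> 2 * \<bar>sin (a / 2)\<bar>"
  proof -
    have "(sin (a / 2))\<^sup>2 = \<bar>sin (a / 2)\<bar> * \<bar>sin (a / 2)\<bar>" by (simp add: power2_eq_square)
    also have "\<dots> \<le> \<bar>sin (a / 2)\<bar> * 1" by (intro mult_left_mono) auto
    finally show ?thesis by simp
  qed
  also have "\<dots> \<le> 2 * \<bar>a / 2\<bar>" using abs_sin_x_le_abs_x[of "a / 2"] by simp
  finally have R: "\<bar>Re (cap j a y - cap j 0 y')\<bar> \<le> a" using assms by simp
  have "\<bar>Im (cap j a y - cap j 0 y')\<bar> = \<bar>y\<bar> * \<bar>sin a\<bar>" by (simp add: cap_Im abs_mult)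
  also have "\<dots> \<le> 1 * \<bar>a\<bar>" using assms abs_sin_x_le_abs_x[of a] by (intro mult_mono) auto
  finally have I: "\<bar>Im (cap j a y - cap j 0 y')\<bar> \<le> a" using assms by simp
  show ?thesis using cmod_le[of "cap j a y - cap j 0 y'"] R I by (simp add: dist_norm)
qed

section \<open>Sector coordinates and small disks around a labelled vertex\<close>

context flow_charts
begin

text \<open>Coordinates at a corner: \<open>a\<close> is the angular distance from the vertex, and
  \<open>y\<close> goes from 1 on \<open>in_edge\<close> to -1 on \<open>out_edge\<close>.\<close>

definition sector :: "'a set \<times> nat => real => real => 'a" where
  "sector c a y = \<omega> (fst c) (cap (snd c) a y)"

lemma sector_edge:
  assumes "c \<in> T \<times> {1, 3}" "a \<in> {0..pi / 6}"
  shows "sector c a 1 = \<gamma> (in_edge c) (3 * a / pi)" "sector c a (-1) = \<gamma> (out_edge c) (3 * a / pi)"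
proof -
  have x: "3 * a / pi \<in> {0..1/2}" using assms(2) by (auto simp: field_simps)
  have a: "pi * (3 * a / pi) / 3 = a" by simp
  show "sector c a 1 = \<gamma> (in_edge c) (3 * a / pi)" "sector c a (-1) = \<gamma> (out_edge c) (3 * a / pi)"
    using \<omega>_cap[OF assms(1) x] unfolding a sector_def by simp_all
qed

lemma sector_vertex:
  assumes "c \<in> T \<times> {1, 3}" shows "sector c 0 y = rim (fst c) (real (snd c))"
proof -
  have "sector c 0 y = sector c 0 1" by (simp add: sector_def cap_def)
  also have "\<dots> = \<gamma> (in_edge c) 0" using sector_edge(1)[OF assms, of 0] by simp
  finally show ?thesis using \<gamma>_corner(1)[OF assms] by simp
qed

lemma cap_pos: "a \<in> {0<..pi / 6} ==> sin a > 0" "a \<in> {0<..pi / 6} ==> cos a < 1" "a \<in> {0..pi / 6} ==> cos a > 0"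
proof -
  show "sin a > 0" if "a \<in> {0<..pi / 6}" using that by (intro sin_gt_zero) auto
  show "cos a < 1" if "a \<in> {0<..pi / 6}" using that cos_monotone_0_pi[of 0 a] by simp
  show "cos a > 0" if "a \<in> {0..pi / 6}"
    using that by (cases "a = 0") (auto intro!: cos_gt_zero)
qed

lemma sector_not_bullet:
  assumes c: "c \<in> T \<times> {1, 3}" and a: "a \<in> {0<..pi / 6}" and y: "\<bar>y\<bar> \<le> 1" shows "sector c a y \<notin> B"
proof
  assume "sector c a y \<in> B"
  moreover have "fst c \<in> T" using c by auto
  ultimately obtain j where "cap (snd c) a y = cap j 0 1"
    using \<omega>_bullet[OF _ cap_cball[OF y]] unfolding sector_def by blast
  then have "Re (cap (snd c) a y) = Re (cap j 0 1)" by simp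
  then show False using cap_pos[of a] a by (auto simp: cap_Re split: if_splits)
qed

text \<open>Inner points of a chord lie in a tile and are not identified with others. At an end of a
  chord the chart follows \<open>\<gamma>\<close> with a parameter determined by \<open>a\<close>
  alone, so sectors meet along common edges at equal distance from the vertex.\<close>

lemma sector_eq_iff:
  assumes c: "c \<in> T \<times> {1, 3}" "c' \<in> T \<times> {1, 3}" and a: "a \<in> {0<..pi / 6}" "a' \<in> {0<..pi / 6}"
    and y: "\<bar>y\<bar> \<le> 1" "\<bar>y'\<bar> \<le> 1"
  shows "sector c a y = sector c' a' y' \<longleftrightarrow> a = a' \<and>
    (c = c' \<and> y = y' \<or> y = -1 \<and> y' = 1 \<and> out_edge c = in_edge c' \<or> y = 1 \<and> y' = -1 \<and> in_edge c = out_edge c')"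
proof -
  have t: "fst c \<in> T" "snd c \<in> {1, 3}" "fst c' \<in> T" "snd c' \<in> {1, 3}" using c by auto
  have inner: "c = c' \<and> a = a' \<and> y = y'"
    if b: "cap (snd c) a y \<in> ball 0 1 \<or> cap (snd c') a' y' \<in> ball 0 1" and eq: "sector c a y = sector c' a' y'"
  proof -
    have "fst c = fst c' \<and> cap (snd c) a y = cap (snd c') a' y'"
      using b \<omega>_tile_points[OF t(1,3) _ cap_cball[OF y(2)], of "cap (snd c) a y" "snd c'" a']
        \<omega>_tile_points[OF t(3,1) _ cap_cball[OF y(1)], of "cap (snd c') a' y'" "snd c" a]
        eq unfolding sector_def by metis
    then show ?thesis using cap_eq_iff[OF t(2,4) a] by (simp add: prod_eq_iff)
  qed
  have sn: "sin a ~= 0" "sin a' ~= 0" using cap_pos(1) a by (metis less_irrefl)+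
  show ?thesis
  proof (cases "\<bar>y\<bar> < 1 \<or> \<bar>y'\<bar> < 1")
    case True
    then have b: "cap (snd c) a y \<in> ball 0 1 \<or> cap (snd c') a' y' \<in> ball 0 1" using cap_ball sn by blast
    then have "\<not> (y = -1 \<and> y' = 1)" "\<not> (y = 1 \<and> y' = -1)" using True by auto
    then show ?thesis using inner[OF b] by blast
  next
    case False
    then have yy: "y = 1 \<or> y = -1" "y' = 1 \<or> y' = -1" using y by auto
    have x: "3 * a / pi \<in> {0<..<1}" "3 * a' / pi \<in> {0<..<1}" using a pi_gt_zero by (auto simp: field_simps)
    have xeq: "3 * a / pi = 3 * a' / pi \<longleftrightarrow> a = a'" by simp
    have aa: "a \<in> {0..pi/6}" "a' \<in> {0..pi/6}" using a by auto
    note se = sector_edge[OF c(1) aa(1)] sector_edge[OF c(2) aa(2)]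
    note io = in_out_edge_bullet[OF c(1)] in_out_edge_bullet[OF c(2)]
    have ii: "in_edge c = in_edge c' \<longleftrightarrow> c = c'" and oo: "out_edge c = out_edge c' \<longleftrightarrow> c = c'"
      using in_edge_inj[OF c] out_edge_inj[OF c] by auto
    from yy show ?thesis
      by (elim disjE)
        (simp_all add: se \<gamma>_eq_iff[OF io(1,3) x] \<gamma>_eq_iff[OF io(2,4) x] \<gamma>_eq_iff[OF io(1,4) x] \<gamma>_eq_iff[OF io(2,3) x] ii oo xeq conj_commute)
  qed
qed

definition disk :: "'a => real => 'a set" where
  "disk v \<epsilon> = {sector c a y | c a y. c \<in> corners_at v \<and> a \<in> {0..<\<epsilon>} \<and> y \<in> {-1..1}}"

text \<open>\<open>\<omega> t\<close> and \<open>\<phi> t\<close> have the same image on the open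
  disk. The image of the closed disk under \<open>\<omega> t\<close> is closed, so it contains
  whatever \<open>\<phi> t\<close> reaches by continuity.\<close>

lemma \<omega>_covers: assumes "x \<in> S" obtains t z where "t \<in> T" "z \<in> cball 0 1" "x = \<omega> t z"
proof -
  obtain t z where t: "t \<in> T" "z \<in> cball 0 1" "x = \<phi> t z" using S_covered[OF assms] by blast
  have "compact (\<omega> t ` cball 0 1)" by (rule compact_continuous_image[OF \<omega>_cont[OF t(1)] compact_cball])
  then have cl: "closed (\<omega> t ` cball 0 1)" by (rule compact_imp_closed)
  have "\<phi> t ` ball 0 1 \<subseteq> \<omega> t ` cball 0 1"
    unfolding image_ball[OF t(1)]
    using image_mono[OF ball_subset_cball[of 0 1], of "\<omega> t"] \<omega>_image_ball[OF t(1)] by simp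
  then have "\<phi> t ` closure (ball 0 1) \<subseteq> \<omega> t ` cball 0 1"
    using cont[OF t(1)] cl by (intro image_closure_subset) auto
  then have "x \<in> \<omega> t ` cball 0 1" using t by auto
  then show ?thesis using that t(1) by blast
qed

text \<open>The complement is the compact set \<open>K\<close>, the image of those parts of the
  closed disks that lie outside the caps at \<open>v\<close>. Disjointness of \<open>K\<close> and
  the disk is saturation, checked separately for the vertex, for points of tiles and for points of
  edges.\<close>

lemma disk_open:
  assumes v: "v \<in> B" and \<epsilon>: "\<epsilon> \<in> {0<..pi / 6}" shows "openin (top_of_set S) (disk v \<epsilon>)"
proof -
  define R where "R t = {z. \<exists>j\<in>{1, 3}. (t, j) \<in> corners_at v \<and> (if j = 1 then 1 else -1) * Re z > cos \<epsilon>}" for t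
  have R_open: "open (R t)" for t
  proof -
    have "R t = (\<Union>j\<in>{j \<in> {1, 3}. (t, j) \<in> corners_at v}. {z. cos \<epsilon> < (if j = 1 then 1 else -1) * Re z})"
      by (auto simp: R_def)
    also have "open \<dots>" by (intro open_UN ballI open_Collect_less continuous_intros)
    finally show ?thesis .
  qed
  define K where "K = (\<Union>t\<in>T. \<omega> t ` (cball 0 1 - R t))"
  have "compact (\<omega> t ` (cball 0 1 - R t))" if "t \<in> T" for t
    by (rule compact_continuous_image[OF continuous_on_subset[OF \<omega>_cont[OF that]]])
      (auto intro: compact_diff R_open)
  then have "compact K" unfolding K_def using finite_tiles by (intro compact_UN) auto
  then have "closed K" by (rule compact_imp_closed)
  then have "openin (top_of_set S) (S - K)" by (simp add: Diff_eq openin_open_Int open_Compl)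
  moreover have "S - K = disk v \<epsilon>"
  proof (intro equalityI subsetI)
    fix x assume x: "x \<in> S - K"
    then obtain t z where tz: "t \<in> T" "z \<in> cball 0 1" "x = \<omega> t z" using \<omega>_covers by blast
    have "z \<in> R t"
    proof (rule ccontr)
      assume "z \<notin> R t"
      then have "x \<in> K" unfolding K_def tz(3) using tz(1,2) by blast
      then show False using x by blast
    qed
    then obtain j where j: "j \<in> {1, 3}" "(t, j) \<in> corners_at v" "(if j = 1 then 1 else -1) * Re z > cos \<epsilon>"
      unfolding R_def by blast
    then obtain a y where "a \<in> {0..<\<epsilon>}" "y \<in> {-1..1}" "z = cap j a y"
      using cap_region[OF tz(2) j(1) \<epsilon>] by blast
    then have "x = sector (t, j) a y" "a \<in> {0..<\<epsilon>}" "y \<in> {-1..1}" using tz by (simp_all add: sector_def)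
    then show "x \<in> disk v \<epsilon>" unfolding disk_def using j(2) by blast
  next
    fix x assume "x \<in> disk v \<epsilon>"
    then obtain c a y where x: "x = sector c a y" "c \<in> corners_at v" "a \<in> {0..<\<epsilon>}" "y \<in> {-1..1}"
      unfolding disk_def by blast
    have c: "c \<in> T \<times> {1, 3}" "rim (fst c) (real (snd c)) = v" using x(2) unfolding bullet_corners[OF v] by auto
    have y: "\<bar>y\<bar> \<le> 1" using x(4) by auto
    have tc: "fst c \<in> T" using c by auto
    have inR: "cap j a y' \<in> R t" if "(t, j) \<in> corners_at v" "j \<in> {1, 3}" "y' \<in> {-1..1}" for t j y'
    proof -
      have "cap j a y' \<in> cball 0 1" using that(3) by (intro cap_cball) auto
      then have "(if j = 1 then 1 else -1) * Re (cap j a y') > cos \<epsilon>"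
        using cap_region[OF _ that(2) \<epsilon>] x(3) that(3) by blast
      then show ?thesis unfolding R_def using that by blast
    qed
    have notK: "z \<in> R t" if tz: "t \<in> T" "z \<in> cball 0 1" "x = \<omega> t z" for t z
    proof (cases "a = 0")
      case True
      then have "x = v" using sector_vertex[OF c(1)] c(2) x(1) by simp
      then have "\<omega> t z = v" using tz(3) by simp
      then have "\<exists>j\<in>{1, 3}. z = cap j 0 1 \<and> rim t (real j) = v"
        using \<omega>_bullet[OF tz(1,2)] v by simp
      then obtain j where j: "j \<in> {1, 3}" "z = cap j 0 1" "rim t (real j) = v" by blast
      then have "(t, j) \<in> corners_at v" unfolding bullet_corners[OF v] using tz(1) by simp
      then show ?thesis using inR[of t j 1] j True by simp
    next
      case False
      then have a: "a \<in> {0<..pi / 6}" using x(3) \<epsilon> by auto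
      show ?thesis
      proof (cases "\<bar>y\<bar> < 1")
        case True
        have "sin a ~= 0" using cap_pos(1)[OF a] by simp
        then have "cap (snd c) a y \<in> ball 0 1" using True by (intro cap_ball)
        then have "fst c = t" "cap (snd c) a y = z"
          using \<omega>_tile_points[OF tc tz(1) _ tz(2)] x(1) tz(3) unfolding sector_def by blast+
        moreover have "(fst c, snd c) \<in> corners_at v" using x(2) by simp
        ultimately show ?thesis using inR[of "fst c" "snd c" y] c(1) x(4) by auto
      next
        case False
        then have y1: "y = 1 \<or> y = -1" using y by auto
        have aa: "a \<in> {0..pi / 6}" using a by auto
        define e where "e = (if y = 1 then in_edge c else out_edge c)"
        have e: "e \<in> E - blank_edges" using in_out_edge_bullet[OF c(1)] by (simp add: e_def)
        have xe: "x = \<gamma> e (3 * a / pi)" using y1 sector_edge[OF c(1) aa] x(1) by (auto simp: e_def)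
        have e0: "\<gamma> e 0 = v" using \<gamma>_corner[OF c(1)] c(2) by (simp add: e_def)
        have "3 * a / pi \<in> {0<..1/2}" using a pi_gt_zero by (auto simp: field_simps)
        then obtain j where j: "j \<in> {1, 3}" "in_edge (t, j) = e \<and> z = cap j (pi * (3 * a / pi) / 3) 1 \<or>
            out_edge (t, j) = e \<and> z = cap j (pi * (3 * a / pi) / 3) (-1)"
          using \<omega>_eq_\<gamma>[OF tz(1,2) e] xe tz(3) by metis
        have tj: "(t, j) \<in> T \<times> {1, 3}" using tz(1) j(1) by simp
        then have "rim t (real j) = v" using \<gamma>_corner[OF tj] j(2) e0 by auto
        then have "(t, j) \<in> corners_at v" unfolding bullet_corners[OF v] using tj by simp
        moreover have "z = cap j a 1 \<or> z = cap j a (-1)" using j(2) by auto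
        ultimately show ?thesis using inR[of t j 1] inR[of t j "-1"] j(1) by auto
      qed
    qed
    have "cap (snd c) a y \<in> cball 0 1" using y by (rule cap_cball)
    then have "x \<in> S"
    proof (cases "cap (snd c) a y \<in> ball 0 1")
      case True
      then have "x \<in> fst c" using \<omega>_image_ball[OF tc] x(1) unfolding sector_def by blast
      then show ?thesis using S_eq tc by blast
    next
      case False
      then have "cap (snd c) a y \<in> sphere 0 1" using \<open>cap (snd c) a y \<in> cball 0 1\<close> by auto
      then have "x \<in> \<Union>E" using \<omega>_sphere[OF tc] x(1) unfolding sector_def by blast
      then show ?thesis using S_eq by blast
    qed
    moreover have "x \<notin> K"
    proof
      assume "x \<in> K"
      then obtain t z where "t \<in> T" "z \<in> cball 0 1 - R t" "x = \<omega> t z" unfolding K_def by blast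
      then show False using notK[of t z] by blast
    qed
    ultimately show "x \<in> S - K" by blast
  qed
  ultimately show ?thesis by simp
qed

text \<open>At each of the finitely many corners continuity of the chart bounds \<open>a\<close>. A
  common bound is taken and cut at \<open>pi / 6\<close>, up to which sector coordinates are
  available.\<close>

lemma disk_small:
  assumes v: "v \<in> B" and U: "openin (top_of_set S) U" "v \<in> U"
  shows "\<exists>\<epsilon>\<in>{0<..pi / 6}. disk v \<epsilon> \<subseteq> U"
proof -
  have "\<exists>d>0. \<forall>c\<in>corners_at v. \<forall>a\<in>{0..<d}. \<forall>y\<in>{-1..1}. sector c a y \<in> U"
  proof (rule finite_uniform_positive[OF finite_corners_at])
    fix c assume "c \<in> corners_at v"
    then have c: "c \<in> T \<times> {1, 3}" "rim (fst c) (real (snd c)) = v" unfolding bullet_corners[OF v] by auto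
    have tc: "fst c \<in> T" using c by auto
    have S: "\<omega> (fst c) \<in> cball 0 1 \<rightarrow> S"
    proof
      fix z :: complex assume "z \<in> cball 0 1"
      then consider "z \<in> ball 0 1" | "z \<in> sphere 0 1" by fastforce
      then show "\<omega> (fst c) z \<in> S"
      proof cases
        case 1 then show ?thesis using \<omega>_image_ball[OF tc] S_eq tc by blast
      next
        case 2 then show ?thesis using \<omega>_sphere[OF tc] S_eq by blast
      qed
    qed
    have "openin (top_of_set (cball 0 1)) (cball 0 1 \<inter> \<omega> (fst c) -` U)"
      by (rule continuous_openin_preimage[OF \<omega>_cont[OF tc] S U(1)])
    moreover have "cap (snd c) 0 1 \<in> cball 0 1 \<inter> \<omega> (fst c) -` U"
      using sector_vertex[OF c(1), of 1] c(2) U(2) cap_cball[of 1 "snd c" 0] by (auto simp: sector_def)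
    ultimately obtain b where b: "b > 0"
      "\<And>z. z \<in> cball 0 1 ==> dist z (cap (snd c) 0 1) < b ==> \<omega> (fst c) z \<in> U"
      unfolding openin_euclidean_subtopology_iff by blast
    have "\<forall>a\<in>{0..<b / 2}. \<forall>y\<in>{-1..1}. sector c a y \<in> U"
    proof (intro ballI)
      fix a y :: real assume ay: "a \<in> {0..<b / 2}" "y \<in> {-1..1}"
      have y: "\<bar>y\<bar> \<le> 1" using ay by auto
      have "dist (cap (snd c) a y) (cap (snd c) 0 1) < b" using cap_near_vertex[of a y "snd c" 1] ay y by auto
      then show "sector c a y \<in> U" using b(2)[OF cap_cball[OF y]] by (simp add: sector_def)
    qed
    then show "\<exists>d>0. \<forall>a\<in>{0..<d}. \<forall>y\<in>{-1..1}. sector c a y \<in> U" using b(1) by (intro exI[of _ "b / 2"]) auto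
  qed auto
  then obtain d where d: "d > 0" "\<forall>c\<in>corners_at v. \<forall>a\<in>{0..<d}. \<forall>y\<in>{-1..1}. sector c a y \<in> U" by blast
  have "disk v (min d (pi / 6)) \<subseteq> U" using d(2) by (auto simp: disk_def)
  then show ?thesis using d(1) by (intro bexI[of _ "min d (pi / 6)"]) auto
qed

text \<open>With \<open>y = 1 - 2 * w\<close>, a corner is entered at \<open>w = 0\<close> and left
  at \<open>w = 1\<close>; for radius 0 every corner gives \<open>v\<close>. In this form the
  identifications can be compared with those of the sectors of a round disk and of a square.\<close>

lemma sector_adj_iff:
  assumes v: "v \<in> B" and c: "c ` {..<n} = corners_at v" "inj_on c {..<n}"
    and nx: "\<And>i j. i < n ==> j < n ==> out_edge (c i) = in_edge (c j) \<longleftrightarrow> j = cyclic_succ n i"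
    and \<epsilon>: "\<epsilon> \<in> {0<..pi / 6}" and ij: "i < n" "j < n"
    and r: "\<rho> \<in> {0..1}" "\<rho>' \<in> {0..1}" and w: "w \<in> {0..1}" "w' \<in> {0..1}"
  shows "sector (c i) (\<epsilon> * \<rho>) (1 - 2 * w) = sector (c j) (\<epsilon> * \<rho>') (1 - 2 * w') \<longleftrightarrow>
    \<rho> = \<rho>' \<and> (\<rho> = 0 \<or> cyclic_adj n i w j w')"
proof -
  have cT: "c k \<in> T \<times> {1, 3}" "rim (fst (c k)) (real (snd (c k))) = v" if "k < n" for k
  proof -
    have "c k \<in> corners_at v" using c(1) that by blast
    then show "c k \<in> T \<times> {1, 3}" "rim (fst (c k)) (real (snd (c k))) = v"
      unfolding bullet_corners[OF v] by auto
  qed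
  have y: "\<bar>1 - 2 * w\<bar> \<le> 1" "\<bar>1 - 2 * w'\<bar> \<le> 1" using w by auto
  have pos: "\<epsilon> * \<rho> \<in> {0<..pi / 6}" if "\<rho> \<in> {0..1}" "\<rho> ~= 0" for \<rho>
  proof -
    have "\<epsilon> * \<rho> \<le> \<epsilon> * 1" using \<epsilon> that by (intro mult_left_mono) auto
    moreover have "\<epsilon> \<le> pi / 6" "0 < \<epsilon> * \<rho>" using \<epsilon> that by auto
    ultimately have "0 < \<epsilon> * \<rho>" "\<epsilon> * \<rho> \<le> pi / 6" by linarith+
    then show ?thesis by simp
  qed
  have zero: "sector (c k) (\<epsilon> * 0) y = v" if "k < n" for k y
    using sector_vertex[OF cT(1)[OF that], of y] cT(2)[OF that] by simp
  have nzero: "sector (c k) (\<epsilon> * \<rho>) y ~= v" if "k < n" "\<rho> \<in> {0..1}" "\<rho> ~= 0" "\<bar>y\<bar> \<le> 1" for k \<rho> y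
    using sector_not_bullet[OF cT(1)[OF that(1)] pos[OF that(2,3)] that(4)] v by auto
  consider "\<rho> = 0" "\<rho>' = 0" | "\<rho> = 0" "\<rho>' ~= 0" | "\<rho> ~= 0" "\<rho>' = 0" | "\<rho> ~= 0" "\<rho>' ~= 0" by blast
  then show ?thesis
  proof cases
    case 1 then show ?thesis using zero[OF ij(1)] zero[OF ij(2)] by simp
  next
    case 2 then show ?thesis using zero[OF ij(1)] nzero[OF ij(2) r(2) _ y(2)] by metis
  next
    case 3 then show ?thesis using zero[OF ij(2)] nzero[OF ij(1) r(1) _ y(1)] by metis
  next
    case 4
    have e: "\<epsilon> * \<rho> = \<epsilon> * \<rho>' \<longleftrightarrow> \<rho> = \<rho>'" using \<epsilon> by auto
    have cij: "c i = c j \<longleftrightarrow> i = j" using inj_on_eq_iff[OF c(2)] ij by simp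
    have nx': "in_edge (c i) = out_edge (c j) \<longleftrightarrow> i = cyclic_succ n j"
      unfolding nx[OF ij(2,1), symmetric] by (rule eq_commute)
    have ws: "1 - 2 * w = 1 - 2 * w' \<longleftrightarrow> w = w'" "1 - 2 * w = -1 \<longleftrightarrow> w = 1" "1 - 2 * w = 1 \<longleftrightarrow> w = 0"
      "1 - 2 * w' = -1 \<longleftrightarrow> w' = 1" "1 - 2 * w' = 1 \<longleftrightarrow> w' = 0" by auto
    show ?thesis
      unfolding sector_eq_iff[OF cT(1)[OF ij(1)] cT(1)[OF ij(2)] pos[OF r(1) 4(1)] pos[OF r(2) 4(2)] y]
        e cij nx[OF ij] nx' ws cyclic_adj_def using 4(1) by simp
  qed
qed

text \<open>Both spaces are cones over a cycle of \<open>n\<close> arcs: the round disk cut into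
  \<open>n\<close> equal sectors, and the sectors at the corners in their order of rotation.
  Restricting the radius to \<open>fst y < 1\<close> yields the open disk.\<close>

lemma disk_homeomorphic_ball:
  assumes v: "v \<in> B" and \<epsilon>: "\<epsilon> \<in> {0<..pi / 6}" shows "disk v \<epsilon> homeomorphic ball (0::complex) 1"
proof -
  obtain e where "e \<in> E" "v \<in> e" using vertex_on_edge B_V v by blast
  then obtain c0 where c0: "c0 \<in> corners_at v" using edge_at_vertex B_V v by blast
  obtain n and c :: "nat => 'a set \<times> nat" where n: "n > 0" and c: "c ` {..<n} = corners_at v" "inj_on c {..<n}"
    and nx: "\<And>i j. i < n ==> j < n ==> out_edge (c i) = in_edge (c j) \<longleftrightarrow> j = cyclic_succ n i"
    using corner_cycle[OF v c0] unfolding cyclic_succ_def by metis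
  define Y where "Y = {0..1::real} \<times> {0..1::real}"
  define N where "N = {y \<in> Y. fst y < 1}"
  \<comment> \<open>The shift by 1 adapts indices counted from 0 to the period of
    \<open>circle_point\<close>, which runs from 1 to \<open>n + 1\<close>.\<close>
  define p where "p i y = of_real (fst y) * circle_point n (real i + 1 + snd y)" for i and y :: "real \<times> real"
  define q where "q i y = sector (c i) (\<epsilon> * fst y) (1 - 2 * snd y)" for i and y :: "real \<times> real"
  have Yc: "compact Y" unfolding Y_def by (intro compact_Times compact_Icc)
  have p_cont: "continuous_on Y (p i)" for i unfolding p_def by (intro continuous_intros)
  have q_cont: "continuous_on Y (q i)" if "i < n" for i
  proof -
    have "c i \<in> corners_at v" using c(1) that by blast
    then have t: "fst (c i) \<in> T" unfolding bullet_corners[OF v] by auto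
    show ?thesis unfolding q_def sector_def
      by (rule continuous_on_compose2[OF \<omega>_cont[OF t]])
        (auto intro!: continuous_intros cap_cball simp: Y_def)
  qed
  have eq: "p i y = p j z \<longleftrightarrow> q i y = q j z" if "i < n" "j < n" "y \<in> Y" "z \<in> Y" for i j y z
  proof -
    have y: "fst y \<in> {0..1}" "snd y \<in> {0..1}" and z: "fst z \<in> {0..1}" "snd z \<in> {0..1}"
      using that by (auto simp: Y_def)
    have rng: "real i + 1 + snd y \<in> {1..real n + 1}" "real j + 1 + snd z \<in> {1..real n + 1}" using that(1,2) y z by auto
    let ?\<beta> = "\<lambda>k. real k + 1"
    have "p i y = p j z \<longleftrightarrow> fst y = fst z \<and> (fst y = 0 \<or>
        circle_point n (real i + 1 + snd y) = circle_point n (real j + 1 + snd z))"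
      unfolding p_def using y z by (intro polar_eq_iff) auto
    also have "circle_point n (real i + 1 + snd y) = circle_point n (real j + 1 + snd z) \<longleftrightarrow>
        ?\<beta> i + snd y * (?\<beta> (i + 1) - ?\<beta> i) = ?\<beta> j + snd z * (?\<beta> (j + 1) - ?\<beta> j) \<or>
      {?\<beta> i + snd y * (?\<beta> (i + 1) - ?\<beta> i), ?\<beta> j + snd z * (?\<beta> (j + 1) - ?\<beta> j)} = {?\<beta> 0, ?\<beta> n}"
      unfolding circle_point_eq_iff[OF n rng] by simp
    also have "\<dots> \<longleftrightarrow> cyclic_adj n i (snd y) j (snd z)"
      by (rule interpolation_cyclic) (use that y z in auto)
    finally have "p i y = p j z \<longleftrightarrow> fst y = fst z \<and> (fst y = 0 \<or> cyclic_adj n i (snd y) j (snd z))" .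
    moreover have "q i y = q j z \<longleftrightarrow> fst y = fst z \<and> (fst y = 0 \<or> cyclic_adj n i (snd y) j (snd z))"
      unfolding q_def by (rule sector_adj_iff[OF v c _ \<epsilon> that(1,2) y(1) z(1) y(2) z(2)]) (rule nx)
    ultimately show ?thesis by simp
  qed
  obtain f g where fg: "homeomorphism (\<Union>i\<in>{..<n}. p i ` N) (\<Union>i\<in>{..<n}. q i ` N) f g"
    by (rule homeomorphism_from_compact_pieces[of "{..<n}" "\<lambda>_. Y" p q "\<lambda>_. N"])
      (use p_cont q_cont Yc eq in \<open>auto simp: N_def\<close>)
  have "(\<Union>i\<in>{..<n}. p i ` N) = ball 0 1"
  proof (intro equalityI subsetI)
    fix x assume "x \<in> (\<Union>i\<in>{..<n}. p i ` N)"
    then show "x \<in> ball 0 1" by (auto simp: p_def N_def Y_def norm_mult)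
  next
    fix x :: complex assume x: "x \<in> ball 0 1"
    obtain w where w: "norm w = 1" "x = of_real (norm x) * w"
    proof (cases "x = 0")
      case True then show ?thesis using that[of 1] by simp
    next
      case False then show ?thesis using that[of "x / of_real (norm x)"] by (simp add: norm_divide)
    qed
    have "w \<in> sphere 0 1" using w(1) by simp
    then obtain s where s: "s \<in> {1..<real n + 1}" "w = circle_point n s" unfolding sphere_circle_point[OF n] by blast
    obtain j where j: "j \<in> {1..n}" "s \<in> {real j..<real j + 1}" using ex_side_index[OF s(1)] .
    have "x = p (j - 1) (norm x, s - real j)" using w(2) s(2) j(1) by (simp add: p_def of_nat_diff)
    moreover have "(norm x, s - real j) \<in> N" using x j by (auto simp: N_def Y_def)
    moreover have "j - 1 < n" using j(1) by auto
    ultimately show "x \<in> (\<Union>i\<in>{..<n}. p i ` N)" by blast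
  qed
  moreover have "(\<Union>i\<in>{..<n}. q i ` N) = disk v \<epsilon>"
  proof (intro equalityI subsetI)
    fix x assume "x \<in> (\<Union>i\<in>{..<n}. q i ` N)"
    then obtain i y where iy: "i < n" "y \<in> N" "x = q i y" by blast
    have "c i \<in> corners_at v" using c(1) iy(1) by blast
    moreover have "\<epsilon> * fst y < \<epsilon> * 1" using iy(2) \<epsilon> by (intro mult_strict_left_mono) (auto simp: N_def)
    then have "\<epsilon> * fst y \<in> {0..<\<epsilon>}" using iy(2) \<epsilon> by (auto simp: N_def Y_def)
    moreover have "1 - 2 * snd y \<in> {-1..1}" using iy(2) by (auto simp: N_def Y_def)
    ultimately show "x \<in> disk v \<epsilon>" unfolding disk_def iy(3) q_def by blast
  next
    fix x assume "x \<in> disk v \<epsilon>"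
    then obtain d a y where d: "x = sector d a y" "d \<in> corners_at v" "a \<in> {0..<\<epsilon>}" "y \<in> {-1..1}"
      unfolding disk_def by blast
    then obtain i where i: "i < n" "d = c i" using c(1) by blast
    have "1 - 2 * ((1 - y) / 2) = y" by (simp add: field_simps)
    moreover have "\<epsilon> * (a / \<epsilon>) = a" using \<epsilon> by simp
    ultimately have "x = q i (a / \<epsilon>, (1 - y) / 2)" using d(1) i(2) unfolding q_def fst_conv snd_conv by metis
    moreover have "(a / \<epsilon>, (1 - y) / 2) \<in> N" using d(3,4) \<epsilon> by (auto simp: N_def Y_def)
    ultimately show "x \<in> (\<Union>i\<in>{..<n}. q i ` N)" using i(1) by blast
  qed
  ultimately have "homeomorphism (ball 0 1) (disk v \<epsilon>) f g" using fg by simp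
  then show ?thesis unfolding homeomorphic_def using homeomorphism_symD by blast
qed

end

section \<open>Moebius bands\<close>

definition clamp01 :: "real => real" where "clamp01 x = max 0 (min 1 x)"

text \<open>The boundary of the square \<open>[-1, 1]\<^sup>2\<close>, run through counterclockwise from the corner \<open>(-1, 1)\<close> in four unit time steps.\<close>

definition square_rim :: "real => complex" where
  "square_rim s = Complex (2 * clamp01 (s - 1) - 2 * clamp01 (s - 3) - 1) (1 - 2 * clamp01 s + 2 * clamp01 (s - 2))"

lemma square_rim_values:
  "s \<in> {0..1} ==> square_rim s = Complex (-1) (1 - 2 * s)"
  "s \<in> {1..2} ==> square_rim s = Complex (2 * s - 3) (-1)"
  "s \<in> {2..3} ==> square_rim s = Complex 1 (2 * s - 5)"
  "s \<in> {3..4} ==> square_rim s = Complex (7 - 2 * s) 1"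
  by (auto simp: square_rim_def clamp01_def)

lemma square_rim_cases:
  assumes "s \<in> {0..4::real}" obtains "s \<in> {0..1}" | "s \<in> {1..2}" | "s \<in> {2..3}" | "s \<in> {3..4}"
  using assms by fastforce

text \<open>The gauge of the square, in the part of the norm when the square is described by polar
  coordinates over \<open>square_rim\<close>.\<close>

definition sup_norm :: "complex => real" where "sup_norm z = max \<bar>Re z\<bar> \<bar>Im z\<bar>"

lemma sup_norm_scale: "a \<ge> 0 ==> sup_norm (of_real a * z) = a * sup_norm z"
  by (simp add: sup_norm_def abs_mult max_mult_distrib_left)

lemma sup_norm_square_rim: "s \<in> {0..4} ==> sup_norm (square_rim s) = 1"
  by (erule square_rim_cases) (auto simp: square_rim_values sup_norm_def)

lemma square_rim_eq_iff:
  assumes "s \<in> {0..4}" "s' \<in> {0..4}"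
  shows "square_rim s = square_rim s' \<longleftrightarrow> s = s' \<or> {s, s'} = {0, 4}"
  unfolding doubleton_eq_iff
  by (rule square_rim_cases[OF assms(1)]; rule square_rim_cases[OF assms(2)]) (simp_all add: square_rim_values; linarith)+

lemma square_rim_inner:
  assumes "s \<in> {0..4}" "\<bar>Im (square_rim s)\<bar> < 1" shows "0 < s \<and> s < 1 \<or> 2 < s \<and> s < 3"
  by (rule square_rim_cases[OF assms(1)]) (use assms(2) in \<open>auto simp: square_rim_values\<close>)

lemma square_rim_surj:
  assumes "sup_norm z = 1" shows "\<exists>s\<in>{0..4}. z = square_rim s"
proof -
  have b: "\<bar>Re z\<bar> \<le> 1" "\<bar>Im z\<bar> \<le> 1" using assms by (auto simp: sup_norm_def)
  have "\<bar>Re z\<bar> = 1 \<or> \<bar>Im z\<bar> = 1" using assms by (auto simp: sup_norm_def max_def split: if_splits)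
  then consider "Re z = -1" | "Im z = -1" | "Re z = 1" | "Im z = 1" by linarith
  then show ?thesis
  proof cases
    case 1
    then have "z = square_rim ((1 - Im z) / 2)" using b by (subst square_rim_values(1)) (auto simp: complex_eq_iff field_simps)
    then show ?thesis using b by (intro bexI[of _ "(1 - Im z) / 2"]) auto
  next
    case 2
    then have "z = square_rim ((Re z + 3) / 2)" using b by (subst square_rim_values(2)) (auto simp: complex_eq_iff field_simps)
    then show ?thesis using b by (intro bexI[of _ "(Re z + 3) / 2"]) auto
  next
    case 3
    then have "z = square_rim ((Im z + 5) / 2)" using b by (subst square_rim_values(3)) (auto simp: complex_eq_iff field_simps)
    then show ?thesis using b by (intro bexI[of _ "(Im z + 5) / 2"]) auto
  next
    case 4
    then have "z = square_rim ((7 - Re z) / 2)" using b by (subst square_rim_values(4)) (auto simp: complex_eq_iff field_simps)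
    then show ?thesis using b by (intro bexI[of _ "(7 - Re z) / 2"]) auto
  qed
qed

lemma square_polar_eq_iff:
  assumes "s \<in> {0..4}" "s' \<in> {0..4}" "a \<ge> 0" "b \<ge> 0"
  shows "of_real a * square_rim s = of_real b * square_rim s' \<longleftrightarrow> a = b \<and> (a = 0 \<or> square_rim s = square_rim s')"
proof
  assume eq: "of_real a * square_rim s = of_real b * square_rim s'"
  then have "sup_norm (of_real a * square_rim s) = sup_norm (of_real b * square_rim s')" by simp
  then have "a = b" using assms by (simp add: sup_norm_scale sup_norm_square_rim)
  then show "a = b \<and> (a = 0 \<or> square_rim s = square_rim s')" using eq by auto
qed auto

lemma square_polar_ex:
  assumes "sup_norm z \<le> 1" shows "\<exists>a\<in>{0..1}. \<exists>s\<in>{0..4}. z = of_real a * square_rim s"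
proof (cases "sup_norm z = 0")
  case True
  then have "z = 0" by (auto simp: sup_norm_def max_def complex_eq_iff split: if_splits)
  then show ?thesis by (intro bexI[of _ 0] bexI[of _ 0]) auto
next
  case False
  have p: "sup_norm z \<ge> 0" by (simp add: sup_norm_def max_def)
  have zz: "z = of_real (sup_norm z) * (of_real (1 / sup_norm z) * z)" using False by simp
  have "sup_norm (of_real (1 / sup_norm z) * z) = 1" using False p by (subst sup_norm_scale) auto
  then obtain s where "s \<in> {0..4}" "of_real (1 / sup_norm z) * z = square_rim s" using square_rim_surj by blast
  then show ?thesis using zz p assms by (intro bexI[of _ "sup_norm z"] bexI[of _ s]) auto
qed

lemma continuous_on_square_rim [continuous_intros]:
  fixes f :: "'b::t2_space => real"
  assumes "continuous_on A f" shows "continuous_on A (\<lambda>x. square_rim (f x))"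
proof -
  have *: "square_rim s = of_real (2 * clamp01 (s - 1) - 2 * clamp01 (s - 3) - 1) +
      \<i> * of_real (1 - 2 * clamp01 s + 2 * clamp01 (s - 2))" for s
    by (simp add: square_rim_def complex_eq_iff)
  show ?thesis unfolding * clamp01_def by (intro continuous_intros assms)
qed

text \<open>The Moebius band consists of the points over the upper half circle and, as a square, those over the lower one.\<close>

definition upper_band :: "real => real => complex \<times> complex" where
  "upper_band s r = (cis (pi * s), r *\<^sub>R cis (pi * s / 2))"

definition lower_band :: "complex => complex \<times> complex" where
  "lower_band z = (cis (pi + pi * (Re z + 1) / 2), Im z *\<^sub>R cis ((pi + pi * (Re z + 1) / 2) / 2))"

lemma lower_angle:
  assumes "\<bar>x\<bar> \<le> 1" shows "pi + pi * (x + 1) / 2 \<in> {pi..2 * pi}"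
proof -
  have "0 \<le> pi * (x + 1)" using assms by simp
  moreover have "pi * (x + 1) \<le> pi * 2" using assms by (intro mult_left_mono) auto
  ultimately show ?thesis by simp
qed

lemma lower_band_eq_iff:
  assumes "\<bar>Re z\<bar> \<le> 1" "\<bar>Re z'\<bar> \<le> 1" shows "lower_band z = lower_band z' \<longleftrightarrow> z = z'"
proof
  assume eq: "lower_band z = lower_band z'"
  let ?a = "pi + pi * (Re z + 1) / 2" and ?b = "pi + pi * (Re z' + 1) / 2"
  have r: "?a \<in> {pi..2 * pi}" "?b \<in> {pi..2 * pi}" using lower_angle assms by blast+
  then have "?a \<in> {0..0 + 2 * pi}" "?b \<in> {0..0 + 2 * pi}" using pi_gt_zero by auto
  moreover have "cis ?a = cis ?b" using eq by (simp add: lower_band_def)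
  ultimately have "?a = ?b \<or> {?a, ?b} = {0, 0 + 2 * pi}" using cis_eq_iff_within_period by blast
  moreover have "?a > 0" "?b > 0" using r pi_gt_zero unfolding atLeastAtMost_iff by linarith+
  ultimately have "?a = ?b" unfolding doubleton_eq_iff by linarith
  then have R: "Re z = Re z'" by simp
  then have "Im z = Im z'" using eq by (simp add: lower_band_def)
  then show "z = z'" using R by (simp add: complex_eq_iff)
qed simp

lemma upper_band_eq_iff:
  assumes "s \<in> {0..1}" "s' \<in> {0..1}" shows "upper_band s r = upper_band s' r' \<longleftrightarrow> s = s' \<and> r = r'"
proof
  assume eq: "upper_band s r = upper_band s' r'"
  have "pi * s \<le> pi * 1" "pi * s' \<le> pi * 1" using assms by (auto intro: mult_left_mono)
  then have "pi * s \<in> {0..0 + 2 * pi}" "pi * s' \<in> {0..0 + 2 * pi}" "pi * s < 2 * pi" "pi * s' < 2 * pi"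
    using assms pi_gt_zero by auto
  moreover have "cis (pi * s) = cis (pi * s')" using eq by (simp add: upper_band_def)
  ultimately have "s = s'" using cis_eq_iff_within_period[of "pi * s" 0 "pi * s'"] by (auto simp: doubleton_eq_iff)
  then show "s = s' \<and> r = r'" using eq by (simp add: upper_band_def)
qed auto

text \<open>Over the angle \<open>pi\<close> both parametrisations use the same direction of the
  fibre. The angles 0 and \<open>2 * pi\<close> are the same point of the circle, but their halves 0
  and \<open>pi\<close> give opposite directions, so there the fibre coordinate changes
  sign.\<close>

lemma upper_lower_band_eq_iff:
  assumes s: "s \<in> {0..1}" and z: "\<bar>Re z\<bar> \<le> 1"
  shows "upper_band s r = lower_band z \<longleftrightarrow> s = 1 \<and> Re z = -1 \<and> Im z = r \<or> s = 0 \<and> Re z = 1 \<and> Im z = - r"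
proof
  let ?b = "pi + pi * (Re z + 1) / 2"
  assume eq: "upper_band s r = lower_band z"
  have b: "?b \<in> {pi..2 * pi}" by (rule lower_angle[OF z])
  have ps: "pi * s \<le> pi" "0 \<le> pi * s" using s mult_left_mono[of s 1 pi] by auto
  then have "pi * s \<in> {0..0 + 2 * pi}" "?b \<in> {0..0 + 2 * pi}" using b pi_gt_zero by auto
  moreover have "cis (pi * s) = cis ?b" using eq by (simp add: upper_band_def lower_band_def)
  ultimately have "pi * s = ?b \<or> {pi * s, ?b} = {0, 0 + 2 * pi}" using cis_eq_iff_within_period by blast
  then consider "pi * s = ?b" | "pi * s = 0" "?b = 2 * pi"
    unfolding doubleton_eq_iff using ps b pi_gt_zero by force
  then show "s = 1 \<and> Re z = -1 \<and> Im z = r \<or> s = 0 \<and> Re z = 1 \<and> Im z = - r"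
  proof cases
    case 1
    then have "pi * s = pi * 1" "?b = pi" using ps b by auto
    then have "s = 1" "pi * (Re z + 1) = 0" by simp_all
    then have "s = 1" "Re z = -1" by auto
    then show ?thesis using eq by (simp add: upper_band_def lower_band_def)
  next
    case 2
    then have "pi * (Re z + 1) = pi * 2" by simp
    then have "Re z + 1 = 2" by (simp only: mult_left_cancel[OF pi_neq_zero])
    then have "s = 0" "Re z = 1" using 2 by auto
    then show ?thesis using eq by (auto simp: upper_band_def lower_band_def complex_eq_iff)
  qed
next
  assume "s = 1 \<and> Re z = -1 \<and> Im z = r \<or> s = 0 \<and> Re z = 1 \<and> Im z = - r"
  then show "upper_band s r = lower_band z"
    by (auto simp: upper_band_def lower_band_def complex_eq_iff)
qed

lemma moebius_band_eq:
  "moebius_band = {upper_band s r | s r. s \<in> {0..1} \<and> \<bar>r\<bar> < 1} \<union> {lower_band z | z. \<bar>Re z\<bar> \<le> 1 \<and> \<bar>Im z\<bar> < 1}"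
proof (intro equalityI subsetI)
  fix x assume "x \<in> moebius_band"
  then obtain \<theta> r where x: "x = (cis \<theta>, r *\<^sub>R cis (\<theta> / 2))" "\<bar>r\<bar> < 1" unfolding moebius_band_def by blast
  obtain \<theta>' where \<theta>': "\<theta>' \<in> {0..<0 + 2 * pi}" "cis \<theta> = cis \<theta>'"
    using cis_surj_period[of "cis \<theta>" 0] by (metis norm_cis)
  then obtain k :: int where k: "\<theta> = \<theta>' + 2 * pi * k" using cis_eq_iff_int by blast
  \<comment> \<open>Removing \<open>k\<close> full turns from \<open>\<theta>\<close> removes
    \<open>k\<close> half turns from the direction of the fibre; the resulting sign is absorbed into
    \<open>r'\<close>.\<close>
  have "cis (\<theta> / 2) = cis (\<theta>' / 2) * cis (pi * k)" unfolding k cis_mult by (simp add: add_divide_distrib)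
  also have "cis (pi * k) = 1 \<or> cis (pi * k) = -1"
    by (cases "even k") (auto simp: complex_eq_iff cos_integer_2pi elim!: evenE oddE simp: algebra_simps cos_add sin_add sin_integer_2pi)
  then obtain r' where r': "r *\<^sub>R cis (\<theta>' / 2) * cis (pi * k) = r' *\<^sub>R cis (\<theta>' / 2)" "\<bar>r'\<bar> < 1"
    using x(2) that[of r] that[of "- r"] by auto
  ultimately have x': "x = (cis \<theta>', r' *\<^sub>R cis (\<theta>' / 2))" using x(1) \<theta>'(2) by simp
  show "x \<in> {upper_band s r | s r. s \<in> {0..1} \<and> \<bar>r\<bar> < 1} \<union> {lower_band z | z. \<bar>Re z\<bar> \<le> 1 \<and> \<bar>Im z\<bar> < 1}"
  proof (cases "\<theta>' \<le> pi")
    case True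
    have "x = upper_band (\<theta>' / pi) r'" using x' by (simp add: upper_band_def)
    moreover have "\<theta>' / pi \<in> {0..1}" using True \<theta>'(1) by (simp add: field_simps)
    ultimately show ?thesis using r'(2) by blast
  next
    case False
    let ?z = "Complex (2 * (\<theta>' - pi) / pi - 1) r'"
    have "pi + pi * (Re ?z + 1) / 2 = \<theta>'" by (simp add: field_simps)
    then have "x = lower_band ?z" using x' unfolding lower_band_def by simp
    moreover have "\<bar>Re ?z\<bar> \<le> 1" using False \<theta>'(1) by (auto simp: field_simps abs_le_iff)
    moreover have "\<bar>Im ?z\<bar> < 1" using r'(2) by simp
    ultimately show ?thesis by blast
  qed
next
  fix x assume "x \<in> {upper_band s r | s r. s \<in> {0..1} \<and> \<bar>r\<bar> < 1} \<union> {lower_band z | z. \<bar>Re z\<bar> \<le> 1 \<and> \<bar>Im z\<bar> < 1}"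
  then show "x \<in> moebius_band" unfolding moebius_band_def upper_band_def lower_band_def by blast
qed

text \<open>The part of the unit disk between the chords at angular distance \<open>\<epsilon>\<close> from \<open>1\<close> and \<open>-1\<close>.\<close>

definition core :: "real => real => real => complex" where
  "core \<epsilon> s r = Complex (cos \<epsilon> * (1 - 2 * s)) (r * sqrt (1 - (cos \<epsilon> * (1 - 2 * s))\<^sup>2))"

lemma core_Re: "Re (core \<epsilon> s r) = cos \<epsilon> * (1 - 2 * s)"
  by (simp add: core_def)

lemma core_width:
  assumes "\<epsilon> \<in> {0<..pi / 6}" "s \<in> {0..1}"
  shows "\<bar>cos \<epsilon> * (1 - 2 * s)\<bar> \<le> cos \<epsilon>" "(cos \<epsilon> * (1 - 2 * s))\<^sup>2 < 1" "cos \<epsilon> > 0" "cos \<epsilon> < 1"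
proof -
  show c: "cos \<epsilon> > 0" using assms(1) by (intro cos_gt_zero) auto
  show c1: "cos \<epsilon> < 1" using cos_monotone_0_pi[of 0 \<epsilon>] assms(1) by simp
  have "\<bar>cos \<epsilon> * (1 - 2 * s)\<bar> = cos \<epsilon> * \<bar>1 - 2 * s\<bar>" using c by (simp add: abs_mult)
  also have "\<dots> \<le> cos \<epsilon> * 1" using c assms(2) by (intro mult_left_mono) auto
  finally show w: "\<bar>cos \<epsilon> * (1 - 2 * s)\<bar> \<le> cos \<epsilon>" by simp
  show "(cos \<epsilon> * (1 - 2 * s))\<^sup>2 < 1" using w c1 abs_square_less_1 by (metis le_less_trans)
qed

lemma core_norm:
  assumes "\<epsilon> \<in> {0<..pi / 6}" "s \<in> {0..1}"
  shows "\<bar>r\<bar> \<le> 1 ==> core \<epsilon> s r \<in> cball 0 1" "\<bar>r\<bar> < 1 ==> core \<epsilon> s r \<in> ball 0 1"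
proof -
  let ?x = "cos \<epsilon> * (1 - 2 * s)"
  have x: "?x\<^sup>2 < 1" using core_width[OF assms] by blast
  have n: "(norm (core \<epsilon> s r))\<^sup>2 = ?x\<^sup>2 + r\<^sup>2 * (1 - ?x\<^sup>2)"
    using x by (simp add: core_def cmod_power2 power_mult_distrib)
  show "core \<epsilon> s r \<in> cball 0 1" if "\<bar>r\<bar> \<le> 1"
  proof -
    have "r\<^sup>2 \<le> 1" "0 \<le> 1 - ?x\<^sup>2" using that x by (simp add: abs_square_le_1, linarith)
    then have "r\<^sup>2 * (1 - ?x\<^sup>2) \<le> 1 * (1 - ?x\<^sup>2)" by (rule mult_right_mono)
    then have "(norm (core \<epsilon> s r))\<^sup>2 \<le> 1" unfolding n by simp
    then show ?thesis using power2_le_imp_le[of "norm (core \<epsilon> s r)" 1] by simp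
  qed
  show "core \<epsilon> s r \<in> ball 0 1" if "\<bar>r\<bar> < 1"
  proof -
    have "r\<^sup>2 < 1" "0 < 1 - ?x\<^sup>2" using that x by (simp add: abs_square_less_1, linarith)
    then have "r\<^sup>2 * (1 - ?x\<^sup>2) < 1 * (1 - ?x\<^sup>2)" by (rule mult_strict_right_mono)
    then have "(norm (core \<epsilon> s r))\<^sup>2 < 1" unfolding n by simp
    then show ?thesis using power2_less_imp_less[of "norm (core \<epsilon> s r)" 1] by simp
  qed
qed

lemma core_eq_iff:
  assumes "\<epsilon> \<in> {0<..pi / 6}" "s \<in> {0..1}" "s' \<in> {0..1}"
  shows "core \<epsilon> s r = core \<epsilon> s' r' \<longleftrightarrow> s = s' \<and> r = r'"
proof
  assume eq: "core \<epsilon> s r = core \<epsilon> s' r'"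
  have c: "cos \<epsilon> > 0" using core_width[OF assms(1,2)] by blast
  have "cos \<epsilon> * (1 - 2 * s) = cos \<epsilon> * (1 - 2 * s')" using eq by (simp add: core_def)
  then have s: "s = s'" using c by simp
  have "sqrt (1 - (cos \<epsilon> * (1 - 2 * s))\<^sup>2) > 0" using core_width(2)[OF assms(1,2)] by simp
  then have "r = r'" using eq unfolding s[symmetric] by (simp add: core_def)
  then show "s = s' \<and> r = r'" using s by simp
qed auto

text \<open>On the two end chords \<open>r\<close> is the coordinate \<open>y\<close> of the caps,
  so the strip is glued to the sectors with no change of coordinates.\<close>

lemma core_ends:
  assumes "\<epsilon> \<in> {0<..pi / 6}" shows "core \<epsilon> 0 r = cap 1 \<epsilon> r" "core \<epsilon> 1 r = cap 3 \<epsilon> r"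
proof -
  have "sin \<epsilon> \<ge> 0" using assms by (intro sin_ge_zero) auto
  moreover have "1 - (cos \<epsilon>)\<^sup>2 = (sin \<epsilon>)\<^sup>2" using sin_cos_squared_add[of \<epsilon>] by linarith
  ultimately have "sqrt (1 - (cos \<epsilon>)\<^sup>2) = sin \<epsilon>" by simp
  then show "core \<epsilon> 0 r = cap 1 \<epsilon> r" "core \<epsilon> 1 r = cap 3 \<epsilon> r" by (simp_all add: core_def cap_def)
qed

lemma core_surj:
  assumes "\<epsilon> \<in> {0<..pi / 6}" "z \<in> ball 0 1" "\<bar>Re z\<bar> \<le> cos \<epsilon>"
  obtains s r where "s \<in> {0..1}" "\<bar>r\<bar> < 1" "z = core \<epsilon> s r"
proof -
  have c: "cos \<epsilon> > 0" using core_width[OF assms(1), of 0] by auto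
  define s where "s = (1 - Re z / cos \<epsilon>) / 2"
  have x: "cos \<epsilon> * (1 - 2 * s) = Re z" using c by (simp add: s_def field_simps)
  have s01: "s \<in> {0..1}" using assms(3) c by (auto simp: s_def field_simps abs_le_iff)
  have "(norm z)\<^sup>2 < 1" using assms(2) by (simp add: abs_square_less_1)
  then have i: "(Im z)\<^sup>2 < 1 - (Re z)\<^sup>2" by (simp add: cmod_power2)
  then have q: "sqrt (1 - (Re z)\<^sup>2) > 0" by (smt (verit) real_sqrt_gt_zero zero_le_power2)
  have "\<bar>Im z\<bar> < sqrt (1 - (Re z)\<^sup>2)" using i by (rule real_less_rsqrt[of "\<bar>Im z\<bar>", simplified])
  then have "\<bar>Im z / sqrt (1 - (Re z)\<^sup>2)\<bar> < 1" using q by (simp add: field_simps)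
  moreover have "z = core \<epsilon> s (Im z / sqrt (1 - (Re z)\<^sup>2))"
    unfolding core_def x using q by (simp add: complex_eq_iff)
  ultimately show ?thesis using that s01 by blast
qed

lemma continuous_on_core [continuous_intros]:
  fixes f :: "'b::t2_space => real"
  assumes "continuous_on A f" "continuous_on A g"
  shows "continuous_on A (\<lambda>x. core \<epsilon> (f x) (g x))"
proof -
  have *: "core \<epsilon> s r = of_real (cos \<epsilon> * (1 - 2 * s)) + \<i> * of_real (r * sqrt (1 - (cos \<epsilon> * (1 - 2 * s))\<^sup>2))" for s r
    by (simp add: core_def complex_eq_iff)
  show ?thesis unfolding * by (intro continuous_intros assms)
qed

lemma continuous_on_upper_band [continuous_intros]:
  fixes f :: "'b::t2_space => real"
  assumes "continuous_on A f" "continuous_on A g" shows "continuous_on A (\<lambda>x. upper_band (f x) (g x))"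
  unfolding upper_band_def by (intro continuous_intros assms) simp

lemma continuous_on_lower_band [continuous_intros]:
  fixes f :: "'b::t2_space => complex"
  assumes "continuous_on A f" shows "continuous_on A (\<lambda>x. lower_band (f x))"
  unfolding lower_band_def by (intro continuous_intros assms) simp_all

text \<open>Distributes \<open>n\<close> corners over the rim of the square: corner 0 gets the left
  side, corner \<open>m\<close> the right side, the \<open>m - 1\<close> corners between them share
  the bottom, and the \<open>n - m - 1\<close> corners after \<open>m\<close> share the top.\<close>

definition break_point :: "nat => nat => nat => real" where
  "break_point m n i = (if i \<le> 1 then real i else if i \<le> m then 1 + (real i - 1) / (real m - 1)
     else 3 + (real i - real m - 1) / (real n - real m - 1))"

lemma break_point_mono:
  assumes "2 \<le> m" "m + 2 \<le> n" "i < j" shows "break_point m n i < break_point m n j"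
proof (rule lift_Suc_mono_less[OF _ assms(3)])
  fix i
  have p: "real m - 1 > 0" "real n - real m - 1 > 0" using assms by linarith+
  consider "i = 0" | "i = 1" | "1 < i" "i < m" | "i = m" | "m < i" by linarith
  then show "break_point m n i < break_point m n (Suc i)"
  proof cases
    case 1 then show ?thesis by (simp add: break_point_def)
  next
    case 2 then show ?thesis using assms p by (simp add: break_point_def)
  next
    case 3
    have "(real i - 1) / (real m - 1) < (real (Suc i) - 1) / (real m - 1)" using p by (intro divide_strict_right_mono) auto
    then show ?thesis using 3 by (simp add: break_point_def)
  next
    case 4
    then have "break_point m n i = 2" "break_point m n (Suc i) = 3" using assms p by (auto simp: break_point_def)
    then show ?thesis by simp
  next
    case 5
    have "(real i - real m - 1) / (real n - real m - 1) < (real (Suc i) - real m - 1) / (real n - real m - 1)"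
      using p by (intro divide_strict_right_mono) auto
    then show ?thesis using 5 assms by (simp add: break_point_def)
  qed
qed

lemma break_point_values:
  assumes "2 \<le> m" "m + 2 \<le> n"
  shows "break_point m n 0 = 0" "break_point m n 1 = 1" "break_point m n m = 2" "break_point m n (m + 1) = 3"
    "break_point m n n = 4"
proof -
  have p: "real m - 1 > 0" "real n - real m - 1 > 0" using assms by linarith+
  show "break_point m n 0 = 0" "break_point m n 1 = 1" by (simp_all add: break_point_def)
  show "break_point m n m = 2" "break_point m n (m + 1) = 3" "break_point m n n = 4"
    using assms p by (simp_all add: break_point_def)
qed

text \<open>The disk around \<open>v\<close> is modelled by a square with the two corners of
  \<open>t0\<close> at its vertical sides; the strip of \<open>t0\<close> between the corners joins
  these sides. Square and strip are the lower and the upper part of the model band.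
  \<open>ne\<close> guarantees that corners are left for the bottom and the top.\<close>

lemma (in flow_charts) moebius:
  assumes t0: "t0 \<in> T" and r1: "rim t0 1 = v" and r3: "rim t0 3 = v"
    and ne: "edge t0 3 ~= edge t0 1" "edge t0 5 ~= edge t0 2" and \<epsilon>: "\<epsilon> \<in> {0<..pi / 6}"
  shows "(t0 \<union> disk v \<epsilon>) homeomorphic moebius_band"
proof -
  have v: "v \<in> B" using bullets(1)[OF t0] r1 by simp
  have c13: "(t0, 3) \<in> corners_at v" "(t0, 1) \<in> corners_at v"
    unfolding bullet_corners[OF v] using t0 r1 r3 by auto
  obtain n and c :: "nat => 'a set \<times> nat" where n0: "n > 0" and c0: "c 0 = (t0, 3)"
    and c: "c ` {..<n} = corners_at v" "inj_on c {..<n}"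
    and nx0: "\<And>i j. i < n ==> j < n ==> out_edge (c i) = in_edge (c j) \<longleftrightarrow> j = (if i + 1 = n then 0 else i + 1)"
    by (rule corner_cycle[OF v c13(1)]) (rule that; assumption)
  have nx: "out_edge (c i) = in_edge (c j) \<longleftrightarrow> j = cyclic_succ n i" if "i < n" "j < n" for i j
    unfolding cyclic_succ_def by (rule nx0[OF that])
  have "(t0, 1) \<in> c ` {..<n}" using c13(2) c(1) by simp
  then obtain m where m: "m < n" "c m = (t0, 1)" by auto
  have m0: "m ~= 0"
  proof
    assume "m = 0"
    then show False using m(2) c0 by simp
  qed
  \<comment> \<open>Successive corners share an edge. Were \<open>(t0, 1)\<close> next to
    \<open>(t0, 3)\<close> in the rotation, side 3 would be glued to side 1, or, in the other order
    below, side 5 to side 2.\<close>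
  have m1: "m ~= 1"
  proof
    assume "m = 1"
    then have "m = cyclic_succ n 0" using m(1) by (auto simp: cyclic_succ_def)
    then have "out_edge (c 0) = in_edge (c m)" using nx[OF n0 m(1)] by simp
    then show False using ne(1) unfolding c0 m(2) by (simp add: in_edge_def out_edge_def)
  qed
  have mn: "m + 1 ~= n"
  proof
    assume "m + 1 = n"
    then have "0 = cyclic_succ n m" by (simp add: cyclic_succ_def)
    then have "out_edge (c m) = in_edge (c 0)" using nx[OF m(1) n0] by simp
    then show False using ne(2) unfolding c0 m(2) by (simp add: in_edge_def out_edge_def)
  qed
  have mm: "2 \<le> m" "m + 2 \<le> n" using m0 m1 mn m(1) by auto
  have cT: "fst (c i) \<in> T" "c i \<in> T \<times> {1, 3}" "rim (fst (c i)) (real (snd (c i))) = v" if "i < n" for i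
  proof -
    have "c i \<in> corners_at v" using c(1) that by blast
    then show "fst (c i) \<in> T" "c i \<in> T \<times> {1, 3}" "rim (fst (c i)) (real (snd (c i))) = v"
      unfolding bullet_corners[OF v] by auto
  qed
  define \<beta> where "\<beta> = break_point m n"
  have mono: "\<beta> i < \<beta> j" if "i < j" for i j unfolding \<beta>_def by (rule break_point_mono[OF mm that])
  have mono': "\<beta> i \<le> \<beta> j" if "i \<le> j" for i j using mono[of i j] that by (cases "i = j") auto
  note \<beta> = break_point_values[OF mm, folded \<beta>_def]
  define b where "b i w = \<beta> i + w * (\<beta> (i + 1) - \<beta> i)" for i w
  have b04: "b i w \<in> {0..4}" if "i < n" "w \<in> {0..1}" for i w
    using interpolation_eq_iff(2)[of n \<beta> i i w w] mono that \<beta> by (simp add: b_def)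
  have bl: "\<beta> i \<le> b i w" "b i w \<le> \<beta> (i + 1)" if "w \<in> {0..1}" for i w
  proof -
    have d: "\<beta> (i + 1) - \<beta> i > 0" using mono[of i "i + 1"] by simp
    then show "\<beta> i \<le> b i w" using that by (simp add: b_def)
    have "w * (\<beta> (i + 1) - \<beta> i) \<le> 1 * (\<beta> (i + 1) - \<beta> i)" using d that by (intro mult_right_mono) auto
    then show "b i w \<le> \<beta> (i + 1)" by (simp add: b_def)
  qed
  have b0: "b 0 w = w" and bm: "b m w = 2 + w" for w using \<beta> by (simp_all add: b_def)
  have loc: "i = 0 \<or> i = m" "0 < w" "w < 1"
    if "i < n" "w \<in> {0..1}" "0 < b i w \<and> b i w < 1 \<or> 2 < b i w \<and> b i w < 3" for i w
  proof -
    show im: "i = 0 \<or> i = m"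
    proof (rule ccontr)
      assume "\<not> ?thesis"
      then consider "0 < i" "i < m" | "m < i" by linarith
      then show False
      proof cases
        case 1
        then have "\<beta> 1 \<le> \<beta> i" "\<beta> (i + 1) \<le> \<beta> m" by (auto intro: mono')
        then show False using bl[OF that(2), of i] that(3) \<beta> by linarith
      next
        case 2
        then have "\<beta> (m + 1) \<le> \<beta> i" by (auto intro: mono')
        then show False using bl[OF that(2), of i] that(3) \<beta> by linarith
      qed
    qed
    then show "0 < w" "w < 1" using that(2,3) b0[of w] bm[of w] by auto
  qed
  define h where "h i w = square_rim (b i w)" for i w
  \<comment> \<open>Both vertical sides are run through counterclockwise. For the sector coordinate
    \<open>y = 1 - 2 * w\<close> the imaginary part is \<open>y\<close> on the left and
    \<open>- y\<close> on the right; this sign is the twist.\<close>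
  have h0: "h 0 w = Complex (-1) (1 - 2 * w)" and hm: "h m w = Complex 1 (2 * w - 1)" if "w \<in> {0..1}" for w
    using that by (simp_all add: h_def b0 bm square_rim_values)
  have h_adj: "h i w = h j w' \<longleftrightarrow> cyclic_adj n i w j w'" if "i < n" "j < n" "w \<in> {0..1}" "w' \<in> {0..1}" for i j w w'
  proof -
    have "h i w = h j w' \<longleftrightarrow> b i w = b j w' \<or> {b i w, b j w'} = {\<beta> 0, \<beta> n}"
      unfolding h_def using square_rim_eq_iff[OF b04[OF that(1,3)] b04[OF that(2,4)]] \<beta> by simp
    also have "\<dots> \<longleftrightarrow> cyclic_adj n i w j w'"
      unfolding b_def by (rule interpolation_cyclic) (use mono that in auto)
    finally show ?thesis .
  qed
  have h_polar: "of_real a * h i w = of_real a' * h j w' \<longleftrightarrow> a = a' \<and> (a = 0 \<or> h i w = h j w')"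
    if "i < n" "j < n" "w \<in> {0..1}" "w' \<in> {0..1}" "a \<in> {0..1}" "a' \<in> {0..1}" for i j w w' a a'
    unfolding h_def by (rule square_polar_eq_iff) (use b04 that in auto)
  have h_sup: "sup_norm (of_real a * h i w) = a" if "i < n" "w \<in> {0..1}" "a \<in> {0..1}" for i w a
    using sup_norm_scale[of a "h i w"] sup_norm_square_rim[OF b04[OF that(1,2)]] that(3) by (simp add: h_def)
  have h_Re: "\<bar>Re (of_real a * h i w)\<bar> \<le> 1" "\<bar>Im (of_real a * h i w)\<bar> \<le> 1" if "i < n" "w \<in> {0..1}" "a \<in> {0..1}" for i w a
    using h_sup[OF that] that(3) by (auto simp: sup_norm_def)
  have h_inner: "(i = 0 \<or> i = m) \<and> 0 < w \<and> w < 1" if "i < n" "w \<in> {0..1}" "\<bar>Im (h i w)\<bar> < 1" for i w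
    using square_rim_inner[OF b04[OF that(1,2)]] that(3) loc[OF that(1,2)] unfolding h_def by blast
  define Y where "Y = {0..1::real} \<times> {0..1::real}"
  \<comment> \<open>Pieces with index below \<open>n\<close> are the sectors, placed in the square;
    index \<open>n\<close> is the strip across \<open>t0\<close>. \<open>p\<close> maps the pieces
    to the model band and \<open>q\<close> to the surface.\<close>
  define p where "p i y = (if i < n then lower_band (of_real (fst y) * h i (snd y)) else upper_band (fst y) (1 - 2 * snd y))"
    for i and y :: "real \<times> real"
  define q where "q i y = (if i < n then sector (c i) (\<epsilon> * fst y) (1 - 2 * snd y) else \<omega> t0 (core \<epsilon> (fst y) (1 - 2 * snd y)))"
    for i and y :: "real \<times> real"
  define N where "N i = {y \<in> Y. if i < n then \<bar>Im (of_real (fst y) * h i (snd y))\<bar> < 1 else \<bar>1 - 2 * snd y\<bar> < 1}" for i :: nat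
  have Yc: "compact Y" unfolding Y_def by (intro compact_Times compact_Icc)
  have YD: "fst y \<in> {0..1}" "snd y \<in> {0..1}" "\<bar>1 - 2 * snd y\<bar> \<le> 1" if "y \<in> Y" for y
    using that by (auto simp: Y_def)
  have p_cont: "continuous_on Y (p i)" for i
  proof (cases "i < n")
    case True
    have "p i = (\<lambda>y. lower_band (of_real (fst y) * h i (snd y)))" using True by (auto simp: p_def)
    then show ?thesis unfolding h_def b_def by (auto intro!: continuous_intros)
  next
    case False
    have "p i = (\<lambda>y. upper_band (fst y) (1 - 2 * snd y))" using False by (auto simp: p_def)
    then show ?thesis by (auto intro!: continuous_intros)
  qed
  have q_cont: "continuous_on Y (q i)" for i
  proof (cases "i < n")
    case True
    have "q i = (\<lambda>y. \<omega> (fst (c i)) (cap (snd (c i)) (\<epsilon> * fst y) (1 - 2 * snd y)))" using True by (auto simp: q_def sector_def)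
    then show ?thesis
      by (auto intro!: continuous_on_compose2[OF \<omega>_cont[OF cT(1)[OF True]]] continuous_intros cap_cball dest: YD(3))
  next
    case False
    have "q i = (\<lambda>y. \<omega> t0 (core \<epsilon> (fst y) (1 - 2 * snd y)))" using False by (auto simp: q_def)
    moreover have "(\<lambda>y. core \<epsilon> (fst y) (1 - 2 * snd y)) ` Y \<subseteq> cball 0 1"
      using core_norm(1)[OF \<epsilon>] YD by blast
    ultimately show ?thesis
      by (auto intro!: continuous_on_compose2[OF \<omega>_cont[OF t0]] continuous_intros)
  qed
  have eq_sectors: "p i y = p j z \<longleftrightarrow> q i y = q j z" if ij: "i < n" "j < n" and yz: "y \<in> Y" "z \<in> Y" for i j y z
  proof -
    have "p i y = p j z \<longleftrightarrow> of_real (fst y) * h i (snd y) = of_real (fst z) * h j (snd z)"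
      using lower_band_eq_iff[OF h_Re(1)[OF ij(1) YD(2,1)[OF yz(1)]] h_Re(1)[OF ij(2) YD(2,1)[OF yz(2)]]] ij by (simp add: p_def)
    also have "\<dots> \<longleftrightarrow> fst y = fst z \<and> (fst y = 0 \<or> cyclic_adj n i (snd y) j (snd z))"
      unfolding h_polar[OF ij YD(2)[OF yz(1)] YD(2)[OF yz(2)] YD(1)[OF yz(1)] YD(1)[OF yz(2)]]
        h_adj[OF ij YD(2)[OF yz(1)] YD(2)[OF yz(2)]] ..
    also have "\<dots> \<longleftrightarrow> sector (c i) (\<epsilon> * fst y) (1 - 2 * snd y) = sector (c j) (\<epsilon> * fst z) (1 - 2 * snd z)"
      by (rule sector_adj_iff[OF v c _ \<epsilon> ij YD(1)[OF yz(1)] YD(1)[OF yz(2)] YD(2)[OF yz(1)] YD(2)[OF yz(2)], symmetric]) (rule nx)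
    finally show ?thesis using ij by (simp add: q_def)
  qed
  have core_sector: "upper_band s (1 - 2 * w) = lower_band (of_real a * h j w') \<longleftrightarrow>
      \<omega> t0 (core \<epsilon> s (1 - 2 * w)) = sector (c j) (\<epsilon> * a) (1 - 2 * w')"
    if j: "j < n" and s: "s \<in> {0..1}" and w: "w \<in> {0..1}" "w' \<in> {0..1}" and a: "a \<in> {0..1}"
      and good: "\<bar>1 - 2 * w\<bar> < 1 \<or> \<bar>Im (of_real a * h j w')\<bar> < 1" for j s w w' a
  proof -
    \<comment> \<open>The pattern common to model and surface: strip and square meet along the
      vertical sides only, the end \<open>s = 1\<close> at corner 0 and the end \<open>s = 0\<close>
      at corner \<open>m\<close>, with equal \<open>w\<close>.\<close>
    define Q where "Q \<longleftrightarrow> a = 1 \<and> w' = w \<and> (s = 1 \<and> j = 0 \<or> s = 0 \<and> j = m)"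
    let ?z = "of_real a * h j w'"
    have aw: "\<bar>1 - 2 * w\<bar> \<le> 1" "\<bar>1 - 2 * w'\<bar> \<le> 1" using w by auto
    have "upper_band s (1 - 2 * w) = lower_band ?z \<longleftrightarrow>
        s = 1 \<and> Re ?z = -1 \<and> Im ?z = 1 - 2 * w \<or> s = 0 \<and> Re ?z = 1 \<and> Im ?z = - (1 - 2 * w)"
      by (rule upper_lower_band_eq_iff[OF s h_Re(1)[OF j w(2) a]])
    also have "\<dots> \<longleftrightarrow> Q"
    proof
      assume l: "s = 1 \<and> Re ?z = -1 \<and> Im ?z = 1 - 2 * w \<or> s = 0 \<and> Re ?z = 1 \<and> Im ?z = - (1 - 2 * w)"
      then have "\<bar>Im ?z\<bar> < 1" using good by auto
      moreover have "\<bar>Re ?z\<bar> = 1" using l by auto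
      ultimately have "sup_norm ?z = 1" by (simp add: sup_norm_def)
      then have a1: "a = 1" using h_sup[OF j w(2) a] by simp
      then have "\<bar>Im (h j w')\<bar> < 1" using \<open>\<bar>Im ?z\<bar> < 1\<close> by simp
      then have "j = 0 \<or> j = m" using h_inner[OF j w(2)] by blast
      then show Q using l a1 h0[OF w(2)] hm[OF w(2)] unfolding Q_def by auto
    next
      assume Q
      then show "s = 1 \<and> Re ?z = -1 \<and> Im ?z = 1 - 2 * w \<or> s = 0 \<and> Re ?z = 1 \<and> Im ?z = - (1 - 2 * w)"
        using h0[OF w(1)] hm[OF w(1)] unfolding Q_def by auto
    qed
    also have "\<dots> \<longleftrightarrow> \<omega> t0 (core \<epsilon> s (1 - 2 * w)) = sector (c j) (\<epsilon> * a) (1 - 2 * w')"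
    proof
      assume Q
      then show "\<omega> t0 (core \<epsilon> s (1 - 2 * w)) = sector (c j) (\<epsilon> * a) (1 - 2 * w')"
        unfolding Q_def using core_ends[OF \<epsilon>] c0 m(2) by (auto simp: sector_def)
    next
      assume eq: "\<omega> t0 (core \<epsilon> s (1 - 2 * w)) = sector (c j) (\<epsilon> * a) (1 - 2 * w')"
      have kc: "core \<epsilon> s (1 - 2 * w) \<in> cball 0 1" by (rule core_norm(1)[OF \<epsilon> s aw(1)])
      have cc: "cap (snd (c j)) (\<epsilon> * a) (1 - 2 * w') \<in> cball 0 1" by (rule cap_cball[OF aw(2)])
      have cw: "\<bar>Re (core \<epsilon> s (1 - 2 * w))\<bar> \<le> cos \<epsilon>" unfolding core_Re by (rule core_width(1)[OF \<epsilon> s])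
      have ce: "0 < cos \<epsilon>" "cos \<epsilon> < 1" using core_width(3,4)[OF \<epsilon> s] .
      have ea: "\<epsilon> * a \<le> \<epsilon>" using \<epsilon> a mult_left_mono[of a 1 \<epsilon>] by auto
      have ea0: "0 \<le> \<epsilon> * a" using \<epsilon> a by auto
      have cos_ge: "cos \<epsilon> \<le> cos (\<epsilon> * a)" using ea ea0 \<epsilon> by (intro cos_monotone_0_pi_le) auto
      have cos_gt: "cos \<epsilon> < cos (\<epsilon> * a)" if "a ~= 1"
      proof -
        have "a < 1" using a that by auto
        then have "\<epsilon> * a < \<epsilon> * 1" using \<epsilon> by (intro mult_strict_left_mono) auto
        then show ?thesis using ea0 \<epsilon> by (intro cos_monotone_0_pi) auto
      qed
      have same: "fst (c j) = t0 \<and> core \<epsilon> s (1 - 2 * w) = cap (snd (c j)) (\<epsilon> * a) (1 - 2 * w')"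
      proof (cases "core \<epsilon> s (1 - 2 * w) \<in> ball 0 1 \<or> cap (snd (c j)) (\<epsilon> * a) (1 - 2 * w') \<in> ball 0 1")
        case True
        then show ?thesis
          using \<omega>_tile_points[OF t0 cT(1)[OF j] _ cc] \<omega>_tile_points[OF cT(1)[OF j] t0 _ kc] eq
          unfolding sector_def by metis
      next
        case False
        then have "\<not> \<bar>1 - 2 * w\<bar> < 1" using core_norm(2)[OF \<epsilon> s] by blast
        then have im: "\<bar>Im ?z\<bar> < 1" using good by blast
        show ?thesis
        proof (cases "a = 0")
          case True
          then have "sector (c j) (\<epsilon> * a) (1 - 2 * w') = v"
            using sector_vertex[OF cT(2)[OF j], of "1 - 2 * w'"] cT(3)[OF j] by simp
          then have "\<omega> t0 (core \<epsilon> s (1 - 2 * w)) \<in> B" using eq v by simp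
          then obtain l where "core \<epsilon> s (1 - 2 * w) = cap l 0 1" using \<omega>_bullet[OF t0 kc] by blast
          then have "\<bar>Re (core \<epsilon> s (1 - 2 * w))\<bar> = 1" by (simp add: cap_Re)
          then show ?thesis using cw ce by simp
        next
          case a0: False
          have "\<epsilon> \<le> pi / 6" "0 < \<epsilon> * a" using a0 a \<epsilon> by auto
          then have "0 < \<epsilon> * a" "\<epsilon> * a \<le> pi / 6" using ea by linarith+
          then have eap: "\<epsilon> * a \<in> {0<..pi / 6}" by simp
          have "sin (\<epsilon> * a) ~= 0" using cap_pos(1)[OF eap] by simp
          then have "\<not> \<bar>1 - 2 * w'\<bar> < 1" using False cap_ball by blast
          then have w01: "w' = 0 \<or> w' = 1" using w(2) by auto
          have a1: "a ~= 1"
          proof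
            assume "a = 1"
            then have "\<bar>Im (h j w')\<bar> < 1" using im by simp
            then show False using h_inner[OF j w(2)] w01 by auto
          qed
          define e where "e = (if w' = 0 then in_edge (c j) else out_edge (c j))"
          have e: "e \<in> E - blank_edges" using in_out_edge_bullet[OF cT(2)[OF j]] by (simp add: e_def)
          have eap': "\<epsilon> * a \<in> {0..pi / 6}" using eap by auto
          \<comment> \<open>Otherwise the point lies on an edge at an angular distance
            \<open>\<epsilon> * a\<close> smaller than \<open>\<epsilon>\<close>. Its preimages then
            have real part of absolute value above \<open>cos \<epsilon>\<close>, outside the
            strip.\<close>
          have xe: "\<omega> t0 (core \<epsilon> s (1 - 2 * w)) = \<gamma> e (3 * (\<epsilon> * a) / pi)"
            using w01 sector_edge[OF cT(2)[OF j] eap'] eq by (auto simp: e_def)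
          have "3 * (\<epsilon> * a) / pi \<in> {0<..1/2}" using eap pi_gt_zero by (auto simp: field_simps)
          then obtain l where l: "core \<epsilon> s (1 - 2 * w) = cap l (pi * (3 * (\<epsilon> * a) / pi) / 3) 1 \<or>
              core \<epsilon> s (1 - 2 * w) = cap l (pi * (3 * (\<epsilon> * a) / pi) / 3) (-1)"
            using \<omega>_eq_\<gamma>[OF t0 kc e _ xe] by metis
          have "pi * (3 * (\<epsilon> * a) / pi) / 3 = \<epsilon> * a" by simp
          then have "\<bar>Re (core \<epsilon> s (1 - 2 * w))\<bar> = \<bar>cos (\<epsilon> * a)\<bar>" using l by (auto simp: cap_Re)
          then show ?thesis using cos_gt[OF a1] cw ce by linarith
        qed
      qed
      have "\<bar>Re (cap (snd (c j)) (\<epsilon> * a) (1 - 2 * w'))\<bar> = cos (\<epsilon> * a)" using cos_ge ce by (auto simp: cap_Re)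
      then have "cos (\<epsilon> * a) \<le> cos \<epsilon>" using same cw by simp
      then have a1: "a = 1" using cos_gt by fastforce
      have "c j = (t0, 1) \<or> c j = (t0, 3)" using same cT(2)[OF j] by (auto simp: prod_eq_iff)
      then show Q
      proof
        assume cj: "c j = (t0, 1)"
        then have "j = m" using inj_onD[OF c(2), of j m] m j by simp
        moreover have "core \<epsilon> s (1 - 2 * w) = core \<epsilon> 0 (1 - 2 * w')" using same cj a1 core_ends(1)[OF \<epsilon>] by simp
        then have "s = 0" "w = w'" using core_eq_iff[OF \<epsilon> s, of 0] by auto
        ultimately show Q using a1 by (simp add: Q_def)
      next
        assume cj: "c j = (t0, 3)"
        then have "j = 0" using inj_onD[OF c(2), of j 0] c0 j n0 by simp
        moreover have "core \<epsilon> s (1 - 2 * w) = core \<epsilon> 1 (1 - 2 * w')" using same cj a1 core_ends(2)[OF \<epsilon>] by simp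
        then have "s = 1" "w = w'" using core_eq_iff[OF \<epsilon> s, of 1] by auto
        ultimately show Q using a1 by (simp add: Q_def)
      qed
    qed
    finally show ?thesis .
  qed
  have eq: "p i y = p j z \<longleftrightarrow> q i y = q j z" if ij: "i \<in> {..n}" "j \<in> {..n}" and yz: "y \<in> N i" "z \<in> Y" for i j y z
  proof -
    have y: "y \<in> Y" using yz(1) by (simp add: N_def)
    consider "i < n" "j < n" | "i < n" "j = n" | "i = n" "j < n" | "i = n" "j = n" using ij by force
    then show ?thesis
    proof cases
      case 1 then show ?thesis using eq_sectors[OF 1 y yz(2)] by blast
    next
      case 2
      then have "\<bar>Im (of_real (fst y) * h i (snd y))\<bar> < 1" using yz(1) by (simp add: N_def)
      then have "upper_band (fst z) (1 - 2 * snd z) = lower_band (of_real (fst y) * h i (snd y)) \<longleftrightarrow>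
          \<omega> t0 (core \<epsilon> (fst z) (1 - 2 * snd z)) = sector (c i) (\<epsilon> * fst y) (1 - 2 * snd y)"
        by (intro core_sector[OF 2(1) YD(1,2)[OF yz(2)] YD(2,1)[OF y]]) blast
      then show ?thesis using 2 by (simp add: p_def q_def eq_commute)
    next
      case 3
      then have "\<bar>1 - 2 * snd y\<bar> < 1" using yz(1) by (simp add: N_def)
      then have "upper_band (fst y) (1 - 2 * snd y) = lower_band (of_real (fst z) * h j (snd z)) \<longleftrightarrow>
          \<omega> t0 (core \<epsilon> (fst y) (1 - 2 * snd y)) = sector (c j) (\<epsilon> * fst z) (1 - 2 * snd z)"
        by (intro core_sector[OF 3(2) YD(1,2)[OF y] YD(2,1)[OF yz(2)]]) blast
      then show ?thesis using 3 by (simp add: p_def q_def)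
    next
      case 4
      then have "\<bar>1 - 2 * snd y\<bar> < 1" using yz(1) by (simp add: N_def)
      then have "core \<epsilon> (fst y) (1 - 2 * snd y) \<in> ball 0 1" by (rule core_norm(2)[OF \<epsilon> YD(1)[OF y]])
      moreover have "core \<epsilon> (fst z) (1 - 2 * snd z) \<in> cball 0 1" by (rule core_norm(1)[OF \<epsilon> YD(1,3)[OF yz(2)]])
      ultimately have "\<omega> t0 (core \<epsilon> (fst y) (1 - 2 * snd y)) = \<omega> t0 (core \<epsilon> (fst z) (1 - 2 * snd z)) \<longleftrightarrow>
          core \<epsilon> (fst y) (1 - 2 * snd y) = core \<epsilon> (fst z) (1 - 2 * snd z)"
        using \<omega>_tile_points(2)[OF t0 t0] by metis
      then show ?thesis
        using 4 core_eq_iff[OF \<epsilon> YD(1)[OF y] YD(1)[OF yz(2)]] upper_band_eq_iff[OF YD(1)[OF y] YD(1)[OF yz(2)]]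
        by (simp add: p_def q_def)
    qed
  qed
  obtain f g where fg: "homeomorphism (\<Union>i\<in>{..n}. p i ` N i) (\<Union>i\<in>{..n}. q i ` N i) f g"
  proof (rule homeomorphism_from_compact_pieces[of "{..n}" "\<lambda>_. Y" p q N])
    show "N i \<subseteq> Y" for i by (auto simp: N_def)
  qed (use Yc p_cont q_cont eq in auto)
  have P: "(\<Union>i\<in>{..n}. p i ` N i) = moebius_band"
  proof (intro equalityI subsetI)
    fix x assume "x \<in> (\<Union>i\<in>{..n}. p i ` N i)"
    then obtain i y where iy: "i \<le> n" "y \<in> N i" "x = p i y" by blast
    have y: "y \<in> Y" using iy(2) by (simp add: N_def)
    show "x \<in> moebius_band"
    proof (cases "i < n")
      case True
      then have "x = lower_band (of_real (fst y) * h i (snd y))" "\<bar>Im (of_real (fst y) * h i (snd y))\<bar> < 1"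
        using iy by (simp_all add: p_def N_def)
      then show ?thesis unfolding moebius_band_eq using h_Re(1)[OF True YD(2,1)[OF y]] by blast
    next
      case False
      then have "x = upper_band (fst y) (1 - 2 * snd y)" "\<bar>1 - 2 * snd y\<bar> < 1"
        using iy by (simp_all add: p_def N_def)
      then show ?thesis unfolding moebius_band_eq using YD(1)[OF y] by blast
    qed
  next
    fix x assume "x \<in> moebius_band"
    then consider s r where "x = upper_band s r" "s \<in> {0..1}" "\<bar>r\<bar> < 1" | z where "x = lower_band z" "\<bar>Re z\<bar> \<le> 1" "\<bar>Im z\<bar> < 1"
      unfolding moebius_band_eq by blast
    then show "x \<in> (\<Union>i\<in>{..n}. p i ` N i)"
    proof cases
      case 1
      have r: "1 - 2 * ((1 - r) / 2) = r" by (simp add: field_simps)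
      have "x = p n (s, (1 - r) / 2)" using 1(1) r by (simp only: p_def fst_conv snd_conv less_irrefl if_False)
      moreover have "(1 - r) / 2 \<in> {0..1}" using 1(3) by auto
      then have "(s, (1 - r) / 2) \<in> N n"
        unfolding N_def using 1(2,3) r by (simp only: mem_Collect_eq fst_conv snd_conv less_irrefl if_False Y_def mem_Times_iff)
      ultimately show ?thesis by blast
    next
      case 2
      then have "sup_norm z \<le> 1" by (simp add: sup_norm_def)
      then obtain a s where as: "a \<in> {0..1}" "s \<in> {0..4}" "z = of_real a * square_rim s" using square_polar_ex by blast
      have sb: "\<beta> 0 \<le> s" "s \<le> \<beta> n" using as(2) \<beta> by auto
      have "\<exists>i w. i < n \<and> w \<in> {0..1} \<and> s = \<beta> i + w * (\<beta> (i + 1) - \<beta> i)"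
      proof (rule interpolation_surj[of n \<beta> s])
        show "\<beta> i < \<beta> j" if "i < j" "j \<le> n" for i j by (rule mono[OF that(1)])
      qed (use sb n0 in blast)+
      then obtain i w where iw: "i < n" "w \<in> {0..1}" "s = \<beta> i + w * (\<beta> (i + 1) - \<beta> i)" by blast
      then have z: "z = of_real a * h i w" using as(3) by (simp add: h_def b_def)
      have "x = p i (a, w)" using 2(1) z iw(1) by (simp add: p_def)
      moreover have "(a, w) \<in> N i" using z 2(3) iw as(1) by (simp add: N_def Y_def)
      ultimately show ?thesis using iw(1) by (intro UN_I[of i]) auto
    qed
  qed
  have Q: "(\<Union>i\<in>{..n}. q i ` N i) = t0 \<union> disk v \<epsilon>"
  proof (intro equalityI subsetI)
    fix x assume "x \<in> (\<Union>i\<in>{..n}. q i ` N i)"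
    then obtain i y where iy: "i \<le> n" "y \<in> N i" "x = q i y" by blast
    have y: "y \<in> Y" using iy(2) by (simp add: N_def)
    show "x \<in> t0 \<union> disk v \<epsilon>"
    proof (cases "i < n")
      case True
      then have x: "x = sector (c i) (\<epsilon> * fst y) (1 - 2 * snd y)" "\<bar>Im (of_real (fst y) * h i (snd y))\<bar> < 1"
        using iy by (simp_all add: q_def N_def)
      show ?thesis
      proof (cases "fst y = 1")
        case True
        then have hi: "(i = 0 \<or> i = m) \<and> 0 < snd y \<and> snd y < 1" using h_inner[OF \<open>i < n\<close> YD(2)[OF y]] x(2) by simp
        then have "fst (c i) = t0" using c0 m(2) by auto
        moreover have "sin \<epsilon> ~= 0" using cap_pos(1)[OF \<epsilon>] by simp
        then have "cap (snd (c i)) \<epsilon> (1 - 2 * snd y) \<in> ball 0 1" using hi by (intro cap_ball) auto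
        ultimately have "x \<in> t0" using x(1) True \<omega>_image_ball[OF t0] unfolding sector_def by auto
        then show ?thesis by blast
      next
        case False
        then have "\<epsilon> * fst y < \<epsilon> * 1" using \<epsilon> YD(1)[OF y] by (intro mult_strict_left_mono) auto
        then have "\<epsilon> * fst y \<in> {0..<\<epsilon>}" using \<epsilon> YD(1)[OF y] by auto
        moreover have "1 - 2 * snd y \<in> {-1..1}" using YD(2)[OF y] by auto
        moreover have "c i \<in> corners_at v" using c(1) True by blast
        ultimately show ?thesis unfolding disk_def x(1) by blast
      qed
    next
      case False
      then have "x = \<omega> t0 (core \<epsilon> (fst y) (1 - 2 * snd y))" "\<bar>1 - 2 * snd y\<bar> < 1"
        using iy by (simp_all add: q_def N_def)
      then show ?thesis using core_norm(2)[OF \<epsilon> YD(1)[OF y]] \<omega>_image_ball[OF t0] by blast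
    qed
  next
    have disk: "x \<in> (\<Union>i\<in>{..n}. q i ` N i)"
      if x: "x = sector d a y" "d \<in> corners_at v" "a \<in> {0..<\<epsilon>}" "y \<in> {-1..1}" for x d a y
    proof -
      obtain i where i: "i < n" "d = c i" using c(1) x(2) by blast
      have "1 - 2 * ((1 - y) / 2) = y" by (simp add: field_simps)
      moreover have "\<epsilon> * (a / \<epsilon>) = a" using \<epsilon> by simp
      ultimately have "x = q i (a / \<epsilon>, (1 - y) / 2)"
        using x(1) i unfolding q_def fst_conv snd_conv by (metis (full_types))
      moreover have a1: "a / \<epsilon> \<in> {0..1}" "a / \<epsilon> < 1" "(1 - y) / 2 \<in> {0..1}" using x(3,4) \<epsilon> by auto
      then have "sup_norm (of_real (a / \<epsilon>) * h i ((1 - y) / 2)) < 1" using h_sup[OF i(1) a1(3,1)] by simp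
      then have "\<bar>Im (of_real (a / \<epsilon>) * h i ((1 - y) / 2))\<bar> < 1" by (simp only: sup_norm_def max_less_iff_conj)
      then have "(a / \<epsilon>, (1 - y) / 2) \<in> N i"
        unfolding N_def using i(1) a1 by (simp only: mem_Collect_eq fst_conv snd_conv if_True Y_def mem_Times_iff)
      ultimately show ?thesis using i(1) by (intro UN_I[of i]) auto
    qed
    fix x assume "x \<in> t0 \<union> disk v \<epsilon>"
    then show "x \<in> (\<Union>i\<in>{..n}. q i ` N i)"
    proof
      assume "x \<in> disk v \<epsilon>"
      then show ?thesis using disk unfolding disk_def by blast
    next
      assume "x \<in> t0"
      then obtain z where z: "z \<in> ball 0 1" "x = \<omega> t0 z" using \<omega>_image_ball[OF t0] by blast
      have zc: "z \<in> cball 0 1" using z(1) by simp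
      consider "\<bar>Re z\<bar> \<le> cos \<epsilon>" | "Re z > cos \<epsilon>" | "- Re z > cos \<epsilon>" by linarith
      then show ?thesis
      proof cases
        case 1
        then obtain s r where sr: "s \<in> {0..1}" "\<bar>r\<bar> < 1" "z = core \<epsilon> s r" by (rule core_surj[OF \<epsilon> z(1)])
        have r: "1 - 2 * ((1 - r) / 2) = r" by (simp add: field_simps)
        have "x = q n (s, (1 - r) / 2)" using z(2) sr(3) r by (simp only: q_def fst_conv snd_conv less_irrefl if_False)
        moreover have "(1 - r) / 2 \<in> {0..1}" using sr(2) by auto
        then have "(s, (1 - r) / 2) \<in> N n"
          unfolding N_def using sr(1,2) r by (simp only: mem_Collect_eq fst_conv snd_conv less_irrefl if_False Y_def mem_Times_iff)
        ultimately show ?thesis by blast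
      next
        case 2
        then have "\<exists>a\<in>{0..<\<epsilon>}. \<exists>y\<in>{-1..1}. z = cap 1 a y" using cap_region[OF zc, of 1 \<epsilon>] \<epsilon> by simp
        then obtain a y where "a \<in> {0..<\<epsilon>}" "y \<in> {-1..1}" "z = cap 1 a y" by blast
        then show ?thesis using disk[of x "(t0, 1)" a y] c13(2) z(2) by (simp add: sector_def)
      next
        case 3
        then have "\<exists>a\<in>{0..<\<epsilon>}. \<exists>y\<in>{-1..1}. z = cap 3 a y" using cap_region[OF zc, of 3 \<epsilon>] \<epsilon> by simp
        then obtain a y where "a \<in> {0..<\<epsilon>}" "y \<in> {-1..1}" "z = cap 3 a y" by blast
        then show ?thesis using disk[of x "(t0, 3)" a y] c13(1) z(2) by (simp add: sector_def)
      qed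
    qed
  qed
  show ?thesis using fg unfolding P Q homeomorphic_def using homeomorphism_symD by blast
qed

text \<open>The bullet edges are directed away from their labelled ends, and these paths are
  prescribed on sides 1, 2, 3 and 5 of every tile, reversed on 2 and 5. Side 4 keeps its own path;
  \<open>reparametrize\<close> with the angles \<open>side_angle\<close> does the rest.\<close>

lemma (in labelled_pentagons) ex_flow_charts:
  obtains \<gamma> \<omega> where "flow_charts S V E \<phi> B \<gamma> \<omega>"
proof -
  have "\<exists>g. arc g \<and> path_image g = e \<and> g 0 \<in> B \<and> g 1 \<in> V - B" if e: "e \<in> E - blank_edges" for e
  proof -
    obtain b u where bu: "e \<inter> V = {b, u}" "b \<in> B" "u \<in> V - B" using bullet_edge_ends[OF e] .
    obtain g where g: "simple_path g" "path_image g = e" "e \<inter> V = {g 0, g 1}"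
      using ex_edge_path[of e] e by (auto simp: edge_path_def pathstart_def pathfinish_def)
    have "b ~= u" using bu by blast
    then have "g 0 = b \<and> g 1 = u \<or> g 0 = u \<and> g 1 = b" using g(3) bu(1) by (metis doubleton_eq_iff)
    moreover have "arc g" using g(1) \<open>b ~= u\<close> calculation by (auto simp: arc_simple_path pathstart_def pathfinish_def)
    ultimately show ?thesis
    proof (elim disjE conjE)
      assume "g 0 = b" "g 1 = u" "arc g"
      then show ?thesis using g(2) bu by blast
    next
      assume gu: "g 0 = u" "g 1 = b" "arc g"
      have "arc (reversepath g)" by (rule arc_reversepath[OF gu(3)])
      moreover have "path_image (reversepath g) = e" using g(2) by simp
      moreover have "reversepath g 0 \<in> B" "reversepath g 1 \<in> V - B" using gu bu by (simp_all add: reversepath_def)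
      ultimately show ?thesis by blast
    qed
  qed
  then have "\<forall>e\<in>E - blank_edges. \<exists>g. arc g \<and> path_image g = e \<and> g 0 \<in> B \<and> g 1 \<in> V - B" by blast
  then obtain \<gamma> where \<gamma>: "\<forall>e\<in>E - blank_edges. arc (\<gamma> e) \<and> path_image (\<gamma> e) = e \<and> \<gamma> e 0 \<in> B \<and> \<gamma> e 1 \<in> V - B"
    by (rule bchoice[THEN exE])
  define \<delta> where "\<delta> t j = (if j = 1 \<or> j = 3 then \<gamma> (edge t j) else if j = 4 then (\<lambda>x. rim t (4 + x)) else reversepath (\<gamma> (edge t j)))"
    for t :: "'a set" and j :: nat
  have ends: "\<gamma> e 0 = b \<and> \<gamma> e 1 = u" if e: "e \<in> E - blank_edges" "e \<inter> V = {b, u}" "b \<in> B" "u \<notin> B" for e b u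
  proof -
    have g: "path_image (\<gamma> e) = e" "\<gamma> e 0 \<in> B" "\<gamma> e 1 \<in> V - B" using bspec[OF \<gamma> e(1)] by simp_all
    have "\<gamma> e 0 \<in> path_image (\<gamma> e)" "\<gamma> e 1 \<in> path_image (\<gamma> e)" by (simp_all add: path_image_def)
    then have "\<gamma> e 0 \<in> e \<inter> V" "\<gamma> e 1 \<in> e \<inter> V" using g B_V by auto
    then show ?thesis unfolding e(2) using g(2,3) e(3,4) by auto
  qed
  have \<delta>: "arc (\<delta> t j) \<and> path_image (\<delta> t j) = edge t j \<and> \<delta> t j 0 = rim t (real j) \<and> \<delta> t j 1 = rim t (real j + 1)"
    if t: "t \<in> T" and j: "j \<in> {1..5}" for t j
  proof -
    have b': "edge t 1 \<in> E - blank_edges" "edge t 2 \<in> E - blank_edges" "edge t 3 \<in> E - blank_edges" "edge t 5 \<in> E - blank_edges"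
      using edge_blank_iff[OF t] edge_in_E[OF t] by auto
    note V = edge_V[OF t] and l = bullets[OF t] and u = blanks[OF t]
    have e: "\<gamma> (edge t 1) 0 = rim t 1 \<and> \<gamma> (edge t 1) 1 = rim t 2" "\<gamma> (edge t 2) 0 = rim t 3 \<and> \<gamma> (edge t 2) 1 = rim t 2"
      "\<gamma> (edge t 3) 0 = rim t 3 \<and> \<gamma> (edge t 3) 1 = rim t 4" "\<gamma> (edge t 5) 0 = rim t 1 \<and> \<gamma> (edge t 5) 1 = rim t 5"
      using ends[OF b'(1) V(1) l(1) u(1)] ends[OF b'(2) V(2)[unfolded insert_commute[of "rim t 2"]] l(2) u(1)]
        ends[OF b'(3) V(3) l(2) u(2)] ends[OF b'(4) V(5)[unfolded insert_commute[of "rim t 5"]] l(1) u(3)] by blast+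
    show ?thesis using j
    proof (cases rule: side_index_cases)
      case 1 then show ?thesis using bspec[OF \<gamma> b'(1)] e(1) by (simp add: \<delta>_def)
    next
      case 2
      then show ?thesis using bspec[OF \<gamma> b'(2)] e(2)
        by (simp add: \<delta>_def arc_reversepath) (simp add: reversepath_def)
    next
      case 3 then show ?thesis using bspec[OF \<gamma> b'(3)] e(3) by (simp add: \<delta>_def)
    next
      case 4
      have "edge_path V (edge t 4) (\<lambda>x. rim t (4 + x))" using edge_path_side[OF t, of 4] by simp
      then show ?thesis using 4 rim45[OF t]
        by (simp add: \<delta>_def edge_path_def arc_simple_path pathstart_def pathfinish_def)
    next
      case 5
      then show ?thesis using bspec[OF \<gamma> b'(4)] e(4) rim6[of t]
        by (simp add: \<delta>_def arc_reversepath) (simp add: reversepath_def)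
    qed
  qed
  have "\<forall>t\<in>T. \<exists>\<omega>. continuous_on (cball 0 1) \<omega> \<and> (\<exists>\<psi>. homeomorphism (ball 0 1) t \<omega> \<psi>) \<and>
      (\<forall>j\<in>{1..5}. \<forall>x\<in>{0..1}. \<omega> (cis (side_angle (real j + x))) = \<delta> t j x)"
  proof
    fix t assume t: "t \<in> T"
    have "side_angle (real 5 + 1) = side_angle 1 + 2 * pi" by (simp add: side_angle_def)
    then show "\<exists>\<omega>. continuous_on (cball 0 1) \<omega> \<and> (\<exists>\<psi>. homeomorphism (ball 0 1) t \<omega> \<psi>) \<and>
      (\<forall>j\<in>{1..5}. \<forall>x\<in>{0..1}. \<omega> (cis (side_angle (real j + x))) = \<delta> t j x)"
      by (intro reparametrize[OF t side_angle_cont side_angle_mono]) (use \<delta>[OF t] in blast)+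
  qed
  then obtain \<omega> where \<omega>: "\<forall>t\<in>T. continuous_on (cball 0 1) (\<omega> t) \<and> (\<exists>\<psi>. homeomorphism (ball 0 1) t (\<omega> t) \<psi>) \<and>
      (\<forall>j\<in>{1..5}. \<forall>x\<in>{0..1}. \<omega> t (cis (side_angle (real j + x))) = \<delta> t j x)" by (rule bchoice[THEN exE])
  have "flow_charts S V E \<phi> B \<gamma> \<omega>"
  proof (unfold_locales)
    show "arc (\<gamma> e)" "path_image (\<gamma> e) = e" "\<gamma> e 0 \<in> B" "\<gamma> e 1 \<in> V - B" if "e \<in> E - blank_edges" for e
      using bspec[OF \<gamma> that] by simp_all
    fix t assume t: "t \<in> T"
    show "continuous_on (cball 0 1) (\<omega> t)" "\<exists>\<psi>. homeomorphism (ball 0 1) t (\<omega> t) \<psi>" using bspec[OF \<omega> t] by simp_all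
    fix x :: real assume x: "x \<in> {0..1}"
    have w: "\<omega> t (cis (side_angle (real j + x))) = \<delta> t j x" if "j \<in> {1..5}" for j
      using bspec[OF \<omega> t] x that by simp
    show "\<omega> t (cis (side_angle (1 + x))) = \<gamma> (edge t 1) x" using w[of 1] by (simp add: \<delta>_def)
    show "\<omega> t (cis (side_angle (2 + x))) = \<gamma> (edge t 2) (1 - x)" using w[of 2] by (simp add: \<delta>_def reversepath_def)
    show "\<omega> t (cis (side_angle (3 + x))) = \<gamma> (edge t 3) x" using w[of 3] by (simp add: \<delta>_def)
    have "\<delta> t 4 x \<in> edge t 4" using \<delta>[OF t, of 4] x unfolding path_image_def by auto
    then show "\<omega> t (cis (side_angle (4 + x))) \<in> edge t 4" using w[of 4] by simp
    show "\<omega> t (cis (side_angle (5 + x))) = \<gamma> (edge t 5) (1 - x)" using w[of 5] by (simp add: \<delta>_def reversepath_def)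
  qed
  then show ?thesis by (rule that)
qed

text \<open>This is the topological condition in the type \<open>P\<^sub>2\<close>; it holds automatically.\<close>

lemma (in labelled_pentagons) moebius_neighbourhood:
  assumes t: "t \<in> T" and r: "rim t 1 = rim t 3" and ne: "edge t 3 ~= edge t 1" "edge t 5 ~= edge t 2"
    and U: "openin (top_of_set S) U" "rim t 1 \<in> U"
  shows "\<exists>D\<subseteq>U. openin (top_of_set S) D \<and> rim t 1 \<in> D \<and> D homeomorphic ball (0::complex) 1 \<and>
    (t \<union> D) homeomorphic moebius_band"
proof -
  obtain \<gamma> \<omega> where "flow_charts S V E \<phi> B \<gamma> \<omega>" by (rule ex_flow_charts)
  then interpret flow_charts S V E \<phi> B \<gamma> \<omega> .
  have v: "rim t 1 \<in> B" by (rule bullets(1)[OF t])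
  obtain \<epsilon> where \<epsilon>: "\<epsilon> \<in> {0<..pi / 6}" "disk (rim t 1) \<epsilon> \<subseteq> U" using disk_small[OF v U] by blast
  have c: "(t, 1) \<in> T \<times> {1, 3}" using t by simp
  then have "rim t 1 = sector (t, 1) 0 1" using sector_vertex[OF c, of 1] by simp
  moreover have "(t, 1) \<in> corners_at (rim t 1)" unfolding bullet_corners[OF v] using t by simp
  ultimately have "rim t 1 \<in> disk (rim t 1) \<epsilon>"
    unfolding disk_def using \<epsilon>(1) by (intro CollectI exI[of _ "(t, 1)"] exI[of _ 0] exI[of _ 1]) simp
  then show ?thesis
    using \<epsilon>(2) disk_open[OF v \<epsilon>(1)] disk_homeomorphic_ball[OF v \<epsilon>(1)] moebius[OF t refl r[symmetric] ne \<epsilon>(1)]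
    by (intro exI[of _ "disk (rim t 1) \<epsilon>"]) simp
qed

section \<open>The type of a tile\<close>

lemma polygon_map_compose:
  assumes pm: "polygon_map V E k t \<phi>" and h: "homeomorphism (cball 0 1) (cball 0 1) \<iota> \<kappa>" and b: "\<iota> ` ball 0 1 = ball 0 1"
    and i: "\<And>j. j \<in> {1..k} ==> \<exists>i\<in>{1..k}. \<iota> ` side k j = side k i \<and> \<iota> ` open_side k j = open_side k i"
    and c: "\<And>j. j \<in> {1..k} ==> \<exists>i\<in>{1..k}. \<iota> (corner k j) = corner k i"
  shows "polygon_map V E k t (\<phi> \<circ> \<iota>)"
proof -
  have hb: "homeomorphism (ball 0 1) (ball 0 1) \<iota> \<kappa>" by (rule homeomorphism_of_subsets[OF h _ _ b]) auto
  obtain \<psi> where \<psi>: "homeomorphism (ball 0 1) t \<phi> \<psi>" using pm unfolding polygon_map_def by blast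
  have "continuous_on (cball 0 1) (\<phi> \<circ> \<iota>)"
    using homeomorphism_cont1[OF h] homeomorphism_image1[OF h] pm
    unfolding polygon_map_def by (intro continuous_on_compose) simp_all
  moreover have "homeomorphism (ball 0 1) t (\<phi> \<circ> \<iota>) (\<kappa> \<circ> \<psi>)" by (rule homeomorphism_compose[OF hb \<psi>])
  moreover have "(\<phi> \<circ> \<iota>) (corner k j) \<in> V \<and> (\<phi> \<circ> \<iota>) ` side k j \<in> E \<and> inj_on (\<phi> \<circ> \<iota>) (open_side k j) \<and>
      (\<phi> \<circ> \<iota>) ` open_side k j \<inter> V = {}" if j: "j \<in> {1..k}" for j
  proof -
    obtain i where i: "i \<in> {1..k}" "\<iota> ` side k j = side k i" "\<iota> ` open_side k j = open_side k i" using i[OF j] by blast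
    obtain l where l: "l \<in> {1..k}" "\<iota> (corner k j) = corner k l" using c[OF j] by blast
    have "inj_on \<iota> (cball 0 1)" by (rule inj_on_inverseI[of _ \<kappa>]) (rule homeomorphism_apply1[OF h])
    moreover have "open_side k j \<subseteq> cball 0 1" by (auto simp: open_side_def)
    ultimately have "inj_on \<iota> (open_side k j)" by (rule inj_on_subset)
    moreover have "inj_on \<phi> (\<iota> ` open_side k j)" using pm i unfolding polygon_map_def by simp
    ultimately have "inj_on (\<phi> \<circ> \<iota>) (open_side k j)" by (rule comp_inj_on)
    moreover have "(\<phi> \<circ> \<iota>) ` side k j = \<phi> ` side k i" "(\<phi> \<circ> \<iota>) ` open_side k j = \<phi> ` open_side k i"
      unfolding image_comp[symmetric] i(2,3) by (rule refl)+
    ultimately show ?thesis using pm i(1) l unfolding polygon_map_def by simp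
  qed
  ultimately show ?thesis unfolding polygon_map_def by blast
qed

lemma circle_point_cnj: "cnj (circle_point k s) = circle_point k (- s)"
  by (simp add: circle_point_def cis_cnj)

lemma circle_point_shift: "k > 0 ==> circle_point k (s + real k) = circle_point k s"
  by (simp add: circle_point_add)

text \<open>The reflection \<open>s\<close> to \<open>4 - s\<close> of the boundary parameter: it
  exchanges \<open>v_1\<close> with \<open>v_3\<close> and \<open>v_4\<close> with
  \<open>v_5\<close> and fixes \<open>v_2\<close>, so it preserves the pattern of labels.\<close>

definition pentagon_reflection :: "complex => complex" where
  "pentagon_reflection z = cnj z * circle_point 5 4"

lemma pentagon_reflection_circle_point: "pentagon_reflection (circle_point 5 s) = circle_point 5 (4 - s)"
  using circle_point_add[of 5 "- s" 4] by (simp add: pentagon_reflection_def circle_point_cnj)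

lemma pentagon_reflection_involution: "pentagon_reflection (pentagon_reflection z) = z"
proof -
  have "circle_point 5 (-4) * circle_point 5 4 = 1" using circle_point_add[of 5 "-4" 4] by (simp add: circle_point_def)
  then show ?thesis by (simp add: pentagon_reflection_def circle_point_cnj mult.assoc)
qed

lemma image_circle_point_reflect:
  assumes "\<And>s. \<iota> (circle_point k s) = circle_point k (d - s)" "k > 0" "d - real j - 1 = real i + m * real k" "m \<in> {0, -1}"
  shows "\<iota> ` side k j = side k i" "\<iota> ` open_side k j = open_side k i"
proof -
  have per: "circle_point k (x + m * real k) = circle_point k x" for x
    using assms(4) circle_point_shift[OF assms(2), of "x - real k"] by auto
  have e: "\<iota> (circle_point k (real j + x)) = circle_point k (real i + (1 - x))" for x
  proof -
    have "d - (real j + x) = (real i + (1 - x)) + m * real k" using assms(3) by simp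
    then show ?thesis unfolding assms(1) by (simp only: per)
  qed
  have flip: "(\<lambda>x. 1 - x) ` {0..1::real} = {0..1}" "(\<lambda>x. 1 - x) ` {0<..<1::real} = {0<..<1}"
  proof -
    have "y \<in> (\<lambda>x. 1 - x) ` {0..1}" if "y \<in> {0..1}" for y :: real using that by (intro image_eqI[of _ _ "1 - y"]) auto
    then show "(\<lambda>x. 1 - x) ` {0..1::real} = {0..1}" by auto
    have "y \<in> (\<lambda>x. 1 - x) ` {0<..<1}" if "y \<in> {0<..<1}" for y :: real using that by (intro image_eqI[of _ _ "1 - y"]) auto
    then show "(\<lambda>x. 1 - x) ` {0<..<1::real} = {0<..<1}" by auto
  qed
  have "\<iota> ` circle_point k ` (\<lambda>x. real j + x) ` I = circle_point k ` (\<lambda>x. real i + x) ` (\<lambda>x. 1 - x) ` I" for I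
    by (simp only: image_image e)
  then show "\<iota> ` side k j = side k i" "\<iota> ` open_side k j = open_side k i"
    unfolding side_circle_point[OF assms(2)] open_side_circle_point[OF assms(2)]
      image_shift_unit_Icc[symmetric] image_shift_unit_Ioo[symmetric] by (simp_all only: flip)
qed

lemma image_circle_point_rotate:
  assumes "\<And>s. \<iota> (circle_point k s) = circle_point k (s + d)" "k > 0" "real j + d = real i + m * real k" "m \<in> {0, 1}"
  shows "\<iota> ` side k j = side k i" "\<iota> ` open_side k j = open_side k i"
proof -
  have per: "circle_point k (x + m * real k) = circle_point k x" for x
    using assms(4) circle_point_shift[OF assms(2), of x] by auto
  have e: "\<iota> (circle_point k (real j + x)) = circle_point k (real i + x)" for x
  proof -
    have "real j + x + d = real i + x + m * real k" using assms(3) by simp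
    then show ?thesis unfolding assms(1) by (simp only: per)
  qed
  then show "\<iota> ` side k j = side k i" "\<iota> ` open_side k j = open_side k i"
    unfolding side_circle_point[OF assms(2)] open_side_circle_point[OF assms(2)]
      image_shift_unit_Icc[symmetric] image_shift_unit_Ioo[symmetric] by (simp_all only: image_image e)
qed

lemma polygon_map_reflect:
  assumes "polygon_map V E 5 t \<phi>" shows "polygon_map V E 5 t (\<phi> \<circ> pentagon_reflection)"
proof (rule polygon_map_compose[OF assms])
  have n: "norm (pentagon_reflection z) = norm z" for z by (simp add: pentagon_reflection_def norm_mult)
  have c: "continuous_on A pentagon_reflection" for A unfolding pentagon_reflection_def by (intro continuous_intros)
  show "homeomorphism (cball 0 1) (cball 0 1) pentagon_reflection pentagon_reflection"
    by (rule homeomorphismI) (use c n pentagon_reflection_involution in auto)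
  show "pentagon_reflection ` ball 0 1 = ball 0 1"
  proof
    show "pentagon_reflection ` ball 0 1 \<subseteq> ball 0 1" using n by auto
    show "ball 0 1 \<subseteq> pentagon_reflection ` ball 0 1"
    proof
      fix z :: complex assume "z \<in> ball 0 1"
      then show "z \<in> pentagon_reflection ` ball 0 1"
        using n[of z] pentagon_reflection_involution[of z] by (intro image_eqI[of _ _ "pentagon_reflection z"]) auto
    qed
  qed
  fix j :: nat assume j: "j \<in> {1..5}"
  note img = image_circle_point_reflect[of pentagon_reflection 5 4, OF pentagon_reflection_circle_point]
  have j5: "j = 1 \<or> j = 2 \<or> j = 3 \<or> j = 4 \<or> j = 5" using j by auto
  have "\<exists>i\<in>{1..5::nat}. \<exists>m\<in>{0, -1::real}. 4 - real j - 1 = real i + m * 5"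
    using j5
  proof (elim disjE)
    assume "j = 1" then show ?thesis by (intro bexI[of _ 2] bexI[of _ 0]) auto
  next
    assume "j = 2" then show ?thesis by (intro bexI[of _ 1] bexI[of _ 0]) auto
  next
    assume "j = 3" then show ?thesis by (intro bexI[of _ 5] bexI[of _ "-1"]) auto
  next
    assume "j = 4" then show ?thesis by (intro bexI[of _ 4] bexI[of _ "-1"]) auto
  next
    assume "j = 5" then show ?thesis by (intro bexI[of _ 3] bexI[of _ "-1"]) auto
  qed
  then obtain i m where im: "i \<in> {1..5::nat}" "m \<in> {0, -1::real}" "4 - real j - 1 = real i + m * real 5" by auto
  then show "\<exists>i\<in>{1..5}. pentagon_reflection ` side 5 j = side 5 i \<and> pentagon_reflection ` open_side 5 j = open_side 5 i"
    using img[OF _ im(3,2)] by auto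
  have cp: "pentagon_reflection (corner 5 j) = circle_point 5 (4 - real j)"
    by (simp add: corner_circle_point pentagon_reflection_circle_point)
  have sh: "circle_point 5 (4 - real j) = circle_point 5 (9 - real j)" using circle_point_shift[of 5 "4 - real j"] by simp
  show "\<exists>i\<in>{1..5}. pentagon_reflection (corner 5 j) = corner 5 i"
  proof (cases "j \<le> 3")
    case True
    then have "pentagon_reflection (corner 5 j) = corner 5 (4 - j)" unfolding cp by (simp add: corner_circle_point of_nat_diff)
    then show ?thesis using True j by (intro bexI[of _ "4 - j"]) auto
  next
    case False
    then have "pentagon_reflection (corner 5 j) = corner 5 (9 - j)" unfolding cp sh using j by (simp add: corner_circle_point of_nat_diff)
    then show ?thesis using False j by (intro bexI[of _ "9 - j"]) auto
  qed
qed

lemma polygon_map_rotate: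
  assumes "polygon_map V E k t \<phi>" "k > 0" "m < k" shows "polygon_map V E k t (\<phi> \<circ> (\<lambda>z. z * circle_point k (real m)))"
proof (rule polygon_map_compose[OF assms(1)])
  let ?\<iota> = "\<lambda>z. z * circle_point k (real m)" and ?\<kappa> = "\<lambda>z. z * circle_point k (- real m)"
  have inv: "circle_point k (real m) * circle_point k (- real m) = 1" "circle_point k (- real m) * circle_point k (real m) = 1"
    using circle_point_add[of k "real m" "- real m"] circle_point_add[of k "- real m" "real m"] by (simp_all add: circle_point_def)
  show "homeomorphism (cball 0 1) (cball 0 1) ?\<iota> ?\<kappa>"
    by (rule homeomorphismI) (auto intro!: continuous_intros simp: norm_mult mult.assoc inv)
  show "?\<iota> ` ball 0 1 = ball 0 1"
  proof
    show "?\<iota> ` ball 0 1 \<subseteq> ball 0 1" by (auto simp: norm_mult)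
    show "ball 0 1 \<subseteq> ?\<iota> ` ball 0 1"
    proof
      fix z :: complex assume "z \<in> ball 0 1"
      then show "z \<in> ?\<iota> ` ball 0 1" by (intro image_eqI[of _ _ "?\<kappa> z"]) (auto simp: norm_mult mult.assoc inv)
    qed
  qed
  have e: "?\<iota> (circle_point k s) = circle_point k (s + real m)" for s by (simp add: circle_point_add)
  fix j assume j: "j \<in> {1..k}"
  define i where "i = (if j + m \<le> k then j + m else j + m - k)"
  define l where "l = (if j + m \<le> k then 0 else 1 :: real)"
  have i: "i \<in> {1..k}" using j assms by (auto simp: i_def)
  have il: "real j + real m = real i + l * real k" "l \<in> {0, 1}" using j assms by (auto simp: i_def l_def of_nat_diff)
  show "\<exists>i\<in>{1..k}. ?\<iota> ` side k j = side k i \<and> ?\<iota> ` open_side k j = open_side k i"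
    using image_circle_point_rotate[of ?\<iota> k "real m", OF e assms(2) il] i by blast
  have "?\<iota> (corner k j) = circle_point k (real i + l * real k)" unfolding corner_circle_point e il(1) ..
  also have "\<dots> = corner k i"
    using il(2) circle_point_shift[OF assms(2), of "real i"] by (auto simp: corner_circle_point)
  finally show "\<exists>i\<in>{1..k}. ?\<iota> (corner k j) = corner k i" using i by blast
qed

section \<open>Identifications on the boundary of a tile\<close>

context labelled_pentagons
begin

lemma \<phi>_corner: "\<phi> t (corner 5 j) = rim t (real j)"
  by (simp add: rim_def corner_circle_point)

lemma labelled: "t \<in> T ==> labelled_pentagon V E B t (\<phi> t)"
  using polygon bullets blanks by (simp add: labelled_pentagon_def \<phi>_corner)

text \<open>Vertices are disjoint from the interiors of edges, so a coincidence is between two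
  corners or between points of two open sides. Distinct edges meet in vertices only, so in the
  second case the sides are the same edge.\<close>

lemma boundary_identification:
  assumes t: "t \<in> T" and z: "x \<in> sphere 0 1" "y \<in> sphere 0 1" "\<phi> t x = \<phi> t y" "x ~= y"
  shows "(\<exists>i\<in>{1..5}. \<exists>j\<in>{1..5}. i ~= j \<and> x = corner 5 i \<and> y = corner 5 j \<and> rim t (real i) = rim t (real j)) \<or>
    (\<exists>i\<in>{1..5}. \<exists>j\<in>{1..5}. i ~= j \<and> x \<in> open_side 5 i \<and> y \<in> open_side 5 j \<and> edge t i = edge t j)"
proof -
  have k5: "5 > (0::nat)" by simp
  have pm: "\<phi> t (corner 5 j) \<in> V" "inj_on (\<phi> t) (open_side 5 j)" "\<phi> t ` open_side 5 j \<inter> V = {}" if "j \<in> {1..5}" for j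
    using polygon[OF t] that unfolding polygon_map_def by blast+
  show ?thesis
  proof (rule sphere_cases[OF z(1) k5])
    fix i assume i: "i \<in> {1..5}" "x = corner 5 i"
    show ?thesis
    proof (rule sphere_cases[OF z(2) k5])
      fix j assume j: "j \<in> {1..5}" "y = corner 5 j"
      then have "i ~= j" using i z(4) by blast
      moreover have "rim t (real i) = rim t (real j)" using z(3) i j \<phi>_corner by metis
      ultimately show ?thesis using i j by blast
    next
      fix j assume j: "j \<in> {1..5}" "y \<in> open_side 5 j"
      then have "\<phi> t y \<in> \<phi> t ` open_side 5 j" by blast
      then show ?thesis using pm(1)[OF i(1)] pm(3)[OF j(1)] i(2) z(3) by auto
    qed
  next
    fix i assume i: "i \<in> {1..5}" "x \<in> open_side 5 i"
    have xi: "\<phi> t x \<in> \<phi> t ` open_side 5 i" using i(2) by blast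
    show ?thesis
    proof (rule sphere_cases[OF z(2) k5])
      fix j assume j: "j \<in> {1..5}" "y = corner 5 j"
      then show ?thesis using pm(1)[OF j(1)] pm(3)[OF i(1)] xi z(3) by auto
    next
      fix j assume j: "j \<in> {1..5}" "y \<in> open_side 5 j"
      have "i ~= j"
      proof
        assume "i = j"
        then show False using inj_onD[OF pm(2)[OF i(1)] z(3) i(2)] j(2) z(4) by simp
      qed
      moreover have "edge t i = edge t j"
      proof (rule edges_meet)
        show "edge t i \<in> E" "edge t j \<in> E" using edge_in_E[OF t] i(1) j(1) by blast+
        show "\<phi> t x \<in> edge t i" using i(2) open_side_subset_side[of 5 i] by (auto simp: edge_def)
        show "\<phi> t x \<in> edge t j" unfolding z(3) using j(2) open_side_subset_side[of 5 j] by (auto simp: edge_def)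
        show "\<phi> t x \<notin> V" using xi pm(3)[OF i(1)] by blast
      qed
      ultimately show ?thesis using i j by blast
    qed
  qed
qed

text \<open>Side 4 is the only blank one, neighbouring sides differ, and sides 3 and 5 have the
  different blank ends \<open>v_4\<close> and \<open>v_5\<close>. The two remaining pairs are mirror
  images of each other under \<open>pentagon_reflection\<close>.\<close>

lemma blank_end_eq:
  assumes t: "t \<in> T" and "i \<in> {1..5}" "j \<in> {1..5}" "edge t i = edge t j" "i < j"
  shows "i = 1 \<and> j = 3 \<and> rim t 2 = rim t 4 \<or> i = 2 \<and> j = 5 \<and> rim t 2 = rim t 5"
proof -
  have V: "edge t i \<inter> V = edge t j \<inter> V" using assms(4) by simp
  have b4: "i = 4 \<longleftrightarrow> j = 4" using edge_blank_iff[OF t assms(2)] edge_blank_iff[OF t assms(3)] assms(4) by simp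
  have n: "\<not> (i = 1 \<and> j = 2)" "\<not> (i = 2 \<and> j = 3)" "\<not> (i = 1 \<and> j = 5)"
    using next_side_distinct[OF t] assms(4) by auto
  have ij: "i = 1 \<and> j = 3 \<or> i = 2 \<and> j = 5 \<or> i = 3 \<and> j = 5"
  proof -
    have "i = 1 \<or> i = 2 \<or> i = 3 \<or> i = 4 \<or> i = 5" "j = 1 \<or> j = 2 \<or> j = 3 \<or> j = 4 \<or> j = 5" using assms(2,3) by auto
    then show ?thesis using b4 n assms(5) by (elim disjE) simp_all
  qed
  then show ?thesis
  proof (elim disjE conjE)
    assume c: "i = 1" "j = 3"
    then have "rim t 2 \<in> {rim t 3, rim t 4}" using V edge_V(1,3)[OF t] by auto
    then show ?thesis using c rims_distinct[OF t] by auto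
  next
    assume c: "i = 2" "j = 5"
    then have "rim t 2 \<in> {rim t 5, rim t 1}" using V edge_V(2,5)[OF t] by auto
    then show ?thesis using c rims_distinct[OF t] by auto
  next
    assume c: "i = 3" "j = 5"
    then have "rim t 4 \<in> {rim t 5, rim t 1}" using V edge_V(3,5)[OF t] by auto
    then show ?thesis using rims_distinct[OF t] by auto
  qed
qed

lemma rim_eq:
  assumes t: "t \<in> T" and "i \<in> {1..5}" "j \<in> {1..5}" "rim t (real i) = rim t (real j)" "i < j"
  shows "i = 1 \<and> j = 3 \<or> i = 2 \<and> j = 4 \<or> i = 2 \<and> j = 5"
proof -
  have "i = 1 \<or> i = 2 \<or> i = 3 \<or> i = 4 \<or> i = 5" "j = 1 \<or> j = 2 \<or> j = 3 \<or> j = 4 \<or> j = 5" using assms(2,3) by auto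
  then show ?thesis using assms(4,5) rims_distinct[OF t] by (elim disjE) auto
qed

text \<open>At the blank vertex \<open>v_2 = v_5\<close> there are just two bullet edges, and sides
  1 and 2 already use both. So side 5 is glued to one of them; side 1 is its neighbour, which leaves
  side 2.\<close>

lemma type_P3_case:
  assumes t: "t \<in> T" and r: "rim t 2 = rim t 5" shows "type_P3 V E B t"
proof -
  define u where "u = rim t 2"
  have u: "u \<in> V - B" unfolding u_def using rims_V[OF t] blanks[OF t] by blast
  have b: "edge t 1 \<in> E - blank_edges" "edge t 2 \<in> E - blank_edges" "edge t 5 \<in> E - blank_edges"
    using edge_blank_iff[OF t] edge_in_E[OF t] by auto
  have "u \<in> edge t 1 \<inter> V" "u \<in> edge t 2 \<inter> V" "u \<in> edge t 5 \<inter> V"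
    unfolding edge_V[OF t] using r by (simp_all add: u_def)
  then have sub: "{edge t 1, edge t 2} \<subseteq> {e \<in> E - blank_edges. u \<in> e}" "edge t 5 \<in> {e \<in> E - blank_edges. u \<in> e}"
    using b by simp_all
  have "card {edge t 1, edge t 2} = 2" using next_side_distinct(1)[OF t] by simp
  then have "{edge t 1, edge t 2} = {e \<in> E - blank_edges. u \<in> e}"
    using card_blank_edges_at(2)[OF u] finite_E by (intro card_subset_eq sub(1)) simp_all
  then have "edge t 5 \<in> {edge t 1, edge t 2}" using sub(2) by simp
  then have e25: "edge t 2 = edge t 5" using next_side_distinct(3)[OF t] by auto
  have "rim t 3 \<in> edge t 5 \<inter> V" unfolding e25[symmetric] edge_V[OF t] by simp
  then have r31: "rim t 3 = rim t 1" unfolding edge_V[OF t] using rims_distinct[OF t] by auto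
  have k5: "5 > (0::nat)" by simp
  have cs: "corner 5 j \<in> side 5 j" for j unfolding side_circle_point[OF k5] corner_circle_point by (intro imageI) simp
  have "corner 5 1 = circle_point 5 6" using circle_point_shift[of 5 1] by (simp add: corner_circle_point add.commute)
  then have c15: "corner 5 1 \<in> side 5 5" unfolding side_circle_point[OF k5] by simp
  have c32: "corner 5 3 \<in> side 5 2" unfolding side_circle_point[OF k5] corner_circle_point by (intro imageI) simp
  have id: "x = y \<or> x \<in> side 5 2 \<and> y \<in> side 5 5 \<or> x \<in> side 5 5 \<and> y \<in> side 5 2"
    if x: "x \<in> sphere 0 1" "y \<in> sphere 0 1" "\<phi> t x = \<phi> t y" for x y
  proof (cases "x = y")
    case False
    from boundary_identification[OF t x False] show ?thesis
    proof (elim disjE bexE conjE)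
      fix i j assume ij: "i \<in> {1..5}" "j \<in> {1..5}" "i ~= j" "x = corner 5 i" "y = corner 5 j" "rim t (real i) = rim t (real j)"
      have r24: "rim t 2 ~= rim t 4" using r rim45[OF t] by simp
      have "i = 1 \<and> j = 3 \<or> i = 2 \<and> j = 5 \<or> j = 1 \<and> i = 3 \<or> j = 2 \<and> i = 5"
        using rim_eq[OF t ij(1,2,6)] rim_eq[OF t ij(2,1) ij(6)[symmetric]] ij(3,6) r24 by (cases "i < j") auto
      then show ?thesis using ij(4,5) cs c15 c32 by auto
    next
      fix i j assume ij: "i \<in> {1..5}" "j \<in> {1..5}" "i ~= j" "x \<in> open_side 5 i" "y \<in> open_side 5 j" "edge t i = edge t j"
      have r24: "rim t 2 ~= rim t 4" using r rim45[OF t] by simp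
      have "i = 2 \<and> j = 5 \<or> j = 2 \<and> i = 5"
        using blank_end_eq[OF t ij(1,2,6)] blank_end_eq[OF t ij(2,1) ij(6)[symmetric]] ij(3) r24 by (cases "i < j") auto
      then show ?thesis using ij(4,5) open_side_subset_side by blast
    qed
  qed simp
  show ?thesis unfolding type_P3_def
  proof (intro exI[of _ "\<phi> t"] conjI)
    show "labelled_pentagon V E B t (\<phi> t)" by (rule labelled[OF t])
    show "\<phi> t ` side 5 2 = \<phi> t ` side 5 5" using e25 by (simp add: edge_def)
    show "\<phi> t (corner 5 2) = \<phi> t (corner 5 5)" "\<phi> t (corner 5 3) = \<phi> t (corner 5 1)" using r r31 by (simp_all add: \<phi>_corner)
  qed (use id in blast)
qed

text \<open>Changing the chart of a single tile by the reflection respects all assumptions on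
  labels. Thus \<open>v_2 = v_4\<close> reduces to \<open>v_2 = v_5\<close>, and a tile can be
  turned over before it is glued to another.\<close>

lemma reflect_tile:
  assumes t: "t \<in> T"
  shows "labelled_pentagons S V E (\<phi>(t := \<phi> t \<circ> pentagon_reflection)) B"
    "polygons.rim 5 (\<phi>(t := \<phi> t \<circ> pentagon_reflection)) t s = rim t (4 - s)"
proof -
  let ?\<phi> = "\<phi>(t := \<phi> t \<circ> pentagon_reflection)"
  have pm: "polygon_map V E 5 t' (?\<phi> t')" if "t' \<in> T" for t'
    using polygon[OF that] polygon_map_reflect[OF polygon[OF t]] by simp
  interpret R: polygonal_surface S V E 5 ?\<phi>
    using surface graph pm degree by unfold_locales auto
  have rt: "R.rim t s = rim t (4 - s)" for s
    unfolding R.rim_def rim_def by (simp add: pentagon_reflection_circle_point)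
  have ro: "R.rim t' s = rim t' s" if "t' ~= t" for t' s unfolding R.rim_def rim_def using that by simp
  have per: "rim t (-1) = rim t 4" "rim t 0 = rim t 5" using rim_period[of t "-1"] rim_period[of t 0] by simp_all
  show "R.rim t s = rim t (4 - s)" by (rule rt)
  show "labelled_pentagons S V E ?\<phi> B"
  proof (unfold_locales)
    show "B \<subseteq> V" by (rule B_V)
    show "vertex_degree V E u = 3" if "u \<in> V - B" for u by (rule degree3[OF that])
    fix t' assume t': "t' \<in> T"
    have "R.rim t' 1 \<in> B \<and> R.rim t' 3 \<in> B \<and> R.rim t' 2 \<notin> B \<and> R.rim t' 4 \<notin> B \<and> R.rim t' 5 \<notin> B \<and> R.rim t' 4 ~= R.rim t' 5"
    proof (cases "t' = t")
      case True
      then show ?thesis using bullets[OF t] blanks[OF t] rim45[OF t] per by (simp add: rt)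
    next
      case False
      then show ?thesis using bullets[OF t'] blanks[OF t'] rim45[OF t'] by (simp add: ro)
    qed
    then show "R.rim t' 1 \<in> B" "R.rim t' 3 \<in> B" "R.rim t' 2 \<notin> B" "R.rim t' 4 \<notin> B" "R.rim t' 5 \<notin> B" "R.rim t' 4 ~= R.rim t' 5"
      by blast+
  qed
qed

text \<open>If \<open>v_2\<close> differs from \<open>v_4\<close> and \<open>v_5\<close>, the only
  possible coincidence is \<open>v_1 = v_3\<close>, which separates the first two types.
  \<open>v_2 = v_5\<close> forces the third type, and \<open>v_2 = v_4\<close> is its mirror
  image.\<close>

lemma tile_types:
  assumes t: "t \<in> T" shows "type_P1 V E B t \<or> type_P2 S V E B t \<or> type_P3 V E B t"
proof -
  consider "rim t 2 = rim t 5" | "rim t 2 = rim t 4" | "rim t 2 ~= rim t 4" "rim t 2 ~= rim t 5" by blast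
  then show ?thesis
  proof cases
    case 1 then show ?thesis using type_P3_case[OF t] by blast
  next
    case 2
    interpret R: labelled_pentagons S V E "\<phi>(t := \<phi> t \<circ> pentagon_reflection)" B by (rule reflect_tile(1)[OF t])
    have "R.rim t 2 = R.rim t 5" using reflect_tile(2)[OF t, of 2] reflect_tile(2)[OF t, of 5] 2 rim_period[of t "-1"] by simp
    then show ?thesis using R.type_P3_case[OF t] by blast
  next
    case 3
    have id: "\<exists>i\<in>{1..5}. \<exists>j\<in>{1..5}. x = corner 5 i \<and> y = corner 5 j \<and> rim t (real i) = rim t (real j) \<and> (i = 1 \<and> j = 3 \<or> j = 1 \<and> i = 3)"
      if x: "x \<in> sphere 0 1" "y \<in> sphere 0 1" "\<phi> t x = \<phi> t y" "x ~= y" for x y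
      using boundary_identification[OF t x]
    proof (elim disjE bexE conjE)
      fix i j assume ij: "i \<in> {1..5}" "j \<in> {1..5}" "i ~= j" "x = corner 5 i" "y = corner 5 j" "rim t (real i) = rim t (real j)"
      have "i = 1 \<and> j = 3 \<or> j = 1 \<and> i = 3"
        using rim_eq[OF t ij(1,2,6)] rim_eq[OF t ij(2,1) ij(6)[symmetric]] ij(3,6) 3 by (cases "i < j") auto
      then show ?thesis using ij by blast
    next
      fix i j assume ij: "i \<in> {1..5}" "j \<in> {1..5}" "i ~= j" "x \<in> open_side 5 i" "y \<in> open_side 5 j" "edge t i = edge t j"
      then show ?thesis
        using blank_end_eq[OF t ij(1,2,6)] blank_end_eq[OF t ij(2,1) ij(6)[symmetric]] ij(3) 3 by (cases "i < j") auto
    qed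
    show ?thesis
    proof (cases "rim t 1 = rim t 3")
      case False
      have "inj_on (\<phi> t) (sphere 0 1)"
      proof (rule inj_onI, rule ccontr)
        fix x y assume "x \<in> sphere 0 1" "y \<in> sphere 0 1" "\<phi> t x = \<phi> t y" "x ~= y"
        then show False using id[of x y] False by auto
      qed
      then show ?thesis using labelled[OF t] unfolding type_P1_def by blast
    next
      case True
      have ne: "edge t 3 ~= edge t 1" "edge t 5 ~= edge t 2"
        using blank_end_eq[OF t, of 1 3] blank_end_eq[OF t, of 2 5] 3 by auto
      have r1: "\<phi> t (corner 5 1) = rim t 1" "\<phi> t (corner 5 3) = rim t 3" by (simp_all add: \<phi>_corner)
      have "type_P2 S V E B t" unfolding type_P2_def
      proof (intro exI[of _ "\<phi> t"] conjI ballI allI impI)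
        show "labelled_pentagon V E B t (\<phi> t)" by (rule labelled[OF t])
        show "\<phi> t (corner 5 1) = \<phi> t (corner 5 3)" using True r1 by simp
        fix x y :: complex assume x: "x \<in> sphere 0 1" "y \<in> sphere 0 1" "\<phi> t x = \<phi> t y"
        show "x = y \<or> {x, y} = {corner 5 1, corner 5 3}" using id[OF x] by auto
      next
        fix U assume "openin (top_of_set S) U \<and> \<phi> t (corner 5 1) \<in> U"
        then show "\<exists>D\<subseteq>U. openin (top_of_set S) D \<and> \<phi> t (corner 5 1) \<in> D \<and> D homeomorphic ball (0::complex) 1 \<and> (t \<union> D) homeomorphic moebius_band"
          using moebius_neighbourhood[OF t True ne] unfolding r1 by blast
      qed
      then show ?thesis by blast
    qed
  qed
qed

end

section \<open>From a subdivision to a labelling\<close>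

lemma polygonal_tiling_surface:
  assumes "polygonal_tiling k S V E" "k \<ge> 3" "\<And>t. t \<in> tiles S V E ==> polygon_map V E k t (\<phi> t)"
  shows "polygonal_surface S V E k \<phi>"
proof (unfold_locales)
  show "closed_surface S" "embedded_graph S V E" using assms(1) by (simp_all add: polygonal_tiling_def tiling_def)
  show "3 \<le> k" by (rule assms(2))
  show "polygon_map V E k t (\<phi> t)" if "t \<in> tiles S V E" for t by (rule assms(3)[OF that])
  show "3 \<le> vertex_degree V E v" if "v \<in> V" for v using assms(1) that by (simp add: polygonal_tiling_def tiling_def)
qed

lemma ex_polygon_maps:
  assumes "polygonal_tiling k S V E" obtains \<phi> where "\<forall>t\<in>tiles S V E. polygon_map V E k t (\<phi> t)"
proof -
  have "\<forall>t\<in>tiles S V E. \<exists>f. polygon_map V E k t f" using assms by (simp add: polygonal_tiling_def)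
  then show ?thesis by (rule bchoice[THEN exE]) (rule that)
qed

lemma simple_path_point_eq:
  assumes "simple_path g" "x \<in> {0..1}" "y \<in> {0..1}" "g x = g y"
  shows "x = y \<or> x = 0 \<and> y = 1 \<or> x = 1 \<and> y = 0"
  using assms unfolding simple_path_def loop_free_def by blast

text \<open>The charts of the pentagons are given by \<open>pent\<close> and not built from the
  quadrilaterals, so it is never determined which pentagons lie in which quadrilateral. Their single
  blank side is found by parity and by counting; rotating the charts then puts it at index
  4.\<close>

lemma subdivision_imp_labelling:
  fixes S V V0 :: "'a::t2_space set" and E E0 :: "'a set set"
  assumes pent: "pentagonal_tiling S V E" and quad: "quadrilateral_tiling S V0 E0"
    and sub: "simple_pentagonal_subdivision S V0 E0 V E"
  shows "\<exists>B\<subseteq>V. (\<forall>v\<in>V - B. vertex_degree V E v = 3) \<and>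
    (\<forall>t\<in>tiles S V E. type_P1 V E B t \<or> type_P2 S V E B t \<or> type_P3 V E B t)"
proof -
  obtain \<gamma> :: "'a set => real => 'a" and \<phi> :: "'a set => complex => 'a" and s :: "'a set => nat" and c :: "'a set => real => complex"
    where \<gamma>: "\<forall>e\<in>E0. edge_path V0 e (\<gamma> e)"
    and tl: "\<forall>t\<in>tiles S V0 E0.
           polygon_map V0 E0 4 t (\<phi> t) \<and> s t \<in> {1, 2} \<and> arc (c t) \<and> c t ` {0<..<1} \<subseteq> ball 0 1 \<and>
           pathstart (c t) \<in> side 4 (s t) \<and> pathfinish (c t) \<in> side 4 (s t + 2) \<and>
           \<phi> t (pathstart (c t)) = \<gamma> (\<phi> t ` side 4 (s t)) (1/2) \<and>
           \<phi> t (pathfinish (c t)) = \<gamma> (\<phi> t ` side 4 (s t + 2)) (1/2)"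
    and un: "\<forall>e\<in>E0. \<exists>!p. p \<in> (SIGMA t:tiles S V0 E0. {s t, s t + 2}) \<and> \<phi> (fst p) ` side 4 (snd p) = e"
    and V: "V = V0 \<union> (\<lambda>e. \<gamma> e (1/2)) ` E0"
    and E: "E = (\<lambda>e. \<gamma> e ` {0..1/2}) ` E0 \<union> (\<lambda>e. \<gamma> e ` {1/2..1}) ` E0 \<union>
             (\<lambda>t. \<phi> t ` path_image (c t)) ` tiles S V0 E0"
    using sub unfolding simple_pentagonal_subdivision_def by (elim exE conjE)
  interpret Q: polygonal_surface S V0 E0 4 \<phi>
    by (rule polygonal_tiling_surface[OF quad]) (use tl in auto)
  obtain \<phi>5 where "\<forall>t\<in>tiles S V E. polygon_map V E 5 t (\<phi>5 t)" by (rule ex_polygon_maps[OF pent])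
  then have \<phi>5: "\<And>t. t \<in> tiles S V E ==> polygon_map V E 5 t (\<phi>5 t)" by blast
  interpret P: polygonal_surface S V E 5 \<phi>5 by (rule polygonal_tiling_surface[OF pent _ \<phi>5]) auto
  define mid where "mid e = \<gamma> e (1/2)" for e
  define h0 where "h0 e = \<gamma> e ` {0..1/2}" for e
  define h1 where "h1 e = \<gamma> e ` {1/2..1}" for e
  define a where "a t = \<phi> t ` path_image (c t)" for t
  have V': "V = V0 \<union> mid ` E0" unfolding V mid_def ..
  have E': "E = h0 ` E0 \<union> h1 ` E0 \<union> a ` Q.T" unfolding E h0_def h1_def a_def ..
  have g: "simple_path (\<gamma> e)" "path_image (\<gamma> e) = e" "e \<inter> V0 = {\<gamma> e 0, \<gamma> e 1}" if "e \<in> E0" for e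
    using bspec[OF \<gamma> that] by (simp_all add: edge_path_def pathstart_def pathfinish_def)
  have gin: "\<gamma> e x \<in> e" if "e \<in> E0" "x \<in> {0..1}" for e x using g(2)[OF that(1)] that(2) unfolding path_image_def by blast
  have g_int: "\<gamma> e x \<notin> V0" if e: "e \<in> E0" and x: "0 < x" "x < 1" for e x
  proof
    assume "\<gamma> e x \<in> V0"
    then have "\<gamma> e x \<in> e \<inter> V0" using gin[OF e, of x] x by simp
    then have "\<gamma> e x = \<gamma> e 0 \<or> \<gamma> e x = \<gamma> e 1" unfolding g(3)[OF e] by simp
    then show False using simple_path_point_eq[OF g(1)[OF e], of x 0] simple_path_point_eq[OF g(1)[OF e], of x 1] x by auto
  qed
  have mid_e: "mid e \<in> e" "mid e \<notin> V0" if "e \<in> E0" for e using gin[OF that, of "1/2"] g_int[OF that, of "1/2"] by (simp_all add: mid_def)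
  have mid_uniq: "e = e'" if "e \<in> E0" "e' \<in> E0" "mid e \<in> e'" for e e'
    using Q.edges_meet[OF that(1,2) mid_e(1)[OF that(1)] that(3) mid_e(2)[OF that(1)]] .
  have gV: "x = 0 \<or> x = 1/2 \<or> x = 1" if e: "e \<in> E0" and x: "x \<in> {0..1}" "\<gamma> e x \<in> V" for e x
  proof (rule ccontr)
    assume n: "\<not> ?thesis"
    then have "\<gamma> e x \<notin> V0" using g_int[OF e, of x] x(1) by auto
    then obtain e' where e': "e' \<in> E0" "\<gamma> e x = mid e'" using x(2) V' by auto
    then have "mid e' \<in> e" using gin[OF e x(1)] by simp
    then have "e' = e" using mid_uniq[OF e'(1) e] by blast
    then have "\<gamma> e x = \<gamma> e (1/2)" using e'(2) by (simp add: mid_def)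
    then show False using simple_path_point_eq[OF g(1)[OF e] x(1), of "1/2"] n by auto
  qed
  have end_V: "\<gamma> e 0 \<in> V0" "\<gamma> e 1 \<in> V0" if "e \<in> E0" for e using g(3)[OF that] by blast+
  have mid_V: "mid e \<in> V" if "e \<in> E0" for e using that V' by blast
  have h0V: "h0 e \<inter> V = {\<gamma> e 0, mid e}" if e: "e \<in> E0" for e
  proof
    show "h0 e \<inter> V \<subseteq> {\<gamma> e 0, mid e}"
    proof
      fix v assume "v \<in> h0 e \<inter> V"
      then obtain x where x: "x \<in> {0..1/2}" "v = \<gamma> e x" "\<gamma> e x \<in> V" unfolding h0_def by blast
      then have "x = 0 \<or> x = 1/2" using gV[OF e, of x] by auto
      then show "v \<in> {\<gamma> e 0, mid e}" unfolding x(2) mid_def by (elim disjE) (hypsubst, simp)+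
    qed
    have "\<gamma> e 0 \<in> h0 e" "mid e \<in> h0 e" unfolding h0_def mid_def by (rule imageI; simp)+
    moreover have "\<gamma> e 0 \<in> V" using end_V(1)[OF e] unfolding V' by (rule UnI1)
    ultimately show "{\<gamma> e 0, mid e} \<subseteq> h0 e \<inter> V" using mid_V[OF e] by blast
  qed
  have h1V: "h1 e \<inter> V = {\<gamma> e 1, mid e}" if e: "e \<in> E0" for e
  proof
    show "h1 e \<inter> V \<subseteq> {\<gamma> e 1, mid e}"
    proof
      fix v assume "v \<in> h1 e \<inter> V"
      then obtain x where x: "x \<in> {1/2..1}" "v = \<gamma> e x" "\<gamma> e x \<in> V" unfolding h1_def by blast
      then have "x = 1 \<or> x = 1/2" using gV[OF e, of x] by auto
      then show "v \<in> {\<gamma> e 1, mid e}" unfolding x(2) mid_def by (elim disjE) (hypsubst, simp)+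
    qed
    have "\<gamma> e 1 \<in> h1 e" "mid e \<in> h1 e" unfolding h1_def mid_def by (rule imageI; simp)+
    moreover have "\<gamma> e 1 \<in> V" using end_V(2)[OF e] unfolding V' by (rule UnI1)
    ultimately show "{\<gamma> e 1, mid e} \<subseteq> h1 e \<inter> V" using mid_V[OF e] by blast
  qed
  have hsub: "h0 e \<subseteq> e" "h1 e \<subseteq> e" if "e \<in> E0" for e using gin[OF that] unfolding h0_def h1_def by auto
  define e1 where "e1 t = \<phi> t ` side 4 (s t)" for t
  define e2 where "e2 t = \<phi> t ` side 4 (s t + 2)" for t
  have tt: "s t \<in> {1, 2}" "arc (c t)" "c t ` {0<..<1} \<subseteq> ball 0 1" "\<phi> t (c t 0) = mid (e1 t)" "\<phi> t (c t 1) = mid (e2 t)" if "t \<in> Q.T" for t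
    using bspec[OF tl that] by (simp_all add: mid_def e1_def e2_def pathstart_def pathfinish_def)
  have e12: "e1 t \<in> E0" "e2 t \<in> E0" if "t \<in> Q.T" for t
  proof -
    have "s t \<in> {1..4}" "s t + 2 \<in> {1..4}" using tt(1)[OF that] by auto
    then show "e1 t \<in> E0" "e2 t \<in> E0" using Q.edge_in_E[OF that] unfolding Q.edge_def e1_def e2_def by blast+
  qed
  \<comment> \<open>The unique existence requirement of the subdivision, for two pairs of a tile and
    a selected side on the same edge.\<close>
  have used: "t = t' \<and> i = j" if u: "t \<in> Q.T" "t' \<in> Q.T" "i \<in> {s t, s t + 2}" "j \<in> {s t', s t' + 2}" "\<phi> t ` side 4 i = \<phi> t' ` side 4 j" "\<phi> t ` side 4 i \<in> E0" for t t' i j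
  proof -
    obtain p where p: "\<forall>q. q \<in> (SIGMA t:tiles S V0 E0. {s t, s t + 2}) \<and> \<phi> (fst q) ` side 4 (snd q) = \<phi> t ` side 4 i --> q = p"
      using bspec[OF un u(6)] by (elim ex1E) blast
    have ti: "(t, i) \<in> (SIGMA t:tiles S V0 E0. {s t, s t + 2})" using u(1,3) by (rule SigmaI)
    have tj: "(t', j) \<in> (SIGMA t:tiles S V0 E0. {s t, s t + 2})" using u(2,4) by (rule SigmaI)
    have "(t, i) = p" by (rule mp[OF spec[OF p]]) (rule conjI[OF ti], simp)
    moreover have "(t', j) = p" by (rule mp[OF spec[OF p]]) (rule conjI[OF tj], simp add: u(5))
    ultimately show ?thesis by blast
  qed
  have used_tile: "t = t'"
    if u: "t \<in> Q.T" "t' \<in> Q.T" "e \<in> E0" "e = e1 t \<or> e = e2 t" "e = e1 t' \<or> e = e2 t'" for t t' e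
  proof -
    have "\<exists>i\<in>{s t, s t + 2}. \<phi> t ` side 4 i = e" using u(4) unfolding e1_def e2_def by (elim disjE) simp_all
    then obtain i where i: "i \<in> {s t, s t + 2}" "\<phi> t ` side 4 i = e" by (rule bexE)
    have "\<exists>j\<in>{s t', s t' + 2}. \<phi> t' ` side 4 j = e" using u(5) unfolding e1_def e2_def by (elim disjE) simp_all
    then obtain j where j: "j \<in> {s t', s t' + 2}" "\<phi> t' ` side 4 j = e" by (rule bexE)
    show ?thesis using used[OF u(1,2) i(1) j(1)] i(2) j(2) u(3) by simp
  qed
  have e_ne: "e1 t ~= e2 t" if "t \<in> Q.T" for t
  proof
    assume "e1 t = e2 t"
    then have "s t = s t + 2" using used[OF that that, of "s t" "s t + 2"] e12[OF that] unfolding e1_def e2_def by blast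
    then show False by simp
  qed
  have ex_used: "\<exists>t\<in>Q.T. e = e1 t \<or> e = e2 t" if eE: "e \<in> E0" for e
  proof -
    obtain p where p: "p \<in> (SIGMA t:tiles S V0 E0. {s t, s t + 2})" "\<phi> (fst p) ` side 4 (snd p) = e"
      using bspec[OF un eE] by (elim ex1E) blast
    obtain t i where ti: "p = (t, i)" by (cases p)
    then have "t \<in> Q.T" "i = s t \<or> i = s t + 2" "\<phi> t ` side 4 i = e" using p by simp_all
    then show ?thesis unfolding e1_def e2_def by metis
  qed
  have a_int: "\<phi> t (c t x) \<in> t" if "t \<in> Q.T" "0 < x" "x < 1" for t x
  proof -
    have "x \<in> {0<..<1}" using that(2,3) by simp
    then have "c t x \<in> ball 0 1" using tt(3)[OF that(1)] by blast
    then show ?thesis using Q.image_ball[OF that(1)] by blast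
  qed
  have t_V: "x \<notin> V" if "t \<in> Q.T" "x \<in> t" for t x
  proof
    assume "x \<in> V"
    then have "x \<in> V0 \<union> \<Union>E0" using V' mid_e(1) by blast
    then show False using Q.tile_disj_graph[OF that(1)] that(2) by blast
  qed
  have aV: "a t \<inter> V = {mid (e1 t), mid (e2 t)}" if t: "t \<in> Q.T" for t
  proof
    show "a t \<inter> V \<subseteq> {mid (e1 t), mid (e2 t)}"
    proof
      fix v assume "v \<in> a t \<inter> V"
      then obtain x where x: "x \<in> {0..1}" "v = \<phi> t (c t x)" "v \<in> V" unfolding a_def path_image_def by blast
      have "\<not> (0 < x \<and> x < 1)" using t_V[OF t a_int[OF t]] x by blast
      then have "x = 0 \<or> x = 1" using x(1) by auto
      then show "v \<in> {mid (e1 t), mid (e2 t)}" using x(2) tt(4,5)[OF t] by auto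
    qed
    have "c t 0 \<in> path_image (c t)" "c t 1 \<in> path_image (c t)" by (simp_all add: path_image_def)
    then have "mid (e1 t) \<in> a t" "mid (e2 t) \<in> a t" unfolding a_def tt(4,5)[OF t, symmetric] by blast+
    then show "{mid (e1 t), mid (e2 t)} \<subseteq> a t \<inter> V" using mid_V e12[OF t] by blast
  qed
  have mid_inj: "mid e = mid e' \<longleftrightarrow> e = e'" if "e \<in> E0" "e' \<in> E0" for e e'
    using mid_uniq[OF that] mid_e(1)[OF that(2)] by metis
  have mids_ne: "mid (e1 t) ~= mid (e2 t)" if "t \<in> Q.T" for t using mid_inj[OF e12[OF that]] e_ne[OF that] by simp
  \<comment> \<open>What the three kinds of edges have in common: two different ends, at least one
    of which is a middle point.\<close>
  have ends2: "\<exists>p q. x \<inter> V = {p, q} \<and> p ~= q \<and> q \<notin> V0" if x: "x \<in> E" for x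
  proof -
    consider e where "e \<in> E0" "x = h0 e" | e where "e \<in> E0" "x = h1 e" | t where "t \<in> Q.T" "x = a t"
      using x E' by blast
    then show ?thesis
    proof cases
      case 1 then show ?thesis using h0V[OF 1(1)] end_V(1)[OF 1(1)] mid_e(2)[OF 1(1)] by metis
    next
      case 2 then show ?thesis using h1V[OF 2(1)] end_V(2)[OF 2(1)] mid_e(2)[OF 2(1)] by metis
    next
      case 3 then show ?thesis using aV[OF 3(1)] mids_ne[OF 3(1)] mid_e(2)[OF e12(2)[OF 3(1)]] by metis
    qed
  qed
  have V0V: "V0 \<subseteq> V" using V' by blast
  have h_bullet: "h0 e \<inter> V0 ~= {}" "h1 e \<inter> V0 ~= {}" if "e \<in> E0" for e
  proof -
    have "\<gamma> e 0 \<in> h0 e" "\<gamma> e 1 \<in> h1 e" unfolding h0_def h1_def by (rule imageI; simp)+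
    then show "h0 e \<inter> V0 ~= {}" "h1 e \<inter> V0 ~= {}" using end_V[OF that] by blast+
  qed
  have a_blank: "a t \<inter> V0 = {}" if "t \<in> Q.T" for t
  proof -
    have "a t \<inter> V0 = (a t \<inter> V) \<inter> V0" using V0V by blast
    then show ?thesis using aV[OF that] mid_e(2) e12[OF that] by auto
  qed
  define blank where "blank = {e \<in> E. e \<inter> V0 = {}}"
  have hE: "h0 e \<in> E - blank" "h1 e \<in> E - blank" if "e \<in> E0" for e
    unfolding blank_def E' using h_bullet[OF that] that by simp_all
  have aE: "a t \<in> blank" if "t \<in> Q.T" for t unfolding blank_def E' using a_blank[OF that] that by simp
  have blank_eq: "blank = a ` Q.T"
  proof (intro equalityI subsetI)
    fix x assume x: "x \<in> blank"
    then have "x \<in> E" by (simp add: blank_def)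
    then have "x \<in> h0 ` E0 \<union> h1 ` E0 \<union> a ` Q.T" by (simp only: E')
    then show "x \<in> a ` Q.T" using hE x by blast
  qed (use aE in blast)
  have rest_eq: "E - blank = h0 ` E0 \<union> h1 ` E0"
  proof (intro equalityI subsetI)
    fix x assume x: "x \<in> E - blank"
    then have "x \<in> E" by simp
    then have "x \<in> h0 ` E0 \<union> h1 ` E0 \<union> a ` Q.T" by (simp only: E')
    then show "x \<in> h0 ` E0 \<union> h1 ` E0" using aE x by blast
  qed (use hE in blast)
  have a_inj: "inj_on a Q.T"
  proof (rule inj_onI)
    fix t t' assume t: "t \<in> Q.T" "t' \<in> Q.T" "a t = a t'"
    have "\<phi> t (c t (1/2)) \<in> a t" by (simp add: a_def path_image_def)
    then have "\<phi> t (c t (1/2)) \<in> (\<lambda>x. \<phi> t' (c t' x)) ` {0..1}" unfolding t(3) unfolding a_def path_image_def image_image .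
    then obtain x where x': "\<phi> t (c t (1/2)) = \<phi> t' (c t' x)" "x \<in> {0..1}" by (rule imageE)
    note x = x'(2,1)
    have in_t: "\<phi> t (c t (1/2)) \<in> t" using a_int[OF t(1), of "1/2"] by simp
    have "x ~= 0 \<and> x ~= 1"
    proof (rule ccontr)
      assume "\<not> ?thesis"
      then have "\<phi> t' (c t' x) \<in> V" using tt(4,5)[OF t(2)] mid_V e12[OF t(2)] by auto
      then show False using t_V[OF t(1) in_t] x(2) by simp
    qed
    then have "\<phi> t' (c t' x) \<in> t'" using a_int[OF t(2), of x] x(1) by auto
    then show "t = t'" using Q.tiles_disjoint[OF t(1,2) in_t] x(2) by simp
  qed
  have card_blank: "card blank = card Q.T" unfolding blank_eq by (rule card_image[OF a_inj])
  have h_mid: "mid e \<in> h0 e" "mid e \<in> h1 e" for e unfolding h0_def h1_def mid_def by (rule imageI; simp)+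
  have h_inj: "e = e'" if "e \<in> E0" "e' \<in> E0" "mid e \<in> h0 e' \<or> mid e \<in> h1 e'" for e e'
    using mid_uniq[OF that(1,2)] hsub[OF that(2)] that(3) by blast
  have h01: "h0 e ~= h1 e" if e: "e \<in> E0" for e
  proof
    assume "h0 e = h1 e"
    moreover have "\<gamma> e (1/4) \<in> h0 e" unfolding h0_def by (rule imageI) simp
    ultimately obtain x where x: "x \<in> {1/2..1}" "\<gamma> e (1/4) = \<gamma> e x" unfolding h1_def by auto
    then show False using simple_path_point_eq[OF g(1)[OF e], of "1/4" x] by auto
  qed
  have h01': "h0 e ~= h1 e'" if "e \<in> E0" "e' \<in> E0" for e e'
    using h_inj[OF that] h_mid(1)[of e] h01[OF that(1)] by metis
  have "inj_on h0 E0"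
  proof (rule inj_onI)
    fix e e' assume "e \<in> E0" "e' \<in> E0" "h0 e = h0 e'"
    then show "e = e'" using h_inj[of e e'] h_mid(1)[of e] by simp
  qed
  moreover have "inj_on h1 E0"
  proof (rule inj_onI)
    fix e e' assume "e \<in> E0" "e' \<in> E0" "h1 e = h1 e'"
    then show "e = e'" using h_inj[of e e'] h_mid(2)[of e] by simp
  qed
  ultimately have "card (h0 ` E0) = card E0" "card (h1 ` E0) = card E0" by (simp_all add: card_image)
  moreover have "h0 ` E0 \<inter> h1 ` E0 = {}" using h01' by blast
  ultimately have card_rest: "card (E - blank) = 2 * card E0"
    unfolding rest_eq using Q.finite_E by (simp add: card_Un_disjoint)
  have blank_E: "blank \<subseteq> E" by (simp add: blank_def)
  have Q_count: "2 * card E0 = 4 * card Q.T"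
  proof -
    have "(\<Union>e\<in>E0. Q.sides_of e) = Q.T \<times> {1..4}"
    proof (intro equalityI subsetI)
      fix c assume "c \<in> Q.T \<times> {1..4::nat}"
      then have "c \<in> Q.sides_of (Q.edge (fst c) (snd c))" "Q.edge (fst c) (snd c) \<in> E0"
        using Q.edge_in_E[of "fst c" "snd c"] by (simp_all add: Q.sides_of_def mem_Times_iff case_prod_beta)
      then show "c \<in> (\<Union>e\<in>E0. Q.sides_of e)" by blast
    next
      fix c assume "c \<in> (\<Union>e\<in>E0. Q.sides_of e)"
      then obtain e where "c \<in> Q.sides_of e" by blast
      then show "c \<in> Q.T \<times> {1..4}" by (simp add: Q.sides_of_def mem_Times_iff case_prod_beta)
    qed
    then show ?thesis using Q.card_sides_of_Union[of E0] by (simp add: card_cartesian_product)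
  qed
  have P_count: "2 * card E = 5 * card P.T"
  proof -
    have "(\<Union>e\<in>E. P.sides_of e) = P.T \<times> {1..5}"
    proof (intro equalityI subsetI)
      fix c assume "c \<in> P.T \<times> {1..5::nat}"
      then have "c \<in> P.sides_of (P.edge (fst c) (snd c))" "P.edge (fst c) (snd c) \<in> E"
        using P.edge_in_E[of "fst c" "snd c"] by (simp_all add: P.sides_of_def mem_Times_iff case_prod_beta)
      then show "c \<in> (\<Union>e\<in>E. P.sides_of e)" by blast
    next
      fix c assume "c \<in> (\<Union>e\<in>E. P.sides_of e)"
      then obtain e where "c \<in> P.sides_of e" by blast
      then show "c \<in> P.T \<times> {1..5}" by (simp add: P.sides_of_def mem_Times_iff case_prod_beta)
    qed
    then show ?thesis using P.card_sides_of_Union[of E] by (simp add: card_cartesian_product)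
  qed
  have "card E = card blank + card (E - blank)"
    using card_Un_disjoint[of blank "E - blank"] blank_E P.finite_E finite_subset[OF blank_E] by (simp add: Un_absorb1)
  \<comment> \<open>With \<open>F\<close> quadrilaterals there are \<open>2F\<close> old edges,
    hence \<open>4F\<close> halves, and \<open>F\<close> arcs. These \<open>5F\<close> edges have
    \<open>10F\<close> sides, so there are \<open>2F\<close> pentagons, as many as the arcs have
    sides.\<close>
  then have tile_count: "card P.T = 2 * card blank" using Q_count P_count card_rest card_blank by linarith
  \<comment> \<open>At a middle point there are the two halves and the arc of the only tile that
    selects this edge.\<close>
  have deg: "vertex_degree V E (mid e) = 3" if e: "e \<in> E0" for e
  proof -
    obtain t where t: "t \<in> Q.T" "e = e1 t \<or> e = e2 t" using ex_used[OF e] by blast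
    have "{x \<in> E. mid e \<in> x} = {h0 e, h1 e, a t}"
    proof (intro equalityI subsetI)
      fix x assume "x \<in> {x \<in> E. mid e \<in> x}"
      then have x: "x \<in> E" "mid e \<in> x" by auto
      then consider e' where "e' \<in> E0" "x = h0 e'" | e' where "e' \<in> E0" "x = h1 e'" | t' where "t' \<in> Q.T" "x = a t'"
        using E' by blast
      then show "x \<in> {h0 e, h1 e, a t}"
      proof cases
        case 1 then show ?thesis using h_inj[OF e 1(1)] x(2) by auto
      next
        case 2 then show ?thesis using h_inj[OF e 2(1)] x(2) by auto
      next
        case 3
        then have "mid e \<in> a t' \<inter> V" using x(2) mid_V[OF e] by blast
        then have "e = e1 t' \<or> e = e2 t'" using aV[OF 3(1)] mid_inj[OF e] e12[OF 3(1)] by auto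
        then have "t = t'"
          by (rule used_tile[OF t(1) 3(1) e t(2)])
        then show ?thesis using 3 by simp
      qed
    next
      fix x assume x: "x \<in> {h0 e, h1 e, a t}"
      have "mid e \<in> a t" using aV[OF t(1)] t(2) by blast
      moreover have "h0 e \<in> E" "h1 e \<in> E" "a t \<in> E" using hE[OF e] aE[OF t(1)] by (simp_all add: blank_def)
      ultimately show "x \<in> {x \<in> E. mid e \<in> x}" using h_mid[of e] x by blast
    qed
    moreover have "a t ~= h0 e" "a t ~= h1 e" using a_blank[OF t(1)] h_bullet[OF e] by metis+
    then have "card {h0 e, h1 e, a t} = 3" using h01[OF e] by auto
    moreover have "vertex_degree V E v = card {x \<in> E. v \<in> x}" for v
    proof -
      have "x \<inter> V ~= {v}" if "x \<in> E" for x using ends2[OF that] by (metis doubleton_eq_iff insert_absorb2)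
      then have "vertex_degree V E v = (\<Sum>e\<in>{e \<in> E. v \<in> e}. 1)"
        unfolding vertex_degree_def by (intro sum.cong) auto
      then show ?thesis by simp
    qed
    ultimately show ?thesis by simp
  qed
  have PV: "P.edge t j \<inter> V = {P.rim t (real j), P.rim t (real j + 1)}" "P.edge t j \<in> E" if "t \<in> P.T" "j \<in> {1..5}" for t j
    using P.edge_Int_V[OF that] P.edge_in_E[OF that] .
  have not_both: "\<not> (P.rim t (real j) \<in> V0 \<and> P.rim t (real j + 1) \<in> V0)" "P.rim t (real j) ~= P.rim t (real j + 1)"
    if tj: "t \<in> P.T" "j \<in> {1..5}" for t j
  proof -
    obtain p q where pq: "P.edge t j \<inter> V = {p, q}" "p ~= q" "q \<notin> V0" using ends2[OF PV(2)[OF tj]] by blast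
    then have "{P.rim t (real j), P.rim t (real j + 1)} = {p, q}" using PV(1)[OF tj] by simp
    then show "\<not> (P.rim t (real j) \<in> V0 \<and> P.rim t (real j + 1) \<in> V0)" "P.rim t (real j) ~= P.rim t (real j + 1)"
      using pq(2,3) by (auto simp: doubleton_eq_iff)
  qed
  have blank_iff: "P.edge t j \<in> blank \<longleftrightarrow> P.rim t (real j) \<notin> V0 \<and> P.rim t (real j + 1) \<notin> V0" if tj: "t \<in> P.T" "j \<in> {1..5}" for t j
  proof -
    have "P.edge t j \<inter> V0 = (P.edge t j \<inter> V) \<inter> V0" using V0V by blast
    then show ?thesis unfolding blank_def using PV[OF tj] by auto
  qed
  define n where "n t = card {j \<in> {1..5}. P.edge t j \<in> blank}" for t
  have r6: "P.rim t 6 = P.rim t 1" for t using P.rim_last[of t] by simp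
  \<comment> \<open>Otherwise membership in \<open>V0\<close> would alternate along a closed walk of
    five steps.\<close>
  have n1: "1 \<le> n t" if t: "t \<in> P.T" for t
  proof -
    have "\<exists>j\<in>{1..5}. P.edge t j \<in> blank"
    proof (rule ccontr)
      assume no: "\<not> (\<exists>j\<in>{1..5}. P.edge t j \<in> blank)"
      have x: "P.rim t (real j) \<in> V0 \<longleftrightarrow> P.rim t (real j + 1) \<notin> V0" if "j \<in> {1..5}" for j
        using no not_both(1)[OF t that] blank_iff[OF t that] that by blast
      show False using x[of 1] x[of 2] x[of 3] x[of 4] x[of 5] r6[of t] by simp
    qed
    then have "{j \<in> {1..5}. P.edge t j \<in> blank} ~= {}" by blast
    then have "0 < card {j \<in> {1..5::nat}. P.edge t j \<in> blank}" by (subst card_gt_0_iff) simp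
    then show ?thesis unfolding n_def by linarith
  qed
  \<comment> \<open>All \<open>n t\<close> are at least 1, and their sum, the number of sides on
    blank edges, is the number of tiles. So each is equal to 1.\<close>
  have "(\<Sum>t\<in>P.T. n t) = card (SIGMA t:P.T. {j \<in> {1..5}. P.edge t j \<in> blank})"
    unfolding n_def using P.finite_tiles by (subst card_SigmaI) auto
  also have "(SIGMA t:P.T. {j \<in> {1..5}. P.edge t j \<in> blank}) = (\<Union>e\<in>blank. P.sides_of e)"
    unfolding P.sides_of_def by blast
  also have "card (\<Union>e\<in>blank. P.sides_of e) = (\<Sum>t\<in>P.T. 1)"
    using P.card_sides_of_Union[OF blank_E] tile_count by simp
  finally have "(\<Sum>t\<in>P.T. 1) = (\<Sum>t\<in>P.T. n t)" ..
  then have n_one: "n t = 1" if "t \<in> P.T" for t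
    using sum_mono_inv[of "\<lambda>_. 1" P.T n, OF _ n1 that P.finite_tiles] by simp
  \<comment> \<open>\<open>m\<close> is the number of steps by which the chart is rotated so that
    index 4 comes to the blank side; the conditional is \<open>4 + m\<close> reduced to the range
    from 1 to 5.\<close>
  have ex_m: "\<exists>m<5. \<forall>j\<in>{1..5}. P.edge t j \<in> blank \<longleftrightarrow> j = (if 4 + m \<le> 5 then 4 + m else 4 + m - 5)" if t: "t \<in> P.T" for t
  proof -
    obtain j0 where j0: "{j \<in> {1..5}. P.edge t j \<in> blank} = {j0}" using n_one[OF t] unfolding n_def by (rule card_1_singletonE)
    have "j0 \<in> {j \<in> {1..5}. P.edge t j \<in> blank}" unfolding j0 by (rule singletonI)
    then have j05: "j0 \<in> {1..5}" by simp
    define m where "m = (if 4 \<le> j0 then j0 - 4 else j0 + 1)"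
    have "m < 5" "j0 = (if 4 + m \<le> 5 then 4 + m else 4 + m - 5)" using j05 by (auto simp: m_def)
    moreover have "P.edge t j \<in> blank \<longleftrightarrow> j = j0" if "j \<in> {1..5}" for j using j0 that by blast
    ultimately show ?thesis by (intro exI[of _ m]) metis
  qed
  then have "\<forall>t\<in>P.T. \<exists>m. m < 5 \<and> (\<forall>j\<in>{1..5}. P.edge t j \<in> blank \<longleftrightarrow> j = (if 4 + m \<le> 5 then 4 + m else 4 + m - 5))" by blast
  then obtain m where m: "\<forall>t\<in>P.T. m t < 5 \<and> (\<forall>j\<in>{1..5}. P.edge t j \<in> blank \<longleftrightarrow> j = (if 4 + m t \<le> 5 then 4 + m t else 4 + m t - 5))"
    by (rule bchoice[THEN exE])
  define \<phi>6 where "\<phi>6 t = \<phi>5 t \<circ> (\<lambda>z. z * circle_point 5 (real (m t)))" for t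
  interpret R: polygonal_surface S V E 5 \<phi>6
  proof (rule polygonal_tiling_surface[OF pent])
    show "polygon_map V E 5 t (\<phi>6 t)" if "t \<in> P.T" for t
      unfolding \<phi>6_def using bspec[OF m that] by (intro polygon_map_rotate \<phi>5 that) auto
  qed auto
  have rim6: "R.rim t x = P.rim t (x + real (m t))" for t x
    by (simp add: R.rim_def P.rim_def \<phi>6_def circle_point_add)
  have RV: "R.edge t j \<in> blank \<longleftrightarrow> j = 4" if tj: "t \<in> P.T" "j \<in> {1..5}" for t j
  proof -
    define i where "i = (if j + m t \<le> 5 then j + m t else j + m t - 5)"
    have m5: "m t < 5" using bspec[OF m tj(1)] by blast
    have i: "i \<in> {1..5}" using tj(2) m5 by (auto simp: i_def)
    define l where "l = (if j + m t \<le> 5 then 0 else 1 :: real)"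
    have il: "real j + real (m t) = real i + l * real 5" "l \<in> {0, 1}" using tj(2) m5 by (auto simp: i_def l_def of_nat_diff)
    have "R.edge t j = \<phi>5 t ` (\<lambda>z. z * circle_point 5 (real (m t))) ` side 5 j"
      unfolding R.edge_def \<phi>6_def by (rule image_comp[symmetric])
    also have "(\<lambda>z. z * circle_point 5 (real (m t))) ` side 5 j = side 5 i"
      by (rule image_circle_point_rotate(1)[OF _ _ il]) (simp_all add: circle_point_add)
    finally have "R.edge t j = P.edge t i" by (simp add: P.edge_def)
    then have "R.edge t j \<in> blank \<longleftrightarrow> i = (if 4 + m t \<le> 5 then 4 + m t else 4 + m t - 5)"
      using bspec[OF m tj(1)] i by simp
    also have "\<dots> \<longleftrightarrow> j = 4" using tj(2) m5 by (auto simp: i_def split: if_splits)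
    finally show ?thesis .
  qed
  have RE: "R.edge t j \<inter> V = {R.rim t (real j), R.rim t (real j + 1)}" "R.edge t j \<in> E" if "t \<in> P.T" "j \<in> {1..5}" for t j
    using R.edge_Int_V[OF that] R.edge_in_E[OF that] .
  have R_both: "\<not> (R.rim t (real j) \<in> V0 \<and> R.rim t (real j + 1) \<in> V0) \<and> R.rim t (real j) ~= R.rim t (real j + 1) \<and>
      (R.rim t (real j) \<notin> V0 \<and> R.rim t (real j + 1) \<notin> V0 \<longleftrightarrow> j = 4)" if tj: "t \<in> P.T" "j \<in> {1..5}" for t j
  proof -
    obtain p q where pq: "R.edge t j \<inter> V = {p, q}" "p ~= q" "q \<notin> V0" using ends2[OF RE(2)[OF tj]] by blast
    then have pq': "{R.rim t (real j), R.rim t (real j + 1)} = {p, q}" using RE(1)[OF tj] by simp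
    have "R.edge t j \<inter> V0 = (R.edge t j \<inter> V) \<inter> V0" using V0V by blast
    then have "R.edge t j \<in> blank \<longleftrightarrow> R.rim t (real j) \<notin> V0 \<and> R.rim t (real j + 1) \<notin> V0"
      unfolding blank_def using RE[OF tj] by auto
    then show ?thesis using pq' pq(2,3) RV[OF tj] by (auto simp: doubleton_eq_iff)
  qed
  have Rr6: "R.rim t 6 = R.rim t 1" for t using R.rim_last[of t] by simp
  interpret L: labelled_pentagons S V E \<phi>6 V0
  proof (unfold_locales)
    show "V0 \<subseteq> V" by (rule V0V)
    show "vertex_degree V E u = 3" if "u \<in> V - V0" for u using that V' deg by auto
    fix t assume t: "t \<in> P.T"
    have "R.rim t 1 \<in> V0 \<and> R.rim t 3 \<in> V0 \<and> R.rim t 2 \<notin> V0 \<and> R.rim t 4 \<notin> V0 \<and> R.rim t 5 \<notin> V0 \<and> R.rim t 4 ~= R.rim t 5"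
      using R_both[OF t, of 1] R_both[OF t, of 2] R_both[OF t, of 3] R_both[OF t, of 4] R_both[OF t, of 5] Rr6[of t] by auto
    then show "R.rim t 1 \<in> V0" "R.rim t 3 \<in> V0" "R.rim t 2 \<notin> V0" "R.rim t 4 \<notin> V0" "R.rim t 5 \<notin> V0" "R.rim t 4 ~= R.rim t 5"
      by blast+
  qed
  show ?thesis using L.tile_types L.degree3 V0V by (intro exI[of _ V0]) blast
qed

section \<open>From a labelling to a subdivision\<close>

text \<open>The complement of a member is the union of the others, so every member is open and
  closed in the union; being connected and nonempty, it is a component.\<close>

lemma components_of_open_partition:
  assumes op: "\<And>Q. Q \<in> P ==> openin (top_of_set (\<Union>P)) Q"
    and co: "\<And>Q. Q \<in> P ==> connected Q" "\<And>Q. Q \<in> P ==> Q ~= {}"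
    and dj: "\<And>Q Q'. [|Q \<in> P; Q' \<in> P; Q ~= Q'|] ==> Q \<inter> Q' = {}"
  shows "components (\<Union>P) = P"
proof -
  have *: "c = Q" if c: "c \<in> components (\<Union>P)" and Q: "Q \<in> P" and x: "x \<in> c" "x \<in> Q" for c Q x
  proof -
    have cs: "c \<subseteq> \<Union>P" "connected c" using in_components_subset[OF c] in_components_connected[OF c] .
    have ne: "c \<inter> Q ~= {}" using x by blast
    have "Q \<subseteq> \<Union>P" using Q by (rule Union_upper)
    then have "Q \<subseteq> c" using ne by (rule components_maximal[OF c co(1)[OF Q]])
    obtain W where W: "open W" "Q = \<Union>P \<inter> W" using op[OF Q] unfolding openin_open by (elim exE conjE)
    have "c \<inter> Q = c \<inter> W" using W(2) cs(1) by blast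
    then have o1: "openin (top_of_set c) (c \<inter> Q)" by (simp add: openin_open_Int W(1))
    have "openin (top_of_set (\<Union>P)) (\<Union>(P - {Q}))" using op by (intro openin_Union) blast
    then obtain W' where W': "open W'" "\<Union>(P - {Q}) = \<Union>P \<inter> W'" unfolding openin_open by (elim exE conjE)
    have "c \<inter> \<Union>(P - {Q}) = c \<inter> W'" using W'(2) cs(1) by blast
    then have o2: "openin (top_of_set c) (c \<inter> \<Union>(P - {Q}))" by (simp add: openin_open_Int W'(1))
    have "c - c \<inter> Q = c \<inter> \<Union>(P - {Q})" using cs(1) dj[OF _ Q] by blast
    then have "closedin (top_of_set c) (c \<inter> Q)" using o2 by (simp add: closedin_def)
    then have "c \<inter> Q = {} \<or> c \<inter> Q = c" using cs(2)[unfolded connected_clopen] o1 by simp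
    then show ?thesis using x \<open>Q \<subseteq> c\<close> by blast
  qed
  show ?thesis
  proof (intro equalityI subsetI)
    fix c assume c: "c \<in> components (\<Union>P)"
    then obtain x where x: "x \<in> c" using in_components_nonempty by blast
    then obtain Q where Q: "Q \<in> P" "x \<in> Q" using in_components_subset[OF c] by blast
    then show "c \<in> P" using *[OF c Q(1) x Q(2)] by simp
  next
    fix Q assume Q: "Q \<in> P"
    then obtain x where x: "x \<in> Q" using co(2) by blast
    then have "x \<in> \<Union>P" using Q by blast
    then obtain c where c: "c \<in> components (\<Union>P)" "x \<in> c" using Union_components[of "\<Union>P"] by blast
    show "Q \<in> components (\<Union>P)" using *[OF c(1) Q c(2) x] c(1) by simp
  qed
qed

text \<open>The boundary conditions of \<open>polygon_map\<close> are inherited from the paths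
  \<open>h\<close>: a simple path is injective on its interior, even when it is a loop, and an edge
  path meets \<open>V\<close> in its ends only.\<close>

lemma polygon_map_of_edge_paths:
  assumes "continuous_on (cball 0 1) \<Phi>" "\<exists>\<psi>. homeomorphism (ball 0 1) t \<Phi> \<psi>" and k: "k > 0"
    and h: "\<And>j. j \<in> {1..k} ==> edge_path V (e j) (h j)" "\<And>j. j \<in> {1..k} ==> e j \<in> E"
      "\<And>j x. [|j \<in> {1..k}; x \<in> {0..1}|] ==> \<Phi> (circle_point k (real j + x)) = h j x"
  shows "polygon_map V E k t \<Phi>" "j \<in> {1..k} ==> \<Phi> ` side k j = e j"
proof -
  have sd: "\<Phi> ` side k j = e j" if j: "j \<in> {1..k}" for j
  proof -
    have "\<Phi> ` side k j = (\<lambda>x. \<Phi> (circle_point k (real j + x))) ` {0..1}"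
      unfolding side_circle_point[OF k] image_shift_unit_Icc[symmetric] image_image ..
    also have "\<dots> = h j ` {0..1}" using h(3)[OF j] by (intro image_cong) simp_all
    finally show ?thesis using h(1)[OF j] by (simp add: edge_path_def path_image_def)
  qed
  show "j \<in> {1..k} ==> \<Phi> ` side k j = e j" by (rule sd)
  have "\<Phi> (corner k j) \<in> V \<and> \<Phi> ` side k j \<in> E \<and> inj_on \<Phi> (open_side k j) \<and> \<Phi> ` open_side k j \<inter> V = {}"
    if j: "j \<in> {1..k}" for j
  proof (intro conjI)
    have "h j 0 \<in> V" using h(1)[OF j] unfolding edge_path_def pathstart_def by blast
    then show "\<Phi> (corner k j) \<in> V" using h(3)[OF j, of 0] by (simp add: corner_circle_point)
    show "\<Phi> ` side k j \<in> E" using sd[OF j] h(2)[OF j] by simp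
    have os: "open_side k j = (\<lambda>x. circle_point k (real j + x)) ` {0<..<1}"
      unfolding open_side_circle_point[OF k] image_shift_unit_Ioo[symmetric] image_image ..
    have val: "\<Phi> (circle_point k (real j + x)) = h j x" if "x \<in> {0<..<1}" for x using h(3)[OF j, of x] that by simp
    have "\<Phi> ` open_side k j = h j ` {0<..<1}" unfolding os image_image using val by (intro image_cong) simp_all
    then show "\<Phi> ` open_side k j \<inter> V = {}" using edge_path_interior(1)[OF h(1)[OF j]] by blast
    have sp: "simple_path (h j)" using h(1)[OF j] by (simp add: edge_path_def)
    show "inj_on \<Phi> (open_side k j)"
    proof (rule inj_onI)
      fix a b assume ab: "a \<in> open_side k j" "b \<in> open_side k j" "\<Phi> a = \<Phi> b"
      obtain x where x: "a = circle_point k (real j + x)" "x \<in> {0<..<1}" using ab(1) unfolding os by (rule imageE)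
      obtain y where y: "b = circle_point k (real j + y)" "y \<in> {0<..<1}" using ab(2) unfolding os by (rule imageE)
      have "h j x = h j y" using ab(3) val[OF x(2)] val[OF y(2)] x(1) y(1) by simp
      moreover have "x \<in> {0..1}" "y \<in> {0..1}" "x ~= 0" "x ~= 1" using x(2) y(2) by auto
      ultimately have "x = y" using sp unfolding simple_path_def loop_free_def by blast
      then show "a = b" using x(1) y(1) by simp
    qed
  qed
  then show "polygon_map V E k t \<Phi>" unfolding polygon_map_def using assms(1,2) by blast
qed

text \<open>
  The following map carries the upper half of the unit disk onto the disk: it fixes the upper semicircle
  and lowers the diameter to the lower semicircle, so two disks can be glued along their lower
  semicircles.
\<close>

definition unfold_half :: "complex => complex" where
  "unfold_half z = Complex (Re z) (2 * Im z - sqrt (1 - (Re z)\<^sup>2))"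

lemma unfold_half:
  assumes z: "z \<in> cball 0 1" "Im z \<ge> 0"
  shows "unfold_half z \<in> cball 0 1"
    and "unfold_half z \<in> ball 0 1 \<longleftrightarrow> Im z > 0 \<and> norm z < 1"
    and "norm z = 1 ==> unfold_half z = z"
proof -
  define r where "r = sqrt (1 - (Re z)\<^sup>2)"
  have n: "(norm z)\<^sup>2 = (Re z)\<^sup>2 + (Im z)\<^sup>2" by (rule cmod_power2)
  have n1: "(norm z)\<^sup>2 \<le> 1" using z(1) by (simp add: power_le_one)
  have "(Re z)\<^sup>2 \<le> 1" using n n1 zero_le_power2[of "Im z"] by linarith
  then have r2: "r\<^sup>2 = 1 - (Re z)\<^sup>2" "r \<ge> 0" unfolding r_def by simp_all
  have u: "(norm (unfold_half z))\<^sup>2 = (Re z)\<^sup>2 + (2 * Im z - r)\<^sup>2"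
    unfolding cmod_power2 by (simp add: unfold_half_def r_def)
  \<comment> \<open>With \<open>r\<close> the height of the semicircle above \<open>Re z\<close>,
    the factors \<open>Im z\<close> and \<open>r - Im z\<close> vanish exactly on the diameter and
    on the semicircle. These are the points that \<open>unfold_half\<close> sends to the unit
    circle.\<close>
  have key: "(norm (unfold_half z))\<^sup>2 = 1 - 4 * (Im z * (r - Im z))" unfolding u using r2(1) by (simp add: power2_eq_square algebra_simps)
  have "(Im z)\<^sup>2 \<le> r\<^sup>2" using n n1 r2(1) by linarith
  then have le: "Im z \<le> r" using r2(2) by (rule power2_le_imp_le)
  have "0 \<le> Im z * (r - Im z)" using z(2) le by (intro mult_nonneg_nonneg) simp_all
  then have "(norm (unfold_half z))\<^sup>2 \<le> 1\<^sup>2" unfolding key by simp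
  then have "norm (unfold_half z) \<le> 1" by (rule power2_le_imp_le) simp
  then show "unfold_half z \<in> cball 0 1" by simp
  have "norm z < 1 \<longleftrightarrow> (norm z)\<^sup>2 < 1" by (simp add: power_less_one_iff)
  also have "\<dots> \<longleftrightarrow> (Im z)\<^sup>2 < r\<^sup>2" using n r2(1) by linarith
  also have "\<dots> \<longleftrightarrow> Im z < r" using z(2) r2(2) by (metis abs_of_nonneg power2_abs power_strict_mono power_less_imp_less_base pos2)
  finally have lt: "norm z < 1 \<longleftrightarrow> Im z < r" .
  have "unfold_half z \<in> ball 0 1 \<longleftrightarrow> (norm (unfold_half z))\<^sup>2 < 1" by (simp add: power_less_one_iff)
  also have "\<dots> \<longleftrightarrow> 0 < Im z * (r - Im z)" unfolding key by linarith
  also have "\<dots> \<longleftrightarrow> Im z > 0 \<and> norm z < 1" unfolding lt zero_less_mult_iff using z(2) le by auto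
  finally show "unfold_half z \<in> ball 0 1 \<longleftrightarrow> Im z > 0 \<and> norm z < 1" .
  show "unfold_half z = z" if "norm z = 1"
  proof -
    have "Im z = r" using that lt le by auto
    then show ?thesis by (simp add: unfold_half_def complex_eq_iff r_def[symmetric])
  qed
qed

lemma unfold_half_inj: "unfold_half z = unfold_half z' ==> z = z'"
  by (auto simp: unfold_half_def complex_eq_iff)

lemma continuous_on_unfold_half [continuous_intros]: "continuous_on A unfold_half"
  unfolding unfold_half_def Complex_eq by (intro continuous_intros)

lemma unfold_half_real:
  assumes "x \<in> {-1..1}"
  shows "unfold_half (of_real x) \<in> sphere 0 1" "Im (unfold_half (of_real x)) \<le> 0"
    "\<bar>x\<bar> < 1 ==> Im (unfold_half (of_real x)) < 0"
proof -
  have x: "x\<^sup>2 \<le> 1" using assms by (simp add: abs_square_le_1 abs_le_iff)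
  have "(norm (unfold_half (of_real x)))\<^sup>2 = 1" unfolding cmod_power2 using x by (simp add: unfold_half_def)
  then show "unfold_half (of_real x) \<in> sphere 0 1" by (simp add: power2_eq_1_iff) (metis norm_ge_zero neg_0_le_iff_le not_one_le_zero)
  show "Im (unfold_half (of_real x)) \<le> 0" using x by (simp add: unfold_half_def)
  show "Im (unfold_half (of_real x)) < 0" if "\<bar>x\<bar> < 1" using that by (simp add: unfold_half_def abs_square_less_1)
qed

lemma unfold_half_real_image:
  assumes "z \<in> sphere 0 1" "Im z \<le> 0" shows "z = unfold_half (of_real (Re z))" "Re z \<in> {-1..1}"
    "Im z < 0 ==> \<bar>Re z\<bar> < 1"
proof -
  have n: "(Re z)\<^sup>2 + (Im z)\<^sup>2 = 1" using assms(1) cmod_power2[of z] by simp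
  then have "1 - (Re z)\<^sup>2 = (Im z)\<^sup>2" by linarith
  then have "sqrt (1 - (Re z)\<^sup>2) = - Im z" using assms(2) by simp
  then show "z = unfold_half (of_real (Re z))" by (simp add: unfold_half_def complex_eq_iff)
  have "(Re z)\<^sup>2 \<le> 1" using n zero_le_power2[of "Im z"] by linarith
  then show "Re z \<in> {-1..1}" by (simp add: abs_square_le_1 abs_le_iff)
  assume "Im z < 0"
  then have "0 < (Im z)\<^sup>2" by simp
  then have "(Re z)\<^sup>2 < 1" using n by linarith
  then show "\<bar>Re z\<bar> < 1" by (simp add: abs_square_less_1)
qed

text \<open>\<open>\<Psi>\<close> uses \<open>\<omega>\<close> after \<open>unfold_half\<close> on
  the upper half disk and, mirrored, \<open>\<omega>'\<close> on the lower one; by \<open>ag\<close>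
  they match on the diameter, whose interior covers \<open>I\<close>. The other assumptions keep the
  outer circle away from \<open>I\<close> and from the tiles, so the open disk is saturated.\<close>

lemma glue_disks:
  fixes \<omega> \<omega>' :: "complex => 'z::t2_space"
  assumes c: "continuous_on (cball 0 1) \<omega>" "continuous_on (cball 0 1) \<omega>'"
    and inj: "inj_on \<omega> (ball 0 1)" "inj_on \<omega>' (ball 0 1)" and im: "\<omega> ` ball 0 1 = t" "\<omega>' ` ball 0 1 = t'"
    and dj: "t \<inter> t' = {}" "\<And>z. z \<in> sphere 0 1 ==> \<omega> z \<notin> t \<union> t'" "\<And>z. z \<in> sphere 0 1 ==> \<omega>' z \<notin> t \<union> t'"
    and ag: "\<And>z. [|z \<in> sphere 0 1; Im z \<le> 0|] ==> \<omega>' z = \<omega> z"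
    and low: "\<And>z. [|z \<in> sphere 0 1; Im z < 0|] ==> \<omega> z \<in> I"
      "\<And>z z'. [|z \<in> sphere 0 1; Im z < 0; z' \<in> sphere 0 1; Im z' < 0; \<omega> z = \<omega> z'|] ==> z = z'"
      "\<And>z. [|z \<in> sphere 0 1; Im z \<ge> 0|] ==> \<omega> z \<notin> I" "\<And>z. [|z \<in> sphere 0 1; Im z \<ge> 0|] ==> \<omega>' z \<notin> I"
      "I \<subseteq> \<omega> ` {z \<in> sphere 0 1. Im z < 0}"
  shows "\<exists>\<Psi>. continuous_on (cball 0 1) \<Psi> \<and> (\<exists>\<psi>. homeomorphism (ball 0 1) (t \<union> t' \<union> I) \<Psi> \<psi>) \<and>
    (\<forall>z\<in>sphere 0 1. Im z \<ge> 0 --> \<Psi> z = \<omega> z \<and> \<Psi> (cnj z) = \<omega>' z) \<and>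
    (\<forall>x\<in>{-1..1}. \<Psi> (of_real x) = \<omega> (unfold_half (of_real x)))"
proof -
  define \<Psi> where "\<Psi> z = (if Im z \<ge> 0 then \<omega> (unfold_half z) else \<omega>' (unfold_half (cnj z)))" for z
  have real_ag: "\<omega>' (unfold_half (of_real x)) = \<omega> (unfold_half (of_real x))" if "x \<in> {-1..1}" for x
    using ag unfold_half_real[OF that] by blast
  have Rez: "Re z \<in> {-1..1}" if "z \<in> cball 0 1" for z
    using that abs_Re_le_cmod[of z] by auto
  have flat: "z = of_real (Re z)" if "Im z = 0" for z :: complex using that by (simp add: complex_eq_iff)
  have \<Psi>_low: "\<Psi> z = \<omega>' (unfold_half (cnj z))" if "z \<in> cball 0 1" "Im z \<le> 0" for z
  proof (cases "Im z = 0")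
    case True
    have "cnj z = z" using True by (simp add: complex_eq_iff)
    moreover have "\<omega>' (unfold_half z) = \<omega> (unfold_half z)" using real_ag[OF Rez[OF that(1)]] flat[OF True] by simp
    ultimately show ?thesis using True by (simp add: \<Psi>_def)
  qed (use that in \<open>simp add: \<Psi>_def\<close>)
  have pts: "\<exists>w. w \<in> cball 0 1 \<and> (w \<in> ball 0 1 \<longleftrightarrow> Im z ~= 0 \<and> norm z < 1) \<and>
     (Im z \<ge> 0 \<and> \<Psi> z = \<omega> w \<and> w = unfold_half z \<or> Im z < 0 \<and> \<Psi> z = \<omega>' w \<and> w = unfold_half (cnj z))"
    if z: "z \<in> cball 0 1" for z
  proof (cases "Im z \<ge> 0")
    case True
    then show ?thesis using unfold_half(1,2)[OF z True] by (intro exI[of _ "unfold_half z"]) (auto simp: \<Psi>_def)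
  next
    case False
    then have "cnj z \<in> cball 0 1" "Im (cnj z) \<ge> 0" using z by simp_all
    then show ?thesis using unfold_half(1,2)[of "cnj z"] False by (intro exI[of _ "unfold_half (cnj z)"]) (auto simp: \<Psi>_def)
  qed
  have "cball 0 1 = {z \<in> cball 0 1. Im z \<ge> 0} \<union> {z \<in> cball (0::complex) 1. Im z \<le> 0}" by auto
  moreover have "continuous_on ({z \<in> cball 0 1. Im z \<ge> 0} \<union> {z \<in> cball (0::complex) 1. Im z \<le> 0}) \<Psi>"
  proof (rule continuous_on_closed_Un)
    have "closed (cball 0 1 \<inter> {z. Im z \<ge> 0})" "closed (cball 0 1 \<inter> {z. Im z \<le> 0})"
      by (intro closed_Int closed_cball closed_halfspace_Im_ge closed_halfspace_Im_le)+
    then show "closed {z \<in> cball 0 1. Im z \<ge> 0}" "closed {z \<in> cball (0::complex) 1. Im z \<le> 0}" by (simp_all only: Int_def mem_Collect_eq)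
    have "continuous_on {z \<in> cball 0 1. Im z \<ge> 0} (\<lambda>z. \<omega> (unfold_half z))"
      by (rule continuous_on_compose2[OF c(1)]) (auto intro!: continuous_intros unfold_half(1) simp del: mem_cball_0)
    then show "continuous_on {z \<in> cball 0 1. Im z \<ge> 0} \<Psi>"
      by (rule continuous_on_cong[THEN iffD1, rotated -1]) (simp_all add: \<Psi>_def)
    have "continuous_on {z \<in> cball 0 1. Im z \<le> 0} (\<lambda>z. \<omega>' (unfold_half (cnj z)))"
    proof (rule continuous_on_compose2[OF c(2)])
      show "continuous_on {z \<in> cball 0 1. Im z \<le> 0} (\<lambda>z. unfold_half (cnj z))"
        by (rule continuous_on_compose2[OF continuous_on_unfold_half[of UNIV]]) (auto intro!: continuous_intros)
      show "(\<lambda>z. unfold_half (cnj z)) ` {z \<in> cball 0 1. Im z \<le> 0} \<subseteq> cball 0 1"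
      proof (rule image_subsetI)
        fix z :: complex assume "z \<in> {z \<in> cball 0 1. Im z \<le> 0}"
        then have "cnj z \<in> cball 0 1" "Im (cnj z) \<ge> 0" by simp_all
        then show "unfold_half (cnj z) \<in> cball 0 1" by (rule unfold_half(1))
      qed
    qed
    then show "continuous_on {z \<in> cball 0 1. Im z \<le> 0} \<Psi>"
      by (rule continuous_on_cong[THEN iffD1, rotated -1]) (simp_all add: \<Psi>_low)
  qed
  ultimately have cont: "continuous_on (cball 0 1) \<Psi>" by (rule ssubst)
  have sph: "w \<in> sphere 0 1" if "w \<in> cball 0 1" "w \<notin> ball 0 1" for w :: complex using that by simp
  have inj_\<Psi>: "a = x" if a: "a \<in> ball 0 1" and x: "x \<in> cball 0 1" and eq: "\<Psi> a = \<Psi> x" for a x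
  proof -
    have a': "a \<in> cball 0 1" "norm a < 1" using a by simp_all
    obtain w where w: "w \<in> cball 0 1" "w \<in> ball 0 1 \<longleftrightarrow> Im a ~= 0 \<and> norm a < 1"
       "Im a \<ge> 0 \<and> \<Psi> a = \<omega> w \<and> w = unfold_half a \<or> Im a < 0 \<and> \<Psi> a = \<omega>' w \<and> w = unfold_half (cnj a)"
      using pts[OF a'(1)] by blast
    obtain v where v: "v \<in> cball 0 1" "v \<in> ball 0 1 \<longleftrightarrow> Im x ~= 0 \<and> norm x < 1"
       "Im x \<ge> 0 \<and> \<Psi> x = \<omega> v \<and> v = unfold_half x \<or> Im x < 0 \<and> \<Psi> x = \<omega>' v \<and> v = unfold_half (cnj x)"
      using pts[OF x] by blast
    show ?thesis
    proof (cases "Im a = 0")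
      case False
      then have wb: "w \<in> ball 0 1" using w(2) a' by simp
      have "\<Psi> a \<in> t \<union> t'" using w(3) im wb by blast
      then have "\<Psi> x \<in> t \<union> t'" using eq by simp
      then have vb: "v \<in> ball 0 1" using v(3) dj(2,3) sph[OF v(1)] by metis
      have iw: "\<omega> w \<in> t" "\<omega>' w \<in> t'" "\<omega> v \<in> t" "\<omega>' v \<in> t'" using im wb vb by blast+
      have "Im a \<ge> 0 \<longleftrightarrow> Im x \<ge> 0"
      proof (rule ccontr)
        assume "\<not> ?thesis"
        then have "\<Psi> a = \<omega> w \<and> \<Psi> x = \<omega>' v \<or> \<Psi> a = \<omega>' w \<and> \<Psi> x = \<omega> v" using w(3) v(3) by linarith
        then show False using eq iw dj(1) by (metis IntI empty_iff)
      qed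
      then consider "\<omega> w = \<omega> v" "w = unfold_half a" "v = unfold_half x" | "\<omega>' w = \<omega>' v" "w = unfold_half (cnj a)" "v = unfold_half (cnj x)"
        using w(3) v(3) eq by (metis linorder_not_le)
      then show ?thesis
      proof cases
        case 1 then show ?thesis using inj_onD[OF inj(1) 1(1) wb vb] unfold_half_inj by blast
      next
        case 2
        then have "cnj a = cnj x" using inj_onD[OF inj(2) 2(1) wb vb] unfold_half_inj by blast
        then show ?thesis by simp
      qed
    next
      case True
      have aR: "a = of_real (Re a)" by (rule flat[OF True])
      have rb: "\<bar>Re a\<bar> < 1" using abs_Re_le_cmod[of a] a'(2) by linarith
      then have ri: "Re a \<in> {-1..1}" by auto
      have wl: "w \<in> sphere 0 1" "Im w < 0" "\<Psi> a = \<omega> w" "w = unfold_half a"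
        using unfold_half_real(1,2)[OF ri] unfold_half_real(3)[OF ri rb] w(3) True unfolding aR[symmetric] by auto
      have in_I: "\<Psi> x \<in> I" using low(1)[OF wl(1,2)] wl(3) eq by simp
      have "\<Psi> x \<notin> t \<union> t'" using dj(2)[OF wl(1)] wl(3) eq by simp
      then have "v \<notin> ball 0 1" using v(3) im by blast
      then have vs: "v \<in> sphere 0 1" "Im x = 0 \<or> norm x = 1" using sph[OF v(1)] v(2) x by auto
      have "Im x = 0"
      proof (rule ccontr)
        assume n: "Im x ~= 0"
        then have nx: "norm x = 1" using vs(2) by simp
        show False
        proof (cases "Im x \<ge> 0")
          case True
          then have "v = x" using v(3) unfold_half(3)[OF x True nx] by simp
          then show False using low(3)[of x] v(3) True in_I nx by simp
        next
          case False
          then have "v = cnj x" using v(3) unfold_half(3)[of "cnj x"] nx by simp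
          then show False using low(4)[of "cnj x"] v(3) False in_I nx by simp
        qed
      qed
      then have xR: "x = of_real (Re x)" "v = unfold_half x" "\<Psi> x = \<omega> v" using flat v(3) by auto
      have "Im v \<le> 0" using unfold_half_real(2)[OF Rez[OF x]] xR(1,2) by simp
      moreover have "\<not> 0 \<le> Im v" using low(3)[OF vs(1)] in_I xR(3) by auto
      ultimately have "w = v" using low(2)[OF wl(1,2) vs(1)] eq wl(3) xR(3) by simp
      then show ?thesis using wl(4) xR(2) unfold_half_inj by blast
    qed
  qed
  have "\<exists>g. homeomorphism (ball 0 1) (\<Psi> ` ball 0 1) \<Psi> g"
    by (rule homeomorphism_saturated[of "cball 0 1"]) (use cont inj_\<Psi> in \<open>simp_all\<close>)
  moreover have "\<Psi> ` ball 0 1 = t \<union> t' \<union> I"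
  proof (intro equalityI subsetI)
    fix y assume "y \<in> \<Psi> ` ball 0 1"
    then obtain z where z: "y = \<Psi> z" "z \<in> ball 0 1" by (rule imageE)
    then have zc: "z \<in> cball 0 1" "norm z < 1" by simp_all
    obtain w where w: "w \<in> ball 0 1 \<longleftrightarrow> Im z ~= 0 \<and> norm z < 1"
       "Im z \<ge> 0 \<and> \<Psi> z = \<omega> w \<and> w = unfold_half z \<or> Im z < 0 \<and> \<Psi> z = \<omega>' w \<and> w = unfold_half (cnj z)"
      using pts[OF zc(1)] by blast
    show "y \<in> t \<union> t' \<union> I"
    proof (cases "Im z = 0")
      case True
      have rb: "\<bar>Re z\<bar> < 1" using abs_Re_le_cmod[of z] zc(2) by linarith
      then have ri: "Re z \<in> {-1..1}" by auto
      have "w \<in> sphere 0 1" "Im w < 0" "\<Psi> z = \<omega> w"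
        using unfold_half_real(1,2)[OF ri] unfold_half_real(3)[OF ri rb] w(2) True unfolding flat[OF True, symmetric] by auto
      then show ?thesis using low(1) z(1) by simp
    next
      case False
      then have "w \<in> ball 0 1" using w(1) zc by simp
      then show ?thesis using w(2) im z(1) by blast
    qed
  next
    have half: "\<exists>z. w = unfold_half z \<and> z \<in> ball 0 1 \<and> Im z > 0" if w: "w \<in> ball 0 1" for w
    proof -
      define r where "r = sqrt (1 - (Re w)\<^sup>2)"
      have "(norm w)\<^sup>2 < 1" using w by (simp add: power_less_one_iff)
      then have n: "(Re w)\<^sup>2 + (Im w)\<^sup>2 < 1" by (simp add: cmod_power2)
      then have "(Re w)\<^sup>2 \<le> 1" using zero_le_power2[of "Im w"] by linarith
      then have r2: "r\<^sup>2 = 1 - (Re w)\<^sup>2" "r \<ge> 0" unfolding r_def by simp_all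
      have "\<bar>Im w\<bar>\<^sup>2 < r\<^sup>2" using n r2(1) by simp
      then have ab: "\<bar>Im w\<bar> < r" using r2(2) by (rule power2_less_imp_less)
      \<comment> \<open>The inverse of \<open>unfold_half\<close>, from solving
        \<open>2 * Im z - r = Im w\<close>.\<close>
      define z where "z = Complex (Re w) ((Im w + r) / 2)"
      have uz: "w = unfold_half z" by (simp add: z_def unfold_half_def complex_eq_iff r_def[symmetric] field_simps)
      have Iz: "0 < Im z" "Im z < r" using ab by (auto simp: z_def)
      then have "(Im z)\<^sup>2 < r\<^sup>2" by (intro power_strict_mono) simp_all
      then have "(norm z)\<^sup>2 < 1" using r2(1) by (simp add: cmod_power2 z_def)
      then have "z \<in> ball 0 1" by (simp add: power_less_one_iff)
      then show ?thesis using uz Iz by blast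
    qed
    fix y assume "y \<in> t \<union> t' \<union> I"
    then consider w where "w \<in> ball 0 1" "y = \<omega> w" | w where "w \<in> ball 0 1" "y = \<omega>' w" | w where "w \<in> sphere 0 1" "Im w < 0" "y = \<omega> w"
      using im low(5) by blast
    then show "y \<in> \<Psi> ` ball 0 1"
    proof cases
      case 1
      then obtain z where "w = unfold_half z" "z \<in> ball 0 1" "Im z > 0" using half by blast
      then show ?thesis using 1 by (intro image_eqI[of _ _ z]) (simp_all add: \<Psi>_def)
    next
      case 2
      then obtain z where "w = unfold_half z" "z \<in> ball 0 1" "Im z > 0" using half by blast
      then show ?thesis using 2 by (intro image_eqI[of _ _ "cnj z"]) (simp_all add: \<Psi>_def)
    next
      case 3
      then have "w = unfold_half (of_real (Re w))" "\<bar>Re w\<bar> < 1" using unfold_half_real_image[of w] by simp_all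
      then show ?thesis using 3 by (intro image_eqI[of _ _ "of_real (Re w)"]) (simp_all add: \<Psi>_def)
    qed
  qed
  moreover have "\<Psi> z = \<omega> z \<and> \<Psi> (cnj z) = \<omega>' z" if "z \<in> sphere 0 1" "Im z \<ge> 0" for z
  proof -
    have z: "z \<in> cball 0 1" "norm z = 1" using that(1) by simp_all
    have "cnj z \<in> cball 0 1" "Im (cnj z) \<le> 0" using z that(2) by simp_all
    then have "\<Psi> (cnj z) = \<omega>' (unfold_half z)" using \<Psi>_low[of "cnj z"] by simp
    then show ?thesis using unfold_half(3)[OF z(1) that(2) z(2)] that(2) by (simp add: \<Psi>_def)
  qed
  ultimately show ?thesis using cont by (intro exI[of _ \<Psi>]) (simp add: \<Psi>_def)
qed

section \<open>Joining edge paths and dividing the circle into arcs\<close>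

lemma edge_path_reversepath:
  assumes "edge_path V e p" shows "edge_path V e (reversepath p)"
  using assms simple_path_reversepath[of p] by (simp add: edge_path_def insert_commute)

lemma joinpaths_halves:
  assumes "p 1 = q 0"
  shows "(p +++ q) ` {0..1/2} = path_image p" "(p +++ q) ` {1/2..1} = path_image q" "(p +++ q) (1/2) = p 1"
proof -
  have "{0..1/2} = (\<lambda>x. x / 2) ` {0..1::real}"
  proof (intro equalityI subsetI)
    fix x :: real assume "x \<in> {0..1/2}"
    then show "x \<in> (\<lambda>x. x / 2) ` {0..1}" by (intro image_eqI[of _ _ "2 * x"]) simp_all
  qed auto
  then have "(p +++ q) ` {0..1/2} = (\<lambda>x. (p +++ q) (x / 2)) ` {0..1}" by (simp only: image_image)
  also have "\<dots> = p ` {0..1}" by (intro image_cong) (simp_all add: joinpaths_def)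
  finally show "(p +++ q) ` {0..1/2} = path_image p" by (simp add: path_image_def)
  have "{1/2..1} = (\<lambda>x. (x + 1) / 2) ` {0..1::real}"
  proof (intro equalityI subsetI)
    fix x :: real assume "x \<in> {1/2..1}"
    then show "x \<in> (\<lambda>x. (x + 1) / 2) ` {0..1}" by (intro image_eqI[of _ _ "2 * x - 1"]) simp_all
  qed auto
  then have "(p +++ q) ` {1/2..1} = (\<lambda>x. (p +++ q) ((x + 1) / 2)) ` {0..1}" by (simp only: image_image)
  also have "\<dots> = q ` {0..1}"
  proof (intro image_cong refl)
    fix x :: real assume x: "x \<in> {0..1}"
    show "(p +++ q) ((x + 1) / 2) = q x"
    proof (cases "x = 0")
      case True then show ?thesis using assms by (simp add: joinpaths_def)
    next
      case False
      then have "\<not> (x + 1) / 2 \<le> 1 / 2" "2 * ((x + 1) / 2) - 1 = x" using x by (auto simp: field_simps)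
      then show ?thesis by (simp only: joinpaths_def if_False)
    qed
  qed
  finally show "(p +++ q) ` {1/2..1} = path_image q" by (simp add: path_image_def)
  show "(p +++ q) (1/2) = p 1" by (simp add: joinpaths_def)
qed

text \<open>Four arcs of angle \<open>pi/4\<close> are the places of sides 5, 1, 2, 3 of a pentagon
  whose side 4 fills the lower semicircle.\<close>

lemma sphere_upper_cases:
  assumes "z \<in> sphere 0 1" "Im z \<ge> 0"
  shows "\<exists>x\<in>{0..1}. z = cis (pi/4 * x) \<or> z = cis (pi/4 * (1 + x)) \<or> z = cis (pi/4 * (2 + x)) \<or> z = cis (pi/4 * (3 + x))"
proof -
  have "norm z = 1" using assms(1) by simp
  then obtain \<theta> where \<theta>: "\<theta> \<in> {0..<0 + 2 * pi}" "z = cis \<theta>" by (rule cis_surj_period)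
  have le: "\<theta> \<le> pi" using sin_lt_zero[of \<theta>] \<theta> assms(2) by force
  define y where "y = \<theta> * 4 / pi"
  have y: "\<theta> = pi/4 * y" "0 \<le> y" using \<theta>(1) by (simp_all add: y_def)
  have "pi * y \<le> pi * 4" using le y(1) by simp
  then have "y \<le> 4" by (simp only: mult_le_cancel_left_pos[OF pi_gt_zero])
  then consider "y \<in> {0..1}" | "y - 1 \<in> {0..1}" | "y - 2 \<in> {0..1}" | "y - 3 \<in> {0..1}" using y(2) by force
  then show ?thesis
  proof cases
    case 1 then show ?thesis using \<theta>(2) y(1) by (intro bexI[of _ y]) simp_all
  next
    case 2 then show ?thesis using \<theta>(2) y(1) by (intro bexI[of _ "y - 1"]) simp_all
  next
    case 3 then show ?thesis using \<theta>(2) y(1) by (intro bexI[of _ "y - 2"]) simp_all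
  next
    case 4 then show ?thesis using \<theta>(2) y(1) by (intro bexI[of _ "y - 3"]) simp_all
  qed
qed

lemma sphere_lower_cases:
  assumes "z \<in> sphere 0 1" "Im z \<le> 0"
  shows "\<exists>x\<in>{0..1}. z = cis (pi + pi * x)" "Im z < 0 ==> \<exists>x\<in>{0<..<1}. z = cis (pi + pi * x)"
proof -
  have "norm z = 1" using assms(1) by simp
  then obtain \<theta> where \<theta>: "\<theta> \<in> {pi..<pi + 2 * pi}" "z = cis \<theta>" by (rule cis_surj_period)
  have sn: "sin \<theta> = - sin (\<theta> - pi)" "sin \<theta> = sin (\<theta> - 2 * pi)" by (simp_all add: sin_diff)
  have "\<theta> \<le> 2 * pi" using sin_gt_zero[of "\<theta> - 2 * pi"] sn(2) \<theta> assms(2) by force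
  then have le: "\<theta> - pi \<le> pi * 1" "0 \<le> \<theta> - pi" using \<theta>(1) by auto
  define x where "x = (\<theta> - pi) / pi"
  have tx: "\<theta> = pi + pi * x" by (simp add: x_def)
  have "pi * x \<le> pi * 1" "pi * 0 \<le> pi * x" using le tx by simp_all
  then have x: "x \<in> {0..1}" by (simp only: mult_le_cancel_left_pos[OF pi_gt_zero] atLeastAtMost_iff)
  show "\<exists>x\<in>{0..1}. z = cis (pi + pi * x)" using \<theta>(2) tx x by blast
  assume "Im z < 0"
  then have "sin \<theta> ~= 0" using \<theta>(2) by simp
  then have "x ~= 0" "x ~= 1" unfolding tx by auto
  then have "x \<in> {0<..<1}" using x by simp
  then show "\<exists>x\<in>{0<..<1}. z = cis (pi + pi * x)" using \<theta>(2) tx by blast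
qed

section \<open>Merging two pentagons along an edge without labelled ends\<close>

context labelled_pentagons
begin

text \<open>The new edge is indexed by its future middle point \<open>u\<close>, where exactly two
  bullet edges meet by \<open>card_blank_edges_at\<close>.\<close>

definition joined_edge :: "'a => 'a set" where
  "joined_edge u = \<Union>{f \<in> E - blank_edges. u \<in> f}"

lemma joined_edge_eq:
  assumes "f \<in> E - blank_edges" "g \<in> E - blank_edges" "f ~= g" "u \<in> f" "u \<in> g" "u \<in> V - B"
  shows "{f \<in> E - blank_edges. u \<in> f} = {f, g}" "joined_edge u = f \<union> g"
proof -
  have "{f, g} = {f \<in> E - blank_edges. u \<in> f}"
  proof (rule card_subset_eq)
    show "finite {f \<in> E - blank_edges. u \<in> f}" using finite_E by simp
    show "{f, g} \<subseteq> {f \<in> E - blank_edges. u \<in> f}" using assms by blast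
    show "card {f, g} = card {f \<in> E - blank_edges. u \<in> f}" using card_blank_edges_at(2)[OF assms(6)] assms(3) by simp
  qed
  then show "{f \<in> E - blank_edges. u \<in> f} = {f, g}" ..
  then show "joined_edge u = f \<union> g" unfolding joined_edge_def by simp
qed

lemma bullet_edge_path:
  assumes f: "f \<in> E - blank_edges" and p: "edge_path V f p" "p 1 = u" and u: "u \<in> V - B"
  shows "arc p" "p 0 \<in> B" "f \<inter> V = {p 0, u}" "f \<inter> B = {p 0}"
proof -
  obtain b v where bv: "f \<inter> V = {b, v}" "b \<in> B" "v \<in> V - B" using bullet_edge_ends[OF f] .
  have fV: "f \<inter> V = {p 0, u}" using p by (simp add: edge_path_def pathstart_def pathfinish_def)
  then have "p 0 = b" using bv u by (auto simp: doubleton_eq_iff)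
  then show p0: "p 0 \<in> B" and "f \<inter> V = {p 0, u}" using bv(2) fV by simp_all
  have "p 0 ~= p 1" using p0 p(2) u by auto
  then show "arc p" using p(1) by (simp add: edge_path_def arc_simple_path pathstart_def pathfinish_def)
  have "f \<inter> B = (f \<inter> V) \<inter> B" using B_V by blast
  then show "f \<inter> B = {p 0}" unfolding fV using p0 u by blast
qed

text \<open>The two edges meet in \<open>u\<close> and possibly in their labelled ends. If those
  coincide the joined path is a loop, otherwise an arc. The vertex set is now \<open>B\<close>, so
  \<open>u\<close> is an interior point.\<close>

lemma joined_edge_path:
  assumes fg: "f \<in> E - blank_edges" "g \<in> E - blank_edges" "f ~= g" and u: "u \<in> V - B"
    and p: "edge_path V f p" "p 1 = u" and q: "edge_path V g q" "q 0 = u"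
  shows "edge_path B (joined_edge u) (p +++ q)"
proof -
  note P = bullet_edge_path[OF fg(1) p u]
  have q': "edge_path V g (reversepath q)" "reversepath q 1 = u" using edge_path_reversepath[OF q(1)] q(2) by (simp_all add: reversepath_def)
  note Q = bullet_edge_path[OF fg(2) q' u]
  have q0: "reversepath q 0 = q 1" by (simp add: reversepath_def)
  have ac: "arc p" "arc q" using P(1) Q(1) arc_reversepath[of "reversepath q"] by simp_all
  have im: "path_image p = f" "path_image q = g" using p(1) q(1) by (simp_all add: edge_path_def)
  have mt: "pathfinish p = pathstart q" "pathstart q = u" "pathstart p = p 0" "pathfinish q = q 1" using p(2) q(2) by (simp_all add: pathfinish_def pathstart_def)
  have "f \<inter> g \<subseteq> V" using edges_meet fg by blast
  then have "f \<inter> g \<subseteq> (f \<inter> V) \<inter> (g \<inter> V)" by blast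
  then have int: "f \<inter> g \<subseteq> {p 0, u} \<inter> {q 1, u}" unfolding P(3) Q(3) q0 .
  have sp: "simple_path (p +++ q)"
  proof (cases "q 1 = p 0")
    case True
    have "path_image p \<inter> path_image q \<subseteq> {pathstart p, pathstart q}" unfolding im mt using int by blast
    then show ?thesis using True mt by (intro simple_path_join_loop ac) simp_all
  next
    case False
    have "{p 0, u} \<inter> {q 1, u} \<subseteq> {u}" using False by auto
    with int have "f \<inter> g \<subseteq> {u}" by (rule subset_trans)
    then have "path_image p \<inter> path_image q \<subseteq> {pathstart q}" unfolding im mt .
    then show ?thesis by (intro arc_imp_simple_path arc_join ac mt(1))
  qed
  have ju: "joined_edge u = f \<union> g"
    using joined_edge_eq(2)[OF fg] P(3) Q(3) u by blast
  have "(f \<union> g) \<inter> B = f \<inter> B \<union> g \<inter> B" by blast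
  then have "(f \<union> g) \<inter> B = {p 0, q 1}" unfolding P(4) Q(4) q0 by blast
  then show ?thesis using sp mt unfolding edge_path_def ju by (simp add: path_image_join im)
qed

text \<open>\<open>blank_vertex_structure\<close> treats a single end of \<open>e\<close>. The pair
  of tiles is determined by \<open>sides_of e\<close>, so the same two tiles serve at both
  ends.\<close>

lemma blank_edge_tiles:
  assumes e: "e \<in> blank_edges"
  obtains t t' where "t \<in> T" "t' \<in> T" "t ~= t'" "edge t 4 = e" "edge t' 4 = e" "sides_of e = {(t, 4), (t', 4)}"
    "\<forall>u\<in>e \<inter> V. edge t (snd (out_side u t)) ~= edge t' (snd (out_side u t'))"
proof -
  have eV: "u \<in> V - B" if "u \<in> e \<inter> V" for u using e that by (auto simp: blank_edges_def)
  have *: "\<exists>t t'. sides_of e = {(t, 4), (t', 4)} \<and> t ~= t' \<and> t \<in> T \<and> t' \<in> T \<and>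
     edge t (snd (out_side u t)) ~= edge t' (snd (out_side u t'))" if u: "u \<in> e \<inter> V" for u
  proof -
    obtain e1 t t' where s: "e1 \<in> blank_edges" "sides_of e1 = {(t, 4), (t', 4)}" "t ~= t'" "u \<in> e1" "t \<in> T" "t' \<in> T"
      "edge t (snd (out_side u t)) ~= edge t' (snd (out_side u t'))"
      by (rule blank_vertex_structure[OF eV[OF u]])
    obtain x where x: "{e \<in> blank_edges. u \<in> e} = {x}" using card_blank_edges_at(1)[OF eV[OF u]] by (rule card_1_singletonE)
    have "e1 \<in> {e \<in> blank_edges. u \<in> e}" "e \<in> {e \<in> blank_edges. u \<in> e}" using s(1,4) e u by simp_all
    then have "e1 = e" unfolding x by simp
    then show ?thesis using s by blast
  qed
  have "{u \<in> V - B. u \<in> e} ~= {}" using blank_edge_ends[OF e] by (metis card.empty zero_neq_numeral)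
  then obtain u0 where "u0 \<in> e \<inter> V" by blast
  from *[OF this] obtain t t' where s: "sides_of e = {(t, 4), (t', 4)}" "t ~= t'" "t \<in> T" "t' \<in> T" by blast
  have "(t, 4) \<in> sides_of e" "(t', 4) \<in> sides_of e" unfolding s(1) by simp_all
  then have ed: "edge t 4 = e" "edge t' 4 = e" by (simp_all add: sides_of_def)
  have "edge t (snd (out_side u t)) ~= edge t' (snd (out_side u t'))" if u: "u \<in> e \<inter> V" for u
  proof -
    obtain r r' where r: "sides_of e = {(r, 4), (r', 4)}" "edge r (snd (out_side u r)) ~= edge r' (snd (out_side u r'))"
      using *[OF u] by blast
    have "{(t, 4::nat), (t', 4)} = {(r, 4), (r', 4)}" using s(1) r(1) by simp
    then have "t = r \<and> t' = r' \<or> t = r' \<and> t' = r" by (simp add: doubleton_eq_iff)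
    then show ?thesis using r(2) by (elim disjE conjE) simp_all
  qed
  then show ?thesis using that s ed by blast
qed

text \<open>\<open>v_5\<close> is placed at 1 and \<open>v_4\<close> at -1. The sides 5, 1, 2, 3
  fill the upper semicircle, and side 4, along which tiles are glued, fills the lower one as
  \<open>glue_disks\<close> requires.\<close>

lemma half_disk_chart:
  assumes t: "t \<in> T" and \<gamma>: "arc \<gamma>" "path_image \<gamma> = edge t 4" "\<gamma> 0 = rim t 4" "\<gamma> 1 = rim t 5"
  obtains \<omega> where "continuous_on (cball 0 1) \<omega>" "\<exists>\<psi>. homeomorphism (ball 0 1) t \<omega> \<psi>"
    "\<forall>x\<in>{0..1}. \<omega> (cis (pi/4 * x)) = rim t (5 + x) \<and> \<omega> (cis (pi/4 * (1 + x))) = rim t (1 + x) \<and>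
      \<omega> (cis (pi/4 * (2 + x))) = rim t (2 + x) \<and> \<omega> (cis (pi/4 * (3 + x))) = rim t (3 + x) \<and> \<omega> (cis (pi + pi * x)) = \<gamma> x"
proof -
  \<comment> \<open>The slope is \<open>pi/4\<close>, raised to \<open>pi\<close> for
    \<open>s\<close> between 4 and 5, where side 4 covers half the circle.\<close>
  define \<Theta> where "\<Theta> s = pi/4 * s + 3 * pi/4 * max 0 (min 1 (s - 4))" for s :: real
  define \<delta> where "\<delta> j x = (if j = (4::nat) then \<gamma> x else rim t (real j + x))" for j x
  have ac: "arc (\<lambda>x. rim t (real j + x))" "path_image (\<lambda>x. rim t (real j + x)) = edge t j" if "j \<in> {1..5}" for j
    using edge_path_side[OF t that] no_loops[OF t that]
    by (simp_all add: edge_path_def arc_simple_path pathstart_def pathfinish_def)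
  have r56: "rim t 6 = rim t 1" by (rule rim6)
  have "\<exists>\<omega>. continuous_on (cball 0 1) \<omega> \<and> (\<exists>\<psi>. homeomorphism (ball 0 1) t \<omega> \<psi>) \<and>
    (\<forall>j\<in>{1..5}. \<forall>x\<in>{0..1}. \<omega> (cis (\<Theta> (real j + x))) = \<delta> j x)"
  proof (rule reparametrize[OF t])
    show "continuous_on {1..real 5 + 1} \<Theta>" unfolding \<Theta>_def by (intro continuous_intros)
    show "strict_mono_on {1..real 5 + 1} \<Theta>"
    proof (rule strict_mono_onI)
      fix r s :: real assume "r < s"
      then have "pi/4 * r < pi/4 * s" by (intro mult_strict_left_mono) simp_all
      moreover have "3 * pi/4 * max 0 (min 1 (r - 4)) \<le> 3 * pi/4 * max 0 (min 1 (s - 4))"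
        using \<open>r < s\<close> by (intro mult_left_mono) (auto simp: max_def min_def)
      ultimately show "\<Theta> r < \<Theta> s" unfolding \<Theta>_def by (rule add_less_le_mono)
    qed
    show "\<Theta> (real 5 + 1) = \<Theta> 1 + 2 * pi" by (simp add: \<Theta>_def)
    fix j :: nat assume j: "j \<in> {1..5}"
    have "\<delta> j = \<gamma> \<and> j = 4 \<or> \<delta> j = (\<lambda>x. rim t (real j + x))" by (auto simp: \<delta>_def fun_eq_iff)
    then have "arc (\<delta> j) \<and> path_image (\<delta> j) = edge t j \<and> \<delta> j 0 = rim t (real j) \<and> \<delta> j 1 = rim t (real j + 1)"
      using ac[OF j] \<gamma> by (elim disjE conjE) simp_all
    then show "arc (\<delta> j)" "path_image (\<delta> j) = edge t j" "\<delta> j 0 = rim t (real j)" "\<delta> j 1 = rim t (real j + 1)" by blast+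
  qed
  then obtain \<omega> where w: "continuous_on (cball 0 1) \<omega>" "\<exists>\<psi>. homeomorphism (ball 0 1) t \<omega> \<psi>"
    "\<forall>j\<in>{1..5}. \<forall>x\<in>{0..1}. \<omega> (cis (\<Theta> (real j + x))) = \<delta> j x"
    by (elim exE conjE) (rule that, assumption, rule exI, assumption+)
  have v: "\<omega> (cis (\<Theta> (real j + x))) = \<delta> j x" if "j \<in> {1..5}" "x \<in> {0..1}" for j x using bspec[OF bspec[OF w(3) that(1)] that(2)] .
  have "\<omega> (cis (pi/4 * x)) = rim t (5 + x) \<and> \<omega> (cis (pi/4 * (1 + x))) = rim t (1 + x) \<and>
      \<omega> (cis (pi/4 * (2 + x))) = rim t (2 + x) \<and> \<omega> (cis (pi/4 * (3 + x))) = rim t (3 + x) \<and> \<omega> (cis (pi + pi * x)) = \<gamma> x"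
    if x: "x \<in> {0..1}" for x
  proof -
    have th: "\<Theta> (1 + x) = pi/4 * (1 + x)" "\<Theta> (2 + x) = pi/4 * (2 + x)" "\<Theta> (3 + x) = pi/4 * (3 + x)"
      "\<Theta> (4 + x) = pi + pi * x" "\<Theta> (5 + x) = pi/4 * x + 2 * pi"
      using x by (auto simp: \<Theta>_def max_def min_def field_simps)
    have "cis (pi/4 * x) = cis (\<Theta> (5 + x))" unfolding th by (simp add: cis_mult[symmetric])
    then show ?thesis using v[OF _ x, of 1] v[OF _ x, of 2] v[OF _ x, of 3] v[OF _ x, of 4] v[OF _ x, of 5]
      by (simp add: th(1-4) \<delta>_def)
  qed
  then show ?thesis using that[OF w(1,2)] by blast
qed

text \<open>The glued disk has eight sides in steps of angle \<open>pi/4\<close>: sides 5, 1, 2, 3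
  of \<open>t\<close> above and, mirrored, those of \<open>t'\<close> below. Labelled corners are at
  odd steps and blank ones at even steps, so pairs of sides beginning at odd steps form the four
  joined edges. By \<open>r\<close> both tiles run along \<open>e\<close> in the same direction; by
  \<open>ne\<close> the edges meeting at either end of \<open>e\<close> differ, as
  \<open>joined_edge_path\<close> requires.\<close>

lemma glue_tiles:
  assumes t: "t \<in> T" "t' \<in> T" "t ~= t'" and e: "edge t 4 = e" "edge t' 4 = e"
    and r: "rim t' 4 = rim t 4" "rim t' 5 = rim t 5" and ne: "edge t 3 ~= edge t' 3" "edge t 5 ~= edge t' 5"
  shows "\<exists>\<Phi>. polygon_map B (joined_edge ` (V - B)) 4 (t \<union> t' \<union> (e - V)) \<Phi> \<and>
    \<Phi> ` side 4 1 = joined_edge (rim t 4) \<and> \<Phi> ` side 4 3 = joined_edge (rim t 5) \<and>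
    \<Phi> (cis (3 * pi/4)) = rim t 4 \<and> \<Phi> (- cis (3 * pi/4)) = rim t 5 \<and>
    (\<lambda>x. \<Phi> (of_real x * cis (3 * pi/4))) ` {-1..1} = e"
proof -
  have bl: "edge s j \<in> E - blank_edges" if "s \<in> T" "j \<in> {1, 2, 3, 5}" for s j
    using edge_blank_iff[of s j] edge_in_E[of s j] that by auto
  have eE: "e \<in> blank_edges" "e \<in> E" using edge_blank_iff[of t 4] edge_in_E[of t 4] t(1) e(1) by auto
  have eV: "e \<inter> V = {rim t 4, rim t 5}" using edge_Int_V[OF t(1), of 4] e(1) by simp
  define \<gamma> where "\<gamma> x = rim t (4 + x)" for x
  have g: "simple_path \<gamma>" "path_image \<gamma> = e" using edge_path_side[OF t(1), of 4] e(1) by (simp_all add: edge_path_def \<gamma>_def[abs_def])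
  have g01: "\<gamma> 0 = rim t 4" "\<gamma> 1 = rim t 5" by (simp_all add: \<gamma>_def)
  have ga: "arc \<gamma>" using g(1) rim45[OF t(1)] g01 by (simp add: arc_simple_path pathstart_def pathfinish_def)
  have gep: "edge_path V e \<gamma>" using g eV g01 by (simp add: edge_path_def pathstart_def pathfinish_def)
  obtain \<omega> where \<omega>: "continuous_on (cball 0 1) \<omega>" "\<exists>\<psi>. homeomorphism (ball 0 1) t \<omega> \<psi>"
    "\<forall>x\<in>{0..1}. \<omega> (cis (pi/4 * x)) = rim t (5 + x) \<and> \<omega> (cis (pi/4 * (1 + x))) = rim t (1 + x) \<and>
      \<omega> (cis (pi/4 * (2 + x))) = rim t (2 + x) \<and> \<omega> (cis (pi/4 * (3 + x))) = rim t (3 + x) \<and> \<omega> (cis (pi + pi * x)) = \<gamma> x"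
    by (rule half_disk_chart[OF t(1) ga _ g01]) (simp_all add: g e)
  obtain \<omega>' where \<omega>': "continuous_on (cball 0 1) \<omega>'" "\<exists>\<psi>. homeomorphism (ball 0 1) t' \<omega>' \<psi>"
    "\<forall>x\<in>{0..1}. \<omega>' (cis (pi/4 * x)) = rim t' (5 + x) \<and> \<omega>' (cis (pi/4 * (1 + x))) = rim t' (1 + x) \<and>
      \<omega>' (cis (pi/4 * (2 + x))) = rim t' (2 + x) \<and> \<omega>' (cis (pi/4 * (3 + x))) = rim t' (3 + x) \<and> \<omega>' (cis (pi + pi * x)) = \<gamma> x"
    by (rule half_disk_chart[OF t(2) ga]) (simp_all add: g e g01 r)
  have upper: "\<exists>f\<in>E - blank_edges. \<zeta> z \<in> f"
    if s: "s \<in> T" and ze: "\<forall>x\<in>{0..1}. \<zeta> (cis (pi/4 * x)) = rim s (5 + x) \<and> \<zeta> (cis (pi/4 * (1 + x))) = rim s (1 + x) \<and>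
      \<zeta> (cis (pi/4 * (2 + x))) = rim s (2 + x) \<and> \<zeta> (cis (pi/4 * (3 + x))) = rim s (3 + x) \<and> \<zeta> (cis (pi + pi * x)) = \<gamma> x"
      and z: "z \<in> sphere 0 1" "Im z \<ge> 0" for \<zeta> s z
  proof -
    obtain x where x: "x \<in> {0..1}" "z = cis (pi/4 * x) \<or> z = cis (pi/4 * (1 + x)) \<or> z = cis (pi/4 * (2 + x)) \<or> z = cis (pi/4 * (3 + x))"
      using sphere_upper_cases[OF z] by blast
    have "\<exists>j\<in>{1, 2, 3, 5::nat}. \<zeta> z = rim s (real j + x)" using bspec[OF ze x(1)] x(2) by auto
    then obtain j where j: "j \<in> {1, 2, 3, 5}" "\<zeta> z = rim s (real j + x)" by blast
    have "\<zeta> z \<in> edge s j" unfolding edge_rim j(2) using x(1) by (rule imageI)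
    then show ?thesis using bl[OF s j(1)] by blast
  qed
  have lower: "\<exists>x\<in>{0..1}. z = cis (pi + pi * x) \<and> \<omega> z = \<gamma> x \<and> \<omega>' z = \<gamma> x" if "z \<in> sphere 0 1" "Im z \<le> 0" for z
    using sphere_lower_cases(1)[OF that] \<omega>(3) \<omega>'(3) by blast
  have lower': "\<exists>x\<in>{0<..<1}. z = cis (pi + pi * x) \<and> \<omega> z = \<gamma> x" if z: "z \<in> sphere 0 1" "Im z < 0" for z
  proof -
    obtain x where x: "x \<in> {0<..<1}" "z = cis (pi + pi * x)" using sphere_lower_cases(2)[OF z(1) _ z(2)] z(2) by auto
    then have "x \<in> {0..1}" by simp
    then show ?thesis using x bspec[OF \<omega>(3)] by blast
  qed
  have gin: "\<gamma> x \<in> e" if "x \<in> {0..1}" for x using g(2) that unfolding path_image_def by blast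
  have I: "\<gamma> ` {0<..<1} = e - V" by (rule edge_path_interior(1)[OF gep])
  have notI: "x \<notin> e - V" if "f \<in> E - blank_edges" "x \<in> f" for f x using edges_meet[of f e x] that eE by blast
  have nt: "x \<notin> t \<union> t'" if "f \<in> E" "x \<in> f" for f x using tile_disj_graph[OF t(1)] tile_disj_graph[OF t(2)] that by blast
  have hb: "\<omega> ` ball 0 1 = t" "inj_on \<omega> (ball 0 1)" "\<omega>' ` ball 0 1 = t'" "inj_on \<omega>' (ball 0 1)"
    using \<omega>(2) \<omega>'(2) by (metis homeomorphism_image1 homeomorphism_apply1 inj_on_inverseI)+
  have "\<exists>\<Psi>. continuous_on (cball 0 1) \<Psi> \<and> (\<exists>\<psi>. homeomorphism (ball 0 1) (t \<union> t' \<union> (e - V)) \<Psi> \<psi>) \<and>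
    (\<forall>z\<in>sphere 0 1. Im z \<ge> 0 --> \<Psi> z = \<omega> z \<and> \<Psi> (cnj z) = \<omega>' z) \<and>
    (\<forall>x\<in>{-1..1}. \<Psi> (of_real x) = \<omega> (unfold_half (of_real x)))"
  proof (rule glue_disks[OF \<omega>(1) \<omega>'(1) hb(2,4,1,3)])
    show "t \<inter> t' = {}" using tiles_disjoint[OF t(1,2)] t(3) by blast
    fix z :: complex assume z: "z \<in> sphere 0 1"
    show "\<omega> z \<notin> t \<union> t'"
    proof (cases "Im z \<ge> 0")
      case True
      then obtain f where "f \<in> E - blank_edges" "\<omega> z \<in> f" using upper[OF t(1) \<omega>(3) z] by blast
      then show ?thesis using nt by blast
    next
      case False
      then obtain x where "x \<in> {0..1}" "\<omega> z = \<gamma> x" using lower[OF z] by auto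
      then show ?thesis using nt[OF eE(2)] gin by simp
    qed
    show "\<omega>' z \<notin> t \<union> t'"
    proof (cases "Im z \<ge> 0")
      case True
      then obtain f where "f \<in> E - blank_edges" "\<omega>' z \<in> f" using upper[OF t(2) \<omega>'(3) z] by blast
      then show ?thesis using nt by blast
    next
      case False
      then obtain x where "x \<in> {0..1}" "\<omega>' z = \<gamma> x" using lower[OF z] by auto
      then show ?thesis using nt[OF eE(2)] gin by simp
    qed
    show "\<omega>' z = \<omega> z" if "Im z \<le> 0" using lower[OF z that] by auto
    show "\<omega> z \<in> e - V" if "Im z < 0" using lower'[OF z that] I by auto
    show "\<omega> z \<notin> e - V" if "0 \<le> Im z" using upper[OF t(1) \<omega>(3) z that] notI by blast
    show "\<omega>' z \<notin> e - V" if "0 \<le> Im z" using upper[OF t(2) \<omega>'(3) z that] notI by blast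
    show "z = z'" if zz: "Im z < 0" "z' \<in> sphere 0 1" "Im z' < 0" "\<omega> z = \<omega> z'" for z'
    proof -
      obtain x where x: "x \<in> {0<..<1}" "z = cis (pi + pi * x)" "\<omega> z = \<gamma> x" using lower'[OF z zz(1)] by blast
      obtain y where y: "y \<in> {0<..<1}" "z' = cis (pi + pi * y)" "\<omega> z' = \<gamma> y" using lower'[OF zz(2,3)] by blast
      have "x = y" using ga zz(4) x(1,3) y(1,3) by (simp add: arc_def inj_on_def)
      then show ?thesis using x y by simp
    qed
  next
    show "e - V \<subseteq> \<omega> ` {z \<in> sphere 0 1. Im z < 0}"
    proof
      fix y assume "y \<in> e - V"
      then obtain x where x: "x \<in> {0<..<1}" "y = \<gamma> x" unfolding I[symmetric] by blast
      have "0 < pi * x" "pi * x < pi * 1" using x(1) by (intro mult_pos_pos mult_strict_left_mono; simp)+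
      then have "sin (pi + pi * x) < 0" by (intro sin_lt_zero) linarith+
      then have "cis (pi + pi * x) \<in> {z \<in> sphere 0 1. Im z < 0}" by simp
      moreover have "y = \<omega> (cis (pi + pi * x))" using bspec[OF \<omega>(3), of x] x by simp
      ultimately show "y \<in> \<omega> ` {z \<in> sphere 0 1. Im z < 0}" by (rule image_eqI[rotated])
    qed
  qed
  then obtain \<Psi> where \<Psi>: "continuous_on (cball 0 1) \<Psi>" "\<exists>\<psi>. homeomorphism (ball 0 1) (t \<union> t' \<union> (e - V)) \<Psi> \<psi>"
    "\<forall>z\<in>sphere 0 1. Im z \<ge> 0 --> \<Psi> z = \<omega> z \<and> \<Psi> (cnj z) = \<omega>' z"
    "\<forall>x\<in>{-1..1}. \<Psi> (of_real x) = \<omega> (unfold_half (of_real x))"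
    by (elim exE conjE) (rule that, assumption, rule exI, assumption+)
  \<comment> \<open>The boundary of the glued disk by number of steps, with period 8; the tile
    \<open>t'\<close> is read backwards from step 8.\<close>
  define G where "G s = \<Psi> (cis (pi/4 * s))" for s
  have G8: "G (s + 8) = G s" for s by (simp add: G_def distrib_left cis_mult[symmetric])
  have up: "G s = \<omega> (cis (pi/4 * s))" "G (8 - s) = \<omega>' (cis (pi/4 * s))" if s: "0 \<le> s" "s \<le> 4" for s
  proof -
    have "pi/4 * s \<le> pi/4 * 4" using s by (intro mult_left_mono) simp_all
    then have "Im (cis (pi/4 * s)) \<ge> 0" using s by (simp add: sin_ge_zero)
    moreover have "cis (pi/4 * s) \<in> sphere 0 1" by simp
    ultimately have *: "\<Psi> (cis (pi/4 * s)) = \<omega> (cis (pi/4 * s)) \<and> \<Psi> (cnj (cis (pi/4 * s))) = \<omega>' (cis (pi/4 * s))"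
      using \<Psi>(3) by blast
    then show "G s = \<omega> (cis (pi/4 * s))" by (simp add: G_def)
    have "G (8 - s) = G (- s)" using G8[of "- s"] by simp
    also have "\<dots> = \<Psi> (cnj (cis (pi/4 * s)))" by (simp add: G_def cis_cnj)
    finally show "G (8 - s) = \<omega>' (cis (pi/4 * s))" using * by simp
  qed
  have Gt: "G x = rim t (5 + x)" "G (1 + x) = rim t (1 + x)" "G (2 + x) = rim t (2 + x)" "G (3 + x) = rim t (3 + x)"
    "G (8 - x) = rim t' (5 + x)" "G (8 - (1 + x)) = rim t' (1 + x)" "G (8 - (2 + x)) = rim t' (2 + x)" "G (8 - (3 + x)) = rim t' (3 + x)"
    if x: "x \<in> {0..1}" for x
    using bspec[OF \<omega>(3) x] bspec[OF \<omega>'(3) x] up[of x] up[of "1 + x"] up[of "2 + x"] up[of "3 + x"] x by simp_all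
  \<comment> \<open>The rotation by \<open>pi/4\<close> brings the labelled vertices, at odd steps,
    to the corners of the model quadrilateral: its side \<open>j\<close> goes from step
    \<open>2 * j + 1\<close> to step \<open>2 * j + 3\<close>.\<close>
  define \<Phi> where "\<Phi> z = \<Psi> (z * cis (pi/4))" for z
  have \<Phi>G: "\<Phi> (circle_point 4 (real j + x)) = G (2 * real j + 1 + 2 * x)" for j x
  proof -
    have "2 * pi * (real j + x) / real 4 + pi/4 = pi/4 * (2 * real j + 1 + 2 * x)" by (simp add: field_simps)
    then show ?thesis by (simp only: \<Phi>_def G_def circle_point_def cis_mult)
  qed
  define p where "p s j x = rim s (real j + x)" for s x and j :: nat
  \<comment> \<open>\<open>m j\<close> is the blank vertex at step \<open>2 * j + 2\<close>, the
    middle of side \<open>j\<close>; the path \<open>h j\<close> is composed of the two pentagon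
    sides around it.\<close>
  define m where "m j = (if j = (1::nat) then rim t 4 else if j = 2 then rim t' 2 else if j = 3 then rim t 5 else rim t 2)" for j
  define h where "h j = (if j = (1::nat) then p t 3 +++ reversepath (p t' 3) else if j = 2 then reversepath (p t' 2) +++ reversepath (p t' 1)
    else if j = 3 then reversepath (p t' 5) +++ p t 5 else p t 1 +++ p t 2)" for j
  have pe: "edge_path V (edge s j) (p s j)" "p s j 0 = rim s (real j)" "p s j 1 = rim s (real j + 1)"
    "edge_path V (edge s j) (reversepath (p s j))" "reversepath (p s j) 0 = rim s (real j + 1)" "reversepath (p s j) 1 = rim s (real j)"
    if "s \<in> T" "j \<in> {1..5}" for s j
    using edge_path_side[OF that] edge_path_reversepath[OF edge_path_side[OF that]] by (simp_all add: p_def[abs_def] reversepath_def)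
  have uV: "rim s 2 \<in> V - B" "rim s 4 \<in> V - B" "rim s 5 \<in> V - B" if "s \<in> T" for s using rims_V[OF that] blanks[OF that] by simp_all
  have nd: "edge s 1 ~= edge s 2" if "s \<in> T" for s using next_side_distinct(1)[OF that] by simp
  have j4: "j = 1 \<or> j = 2 \<or> j = 3 \<or> j = 4" if "j \<in> {1..4}" for j :: nat using that by auto
  have hp: "edge_path B (joined_edge (m j)) (h j)" if "j \<in> {1..4}" for j
    using j4[OF that]
  proof (elim disjE)
    assume [simp]: "j = 1"
    have "edge_path B (joined_edge (rim t 4)) (p t 3 +++ reversepath (p t' 3))"
      by (rule joined_edge_path[OF bl[of t 3] bl[of t' 3] ne(1) uV(2)[OF t(1)] pe(1) _ pe(4)]) (use t r pe(3)[of t 3] pe(5)[of t' 3] in simp_all)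
    then show ?thesis by (simp add: m_def h_def)
  next
    assume [simp]: "j = 2"
    have "edge_path B (joined_edge (rim t' 2)) (reversepath (p t' 2) +++ reversepath (p t' 1))"
      by (rule joined_edge_path[OF bl[of t' 2] bl[of t' 1] nd[OF t(2), symmetric] uV(1)[OF t(2)] pe(4) _ pe(4)])
        (use t pe(6)[of t' 2] pe(5)[of t' 1] in simp_all)
    then show ?thesis by (simp add: m_def h_def)
  next
    assume [simp]: "j = 3"
    have "edge_path B (joined_edge (rim t 5)) (reversepath (p t' 5) +++ p t 5)"
      by (rule joined_edge_path[OF bl[of t' 5] bl[of t 5] ne(2)[symmetric] uV(3)[OF t(1)] pe(4) _ pe(1)])
        (use t r pe(6)[of t' 5] pe(2)[of t 5] in simp_all)
    then show ?thesis by (simp add: m_def h_def)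
  next
    assume [simp]: "j = 4"
    have "edge_path B (joined_edge (rim t 2)) (p t 1 +++ p t 2)"
      by (rule joined_edge_path[OF bl[of t 1] bl[of t 2] nd[OF t(1)] uV(1)[OF t(1)] pe(1) _ pe(1)])
        (use t pe(3)[of t 1] pe(2)[of t 2] in simp_all)
    then show ?thesis by (simp add: m_def h_def)
  qed
  have hv: "\<Phi> (circle_point 4 (real j + x)) = h j x" if "j \<in> {1..4}" and x: "x \<in> {0..1}" for j x
  proof (cases "x \<le> 1/2")
    case True
    then have y: "2 * x \<in> {0..1}" "1 - 2 * x \<in> {0..1}" using x by auto
    have "G (5 + 2 * x) = rim t' (3 - 2 * x)" using Gt(7)[OF y(2)] by (simp add: algebra_simps)
    moreover have "G (7 + 2 * x) = rim t' (6 - 2 * x)" using Gt(5)[OF y(2)] by (simp add: algebra_simps)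
    moreover have "G (9 + 2 * x) = rim t (1 + 2 * x)" using Gt(2)[OF y(1)] G8[of "1 + 2 * x"] by (simp add: algebra_simps)
    ultimately show ?thesis using j4[OF that(1)] Gt(4)[OF y(1)] True unfolding \<Phi>G
      by (elim disjE) (simp_all add: h_def p_def joinpaths_def reversepath_def algebra_simps)
  next
    case False
    then have y: "2 * x - 1 \<in> {0..1}" "2 - 2 * x \<in> {0..1}" using x by auto
    have "G (3 + 2 * x) = rim t' (5 - 2 * x)" using Gt(8)[OF y(2)] by (simp add: algebra_simps)
    moreover have "G (5 + 2 * x) = rim t' (3 - 2 * x)" using Gt(6)[OF y(2)] by (simp add: algebra_simps)
    moreover have "G (7 + 2 * x) = rim t (4 + 2 * x)" using Gt(1)[OF y(1)] G8[of "2 * x - 1"] by (simp add: algebra_simps)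
    moreover have "G (9 + 2 * x) = rim t (1 + 2 * x)" using Gt(3)[OF y(1)] G8[of "1 + 2 * x"] by (simp add: algebra_simps)
    ultimately show ?thesis using j4[OF that(1)] False unfolding \<Phi>G
      by (elim disjE) (simp_all add: h_def p_def joinpaths_def reversepath_def algebra_simps)
  qed
  have rot: "homeomorphism (ball 0 1) (ball 0 1) (\<lambda>z. z * cis (pi/4)) (\<lambda>z. z * cis (- pi/4))"
  proof -
    have b: "(\<lambda>z. z * cis a) ` ball 0 1 \<subseteq> ball 0 1" for a by (auto simp: norm_mult)
    have "z * cis (pi/4) * cis (- pi/4) = z" "z * cis (- pi/4) * cis (pi/4) = z" for z by (simp_all add: mult.assoc cis_mult)
    then show ?thesis using b by (intro homeomorphismI) (auto intro!: continuous_intros simp: norm_mult)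
  qed
  have \<Phi>c: "continuous_on (cball 0 1) \<Phi>" unfolding \<Phi>_def
    by (rule continuous_on_compose2[OF \<Psi>(1)]) (auto intro!: continuous_intros simp: norm_mult)
  have \<Phi>h: "\<exists>\<psi>. homeomorphism (ball 0 1) (t \<union> t' \<union> (e - V)) \<Phi> \<psi>"
  proof -
    obtain \<psi> where "homeomorphism (ball 0 1) (t \<union> t' \<union> (e - V)) \<Psi> \<psi>" using \<Psi>(2) by blast
    from homeomorphism_compose[OF rot this] show ?thesis unfolding \<Phi>_def comp_def by blast
  qed
  have mV: "joined_edge (m j) \<in> joined_edge ` (V - B)" for j using uV t by (auto simp: m_def)
  note pm = polygon_map_of_edge_paths[where e = "\<lambda>j. joined_edge (m j)", OF \<Phi>c \<Phi>h _ hp mV hv]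
  \<comment> \<open>The diameter through \<open>cis (3 * pi/4)\<close>, the middle of side 1, is the
    horizontal one of \<open>\<Psi>\<close> run backwards; along it the two tiles were
    glued.\<close>
  have diam: "\<Phi> (of_real x * cis (3 * pi/4)) = \<Psi> (of_real (- x))" for x
  proof -
    have "3 * pi/4 + pi/4 = pi" by simp
    then show ?thesis by (simp add: \<Phi>_def mult.assoc cis_mult)
  qed
  have "\<Phi> (cis (3 * pi/4)) = \<Psi> (cis pi)" using diam[of 1] by simp
  also have "\<dots> = rim t 4" using Gt(4)[of 1] by (simp add: G_def)
  finally have \<Phi>4: "\<Phi> (cis (3 * pi/4)) = rim t 4" .
  have "polygon_map B (joined_edge ` (V - B)) 4 (t \<union> t' \<union> (e - V)) \<Phi>" by (rule pm(1)) simp_all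
  moreover have "\<Phi> ` side 4 1 = joined_edge (rim t 4)" "\<Phi> ` side 4 3 = joined_edge (rim t 5)"
    using pm(2)[of 1] pm(2)[of 3] by (simp_all add: m_def)
  moreover note \<Phi>4
  moreover have "\<Phi> (- cis (3 * pi/4)) = rim t 5" using diam[of "-1"] Gt(1)[of 0] by (simp add: G_def)
  moreover have "(\<lambda>x. \<Phi> (of_real x * cis (3 * pi/4))) ` {-1..1} = e"
  proof (intro equalityI subsetI)
    fix y assume "y \<in> (\<lambda>x. \<Phi> (of_real x * cis (3 * pi/4))) ` {-1..1}"
    then obtain x where x: "y = \<Psi> (of_real (- x))" "- x \<in> {-1..1}" unfolding diam by auto
    then have "y = \<omega> (unfold_half (of_real (- x)))" using \<Psi>(4) by blast
    moreover obtain x' where "x' \<in> {0..1}" "\<omega> (unfold_half (of_real (- x))) = \<gamma> x'"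
      using lower[OF unfold_half_real(1,2)[OF x(2)]] by blast
    ultimately show "y \<in> e" using gin by simp
  next
    fix y assume "y \<in> e"
    then obtain x where x: "x \<in> {0..1}" "y = \<gamma> x" using g(2) unfolding path_image_def by blast
    define z where "z = cis (pi + pi * x)"
    have "0 \<le> pi * x" "pi * x \<le> pi * 1" using x(1) by (intro mult_nonneg_nonneg mult_left_mono; simp)+
    then have "sin (pi + pi * x) \<le> 0" by (simp add: sin_add sin_ge_zero)
    then have z: "z \<in> sphere 0 1" "Im z \<le> 0" by (simp_all add: z_def)
    have "y = \<omega> z" using bspec[OF \<omega>(3) x(1)] x(2) by (simp add: z_def)
    also have "\<dots> = \<Psi> (of_real (Re z))" using \<Psi>(4) unfold_half_real_image(1,2)[OF z] by auto
    also have "\<dots> = \<Phi> (of_real (- Re z) * cis (3 * pi/4))" unfolding diam by simp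
    finally show "y \<in> (\<lambda>x. \<Phi> (of_real x * cis (3 * pi/4))) ` {-1..1}"
      using unfold_half_real_image(2)[OF z] by (intro image_eqI[of _ _ "- Re z"]) auto
  qed
  ultimately show ?thesis by blast
qed

text \<open>The numberings of the two tiles may run along \<open>e\<close> in the same or in
  opposite directions. \<open>glue_tiles\<close> covers the first case.\<close>

lemma blank_edge_quadrilateral:
  assumes e: "e \<in> blank_edges"
  shows "\<exists>t t' u u' \<Phi>. sides_of e = {(t, 4), (t', 4)} \<and> u ~= u' \<and> e \<inter> V = {u, u'} \<and>
    polygon_map B (joined_edge ` (V - B)) 4 (t \<union> t' \<union> (e - V)) \<Phi> \<and>
    \<Phi> ` side 4 1 = joined_edge u \<and> \<Phi> ` side 4 3 = joined_edge u' \<and>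
    \<Phi> (cis (3 * pi/4)) = u \<and> \<Phi> (- cis (3 * pi/4)) = u' \<and>
    (\<lambda>x. \<Phi> (of_real x * cis (3 * pi/4))) ` {-1..1} = e"
proof -
  obtain t t' where t: "t \<in> T" "t' \<in> T" "t ~= t'" and et: "edge t 4 = e" "edge t' 4 = e" and sd: "sides_of e = {(t, 4), (t', 4)}"
    and ne: "\<forall>u\<in>e \<inter> V. edge t (snd (out_side u t)) ~= edge t' (snd (out_side u t'))"
    by (rule blank_edge_tiles[OF e])
  have eV: "e \<inter> V = {rim t 4, rim t 5}" "e \<inter> V = {rim t' 4, rim t' 5}"
    using edge_Int_V[OF t(1), of 4] edge_Int_V[OF t(2), of 4] et by simp_all
  have n45: "rim t 4 ~= rim t 5" "rim t' 4 ~= rim t' 5" using rim45 t by simp_all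
  have in4: "rim t 4 \<in> e \<inter> V" "rim t 5 \<in> e \<inter> V" unfolding eV(1) by simp_all
  have "{rim t 4, rim t 5} = {rim t' 4, rim t' 5}" using eV by simp
  then have or: "rim t' 4 = rim t 4 \<and> rim t' 5 = rim t 5 \<or> rim t' 4 = rim t 5 \<and> rim t' 5 = rim t 4"
    by (auto simp: doubleton_eq_iff)
  have "\<exists>\<Phi>. polygon_map B (joined_edge ` (V - B)) 4 (t \<union> t' \<union> (e - V)) \<Phi> \<and>
    \<Phi> ` side 4 1 = joined_edge (rim t 4) \<and> \<Phi> ` side 4 3 = joined_edge (rim t 5) \<and>
    \<Phi> (cis (3 * pi/4)) = rim t 4 \<and> \<Phi> (- cis (3 * pi/4)) = rim t 5 \<and>
    (\<lambda>x. \<Phi> (of_real x * cis (3 * pi/4))) ` {-1..1} = e"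
    using or
  proof (elim disjE conjE)
    assume r: "rim t' 4 = rim t 4" "rim t' 5 = rim t 5"
    have "edge t 3 ~= edge t' 3" "edge t 5 ~= edge t' 5"
      using bspec[OF ne in4(1)] bspec[OF ne in4(2)] n45 r by (simp_all add: out_side_def)
    then show ?thesis by (rule glue_tiles[OF t et r])
  next
    assume r: "rim t' 4 = rim t 5" "rim t' 5 = rim t 4"
    \<comment> \<open>In the second case \<open>t'\<close> is turned over: the reflection exchanges
      its \<open>v_4\<close> and \<open>v_5\<close>, and with them its sides 3 and 5.\<close>
    define \<phi>' where "\<phi>' = \<phi>(t' := \<phi> t' \<circ> pentagon_reflection)"
    interpret R: labelled_pentagons S V E \<phi>' B unfolding \<phi>'_def by (rule reflect_tile(1)[OF t(2)])
    have rr: "R.rim t' s = rim t' (4 - s)" for s unfolding \<phi>'_def by (rule reflect_tile(2)[OF t(2)])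
    have \<phi>t: "\<phi>' t = \<phi> t" "\<phi>' t' = \<phi> t' \<circ> pentagon_reflection" using t(3) by (simp_all add: \<phi>'_def)
    have rt: "R.rim t s = rim t s" for s by (simp only: R.rim_def rim_def \<phi>t)
    have re: "R.edge t j = edge t j" for j by (simp only: R.edge_def edge_def \<phi>t)
    have re': "R.edge t' j = \<phi> t' ` pentagon_reflection ` side 5 j" for j
      by (simp only: R.edge_def \<phi>t image_comp)
    have "R.edge t' 4 = edge t' 4" "R.edge t' 3 = edge t' 5" "R.edge t' 5 = edge t' 3"
      unfolding re' edge_def
      using image_circle_point_reflect(1)[of pentagon_reflection 5 4 4 4 "-1", OF pentagon_reflection_circle_point]
        image_circle_point_reflect(1)[of pentagon_reflection 5 4 3 5 "-1", OF pentagon_reflection_circle_point]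
        image_circle_point_reflect(1)[of pentagon_reflection 5 4 5 3 "-1", OF pentagon_reflection_circle_point] by simp_all
    note ed = this
    have "rim t' 0 = rim t' 5" "rim t' (- 1) = rim t' 4" using rim_period[of t' 0] rim_period[of t' "- 1"] by simp_all
    then have Rr: "R.rim t' 4 = R.rim t 4" "R.rim t' 5 = R.rim t 5" unfolding rr rt using r by simp_all
    have "edge t 3 ~= edge t' 5" "edge t 5 ~= edge t' 3"
      using bspec[OF ne in4(1)] bspec[OF ne in4(2)] n45 r by (simp_all add: out_side_def)
    then have Rne: "R.edge t 3 ~= R.edge t' 3" "R.edge t 5 ~= R.edge t' 5" unfolding ed re .
    have Ret: "R.edge t 4 = e" "R.edge t' 4 = e" unfolding ed re by (rule et)+
    show ?thesis using R.glue_tiles[OF t Ret Rr Rne] unfolding rt .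
  qed
  then show ?thesis using sd n45(1) eV(1) by blast
qed

end

section \<open>The quadrilateral tiling\<close>

context labelled_pentagons
begin

text \<open>Both edges are directed towards \<open>u\<close> and the second is then reversed, so the
  parameter 1/2 belongs to \<open>u\<close> and the two halves are the original edges.\<close>

lemma joined_edge_split:
  assumes u: "u \<in> V - B"
  shows "\<exists>h. edge_path B (joined_edge u) h \<and> h (1/2) = u \<and> {h ` {0..1/2}, h ` {1/2..1}} = {f \<in> E - blank_edges. u \<in> f}"
proof -
  obtain f g where fg: "{f \<in> E - blank_edges. u \<in> f} = {f, g}" "f ~= g"
    using card_blank_edges_at(2)[OF u] unfolding card_2_iff by blast
  have "f \<in> {f \<in> E - blank_edges. u \<in> f}" "g \<in> {f \<in> E - blank_edges. u \<in> f}" unfolding fg(1) by simp_all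
  then have fE: "f \<in> E - blank_edges" "u \<in> f" and gE: "g \<in> E - blank_edges" "u \<in> g" by simp_all
  have *: "\<exists>p. edge_path V e p \<and> p 1 = u" if e: "e \<in> E - blank_edges" "u \<in> e" for e
  proof -
    obtain p where p: "edge_path V e p" using ex_edge_path e(1) by blast
    then have "e \<inter> V = {p 0, p 1}" by (simp add: edge_path_def pathstart_def pathfinish_def)
    then have "u \<in> {p 0, p 1}" using e(2) u by blast
    then consider "p 1 = u" | "reversepath p 1 = u" by (auto simp: reversepath_def)
    then show ?thesis using p edge_path_reversepath[OF p] by cases blast+
  qed
  obtain p where p: "edge_path V f p" "p 1 = u" using *[OF fE] by blast
  obtain q where q: "edge_path V g q" "q 1 = u" using *[OF gE] by blast
  have q': "edge_path V g (reversepath q)" "reversepath q 0 = u" using edge_path_reversepath[OF q(1)] q(2) by (simp_all add: reversepath_def)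
  have im: "path_image p = f" "path_image (reversepath q) = g" using p(1) q'(1) by (simp_all add: edge_path_def)
  have pq: "p 1 = reversepath q 0" using p(2) q'(2) by simp
  have "edge_path B (joined_edge u) (p +++ reversepath q)" by (rule joined_edge_path[OF fE(1) gE(1) fg(2) u p q'])
  moreover have "(p +++ reversepath q) (1/2) = u" using joinpaths_halves(3)[of p "reversepath q", OF pq] p(2) by simp
  moreover have "{(p +++ reversepath q) ` {0..1/2}, (p +++ reversepath q) ` {1/2..1}} = {f \<in> E - blank_edges. u \<in> f}"
    unfolding joinpaths_halves(1,2)[of p "reversepath q", OF pq] im fg(1) ..
  ultimately show ?thesis by blast
qed

lemma mem_joined_edge: "u \<in> V - B ==> u \<in> joined_edge u"
proof -
  assume u: "u \<in> V - B"
  have "{f \<in> E - blank_edges. u \<in> f} ~= {}" using card_blank_edges_at(2)[OF u] by (metis card.empty zero_neq_numeral)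
  then show "u \<in> joined_edge u" unfolding joined_edge_def by blast
qed

lemma blank_vertex_on_joined_edge: "[|u \<in> V - B; v \<in> V - B; v \<in> joined_edge u|] ==> v = u"
  using bullet_edge_blank_end unfolding joined_edge_def by blast

lemma inj_joined_edge: "inj_on joined_edge (V - B)"
proof (rule inj_onI)
  fix u v assume u: "u \<in> V - B" "v \<in> V - B" "joined_edge u = joined_edge v"
  then have "u \<in> joined_edge v" using mem_joined_edge[OF u(1)] by simp
  then show "u = v" using blank_vertex_on_joined_edge u by blast
qed

lemma bullet_edge_joined:
  assumes "f \<in> E - blank_edges" obtains u where "u \<in> V - B" "u \<in> f" "f \<subseteq> joined_edge u"
proof -
  obtain b u where bu: "f \<inter> V = {b, u}" "b \<in> B" "u \<in> V - B" using bullet_edge_ends[OF assms] .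
  then have "u \<in> f" by blast
  then show ?thesis using that bu(3) assms unfolding joined_edge_def by blast
qed

lemma embedded_joined_edges: "embedded_graph S B (joined_edge ` (V - B))"
  unfolding embedded_graph_def
proof (intro conjI ballI impI)
  show "finite B" "finite (joined_edge ` (V - B))" "B \<subseteq> S" using finite_V V_S B_V finite_subset by auto
  fix e assume "e \<in> joined_edge ` (V - B)"
  then obtain u where u: "e = joined_edge u" "u \<in> V - B" by (rule imageE)
  show "e \<subseteq> S" unfolding u(1) joined_edge_def using E_S by blast
  show "\<exists>g. edge_path B e g" using joined_edge_split[OF u(2)] u(1) by blast
  fix e' assume "e' \<in> joined_edge ` (V - B)" and ne: "e ~= e'"
  then obtain v where v: "e' = joined_edge v" "v \<in> V - B" by blast
  show "e \<inter> e' \<subseteq> B"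
  proof (rule subsetI, rule ccontr)
    fix x assume x: "x \<in> e \<inter> e'" "x \<notin> B"
    then obtain f f' where f: "f \<in> E - blank_edges" "u \<in> f" "x \<in> f" "f' \<in> E - blank_edges" "v \<in> f'" "x \<in> f'"
      unfolding u(1) v(1) joined_edge_def by blast
    show False
    proof (cases "x \<in> V")
      case True
      then have "x = u" "x = v" using bullet_edge_blank_end f u(2) v(2) x(2) by blast+
      then show False using ne u(1) v(1) by simp
    next
      case False
      then have "f = f'" using edges_meet[of f f' x] f by blast
      then have "u = v" using bullet_edge_blank_end[OF f(1,2) u(2)] f(5) v(2) by blast
      then show False using ne u(1) v(1) by simp
    qed
  qed
qed

text \<open>Every old edge at \<open>v\<close> is half of a joined edge at \<open>v\<close>. Both
  halves can end at \<open>v\<close> only if the joined edge is a loop there, and then it counts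
  twice. So the degree does not drop below 3.\<close>

lemma degree_joined_edges:
  assumes v: "v \<in> B" shows "vertex_degree V E v \<le> vertex_degree B (joined_edge ` (V - B)) v"
proof -
  define N where "N u = {f \<in> E - blank_edges. u \<in> f}" for u
  define U where "U = {u \<in> V - B. v \<in> joined_edge u}"
  have finN: "finite (N u)" for u unfolding N_def using finite_E by simp
  have finU: "finite U" unfolding U_def using finite_V by simp
  have le: "card {f \<in> N u. v \<in> f} \<le> (if joined_edge u \<inter> B = {v} then 2 else 1)" if u: "u \<in> V - B" for u
  proof -
    have c2: "card (N u) = 2" unfolding N_def by (rule card_blank_edges_at(2)[OF u])
    have "card {f \<in> N u. v \<in> f} \<le> card (N u)" by (rule card_mono[OF finN]) blast
    then have le2: "card {f \<in> N u. v \<in> f} \<le> 2" using c2 by simp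
    have "joined_edge u \<inter> B = {v}" if n: "\<not> card {f \<in> N u. v \<in> f} \<le> 1"
    proof -
      have "{f \<in> N u. v \<in> f} = N u" by (rule card_seteq[OF finN]) (use n c2 in auto)
      then have all: "v \<in> f" if "f \<in> N u" for f using that by blast
      have fB: "f \<inter> B = {v}" if f: "f \<in> N u" for f
      proof -
        have "f \<in> E - blank_edges" using f by (simp add: N_def)
        then obtain b w where bw: "f \<inter> V = {b, w}" "b \<in> B" "w \<in> V - B" by (rule bullet_edge_ends)
        have fb: "f \<inter> B = {b}" using bw edge_Int_B[of f] by auto
        have "v \<in> {b}" unfolding fb[symmetric] using all[OF f] v by (rule IntI)
        then show ?thesis using fb by simp
      qed
      have "N u ~= {}" using c2 by auto
      moreover have "joined_edge u \<inter> B = (\<Union>f\<in>N u. f \<inter> B)" unfolding joined_edge_def N_def by blast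
      ultimately show ?thesis using fB by simp
    qed
    then show ?thesis using le2 by auto
  qed
  have "{f \<in> E. v \<in> f} \<subseteq> (\<Union>u\<in>U. {f \<in> N u. v \<in> f})"
  proof
    fix f assume "f \<in> {f \<in> E. v \<in> f}"
    then have f: "f \<in> E - blank_edges" "v \<in> f" using v by (auto simp: blank_edges_def)
    obtain u where "u \<in> V - B" "u \<in> f" "f \<subseteq> joined_edge u" by (rule bullet_edge_joined[OF f(1)])
    then have "u \<in> U" "f \<in> N u" using f by (auto simp: U_def N_def)
    then show "f \<in> (\<Union>u\<in>U. {f \<in> N u. v \<in> f})" using f(2) by blast
  qed
  then have "card {f \<in> E. v \<in> f} \<le> card (\<Union>u\<in>U. {f \<in> N u. v \<in> f})"
    using finU finN by (intro card_mono finite_UN_I) auto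
  also have "\<dots> \<le> (\<Sum>u\<in>U. card {f \<in> N u. v \<in> f})" by (rule card_UN_le[OF finU])
  also have "\<dots> \<le> (\<Sum>u\<in>U. if joined_edge u \<inter> B = {v} then 2 else 1)"
    by (rule sum_mono) (rule le, simp add: U_def)
  also have "\<dots> = (\<Sum>e\<in>joined_edge ` U. if e \<inter> B = {v} then 2 else 1)"
    using inj_on_subset[OF inj_joined_edge, of U] by (subst sum.reindex) (auto simp: U_def)
  also have "joined_edge ` U = {e \<in> joined_edge ` (V - B). v \<in> e}" by (auto simp: U_def)
  finally show ?thesis unfolding degree_card[of v] unfolding vertex_degree_def[of B] .
qed

text \<open>The tiles involved are the two with their side 4 on \<open>e\<close>; \<open>e\<close>
  without its ends connects them.\<close>

definition quad :: "'a set => 'a set" where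
  "quad e = \<Union>(fst ` sides_of e) \<union> (e - V)"

lemma ex_quad_map:
  assumes "e \<in> blank_edges"
  shows "\<exists>\<Phi>. polygon_map B (joined_edge ` (V - B)) 4 (quad e) \<Phi> \<and>
    \<Phi> (cis (3 * pi/4)) ~= \<Phi> (- cis (3 * pi/4)) \<and> e \<inter> V = {\<Phi> (cis (3 * pi/4)), \<Phi> (- cis (3 * pi/4))} \<and>
    \<Phi> ` side 4 1 = joined_edge (\<Phi> (cis (3 * pi/4))) \<and> \<Phi> ` side 4 3 = joined_edge (\<Phi> (- cis (3 * pi/4))) \<and>
    (\<lambda>x. \<Phi> (of_real x * cis (3 * pi/4))) ` {-1..1} = e"
proof -
  obtain t t' u u' \<Phi> where s: "sides_of e = {(t, 4), (t', 4)}" and r: "u ~= u'" "e \<inter> V = {u, u'}"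
    "polygon_map B (joined_edge ` (V - B)) 4 (t \<union> t' \<union> (e - V)) \<Phi>"
    "\<Phi> ` side 4 1 = joined_edge u" "\<Phi> ` side 4 3 = joined_edge u'"
    "\<Phi> (cis (3 * pi/4)) = u" "\<Phi> (- cis (3 * pi/4)) = u'"
    "(\<lambda>x. \<Phi> (of_real x * cis (3 * pi/4))) ` {-1..1} = e"
    using blank_edge_quadrilateral[OF assms] by (elim exE conjE)
  have q: "quad e = t \<union> t' \<union> (e - V)" unfolding quad_def s by simp
  show ?thesis unfolding q by (rule exI[of _ \<Phi>]) (intro conjI; (simp only: r; fail)?; use r in simp)
qed

lemma quad_side: "e \<in> blank_edges ==> (t, j) \<in> sides_of e ==> j = 4 \<and> t \<in> T \<and> edge t 4 = e"
proof -
  assume e: "e \<in> blank_edges" and s: "(t, j) \<in> sides_of e"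
  have "(t, j) \<in> T \<times> {4}" unfolding blank_sides[symmetric] using e s by (rule UN_I)
  moreover have "edge t j = e" using s by (simp add: sides_of_def)
  ultimately show ?thesis by simp
qed

lemma quad_disjoint:
  assumes e: "e \<in> blank_edges" "e' \<in> blank_edges" and x: "x \<in> quad e" "x \<in> quad e'" shows "e = e'"
proof -
  have eE: "e \<in> E" "e' \<in> E" using e by (simp_all add: blank_edges_def)
  have q: "(\<exists>t\<in>T. edge t 4 = d \<and> x \<in> t) \<or> x \<in> d - V" if d: "d \<in> blank_edges" "x \<in> quad d" for d
  proof (cases "x \<in> d - V")
    case False
    then obtain c where c: "c \<in> sides_of d" "x \<in> fst c" using d(2) unfolding quad_def by blast
    obtain t j where "c = (t, j)" by (cases c)
    then show ?thesis using quad_side[OF d(1), of t j] c by auto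
  qed simp
  have nt: "x \<notin> t" if "t \<in> T" "x \<in> d" "d \<in> E" for t d using tile_disj_graph[OF that(1)] that(2,3) by blast
  from q[OF e(1) x(1)] show ?thesis
  proof (elim disjE bexE conjE)
    fix t assume t: "t \<in> T" "edge t 4 = e" "x \<in> t"
    then have "x \<notin> e' - V" using nt[OF t(1) _ eE(2)] by blast
    then obtain t' where "t' \<in> T" "edge t' 4 = e'" "x \<in> t'" using q[OF e(2) x(2)] by blast
    then show ?thesis using tiles_disjoint[OF t(1)] t by blast
  next
    assume xe: "x \<in> e - V"
    then have "x \<in> e' - V" using q[OF e(2) x(2)] nt[OF _ _ eE(1)] by blast
    then show ?thesis using edges_meet[OF eE] xe by blast
  qed
qed

text \<open>A blank vertex lies on its own joined edge, so a point off the new graph is no vertex at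
  all; it lies in a tile or in the interior of a blank edge, hence in a quad.\<close>

lemma quads_cover: "S - (B \<union> \<Union>(joined_edge ` (V - B))) = \<Union>(quad ` blank_edges)"
proof (intro equalityI subsetI)
  fix x assume x: "x \<in> S - (B \<union> \<Union>(joined_edge ` (V - B)))"
  have xV: "x \<notin> V" using x mem_joined_edge[of x] by blast
  then consider f where "f \<in> E" "x \<in> f" | t where "t \<in> T" "x \<in> t" using x S_eq by blast
  then show "x \<in> \<Union>(quad ` blank_edges)"
  proof cases
    case 1
    have "f \<in> blank_edges"
    proof (rule ccontr)
      assume "f \<notin> blank_edges"
      then have "f \<in> E - blank_edges" using 1 by simp
      then obtain u where "u \<in> V - B" "u \<in> f" "f \<subseteq> joined_edge u" by (rule bullet_edge_joined)
      then show False using x 1(2) by blast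
    qed
    then show ?thesis using 1 xV by (intro UN_I[of f]) (simp_all add: quad_def)
  next
    case 2
    have "(t, 4) \<in> sides_of (edge t 4)" using 2(1) by (simp add: sides_of_def)
    then have "x \<in> \<Union>(fst ` sides_of (edge t 4))" using 2(2) by force
    then show ?thesis using edge_blank_iff[OF 2(1), of 4] by (intro UN_I[of "edge t 4"]) (simp_all add: quad_def)
  qed
next
  fix x assume "x \<in> \<Union>(quad ` blank_edges)"
  then obtain e where e: "e \<in> blank_edges" "x \<in> quad e" by blast
  have eE: "e \<in> E" using e(1) by (simp add: blank_edges_def)
  have jE: "joined_edge u \<subseteq> \<Union>E" for u unfolding joined_edge_def by blast
  show "x \<in> S - (B \<union> \<Union>(joined_edge ` (V - B)))"
  proof (cases "x \<in> e - V")
    case True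
    have "x \<notin> joined_edge u" for u
    proof
      assume "x \<in> joined_edge u"
      then obtain f where "f \<in> E - blank_edges" "x \<in> f" unfolding joined_edge_def by blast
      then show False using edges_meet[of f e x] eE e(1) True by blast
    qed
    then show ?thesis using True E_S[OF eE] B_V by blast
  next
    case False
    then obtain c where c: "c \<in> sides_of e" "x \<in> fst c" using e(2) unfolding quad_def by blast
    then have t: "fst c \<in> T" by (auto simp: sides_of_def)
    then have "x \<in> S" "x \<notin> V \<union> \<Union>E" using c(2) S_eq tile_disj_graph[OF t] by blast+
    then show ?thesis using jE B_V by blast
  qed
qed

text \<open>In every quad the blank edge is the image of the diameter between the middles of sides 1
  and 3, so these sides are selected throughout. Each joined edge is then selected once, because its
  middle point lies on a single blank edge.\<close>

lemma labelling_imp_subdivision: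
  "\<exists>V0 E0. quadrilateral_tiling S V0 E0 \<and> simple_pentagonal_subdivision S V0 E0 V E"
proof -
  \<comment> \<open>Side 1 of the model quadrilateral covers the angles from \<open>pi/2\<close> to
    \<open>pi\<close>, so \<open>a\<close> is its middle, and \<open>- a\<close> is the middle of
    side 3.\<close>
  define a where "a = cis (3 * pi/4)"
  define E0 where "E0 = joined_edge ` (V - B)"
  have "\<forall>e\<in>blank_edges. \<exists>\<Phi>. polygon_map B E0 4 (quad e) \<Phi> \<and> \<Phi> a ~= \<Phi> (- a) \<and> e \<inter> V = {\<Phi> a, \<Phi> (- a)} \<and>
    \<Phi> ` side 4 1 = joined_edge (\<Phi> a) \<and> \<Phi> ` side 4 3 = joined_edge (\<Phi> (- a)) \<and> (\<lambda>x. \<Phi> (of_real x * a)) ` {-1..1} = e"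
    unfolding a_def E0_def by (intro ballI ex_quad_map)
  then obtain \<Phi> where \<Phi>0: "\<forall>e\<in>blank_edges. polygon_map B E0 4 (quad e) (\<Phi> e) \<and> \<Phi> e a ~= \<Phi> e (- a) \<and> e \<inter> V = {\<Phi> e a, \<Phi> e (- a)} \<and>
    \<Phi> e ` side 4 1 = joined_edge (\<Phi> e a) \<and> \<Phi> e ` side 4 3 = joined_edge (\<Phi> e (- a)) \<and> (\<lambda>x. \<Phi> e (of_real x * a)) ` {-1..1} = e"
    by (rule bchoice[THEN exE])
  have \<Phi>: "polygon_map B E0 4 (quad e) (\<Phi> e)" "\<Phi> e a ~= \<Phi> e (- a)" "e \<inter> V = {\<Phi> e a, \<Phi> e (- a)}"
    "\<Phi> e ` side 4 1 = joined_edge (\<Phi> e a)" "\<Phi> e ` side 4 3 = joined_edge (\<Phi> e (- a))" "(\<lambda>x. \<Phi> e (of_real x * a)) ` {-1..1} = e"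
    if "e \<in> blank_edges" for e
    by (rule bspec[OF \<Phi>0 that, THEN conjunct1],
        rule bspec[OF \<Phi>0 that, THEN conjunct2, THEN conjunct1],
        rule bspec[OF \<Phi>0 that, THEN conjunct2, THEN conjunct2, THEN conjunct1],
        rule bspec[OF \<Phi>0 that, THEN conjunct2, THEN conjunct2, THEN conjunct2, THEN conjunct1],
        rule bspec[OF \<Phi>0 that, THEN conjunct2, THEN conjunct2, THEN conjunct2, THEN conjunct2, THEN conjunct1],
        rule bspec[OF \<Phi>0 that, THEN conjunct2, THEN conjunct2, THEN conjunct2, THEN conjunct2, THEN conjunct2])
  have hom: "\<exists>\<psi>. homeomorphism (ball 0 1) (quad e) (\<Phi> e) \<psi>" and cont: "continuous_on (ball 0 1) (\<Phi> e)"
    if "e \<in> blank_edges" for e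
    using \<Phi>(1)[OF that] continuous_on_subset[OF _ ball_subset_cball] by (auto simp: polygon_map_def)
  have img: "\<Phi> e ` ball 0 1 = quad e" and injb: "inj_on (\<Phi> e) (ball 0 1)" if "e \<in> blank_edges" for e
    using hom[OF that] by (metis homeomorphism_image1 homeomorphism_apply1 inj_on_inverseI)+
  have quad_ne: "quad e ~= {}" if "e \<in> blank_edges" for e
    using img[OF that] by auto
  have inj_quad: "inj_on quad blank_edges"
  proof (rule inj_onI)
    fix e e' assume e: "e \<in> blank_edges" "e' \<in> blank_edges" "quad e = quad e'"
    obtain x where "x \<in> quad e" using quad_ne[OF e(1)] by blast
    then show "e = e'" using quad_disjoint[OF e(1,2)] e(3) by simp
  qed
  have quad_S: "quad e \<subseteq> S" if "e \<in> blank_edges" for e using quads_cover that by blast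
  have tiles: "tiles S B E0 = quad ` blank_edges"
    unfolding tiles_def E0_def quads_cover
  proof (rule components_of_open_partition)
    fix Q assume "Q \<in> quad ` blank_edges"
    then obtain e where e: "Q = quad e" "e \<in> blank_edges" by (rule imageE)
    \<comment> \<open>Charts of quads are injective on the open disk, so by invariance of domain
      quads are open; disjoint and connected, they are the components of the complement of the new
      graph.\<close>
    have "openin (top_of_set S) (\<Phi> e ` ball 0 1)"
      by (rule surface_open_map[OF surface open_ball cont[OF e(2)] injb[OF e(2)]]) (simp add: img[OF e(2)] quad_S[OF e(2)])
    then have "openin (top_of_set S) Q" using img[OF e(2)] e(1) by simp
    then show "openin (top_of_set (\<Union>(quad ` blank_edges))) Q"
      by (rule openin_subset_trans) (use e quad_S in auto)
    have "connected (\<Phi> e ` ball 0 1)" using cont[OF e(2)] by (intro connected_continuous_image) auto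
    then show "connected Q" using img[OF e(2)] e(1) by simp
    show "Q ~= {}" using quad_ne e by simp
    show "Q \<inter> Q' = {}" if "Q' \<in> quad ` blank_edges" "Q ~= Q'" for Q'
      using quad_disjoint e that by blast
  qed
  have quads: "quadrilateral_tiling S B E0"
    unfolding polygonal_tiling_def tiling_def
  proof (intro conjI ballI)
    show "closed_surface S" by (rule surface)
    show "embedded_graph S B E0" unfolding E0_def by (rule embedded_joined_edges)
    show "3 \<le> vertex_degree B E0 v" if "v \<in> B" for v
      using degree[of v] degree_joined_edges[OF that] B_V that unfolding E0_def by auto
    fix t assume "t \<in> tiles S B E0"
    then obtain e where e: "t = quad e" "e \<in> blank_edges" unfolding tiles by (rule imageE)
    have "ball (0::complex) 1 homeomorphic t" unfolding homeomorphic_def e(1) using hom[OF e(2)] by blast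
    then show "t homeomorphic ball (0::complex) 1" by (rule homeomorphic_sym[THEN iffD1])
    show "\<exists>\<phi>. polygon_map B E0 4 t \<phi>" using \<Phi>(1)[OF e(2)] e(1) by blast
    then show "\<exists>k\<ge>3. \<exists>\<phi>. polygon_map B E0 k t \<phi>" by (intro exI[of _ 4]) simp
  qed
  have "\<forall>u\<in>V - B. \<exists>h. edge_path B (joined_edge u) h \<and> h (1/2) = u \<and> {h ` {0..1/2}, h ` {1/2..1}} = {f \<in> E - blank_edges. u \<in> f}"
    by (intro ballI joined_edge_split)
  then obtain h where "\<forall>u\<in>V - B. edge_path B (joined_edge u) (h u) \<and> h u (1/2) = u \<and> {h u ` {0..1/2}, h u ` {1/2..1}} = {f \<in> E - blank_edges. u \<in> f}"
    by (rule bchoice[THEN exE])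
  then have h: "edge_path B (joined_edge u) (h u)" "h u (1/2) = u" "{h u ` {0..1/2}, h u ` {1/2..1}} = {f \<in> E - blank_edges. u \<in> f}"
    if "u \<in> V - B" for u using that by blast+
  \<comment> \<open>The subdivision wants data indexed by edges and tiles. The available data are
    indexed by blank vertices and blank edges and are carried over along the injective maps
    \<open>joined_edge\<close> and \<open>quad\<close>.\<close>
  define \<gamma> where "\<gamma> e = h (inv_into (V - B) joined_edge e)" for e
  define \<phi>0 where "\<phi>0 q = \<Phi> (inv_into blank_edges quad q)" for q
  have \<gamma>h: "\<gamma> (joined_edge u) = h u" if "u \<in> V - B" for u
    unfolding \<gamma>_def using inv_into_f_f[OF inj_joined_edge that] by simp
  have \<phi>0: "\<phi>0 (quad e) = \<Phi> e" if "e \<in> blank_edges" for e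
    unfolding \<phi>0_def using inv_into_f_f[OF inj_quad that] by simp
  have ends: "\<Phi> e a \<in> V - B" "\<Phi> e (- a) \<in> V - B" "\<Phi> e a \<in> e" "\<Phi> e (- a) \<in> e" if "e \<in> blank_edges" for e
    using \<Phi>(3)[OF that] that by (auto simp: blank_edges_def)
  have lp: "linepath a (- a) x = of_real (1 - 2 * x) * a" for x
    by (simp add: linepath_def scaleR_conv_of_real algebra_simps)
  have na: "norm a = 1" by (simp add: a_def)
  have "path_image (linepath a (- a)) = (\<lambda>x. of_real x * a) ` {-1..1}"
  proof (intro equalityI subsetI)
    fix z assume "z \<in> path_image (linepath a (- a))"
    then obtain x where "x \<in> {0..1}" "z = of_real (1 - 2 * x) * a" unfolding path_image_def lp by (rule imageE)
    then show "z \<in> (\<lambda>x. of_real x * a) ` {-1..1}" by (intro image_eqI[of _ _ "1 - 2 * x"]) simp_all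
  next
    fix z assume "z \<in> (\<lambda>x. of_real x * a) ` {-1..1}"
    then obtain x where x: "z = of_real x * a" "x \<in> {-1..1}" by (rule imageE)
    have "1 - 2 * ((1 - x) / 2) = x" by (simp add: field_simps)
    then have "z = linepath a (- a) ((1 - x) / 2)" by (simp only: lp x(1))
    moreover have "(1 - x) / 2 \<in> {0..1}" using x(2) by simp
    ultimately show "z \<in> path_image (linepath a (- a))" unfolding path_image_def by (rule image_eqI)
  qed
  then have pim: "\<Phi> e ` path_image (linepath a (- a)) = e" if "e \<in> blank_edges" for e
    using \<Phi>(6)[OF that] by (simp add: image_image)
  have "- a = cis (3 * pi/4 + pi)" using cis_mult[of "3 * pi/4" pi] by (simp add: a_def)
  then have a_side: "a \<in> side 4 1" "- a \<in> side 4 3"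
    unfolding side_def a_def by (auto intro!: imageI)
  have at: "\<exists>x. {e \<in> blank_edges. u \<in> e} = {x}" if "u \<in> V - B" for u
    using card_blank_edges_at(1)[OF that] by (rule card_1_singletonE) blast
  have "simple_pentagonal_subdivision S B E0 V E"
    unfolding simple_pentagonal_subdivision_def
  proof (rule exI[of _ \<gamma>], rule exI[of _ \<phi>0], rule exI[of _ "\<lambda>_. 1"], rule exI[of _ "\<lambda>_. linepath a (- a)"], intro conjI)
    show "\<forall>e\<in>E0. edge_path B e (\<gamma> e)" unfolding E0_def using h(1) \<gamma>h by auto
    show "\<forall>t\<in>tiles S B E0.
           polygon_map B E0 4 t (\<phi>0 t) \<and> 1 \<in> {1, 2::nat} \<and>
           arc (linepath a (- a)) \<and> linepath a (- a) ` {0<..<1} \<subseteq> ball 0 1 \<and>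
           pathstart (linepath a (- a)) \<in> side 4 1 \<and> pathfinish (linepath a (- a)) \<in> side 4 (1 + 2) \<and>
           \<phi>0 t (pathstart (linepath a (- a))) = \<gamma> (\<phi>0 t ` side 4 1) (1/2) \<and>
           \<phi>0 t (pathfinish (linepath a (- a))) = \<gamma> (\<phi>0 t ` side 4 (1 + 2)) (1/2)"
    proof (intro ballI conjI)
      fix t assume "t \<in> tiles S B E0"
      then obtain e where e: "t = quad e" "e \<in> blank_edges" unfolding tiles by (rule imageE)
      note [simp] = e(1) \<phi>0[OF e(2)]
      show "polygon_map B E0 4 t (\<phi>0 t)" using \<Phi>(1)[OF e(2)] by simp
      have "a ~= - a"
      proof
        assume "a = - a"
        then have "a + a = 0" by (rule iffD1[OF eq_neg_iff_add_eq_0])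
        then have "2 * a = 0" by (simp only: mult_2)
        then show False using na by simp
      qed
      then show "arc (linepath a (- a))" by (rule arc_linepath)
      show "linepath a (- a) ` {0<..<1} \<subseteq> ball 0 1"
      proof (rule image_subsetI)
        fix x :: real assume "x \<in> {0<..<1}"
        then have "\<bar>1 - 2 * x\<bar> < 1" by auto
        then show "linepath a (- a) x \<in> ball 0 1" unfolding lp by (simp only: mem_ball_0 norm_mult na norm_of_real mult_1_right)
      qed
      have n3: "(1::nat) + 2 = 3" by simp
      show "pathstart (linepath a (- a)) \<in> side 4 1" "pathfinish (linepath a (- a)) \<in> side 4 (1 + 2)"
        unfolding n3 pathstart_linepath pathfinish_linepath by (rule a_side)+
      show "\<phi>0 t (pathstart (linepath a (- a))) = \<gamma> (\<phi>0 t ` side 4 1) (1/2)"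
        using \<Phi>(4)[OF e(2)] \<gamma>h[OF ends(1)[OF e(2)]] h(2)[OF ends(1)[OF e(2)]] by simp
      show "\<phi>0 t (pathfinish (linepath a (- a))) = \<gamma> (\<phi>0 t ` side 4 (1 + 2)) (1/2)"
        unfolding n3 using \<Phi>(5)[OF e(2)] \<gamma>h[OF ends(2)[OF e(2)]] h(2)[OF ends(2)[OF e(2)]] by simp
    qed simp
    show "\<forall>e\<in>E0. \<exists>!p. p \<in> (SIGMA t:tiles S B E0. {1, 1 + 2}) \<and> \<phi>0 (fst p) ` side 4 (snd p) = e"
    proof
      fix e0 assume "e0 \<in> E0"
      then obtain u where u: "e0 = joined_edge u" "u \<in> V - B" unfolding E0_def by (rule imageE)
      obtain e where e: "{e \<in> blank_edges. u \<in> e} = {e}" using at[OF u(2)] by blast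
      then have "e \<in> {e \<in> blank_edges. u \<in> e}" by simp
      then have eb: "e \<in> blank_edges" "u \<in> e" by simp_all
      \<comment> \<open>Uniqueness of the tile comes from the single blank edge at \<open>u\<close>,
        uniqueness of the side from the two different ends of that edge.\<close>
      have only: "e' = e" if "e' \<in> blank_edges" "u \<in> e'" for e'
      proof -
        have "e' \<in> {e \<in> blank_edges. u \<in> e}" using that by simp
        then show ?thesis unfolding e by simp
      qed
      define w where "w d j = (if j = (1::nat) then \<Phi> d a else \<Phi> d (- a))" for d j
      have wd: "w d j \<in> d" "w d j \<in> V - B" "\<Phi> d ` side 4 j = joined_edge (w d j)" if "d \<in> blank_edges" "j \<in> {1, 1 + 2}" for d j
        using ends[OF that(1)] \<Phi>(4,5)[OF that(1)] that(2) by (auto simp: w_def numeral_3_eq_3)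
      have "u \<in> e \<inter> V" using eb u(2) by blast
      then have "\<exists>j\<in>{1, 1 + 2}. w e j = u" unfolding \<Phi>(3)[OF eb(1)] by (auto simp: w_def)
      then obtain j where j: "j \<in> {1, 1 + 2}" "w e j = u" by (rule bexE)
      show "\<exists>!p. p \<in> (SIGMA t:tiles S B E0. {1, 1 + 2}) \<and> \<phi>0 (fst p) ` side 4 (snd p) = e0"
      proof (rule ex1I[of _ "(quad e, j)"])
        have "(quad e, j) \<in> (SIGMA t:tiles S B E0. {1, 1 + 2})" unfolding tiles using eb(1) j(1) by blast
        then show "(quad e, j) \<in> (SIGMA t:tiles S B E0. {1, 1 + 2}) \<and> \<phi>0 (fst (quad e, j)) ` side 4 (snd (quad e, j)) = e0"
          using wd(3)[OF eb(1) j(1)] j(2) u(1) \<phi>0[OF eb(1)] by simp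
      next
        fix p assume p: "p \<in> (SIGMA t:tiles S B E0. {1, 1 + 2}) \<and> \<phi>0 (fst p) ` side 4 (snd p) = e0"
        obtain q i where qi: "p = (q, i)" by (cases p)
        then have q: "q \<in> quad ` blank_edges" "i \<in> {1, 1 + 2}" "\<phi>0 q ` side 4 i = e0" using p tiles by simp_all
        from q(1) obtain d where d: "q = quad d" "d \<in> blank_edges" by (rule imageE)
        have "joined_edge (w d i) = joined_edge u" using wd(3)[OF d(2) q(2)] q(3) d(1) \<phi>0[OF d(2)] u(1) by simp
        then have wu: "w d i = u" using inj_onD[OF inj_joined_edge _ wd(2)[OF d(2) q(2)] u(2)] by simp
        then have "d = e" using only[OF d(2)] wd(1)[OF d(2) q(2)] by simp
        then have "w e i = w e j" using wu j(2) by simp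
        then have "i = j" using \<Phi>(2)[OF eb(1)] q(2) j(1) by (auto simp: w_def split: if_splits)
        then show "p = (quad e, j)" using qi d(1) \<open>d = e\<close> by simp
      qed
    qed
    have "(\<lambda>e. \<gamma> e (1/2)) ` E0 = (\<lambda>u. u) ` (V - B)"
      unfolding E0_def image_image using \<gamma>h h(2) by (intro image_cong) simp_all
    then show "V = B \<union> (\<lambda>e. \<gamma> e (1/2)) ` E0" using B_V by auto
    have g0: "(\<lambda>e. \<gamma> e ` {0..1/2}) ` E0 = (\<lambda>u. h u ` {0..1/2}) ` (V - B)" "(\<lambda>e. \<gamma> e ` {1/2..1}) ` E0 = (\<lambda>u. h u ` {1/2..1}) ` (V - B)"
      unfolding E0_def image_image using \<gamma>h by (intro image_cong; simp)+
    have g1: "(\<lambda>t. \<phi>0 t ` path_image (linepath a (- a))) ` tiles S B E0 = blank_edges"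
    proof -
      have "(\<lambda>t. \<phi>0 t ` path_image (linepath a (- a))) ` tiles S B E0 = (\<lambda>e. e) ` blank_edges"
        unfolding tiles image_image using \<phi>0 pim by (intro image_cong) simp_all
      then show ?thesis by simp
    qed
    have "(\<lambda>u. h u ` {0..1/2}) ` (V - B) \<union> (\<lambda>u. h u ` {1/2..1}) ` (V - B) = (\<Union>u\<in>V - B. {h u ` {0..1/2}, h u ` {1/2..1}})" by blast
    also have "\<dots> = (\<Union>u\<in>V - B. {f \<in> E - blank_edges. u \<in> f})" by (intro SUP_cong h(3) refl)
    also have "\<dots> = E - blank_edges"
    proof
      show "E - blank_edges \<subseteq> (\<Union>u\<in>V - B. {f \<in> E - blank_edges. u \<in> f})"
      proof
        fix f assume f: "f \<in> E - blank_edges"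
        obtain u where "u \<in> V - B" "u \<in> f" "f \<subseteq> joined_edge u" by (rule bullet_edge_joined[OF f])
        then show "f \<in> (\<Union>u\<in>V - B. {f \<in> E - blank_edges. u \<in> f})" using f by blast
      qed
    qed blast
    finally have g2: "(\<lambda>u. h u ` {0..1/2}) ` (V - B) \<union> (\<lambda>u. h u ` {1/2..1}) ` (V - B) = E - blank_edges" .
    show "E = (\<lambda>e. \<gamma> e ` {0..1/2}) ` E0 \<union> (\<lambda>e. \<gamma> e ` {1/2..1}) ` E0 \<union> (\<lambda>t. \<phi>0 t ` path_image (linepath a (- a))) ` tiles S B E0"
      unfolding g0 g1 g2 using blank_edges_E by blast
  qed
  then show ?thesis using quads by blast
qed

end

text \<open>Each type provides a labelled chart. In each, the corners 4 and 5 are not among the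
  pairs of boundary points that may be identified, so \<open>v_4\<close> and \<open>v_5\<close>
  differ.\<close>

lemma ex_labelled_pentagons:
  assumes pent: "pentagonal_tiling S V E" and B: "B \<subseteq> V" "\<forall>v\<in>V - B. vertex_degree V E v = 3"
    and ty: "\<forall>t\<in>tiles S V E. type_P1 V E B t \<or> type_P2 S V E B t \<or> type_P3 V E B t"
  shows "\<exists>\<phi>. labelled_pentagons S V E \<phi> B"
proof -
  have cp: "corner 5 4 ~= corner 5 5" "corner 5 4 ~= corner 5 1" "corner 5 4 ~= corner 5 3"
    using circle_point_eq_iff[of 5 4 5] circle_point_eq_iff[of 5 4 1] circle_point_eq_iff[of 5 4 3]
    by (auto simp: corner_circle_point doubleton_eq_iff)
  \<comment> \<open>In the type \<open>P_3\<close> identified points lie on sides 2 and 5; corner 4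
    is on neither of them.\<close>
  have c4: "corner 5 4 \<notin> side 5 2 \<and> corner 5 4 \<notin> side 5 5"
  proof (intro conjI notI)
    assume "corner 5 4 \<in> side 5 2"
    then obtain s where "s \<in> {2..3}" "circle_point 5 4 = circle_point 5 s" by (auto simp: side_circle_point corner_circle_point)
    then show False using circle_point_eq_iff[of 5 4 s] by (auto simp: doubleton_eq_iff)
  next
    assume "corner 5 4 \<in> side 5 5"
    then obtain s where "s \<in> {5..6}" "circle_point 5 4 = circle_point 5 s" by (auto simp: side_circle_point corner_circle_point)
    then show False using circle_point_eq_iff[of 5 4 s] by (auto simp: doubleton_eq_iff)
  qed
  have sp: "corner 5 j \<in> sphere 0 1" for j by (simp add: corner_circle_point)
  have "\<exists>f. labelled_pentagon V E B t f \<and> f (corner 5 4) ~= f (corner 5 5)" if t: "t \<in> tiles S V E" for t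
    using bspec[OF ty t]
  proof (elim disjE)
    assume "type_P1 V E B t"
    then obtain f where f: "labelled_pentagon V E B t f" "inj_on f (sphere 0 1)" unfolding type_P1_def by (elim exE conjE)
    then show ?thesis using inj_onD[OF f(2) _ sp sp] cp(1) by blast
  next
    assume "type_P2 S V E B t"
    then obtain f where f: "labelled_pentagon V E B t f"
      "\<forall>x\<in>sphere 0 1. \<forall>y\<in>sphere 0 1. f x = f y --> x = y \<or> {x, y} = {corner 5 1, corner 5 3}"
      unfolding type_P2_def by (elim exE conjE)
    have "f (corner 5 4) ~= f (corner 5 5)" using bspec[OF bspec[OF f(2) sp[of 4]] sp[of 5]] cp by (auto simp: doubleton_eq_iff)
    then show ?thesis using f(1) by blast
  next
    assume "type_P3 V E B t"
    then obtain f where f: "labelled_pentagon V E B t f"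
      "\<forall>x\<in>sphere 0 1. \<forall>y\<in>sphere 0 1. f x = f y -->
           x = y \<or> (x \<in> side 5 2 \<and> y \<in> side 5 5) \<or> (x \<in> side 5 5 \<and> y \<in> side 5 2)"
      unfolding type_P3_def by (elim exE conjE)
    have "f (corner 5 4) ~= f (corner 5 5)" using bspec[OF bspec[OF f(2) sp[of 4]] sp[of 5]] cp(1) c4 by blast
    then show ?thesis using f(1) by blast
  qed
  then have "\<forall>t\<in>tiles S V E. \<exists>f. labelled_pentagon V E B t f \<and> f (corner 5 4) ~= f (corner 5 5)" by (rule ballI)
  then obtain \<phi> where "\<forall>t\<in>tiles S V E. labelled_pentagon V E B t (\<phi> t) \<and> \<phi> t (corner 5 4) ~= \<phi> t (corner 5 5)"
    by (rule bchoice[THEN exE])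
  then have \<phi>: "labelled_pentagon V E B t (\<phi> t)" "\<phi> t (corner 5 4) ~= \<phi> t (corner 5 5)" if "t \<in> tiles S V E" for t
    using that by blast+
  interpret P: polygonal_surface S V E 5 \<phi>
    by (rule polygonal_tiling_surface[OF pent]) (use \<phi>(1) in \<open>simp_all add: labelled_pentagon_def\<close>)
  have c: "\<phi> t (corner 5 1) = P.rim t 1" "\<phi> t (corner 5 2) = P.rim t 2" "\<phi> t (corner 5 3) = P.rim t 3"
    "\<phi> t (corner 5 4) = P.rim t 4" "\<phi> t (corner 5 5) = P.rim t 5" for t
    by (simp_all add: P.rim_def corner_circle_point)
  have "labelled_pentagons S V E \<phi> B"
  proof (unfold_locales)
    show "B \<subseteq> V" by (rule B(1))
    show "vertex_degree V E u = 3" if "u \<in> V - B" for u using B(2) that by blast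
    fix t assume t: "t \<in> P.T"
    have "P.rim t 1 \<in> B \<and> P.rim t 3 \<in> B \<and> P.rim t 2 \<notin> B \<and> P.rim t 4 \<notin> B \<and> P.rim t 5 \<notin> B \<and> P.rim t 4 ~= P.rim t 5"
      using \<phi>[OF t] unfolding labelled_pentagon_def c by (elim conjE) (intro conjI)
    then show "P.rim t 1 \<in> B" "P.rim t 3 \<in> B" "P.rim t 2 \<notin> B" "P.rim t 4 \<notin> B" "P.rim t 5 \<notin> B" "P.rim t 4 ~= P.rim t 5"
      by blast+
  qed
  then show ?thesis by blast
qed

theorem theorem3p2:
  fixes S V :: "'a::t2_space set" and E :: "'a set set"
  assumes "pentagonal_tiling S V E"
  shows "(\<exists>V0 E0. quadrilateral_tiling S V0 E0 \<and> simple_pentagonal_subdivision S V0 E0 V E) \<longleftrightarrow>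
         (\<exists>B\<subseteq>V. (\<forall>v\<in>V - B. vertex_degree V E v = 3) \<and>
                (\<forall>t\<in>tiles S V E. type_P1 V E B t \<or> type_P2 S V E B t \<or> type_P3 V E B t))"
proof
  assume "\<exists>V0 E0. quadrilateral_tiling S V0 E0 \<and> simple_pentagonal_subdivision S V0 E0 V E"
  then obtain V0 E0 where "quadrilateral_tiling S V0 E0" "simple_pentagonal_subdivision S V0 E0 V E" by (elim exE conjE)
  then show "\<exists>B\<subseteq>V. (\<forall>v\<in>V - B. vertex_degree V E v = 3) \<and>
                (\<forall>t\<in>tiles S V E. type_P1 V E B t \<or> type_P2 S V E B t \<or> type_P3 V E B t)"
    by (rule subdivision_imp_labelling[OF assms])
next
  assume "\<exists>B\<subseteq>V. (\<forall>v\<in>V - B. vertex_degree V E v = 3) \<and>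
                (\<forall>t\<in>tiles S V E. type_P1 V E B t \<or> type_P2 S V E B t \<or> type_P3 V E B t)"
  then obtain B where "B \<subseteq> V" "\<forall>v\<in>V - B. vertex_degree V E v = 3"
    "\<forall>t\<in>tiles S V E. type_P1 V E B t \<or> type_P2 S V E B t \<or> type_P3 V E B t" by (elim exE conjE)
  then have "\<exists>\<phi>. labelled_pentagons S V E \<phi> B" by (rule ex_labelled_pentagons[OF assms])
  then obtain \<phi> where "labelled_pentagons S V E \<phi> B" by (rule exE)
  then show "\<exists>V0 E0. quadrilateral_tiling S V0 E0 \<and> simple_pentagonal_subdivision S V0 E0 V E"
    by (rule labelled_pentagons.labelling_imp_subdivision)
qed

end
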